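(* Let $P(t;1)=\sum_n p_n t^n$ be the length generating function of $3$-sided walks ($p_n$ is the number of $n$-step $3$-sided walks). (1) $P(t;1)$ is meromorphic in the disk $\mathcal D=\{t:|t|<t_c\}$, with $t_c=\sqrt2-1$. It has infinitely many poles in this disk, and thus cannot be D-finite. On the segment $(0,t_c)$, the poles are simple and form an increasing sequence $(t_i)_{i\ge0}$ that tends to $t_c$. (2) The pole $t_0$ is the unique dominant singularity (singularity of minimal modulus) of $P(t;1)$ and coincides with the radius of convergence $\rho$ of the length generating function of $2$-sided walks. Thus $t_0=\rho\simeq 0.403$ satisfies $1-2\rho-2\rho^2+2\rho^3=0$, and $$p_n\sim\kappa\mu^n\quad\text{with}\quad \mu=\frac1\rho\simeq2.48$$ for some $\kappa>0$. (3) Let $W_n$ denote the width of the box of a uniformly random $n$-step $3$-sided walk. Then the mean and variance of $W_n$ satisfy $$\mathbb E(W_n)\sim\mathfrak m\,n,\qquad \mathbb V(W_n)\sim\mathfrak s^2\,n,$$ where $$\mathfrak m=\frac{1+\rho}{2(1+3\rho)}\simeq0.31\quad\text{and}\quad \mathfrak s^2=\frac{3\rho(1+\rho)(385-1148\rho^2-494\rho)}{16(\rho^2+\rho-1)(3\rho-1)^3(1+3\rho)^3}\simeq1.41,$$ and the variable $\dfrac{W_n-\mathfrak m\,n}{\mathfrak s\sqrt n}$ converges in law to a standard normal distribution.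
   Context: Walks on the square lattice start at the origin and take unit steps N, E, S, W. A walk is prudent if it never takes a step pointing towards a vertex it has already visited (a step from $p$ in direction $d$ is forbidden if some $p+kd$, $k\ge1$, has already been visited). The box of a walk is the smallest (axis-parallel, possibly degenerate) rectangle containing it; its width is its horizontal side length. A prudent walk is $2$-sided if, as the walk grows, its endpoint always lies on the top or right edge of the box of the walk constructed so far. It is $3$-sided if, as the walk grows, its endpoint always lies on the top, right or left edge of the box; this is also required at non-integral points, i.e. when the walk is viewed as a continuous process (so that, for example, the walk ESW is not $3$-sided). The length of a walk is its number of steps; the empty walk is included. A power series $C(t)$ is D-finite if it satisfies a non-trivial linear differential equation $P_k(t)C^{(k)}(t)+\cdots+P_1(t)C'(t)+P_0(t)C(t)=0$ with polynomial coefficients. A statement that a power series is meromorphic in a domain refers to its analytic (meromorphic) continuation. *)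

theory Defs
  imports
    "HOL-Probability.Probability"
    "HOL-Complex_Analysis.Complex_Analysis"
    "HOL-Computational_Algebra.Computational_Algebra"
    "HOL-Library.Landau_Symbols"
begin

subsection \<open>Walks on the square lattice\<close>

datatype dir = North | East | South | West

fun step_vec :: "dir \<Rightarrow> real \<times> real" where
  "step_vec North = (0, 1)"
| "step_vec East = (1, 0)"
| "step_vec South = (0, -1)"
| "step_vec West = (-1, 0)"

definition vertex :: "dir list \<Rightarrow> nat \<Rightarrow> real \<times> real" where
  "vertex w i = (\<Sum>j<i. step_vec (w ! j))"

text \<open>The walk as a continuous process. At \<open>s = length w\<close> the out-of-range entry of \<open>w\<close> is
  multiplied by \<open>frac s = 0\<close>.\<close>

definition trace :: "dir list \<Rightarrow> real \<Rightarrow> real \<times> real" where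
  "trace w s = vertex w (nat \<lfloor>s\<rfloor>) + frac s *\<^sub>R step_vec (w ! nat \<lfloor>s\<rfloor>)"

definition prudent :: "dir list \<Rightarrow> bool" where
  "prudent w \<longleftrightarrow>
     (\<forall>i<length w. \<forall>j\<le>i. \<forall>k\<ge>1. vertex w i + real k *\<^sub>R step_vec (w ! i) \<noteq> vertex w j)"

text \<open>Edges of the smallest axis-parallel rectangle containing a nonempty compact set.\<close>

definition bounding_box :: "(real \<times> real) set \<Rightarrow> (real \<times> real) set" where
  "bounding_box A = {Inf (fst ` A)..Sup (fst ` A)} \<times> {Inf (snd ` A)..Sup (snd ` A)}"

definition top_edge :: "(real \<times> real) set \<Rightarrow> (real \<times> real) set" where
  "top_edge A = {p \<in> bounding_box A. snd p = Sup (snd ` A)}"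

definition right_edge :: "(real \<times> real) set \<Rightarrow> (real \<times> real) set" where
  "right_edge A = {p \<in> bounding_box A. fst p = Sup (fst ` A)}"

definition left_edge :: "(real \<times> real) set \<Rightarrow> (real \<times> real) set" where
  "left_edge A = {p \<in> bounding_box A. fst p = Inf (fst ` A)}"

definition box_width :: "dir list \<Rightarrow> real" where
  "box_width w = (let A = trace w ` {0..real (length w)} in Sup (fst ` A) - Inf (fst ` A))"

definition two_sided :: "dir list \<Rightarrow> bool" where
  "two_sided w \<longleftrightarrow> prudent w \<and>
     (\<forall>i\<le>length w. let A = trace w ` {0..real i} in
        trace w (real i) \<in> top_edge A \<union> right_edge A)"

text \<open>In contrast to the previous definition, \<open>s\<close> ranges over all real times; this excludes
  for instance \<open>[East, South, West]\<close>.\<close>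

definition three_sided :: "dir list \<Rightarrow> bool" where
  "three_sided w \<longleftrightarrow> prudent w \<and>
     (\<forall>s\<in>{0..real (length w)}. let A = trace w ` {0..s} in
        trace w s \<in> top_edge A \<union> right_edge A \<union> left_edge A)"

definition two_sided_walks :: "nat \<Rightarrow> dir list set" where
  "two_sided_walks n = {w. length w = n \<and> two_sided w}"

definition three_sided_walks :: "nat \<Rightarrow> dir list set" where
  "three_sided_walks n = {w. length w = n \<and> three_sided w}"


subsection \<open>Power series\<close>

definition D_finite :: "complex fps \<Rightarrow> bool" where
  "D_finite C \<longleftrightarrow>
     (\<exists>k (P :: nat \<Rightarrow> complex poly). P k \<noteq> 0 \<and>
        (\<Sum>i\<le>k. fps_of_poly (P i) * (fps_deriv ^^ i) C) = 0)"

text \<open>\<open>F\<close> is a meromorphic continuation, to the connected set \<open>D\<close> containing 0, of the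
  power series with coefficients \<open>a\<close>. Niceness (analytic off the poles, value 0 at the poles)
  determines \<open>F\<close> uniquely on \<open>D\<close>.\<close>

definition meromorphic_continuation ::
    "(nat \<Rightarrow> complex) \<Rightarrow> complex set \<Rightarrow> (complex \<Rightarrow> complex) \<Rightarrow> bool" where
  "meromorphic_continuation a D F \<longleftrightarrow>
     F nicely_meromorphic_on D \<and> (\<forall>\<^sub>F z in nhds 0. (\<lambda>n. a n * z ^ n) sums F z)"

end

theory Submission
  imports Defs
begin

text \<open>Whether a three-sided walk can be continued by a given step depends only on a few integers: the
edge of the box that carries the endpoint, the distances from the endpoint to the corners of that
edge, the width of the box and the direction of the last step (\<open>run_correct\<close>). Three-sided walks
are therefore the words accepted by an infinite automaton, and the series \<open>Q(s)\<close> of the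
continuations of a walk in state \<open>s\<close>, in which \<open>t\<close> marks the length and \<open>v\<close> the final width, satisfy
\<open>Q(s) = v ^ width s + t * (sum of Q(s') over the successors s')\<close>.

These equations have an explicit solution. Let \<open>E(t, x)\<close> be the series of excursions: sequences of
outward, upward and downward steps on a vertical edge that start with an outward step, stay
weakly below their starting height, end at it and never reverse a vertical step, where \<open>x\<close> marks
the outward steps. It satisfies a quadratic equation, so it is given by the Catalan series. Put
\<open>e = E(t, 1)\<close> and \<open>q = t * (1 + e)\<close>. On the top edge, \<open>x ^ (a + b) * q ^ a\<close> solves the homogeneous
equations away from the corners for every \<open>x\<close>; on a side edge, so does \<open>x ^ W * y ^ d\<close> for \<open>y = t * (1 + E(t, x))\<close>. At a
corner, the top modes of parameter \<open>x\<close> meet the side modes of parameters \<open>x\<close> and \<open>x * q\<close>. The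
parameters that occur are thus \<open>v * q ^ k\<close>, and the amplitudes obey a recursion of order one:
the quotient of consecutive amplitudes is explicit, with denominator \<open>1 - e * E(t, v * q ^ k)\<close>
(\<open>coupling\<close>). This yields the series \<open>PP\<close>, an infinite sum of products.

Take \<open>v = 1\<close>. All ingredients of \<open>PP\<close> are analytic in \<open>|t| < sqrt 2 - 1\<close> and \<open>|q| < 1\<close> there, so
singularities come only from zeros of the denominators \<open>1 - e * E(t, q ^ k)\<close>, and in a smaller disc
only finitely many of them can vanish. On the real segment \<open>e * E(t, q ^ k)\<close> increases with \<open>t\<close> from 0
to 2 and decreases with \<open>k\<close>; so it equals 1 at exactly one point \<open>t\<^sub>k\<close>, and these points increase
to \<open>sqrt 2 - 1\<close>. The zero is simple because the increase is at least linear, and the residue does not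
vanish because the rest of the sum is positive (\<open>tail_pos\<close>). Infinitely many poles in a bounded
domain exclude D-finiteness, as the leading coefficient of the differential equation must
vanish at each of them. As \<open>e\<close> is dominated by its values at positive reals, \<open>t\<^sub>0\<close> is the only
singularity of modulus at most \<open>t\<^sub>0\<close>; it is given by \<open>e = 1\<close>, which amounts to the cubic equation.

For \<open>v\<close> near 1 the dominant pole moves to a point \<open>\<rho>(v)\<close>, a local inverse of an explicit function of
\<open>t\<close>, and the width polynomials satisfy \<open>P\<^sub>n(v) * \<rho>(v) ^ n \<longlonglongrightarrow> \<lambda>(v)\<close> uniformly in \<open>v\<close>
(\<open>width_poly_quasi_power\<close>). A general quasi-powers theorem (locale \<open>quasi_power_family\<close>) turns this
into the asymptotics of the mean and the variance and, by characteristic functions, into the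
Gaussian limit. The constants come from the first two derivatives of \<open>\<rho>(v)\<close> at 1, which implicit
differentiation of two polynomial equations provides.

Two-sided walks are three-sided, so their series has radius at least \<open>\<rho>\<close>. Conversely, a family of
two-sided walks that alternate between the two edges already diverges where \<open>e = 1\<close>
(\<open>cont2_diverges\<close>).\<close>

section \<open>Integer coordinates and the step condition\<close>

fun dx :: "dir \<Rightarrow> int" where
  "dx East = 1" | "dx West = -1" | "dx North = 0" | "dx South = 0"

fun dy :: "dir \<Rightarrow> int" where
  "dy North = 1" | "dy South = -1" | "dy East = 0" | "dy West = 0"

definition ivertex :: "dir list \<Rightarrow> nat \<Rightarrow> int \<times> int" where
  "ivertex w i = (\<Sum>j<i. dx (w ! j), \<Sum>j<i. dy (w ! j))"

definition endpoint :: "dir list \<Rightarrow> int \<times> int" where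
  "endpoint w = ivertex w (length w)"

definition visited :: "dir list \<Rightarrow> (int \<times> int) set" where
  "visited w = ivertex w ` {..length w}"

definition real_point :: "int \<times> int \<Rightarrow> real \<times> real" where
  "real_point p = (real_of_int (fst p), real_of_int (snd p))"

definition move :: "int \<times> int \<Rightarrow> dir \<Rightarrow> int \<times> int" where
  "move p d = (fst p + dx d, snd p + dy d)"

lemma step_vec_eq: "step_vec d = (real_of_int (dx d), real_of_int (dy d))"
  by (cases d) auto

lemma vertex_Suc: "vertex w (Suc i) = vertex w i + step_vec (w ! i)"
  by (simp add: vertex_def)

lemma vertex_eq: "vertex w i = real_point (ivertex w i)"
  by (induction i) (auto simp: vertex_Suc real_point_def ivertex_def step_vec_eq vertex_def zero_prod_def)

lemma real_point_inject [simp]: "real_point p = real_point p' \<longleftrightarrow> p = p'"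
  by (auto simp: real_point_def prod_eq_iff)

lemma ivertex_append: "i \<le> length w \<Longrightarrow> ivertex (w @ v) i = ivertex w i"
  by (auto simp: ivertex_def nth_append intro!: sum.cong)

lemma endpoint_snoc: "endpoint (w @ [d]) = move (endpoint w) d"
  using ivertex_append[of "length w" w "[d]"]
  by (simp add: endpoint_def ivertex_def move_def)

lemma visited_snoc: "visited (w @ [d]) = insert (endpoint (w @ [d])) (visited w)"
proof -
  have "visited (w @ [d]) = ivertex (w @ [d]) ` insert (Suc (length w)) {..length w}"
    by (simp add: visited_def atMost_Suc)
  also have "\<dots> = insert (endpoint (w @ [d])) (ivertex w ` {..length w})"
    using ivertex_append[of _ w "[d]"] by (auto simp: endpoint_def image_iff)
  finally show ?thesis by (simp add: visited_def)
qed

lemma endpoint_in_visited: "endpoint w \<in> visited w"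
  by (auto simp: endpoint_def visited_def)

lemma vertex_append: "i \<le> length w \<Longrightarrow> vertex (w @ v) i = vertex w i"
  by (simp add: vertex_eq ivertex_append)

lemma trace_nat [simp]: "trace w (real n) = vertex w n"
  by (simp add: trace_def)

lemma trace_between:
  assumes "real n \<le> s" "s \<le> real n + 1"
  shows "trace w s = vertex w n + (s - real n) *\<^sub>R step_vec (w ! n)"
proof (cases "s = real n + 1")
  case True
  then have "s = real (Suc n)" by simp
  then show ?thesis by (simp only: trace_nat) (simp add: vertex_Suc)
next
  case False
  with assms have fl: "\<lfloor>s\<rfloor> = int n" by linarith
  then have "frac s = s - real n" by (simp add: frac_def)
  with fl show ?thesis by (simp add: trace_def)
qed

lemma trace_append:
  assumes "0 \<le> s" "s \<le> real (length w)"
  shows "trace (w @ v) s = trace w s"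
proof (cases "s = real (length w)")
  case True
  then show ?thesis by (simp add: vertex_append)
next
  case False
  define n where "n = nat \<lfloor>s\<rfloor>"
  have n: "n < length w" using assms False unfolding n_def by linarith
  then show ?thesis
    unfolding trace_def n_def[symmetric] by (simp add: vertex_append nth_append)
qed

text \<open>A linear functional on a polygonal path attains its maximum at a vertex. Applied to the coordinates,
this describes the box by lattice points.\<close>

lemma trace_le_iff:
  fixes \<phi> :: "real \<times> real \<Rightarrow> real"
  assumes lin: "linear \<phi>"
  shows "(\<forall>r\<in>{0..real n}. \<phi> (trace w r) \<le> c) \<longleftrightarrow> (\<forall>i\<le>n. \<phi> (vertex w i) \<le> c)"
proof
  assume "\<forall>r\<in>{0..real n}. \<phi> (trace w r) \<le> c"
  then show "\<forall>i\<le>n. \<phi> (vertex w i) \<le> c"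
    using trace_nat[of w] by (metis atLeastAtMost_iff of_nat_0_le_iff of_nat_le_iff)
next
  assume v: "\<forall>i\<le>n. \<phi> (vertex w i) \<le> c"
  show "\<forall>r\<in>{0..real n}. \<phi> (trace w r) \<le> c"
  proof
    fix r assume r: "r \<in> {0..real n}"
    show "\<phi> (trace w r) \<le> c"
    proof (cases "r = real n")
      case True
      then show ?thesis using v by simp
    next
      case False
      define i where "i = nat \<lfloor>r\<rfloor>"
      have i: "i < n" "real i \<le> r" "r \<le> real i + 1"
        using r False unfolding i_def by (auto; linarith)+
      define f where "f = r - real i"
      have f: "0 \<le> f" "f \<le> 1" using i by (auto simp: f_def)
      have "trace w r = (1 - f) *\<^sub>R vertex w i + f *\<^sub>R vertex w (Suc i)"
        using trace_between[OF i(2,3), of w]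
        by (simp add: f_def vertex_Suc algebra_simps)
      then have "\<phi> (trace w r) = (1 - f) * \<phi> (vertex w i) + f * \<phi> (vertex w (Suc i))"
        using lin by (simp add: linear_add linear_scale)
      also have "\<dots> \<le> (1 - f) * c + f * c"
        using v i f by (intro add_mono mult_left_mono) auto
      finally show ?thesis by (simp add: algebra_simps)
    qed
  qed
qed

lemma trace_snoc_le_iff:
  fixes \<phi> :: "real \<times> real \<Rightarrow> real"
  assumes lin: "linear \<phi>" and s: "real (length w) < s" "s \<le> real (length w) + 1"
  shows "(\<forall>r\<in>{0..s}. \<phi> (trace (w @ [d]) r) \<le> \<phi> (trace (w @ [d]) s)) \<longleftrightarrow>
    (\<forall>p\<in>visited w. \<phi> (real_point p) \<le> \<phi> (real_point (endpoint w) + (s - real (length w)) *\<^sub>R step_vec d))"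
    (is "?L \<longleftrightarrow> ?R")
proof -
  define n where "n = length w"
  define c where "c = \<phi> (trace (w @ [d]) s)"
  have tr: "trace (w @ [d]) r = real_point (endpoint w) + (r - real n) *\<^sub>R step_vec d"
    if "real n \<le> r" "r \<le> real n + 1" for r
    using trace_between[OF that, of "w @ [d]"]
    by (simp add: n_def endpoint_def vertex_eq ivertex_append)
  have c: "c = \<phi> (real_point (endpoint w) + (s - real n) *\<^sub>R step_vec d)"
    using tr[of s] s by (simp add: c_def n_def)
  have c': "c = \<phi> (real_point (endpoint w)) + (s - real n) * \<phi> (step_vec d)"
    using lin by (simp add: c linear_add linear_scale)
  have R: "?R \<longleftrightarrow> (\<forall>i\<le>n. \<phi> (vertex w i) \<le> c)"
    by (auto simp: visited_def vertex_eq c n_def)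
  have "?L \<longleftrightarrow> (\<forall>r\<in>{0..real n}. \<phi> (trace w r) \<le> c)"
  proof
    assume ?L
    then show "\<forall>r\<in>{0..real n}. \<phi> (trace w r) \<le> c"
      using s by (auto simp: c_def n_def trace_append[of _ w "[d]", symmetric])
  next
    assume a: "\<forall>r\<in>{0..real n}. \<phi> (trace w r) \<le> c"
    show ?L unfolding c_def[symmetric]
    proof
      fix r assume r: "r \<in> {0..s}"
      show "\<phi> (trace (w @ [d]) r) \<le> c"
      proof (cases "r \<le> real n")
        case True
        then show ?thesis using a r trace_append[of r w "[d]"] by (auto simp: n_def)
      next
        case False
        have le: "\<phi> (real_point (endpoint w)) \<le> c"
          using bspec[OF a, of "real n"] by (simp add: n_def vertex_eq endpoint_def)
        then have "0 \<le> (s - real n) * \<phi> (step_vec d)" using c' by simp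
        then have pos: "0 \<le> \<phi> (step_vec d)" using s by (simp add: n_def zero_le_mult_iff)
        have "\<phi> (trace (w @ [d]) r) = \<phi> (real_point (endpoint w)) + (r - real n) * \<phi> (step_vec d)"
          using tr[of r] False r s lin by (simp add: linear_add linear_scale n_def)
        also have "\<dots> \<le> c" unfolding c' using r pos by (intro add_left_mono mult_right_mono) auto
        finally show ?thesis .
      qed
    qed
  qed
  also have "\<dots> \<longleftrightarrow> ?R" unfolding R using trace_le_iff[OF lin, of n w c] .
  finally show ?thesis .
qed

definition on_top :: "(int \<times> int) set \<Rightarrow> int \<times> int \<Rightarrow> bool" where
  "on_top V p \<longleftrightarrow> (\<forall>p'\<in>V. snd p' \<le> snd p)"

definition on_right :: "(int \<times> int) set \<Rightarrow> int \<times> int \<Rightarrow> bool" where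
  "on_right V p \<longleftrightarrow> (\<forall>p'\<in>V. fst p' \<le> fst p)"

definition on_left :: "(int \<times> int) set \<Rightarrow> int \<times> int \<Rightarrow> bool" where
  "on_left V p \<longleftrightarrow> (\<forall>p'\<in>V. fst p \<le> fst p')"

definition prudent_step :: "(int \<times> int) set \<Rightarrow> int \<times> int \<Rightarrow> dir \<Rightarrow> bool" where
  "prudent_step V p d \<longleftrightarrow> (\<forall>k\<ge>1. (fst p + k * dx d, snd p + k * dy d) \<notin> V)"

text \<open>The condition that the whole segment of the step, not only its end, lies on an admissible edge: the step
runs along such an edge or pushes it outwards. It excludes the last step of East, South, West.\<close>

fun border_step :: "(int \<times> int) set \<Rightarrow> int \<times> int \<Rightarrow> dir \<Rightarrow> bool" where
  "border_step V p East \<longleftrightarrow> on_top V p \<or> on_right V p"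
| "border_step V p West \<longleftrightarrow> on_top V p \<or> on_left V p"
| "border_step V p North \<longleftrightarrow> on_top V p \<or> on_right V p \<or> on_left V p"
| "border_step V p South \<longleftrightarrow> on_right V p \<or> on_left V p"

definition clear_ray :: "dir list \<Rightarrow> nat \<Rightarrow> dir \<Rightarrow> bool" where
  "clear_ray w i d \<longleftrightarrow> (\<forall>j\<le>i. \<forall>k\<ge>1.
     (fst (ivertex w i) + int k * dx d, snd (ivertex w i) + int k * dy d) \<noteq> ivertex w j)"

lemma prudent_iff: "prudent w \<longleftrightarrow> (\<forall>i<length w. clear_ray w i (w ! i))"
proof -
  have "vertex w i + real k *\<^sub>R step_vec (w ! i) = real_point
     (fst (ivertex w i) + int k * dx (w ! i), snd (ivertex w i) + int k * dy (w ! i))" for i k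
    by (simp add: vertex_eq real_point_def step_vec_eq)
  then show ?thesis unfolding prudent_def clear_ray_def vertex_eq by (simp only: real_point_inject)
qed

lemma clear_ray_append: "i \<le> length w \<Longrightarrow> clear_ray (w @ v) i d \<longleftrightarrow> clear_ray w i d"
  by (auto simp: clear_ray_def ivertex_append)

lemma clear_ray_endpoint: "clear_ray w (length w) d \<longleftrightarrow> prudent_step (visited w) (endpoint w) d"
  unfolding clear_ray_def prudent_step_def visited_def endpoint_def
proof safe
  fix k :: int and j
  assume h: "\<forall>j\<le>length w. \<forall>k\<ge>1. (fst (ivertex w (length w)) + int k * dx d, snd (ivertex w (length w)) + int k * dy d) \<noteq> ivertex w j"
    and k: "1 \<le> k" and j: "j \<le> length w"
    and eq: "(fst (ivertex w (length w)) + k * dx d, snd (ivertex w (length w)) + k * dy d) = ivertex w j"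
  obtain m where "k = int m" using k by (metis nonneg_int_cases order_trans zero_le_one)
  with h[rule_format, OF j, of m] k eq show False by auto
next
  fix j k assume h: "\<forall>k\<ge>1. (fst (ivertex w (length w)) + k * dx d, snd (ivertex w (length w)) + k * dy d)
      \<notin> ivertex w ` {..length w}" and j: "j \<le> length w" and k: "(1::nat) \<le> k"
    and eq: "(fst (ivertex w (length w)) + int k * dx d, snd (ivertex w (length w)) + int k * dy d) = ivertex w j"
  from h[rule_format, of "int k"] k eq j show False by auto
qed

text \<open>Prudence is a condition on the steps that looks only backwards, so it can be checked one step
at a time.\<close>

lemma prudent_snoc:
  "prudent (w @ [d]) \<longleftrightarrow> prudent w \<and> prudent_step (visited w) (endpoint w) d"
  by (auto simp: prudent_iff less_Suc_eq nth_append clear_ray_append clear_ray_endpoint)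

lemma bounding_box_edges:
  assumes "bounded A" "p \<in> A"
  shows "p \<in> top_edge A \<longleftrightarrow> (\<forall>a\<in>A. snd a \<le> snd p)"
    and "p \<in> right_edge A \<longleftrightarrow> (\<forall>a\<in>A. fst a \<le> fst p)"
    and "p \<in> left_edge A \<longleftrightarrow> (\<forall>a\<in>A. fst p \<le> fst a)"
proof -
  have b: "bounded (fst ` A)" "bounded (snd ` A)"
    using assms(1) by (auto simp: bounded_fst bounded_snd)
  have bdd: "bdd_above (fst ` A)" "bdd_above (snd ` A)" "bdd_below (fst ` A)" "bdd_below (snd ` A)"
    using b by (auto intro: bounded_imp_bdd_above bounded_imp_bdd_below)
  have box: "p \<in> bounding_box A"
    using assms(2) bdd unfolding bounding_box_def
    by (cases p) (auto intro!: cInf_lower cSup_upper simp: rev_image_eqI)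
  show "p \<in> top_edge A \<longleftrightarrow> (\<forall>a\<in>A. snd a \<le> snd p)"
  proof -
    have "snd p = Sup (snd ` A) \<longleftrightarrow> (\<forall>a\<in>A. snd a \<le> snd p)"
    proof
      assume "snd p = Sup (snd ` A)"
      then show "\<forall>a\<in>A. snd a \<le> snd p" using bdd by (auto intro: cSup_upper)
    next
      assume "\<forall>a\<in>A. snd a \<le> snd p"
      then show "snd p = Sup (snd ` A)" using assms(2)
        by (intro cSup_eq_maximum[symmetric]) auto
    qed
    then show ?thesis using box by (simp add: top_edge_def)
  qed
  show "p \<in> right_edge A \<longleftrightarrow> (\<forall>a\<in>A. fst a \<le> fst p)"
  proof -
    have "fst p = Sup (fst ` A) \<longleftrightarrow> (\<forall>a\<in>A. fst a \<le> fst p)"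
    proof
      assume "fst p = Sup (fst ` A)"
      then show "\<forall>a\<in>A. fst a \<le> fst p" using bdd by (auto intro: cSup_upper)
    next
      assume "\<forall>a\<in>A. fst a \<le> fst p"
      then show "fst p = Sup (fst ` A)" using assms(2)
        by (intro cSup_eq_maximum[symmetric]) auto
    qed
    then show ?thesis using box by (simp add: right_edge_def)
  qed
  show "p \<in> left_edge A \<longleftrightarrow> (\<forall>a\<in>A. fst p \<le> fst a)"
  proof -
    have "fst p = Inf (fst ` A) \<longleftrightarrow> (\<forall>a\<in>A. fst p \<le> fst a)"
    proof
      assume "fst p = Inf (fst ` A)"
      then show "\<forall>a\<in>A. fst p \<le> fst a" using bdd by (auto intro: cInf_lower)
    next
      assume "\<forall>a\<in>A. fst p \<le> fst a"
      then show "fst p = Inf (fst ` A)" using assms(2)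
        by (intro cInf_eq_minimum[symmetric]) auto
    qed
    then show ?thesis using box by (simp add: left_edge_def)
  qed
qed

lemma bounded_trace: "bounded (trace w ` {0..s})"
proof (rule boundedI)
  fix p assume "p \<in> trace w ` {0..s}"
  then obtain r where r: "0 \<le> r" "r \<le> s" "p = trace w r" by auto
  define n where "n = nat \<lceil>s\<rceil>"
  have rn: "r \<in> {0..real n}" using r unfolding n_def by (auto; linarith)
  have step: "norm (step_vec d) \<le> 1" for d by (cases d) (auto simp: norm_Pair)
  have v: "norm (vertex w i) \<le> real i" for i
  proof (induction i)
    case (Suc i)
    then show ?case using norm_triangle_ineq[of "vertex w i" "step_vec (w ! i)"] step[of "w ! i"]
      by (simp add: vertex_Suc)
  qed (simp add: vertex_def)
  have "norm p \<le> norm (vertex w (nat \<lfloor>r\<rfloor>)) + \<bar>frac r\<bar> * norm (step_vec (w ! nat \<lfloor>r\<rfloor>))"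
    unfolding r(3) trace_def by (metis norm_scaleR norm_triangle_ineq)
  also have "\<dots> \<le> real (nat \<lfloor>r\<rfloor>) + 1 * 1"
    using frac_lt_1[of r] frac_ge_0[of r] by (intro add_mono v mult_mono step) auto
  also have "\<dots> \<le> real n + 1" using rn by (simp add: floor_le_iff nat_le_iff) linarith
  finally show "norm p \<le> real (nat \<lceil>s\<rceil>) + 1" unfolding n_def .
qed

definition at_border :: "dir list \<Rightarrow> real \<Rightarrow> bool" where
  "at_border w s \<longleftrightarrow>
     (\<forall>r\<in>{0..s}. snd (trace w r) \<le> snd (trace w s)) \<or>
     (\<forall>r\<in>{0..s}. fst (trace w r) \<le> fst (trace w s)) \<or>
     (\<forall>r\<in>{0..s}. - fst (trace w r) \<le> - fst (trace w s))"

lemma three_sided_iff: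
  "three_sided w \<longleftrightarrow> prudent w \<and> (\<forall>s\<in>{0..real (length w)}. at_border w s)"
proof -
  have "(trace w s \<in> top_edge (trace w ` {0..s}) \<union> right_edge (trace w ` {0..s}) \<union> left_edge (trace w ` {0..s}))
      \<longleftrightarrow> at_border w s" if "s \<in> {0..real (length w)}" for s
  proof -
    have in_A: "trace w s \<in> trace w ` {0..s}" using that by auto
    show ?thesis
      by (simp only: Un_iff bounding_box_edges[OF bounded_trace in_A]) (auto simp: at_border_def)
  qed
  then show ?thesis by (simp add: three_sided_def Let_def)
qed

lemma at_border_append:
  assumes "0 \<le> s" "s \<le> real (length w)"
  shows "at_border (w @ v) s \<longleftrightarrow> at_border w s"
  using assms trace_append[of _ w v] by (auto simp: at_border_def)

text \<open>The set of admissible one-step continuations depends only on the set of visited points and the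
endpoint. This is what makes an automaton possible.\<close>

lemma three_sided_snoc:
  "three_sided (w @ [d]) \<longleftrightarrow> three_sided w \<and>
     prudent_step (visited w) (endpoint w) d \<and> border_step (visited w) (endpoint w) d"
proof -
  define n where "n = length w"
  define p where "p = endpoint w"
  have lin: "linear (snd :: real \<times> real \<Rightarrow> real)" "linear (fst :: real \<times> real \<Rightarrow> real)"
    "linear (\<lambda>p :: real \<times> real. - fst p)"
    by (auto intro!: linearI)
  have border: "at_border (w @ [d]) s \<longleftrightarrow>
      (\<forall>p'\<in>visited w. snd p' \<le> snd p + (s - real n) * dy d) \<or>
      (\<forall>p'\<in>visited w. fst p' \<le> fst p + (s - real n) * dx d) \<or>
      (\<forall>p'\<in>visited w. fst p + (s - real n) * dx d \<le> fst p')"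
    if "real n < s" "s \<le> real n + 1" for s :: real
    unfolding at_border_def trace_snoc_le_iff[OF lin(1) that[unfolded n_def]]
      trace_snoc_le_iff[OF lin(2) that[unfolded n_def]]
      trace_snoc_le_iff[OF lin(3) that[unfolded n_def]]
    by (auto simp: real_point_def step_vec_eq p_def n_def)
  have p_in: "p \<in> visited w" by (simp add: p_def endpoint_in_visited)
  have "(\<forall>s. real n < s \<and> s \<le> real n + 1 \<longrightarrow> at_border (w @ [d]) s) \<longleftrightarrow> border_step (visited w) p d"
  proof
    assume "\<forall>s. real n < s \<and> s \<le> real n + 1 \<longrightarrow> at_border (w @ [d]) s"
    then have "at_border (w @ [d]) (real n + 1/2)" by auto
    \<comment> \<open>the midpoint of the step decides, since all vertices have integer coordinates\<close>
    then have mid: "(\<forall>p'\<in>visited w. snd p' \<le> snd p + (1/2) * real_of_int (dy d)) \<or>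
      (\<forall>p'\<in>visited w. fst p' \<le> fst p + (1/2) * real_of_int (dx d)) \<or>
      (\<forall>p'\<in>visited w. fst p + (1/2) * real_of_int (dx d) \<le> fst p')"
      using border[of "real n + 1/2"] by simp
    have half: "real_of_int x \<le> real_of_int y + 1/2 \<longleftrightarrow> x \<le> y"
      "real_of_int x - 1/2 \<le> real_of_int y \<longleftrightarrow> x \<le> y"
      "real_of_int x + 1/2 \<le> real_of_int y \<longleftrightarrow> x < y"
      "real_of_int x \<le> real_of_int y - 1/2 \<longleftrightarrow> x < y" for x y :: int
      by linarith+
    show "border_step (visited w) p d"
    proof (cases d)
      case North
      then show ?thesis using mid unfolding on_top_def on_right_def on_left_def by (auto simp: half on_top_def on_right_def on_left_def)
    next
      case East
      then show ?thesis using mid p_in by (auto simp: half on_top_def on_right_def on_left_def)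
    next
      case South
      then show ?thesis using mid p_in by (auto simp: half on_top_def on_right_def on_left_def)
    next
      case West
      then show ?thesis using mid p_in by (auto simp: half on_top_def on_right_def on_left_def)
    qed
  next
    assume b: "border_step (visited w) p d"
    show "\<forall>s. real n < s \<and> s \<le> real n + 1 \<longrightarrow> at_border (w @ [d]) s"
    proof (intro allI impI)
      fix s assume s: "real n < s \<and> s \<le> real n + 1"
      have up: "real_of_int x \<le> real_of_int y + (s - real n)" "real_of_int x - (s - real n) \<le> real_of_int y"
        "real_of_int x + (real n - s) \<le> real_of_int y"
        if "x \<le> y" for x y :: int
        using that s by linarith+
      show "at_border (w @ [d]) s"
        unfolding border[OF s[THEN conjunct1] s[THEN conjunct2]]
        using b up by (cases d) (auto simp: on_top_def on_right_def on_left_def)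
    qed
  qed
  moreover have "(\<forall>s\<in>{0..real (length (w @ [d]))}. at_border (w @ [d]) s) \<longleftrightarrow>
     (\<forall>s\<in>{0..real n}. at_border w s) \<and> (\<forall>s. real n < s \<and> s \<le> real n + 1 \<longrightarrow> at_border (w @ [d]) s)"
  proof -
    have split: "{0..real (length (w @ [d]))} = {0..real n} \<union> {s. real n < s \<and> s \<le> real n + 1}"
      by (auto simp: n_def)
    show ?thesis unfolding split using at_border_append[of _ w "[d]"] by (auto simp: n_def)
  qed
  ultimately show ?thesis
    unfolding three_sided_iff prudent_snoc p_def n_def by blast
qed


section \<open>The transfer automaton of three-sided walks\<close>

text \<open>\<open>Descent j\<close>: the walk has made only \<open>j\<close> steps, all to the south. \<open>TopN a b\<close>, \<open>TopE a b\<close>, \<open>TopW a b\<close>: the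
endpoint is on the top edge, at distance \<open>a\<close> from its right and \<open>b\<close> from its left corner, and the last
step was north, east or west. \<open>SideO c d W\<close>, \<open>SideU c d W\<close>, \<open>SideD c d W\<close>: the endpoint is on the
right (\<open>c\<close>) or left edge, \<open>d\<close> below the top corner of a box of width \<open>W\<close>, and the last step was
outward, up or down. An outward step from a top corner leads to a side edge at depth 0, and an
upward step from depth 0 leads to the top edge.\<close>

datatype state =
    Start
  | Descent nat
  | TopN nat nat | TopE nat nat | TopW nat nat
  | SideO bool nat nat | SideU bool nat nat | SideD bool nat nat

fun width :: "state \<Rightarrow> nat" where
  "width Start = 0"
| "width (Descent j) = 0"
| "width (TopN a b) = a + b"
| "width (TopE a b) = a + b"
| "width (TopW a b) = a + b"
| "width (SideO c d W) = W"
| "width (SideU c d W) = W"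
| "width (SideD c d W) = W"

fun side_up :: "bool \<Rightarrow> nat \<Rightarrow> nat \<Rightarrow> state" where
  "side_up c 0 W = (if c then TopN 0 W else TopN W 0)"
| "side_up c (Suc d) W = SideU c d W"

fun east :: "nat \<Rightarrow> nat \<Rightarrow> state" where
  "east 0 b = SideO True 0 (Suc b)"
| "east (Suc a) b = TopE a (Suc b)"

fun west :: "nat \<Rightarrow> nat \<Rightarrow> state" where
  "west a 0 = SideO False 0 (Suc a)"
| "west a (Suc b) = TopW (Suc a) b"

fun after :: "state \<Rightarrow> dir \<Rightarrow> state option" where
  "after Start North = Some (TopN 0 0)"
| "after Start East = Some (SideO True 0 1)"
| "after Start South = Some (Descent 1)"
| "after Start West = Some (SideO False 0 1)"
| "after (Descent j) North = None"
| "after (Descent j) East = Some (SideO True j 1)"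
| "after (Descent j) South = Some (Descent (Suc j))"
| "after (Descent j) West = Some (SideO False j 1)"
| "after (TopN a b) North = Some (TopN a b)"
| "after (TopN a b) East = Some (east a b)"
| "after (TopN a b) South = None"
| "after (TopN a b) West = Some (west a b)"
| "after (TopE a b) North = Some (TopN a b)"
| "after (TopE a b) East = Some (east a b)"
| "after (TopE a b) South = None"
| "after (TopE a b) West = None"
| "after (TopW a b) North = Some (TopN a b)"
| "after (TopW a b) East = None"
| "after (TopW a b) South = None"
| "after (TopW a b) West = Some (west a b)"
| "after (SideO c d W) North = Some (side_up c d W)"
| "after (SideO c d W) East = (if c then Some (SideO c d (Suc W)) else None)"
| "after (SideO c d W) South = Some (SideD c (Suc d) W)"
| "after (SideO c d W) West = (if c then None else Some (SideO c d (Suc W)))"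
| "after (SideU c d W) North = Some (side_up c d W)"
| "after (SideU c d W) East = (if c then Some (SideO c d (Suc W)) else None)"
| "after (SideU c d W) South = None"
| "after (SideU c d W) West = (if c then None else Some (SideO c d (Suc W)))"
| "after (SideD c d W) North = None"
| "after (SideD c d W) East = (if c then Some (SideO c d (Suc W)) else None)"
| "after (SideD c d W) South = Some (SideD c (Suc d) W)"
| "after (SideD c d W) West = (if c then None else Some (SideO c d (Suc W)))"

definition top_box :: "(int \<times> int) set \<Rightarrow> int \<times> int \<Rightarrow> nat \<Rightarrow> nat \<Rightarrow> bool" where
  "top_box V p a b \<longleftrightarrow> p \<in> V \<and>
     (\<forall>u v. (u, v) \<in> V \<longrightarrow> fst p - int b \<le> u \<and> u \<le> fst p + int a \<and> v \<le> snd p) \<and>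
     (\<exists>v<snd p. (fst p + int a, v) \<in> V) \<and> (\<exists>v<snd p. (fst p - int b, v) \<in> V)"

definition side_box :: "(int \<times> int) set \<Rightarrow> int \<times> int \<Rightarrow> bool \<Rightarrow> nat \<Rightarrow> nat \<Rightarrow> bool" where
  "side_box V p c d W \<longleftrightarrow> p \<in> V \<and>
     (\<forall>u v. (u, v) \<in> V \<longrightarrow> v \<le> snd p + int d \<and>
        (if c then fst p - int W \<le> u \<and> u \<le> fst p else fst p \<le> u \<and> u \<le> fst p + int W)) \<and>
     (\<exists>v. ((if c then fst p - int W else fst p + int W), v) \<in> V) \<and>
     (\<exists>u. (if c then u < fst p else u > fst p) \<and> (u, snd p + int d) \<in> V)"

fun describes :: "(int \<times> int) set \<Rightarrow> int \<times> int \<Rightarrow> state \<Rightarrow> bool" where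
  "describes V p Start \<longleftrightarrow> V = {p}"
| "describes V p (Descent j) \<longleftrightarrow> p \<in> V \<and> (fst p, snd p + 1) \<in> V \<and> (fst p, snd p + int j) \<in> V \<and>
     (\<forall>u v. (u, v) \<in> V \<longrightarrow> u = fst p \<and> snd p \<le> v \<and> v \<le> snd p + int j)"
| "describes V p (TopN a b) \<longleftrightarrow> top_box V p a b \<and> (\<forall>u. (u, snd p) \<in> V \<longrightarrow> u = fst p)"
| "describes V p (TopE a b) \<longleftrightarrow> top_box V p a b \<and> (fst p - 1, snd p) \<in> V \<and>
     (\<forall>u. (u, snd p) \<in> V \<longrightarrow> u \<le> fst p)"
| "describes V p (TopW a b) \<longleftrightarrow> top_box V p a b \<and> (fst p + 1, snd p) \<in> V \<and>
     (\<forall>u. (u, snd p) \<in> V \<longrightarrow> u \<ge> fst p)"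
| "describes V p (SideO c d W) \<longleftrightarrow> side_box V p c d W \<and> (\<forall>v. (fst p, v) \<in> V \<longrightarrow> v = snd p)"
| "describes V p (SideU c d W) \<longleftrightarrow> side_box V p c d W \<and> (fst p, snd p - 1) \<in> V \<and>
     (\<forall>v. (fst p, v) \<in> V \<longrightarrow> v \<le> snd p)"
| "describes V p (SideD c d W) \<longleftrightarrow> side_box V p c d W \<and> (fst p, snd p + 1) \<in> V \<and>
     (\<forall>v. (fst p, v) \<in> V \<longrightarrow> v \<ge> snd p)"

abbreviation allowed :: "(int \<times> int) set \<Rightarrow> int \<times> int \<Rightarrow> dir \<Rightarrow> bool" where
  "allowed V p d \<equiv> prudent_step V p d \<and> border_step V p d"

lemma blocked:
  "(fst p + dx d, snd p + dy d) \<in> V \<Longrightarrow> \<not> prudent_step V p d"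
  unfolding prudent_step_def by (metis mult_1 order_refl)

lemma blocked_East: "(u, snd p) \<in> V \<Longrightarrow> u > fst p \<Longrightarrow> \<not> prudent_step V p East"
  unfolding prudent_step_def by (auto intro!: exI[of _ "u - fst p"])

lemma blocked_West: "(u, snd p) \<in> V \<Longrightarrow> u < fst p \<Longrightarrow> \<not> prudent_step V p West"
  unfolding prudent_step_def by (auto intro!: exI[of _ "fst p - u"])

lemma blocked_South: "(fst p, v) \<in> V \<Longrightarrow> v < snd p \<Longrightarrow> \<not> prudent_step V p South"
  unfolding prudent_step_def by (auto intro!: exI[of _ "snd p - v"])

lemma blocked_North: "(fst p, v) \<in> V \<Longrightarrow> v > snd p \<Longrightarrow> \<not> prudent_step V p North"
  unfolding prudent_step_def by (auto intro!: exI[of _ "v - snd p"])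

lemma free:
  "(\<And>u. (u, snd p) \<in> V \<Longrightarrow> u \<le> fst p) \<Longrightarrow> prudent_step V p East"
  "(\<And>u. (u, snd p) \<in> V \<Longrightarrow> u \<ge> fst p) \<Longrightarrow> prudent_step V p West"
  "(\<And>v. (fst p, v) \<in> V \<Longrightarrow> v \<le> snd p) \<Longrightarrow> prudent_step V p North"
  "(\<And>v. (fst p, v) \<in> V \<Longrightarrow> v \<ge> snd p) \<Longrightarrow> prudent_step V p South"
  unfolding prudent_step_def by force+

lemma after_Top:
  assumes top: "top_box V p a b" and row: "\<And>u. (u, snd p) \<in> V \<Longrightarrow> u \<le> fst p"
  shows "allowed V p East \<and> describes (insert (move p East) V) (move p East) (east a b)"
proof -
  obtain x y where p: "p = (x, y)" by (cases p)
  have V: "x - int b \<le> u \<and> u \<le> x + int a \<and> v \<le> y \<and> (v = y \<longrightarrow> u \<le> x)" if "(u, v) \<in> V" for u v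
    using that top row p by (auto simp: top_box_def)
  obtain v v' where w: "v < y" "(x + int a, v) \<in> V" "v' < y" "(x - int b, v') \<in> V" and pV: "(x, y) \<in> V"
    using top p by (auto simp: top_box_def)
  have "prudent_step V p East" using row by (rule free)
  moreover have "border_step V p East" using V p by (auto simp: on_top_def)
  moreover have "describes (insert (move p East) V) (move p East) (east a b)"
  proof (cases a)
    case 0
    have "\<exists>v. (x - int b, v) \<in> insert (x + 1, y) V" "\<exists>u<x + 1. (u, y) \<in> insert (x + 1, y) V"
      by (use w in blast, use pV in \<open>intro exI[of _ x]; simp\<close>)
    then show ?thesis using 0 p by (auto simp: side_box_def move_def dest!: V)
  next
    case (Suc a')
    have "\<exists>v<y. (x + 1 + int a', v) \<in> insert (x + 1, y) V" "\<exists>v<y. (x - int b, v) \<in> insert (x + 1, y) V"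
      by (intro exI[of _ v], use w Suc in \<open>simp add: add.assoc\<close>) (use w in blast)
    then show ?thesis using Suc p pV by (auto simp: top_box_def move_def dest!: V)
  qed
  ultimately show ?thesis by blast
qed

lemma after_Top':
  assumes top: "top_box V p a b" and row: "\<And>u. (u, snd p) \<in> V \<Longrightarrow> u \<ge> fst p"
  shows "allowed V p West \<and> describes (insert (move p West) V) (move p West) (west a b)"
proof -
  obtain x y where p: "p = (x, y)" by (cases p)
  have V: "x - int b \<le> u \<and> u \<le> x + int a \<and> v \<le> y \<and> (v = y \<longrightarrow> u \<ge> x)" if "(u, v) \<in> V" for u v
    using that top row p by (auto simp: top_box_def)
  obtain v v' where w: "v < y" "(x + int a, v) \<in> V" "v' < y" "(x - int b, v') \<in> V" and pV: "(x, y) \<in> V"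
    using top p by (auto simp: top_box_def)
  have "prudent_step V p West" using row by (rule free)
  moreover have "border_step V p West" using V p by (auto simp: on_top_def)
  moreover have "describes (insert (move p West) V) (move p West) (west a b)"
  proof (cases b)
    case 0
    have "\<exists>v. (x + int a, v) \<in> insert (x - 1, y) V" "\<exists>u>x - 1. (u, y) \<in> insert (x - 1, y) V"
      by (use w in blast, use pV in \<open>intro exI[of _ x]; simp\<close>)
    then show ?thesis using 0 p by (auto simp: side_box_def move_def dest!: V)
  next
    case (Suc b')
    have "\<exists>v<y. (x - 1 - int b', v) \<in> insert (x - 1, y) V" "\<exists>v<y. (x + int a, v) \<in> insert (x - 1, y) V"
      by (intro exI[of _ v'], use w Suc in \<open>simp add: algebra_simps\<close>) (use w in blast)
    then show ?thesis using Suc p pV by (auto simp: top_box_def move_def dest!: V)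
  qed
  ultimately show ?thesis by blast
qed

lemma after_TopN:
  assumes top: "top_box V p a b"
  shows "allowed V p North \<and> describes (insert (move p North) V) (move p North) (TopN a b)"
proof -
  obtain x y where p: "p = (x, y)" by (cases p)
  have V: "x - int b \<le> u \<and> u \<le> x + int a \<and> v \<le> y" if "(u, v) \<in> V" for u v
    using that top p by (auto simp: top_box_def)
  obtain v v' where w: "v < y" "(x + int a, v) \<in> V" "v' < y" "(x - int b, v') \<in> V"
    using top p by (auto simp: top_box_def)
  have "prudent_step V p North" using V p by (intro free) auto
  moreover have "border_step V p North" using V p by (auto simp: on_top_def)
  moreover have "\<exists>v<y + 1. (x + int a, v) \<in> insert (x, y + 1) V" "\<exists>v<y + 1. (x - int b, v) \<in> insert (x, y + 1) V"
    by (intro exI[of _ v], use w in simp) (intro exI[of _ v'], use w in simp)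
  then have "describes (insert (move p North) V) (move p North) (TopN a b)"
    using p by (auto simp: top_box_def move_def dest!: V)
  ultimately show ?thesis by blast
qed

lemma after_TopS:
  assumes "top_box V p a b"
  shows "\<not> allowed V p South"
proof
  assume al: "allowed V p South"
  obtain v v' where v: "v < snd p" "(fst p + int a, v) \<in> V" "v' < snd p" "(fst p - int b, v') \<in> V"
    using assms by (auto simp: top_box_def)
  from al consider "on_right V p" | "on_left V p" by auto
  then show False
  proof cases
    case 1
    then have "a = 0" using v(2) by (auto simp: on_right_def)
    then show False using blocked_South[of p v V] v al by auto
  next
    case 2
    then have "b = 0" using v(4) by (auto simp: on_left_def)
    then show False using blocked_South[of p v' V] v al by auto
  qed
qed

lemma after_Side_inward:
  assumes "side_box V p c d W"
  shows "\<not> allowed V p (if c then West else East)"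
proof
  assume al: "allowed V p (if c then West else East)"
  obtain u where u: "if c then u < fst p else u > fst p" "(u, snd p + int d) \<in> V"
    using assms by (auto simp: side_box_def)
  show False
  proof (cases c)
    case True
    then have "on_top V p" using al u by (force simp: on_left_def)
    then have "d = 0" using u(2) by (auto simp: on_top_def)
    then show False using blocked_West[of u p V] u al True by auto
  next
    case False
    then have "on_top V p" using al u by (force simp: on_right_def)
    then have "d = 0" using u(2) by (auto simp: on_top_def)
    then show False using blocked_East[of u p V] u al False by auto
  qed
qed

lemma after_Side_outward:
  assumes box: "side_box V p c d W"
  shows "allowed V p (if c then East else West) \<and>
    describes (insert (move p (if c then East else West)) V) (move p (if c then East else West)) (SideO c d (Suc W))"
proof (cases c)
  case True
  obtain x y where p: "p = (x, y)" by (cases p)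
  have V: "x - int W \<le> u \<and> u \<le> x \<and> v \<le> y + int d" if "(u, v) \<in> V" for u v
    using that box p True by (auto simp: side_box_def)
  obtain u v where w: "(x - int W, v) \<in> V" "u < x" "(u, y + int d) \<in> V"
    using box p True by (auto simp: side_box_def)
  have "prudent_step V p East" using V p by (intro free) auto
  moreover have "border_step V p East" using V p by (auto simp: on_right_def)
  moreover have "\<exists>v. (x - int W, v) \<in> insert (x + 1, y) V" "\<exists>u<x + 1. (u, y + int d) \<in> insert (x + 1, y) V"
    by (use w in blast) (intro exI[of _ u], use w in simp)
  then have "describes (insert (move p East) V) (move p East) (SideO c d (Suc W))"
    using True p by (auto simp: side_box_def move_def dest!: V)
  ultimately show ?thesis using True by simp
next
  case False
  obtain x y where p: "p = (x, y)" by (cases p)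
  have V: "x \<le> u \<and> u \<le> x + int W \<and> v \<le> y + int d" if "(u, v) \<in> V" for u v
    using that box p False by (auto simp: side_box_def)
  obtain u v where w: "(x + int W, v) \<in> V" "u > x" "(u, y + int d) \<in> V"
    using box p False by (auto simp: side_box_def)
  have "prudent_step V p West" using V p by (intro free) auto
  moreover have "border_step V p West" using V p by (auto simp: on_left_def)
  moreover have "\<exists>v. (x + int W, v) \<in> insert (x - 1, y) V" "\<exists>u>x - 1. (u, y + int d) \<in> insert (x - 1, y) V"
    by (use w in blast) (intro exI[of _ u], use w in simp)
  then have "describes (insert (move p West) V) (move p West) (SideO c d (Suc W))"
    using False p by (auto simp: side_box_def move_def dest!: V)
  ultimately show ?thesis using False by simp
qed

lemma after_Side_up:
  assumes box: "side_box V p c d W" and up: "\<And>v. (fst p, v) \<in> V \<Longrightarrow> v \<le> snd p"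
  shows "allowed V p North \<and> describes (insert (move p North) V) (move p North) (side_up c d W)"
proof -
  obtain x y where p: "p = (x, y)" by (cases p)
  define l where "l = (if c then x - int W else x)"
  define r where "r = (if c then x else x + int W)"
  define far where "far = (if c then x - int W else x + int W)"
  have V: "l \<le> u \<and> u \<le> r \<and> v \<le> y + int d \<and> (u = x \<longrightarrow> v \<le> y)" if "(u, v) \<in> V" for u v
    using that box up p by (auto simp: side_box_def l_def r_def split: if_splits)
  obtain u v where w: "(far, v) \<in> V" "if c then u < x else u > x" "(u, y + int d) \<in> V" and pV: "(x, y) \<in> V"
    using box unfolding side_box_def p fst_conv snd_conv far_def by blast
  have "prudent_step V p North" using up by (rule free)
  moreover have "border_step V p North" using V p
    by (cases c) (auto simp: on_right_def on_left_def l_def r_def)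
  moreover have "describes (insert (move p North) V) (move p North) (side_up c d W)"
  proof (cases d)
    case 0
    have vy: "v < y + 1" using V[OF w(1)] 0 by auto
    have "\<exists>v<y + 1. (far, v) \<in> insert (x, y + 1) V" "\<exists>v<y + 1. (x, v) \<in> insert (x, y + 1) V"
      by (intro exI[of _ v], use w vy in simp) (intro exI[of _ y], use pV in simp)
    then show ?thesis using 0 p by (cases c) (auto simp: top_box_def move_def far_def l_def r_def dest!: V)
  next
    case (Suc d')
    have e1: "\<exists>v. (far, v) \<in> insert (x, y + 1) V" using w by auto
    have e2: "\<exists>u. (if c then u < x else u > x) \<and> (u, y + 1 + int d') \<in> insert (x, y + 1) V"
      using w Suc by (intro exI[of _ u]) (auto simp: add.assoc)
    have "side_box (insert (x, y + 1) V) (x, y + 1) c d' W"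
      unfolding side_box_def fst_conv snd_conv
      by (intro conjI e1[unfolded far_def] e2)
         (use Suc in \<open>auto simp: l_def r_def split: if_splits dest!: V\<close>)
    moreover have "v \<le> y + 1" if "(x, v) \<in> V" for v using V[OF that] by simp
    ultimately show ?thesis using Suc p pV by (auto simp: move_def)
  qed
  ultimately show ?thesis by blast
qed

lemma after_Side_down:
  assumes box: "side_box V p c d W" and down: "\<And>v. (fst p, v) \<in> V \<Longrightarrow> v \<ge> snd p"
  shows "allowed V p South \<and> describes (insert (move p South) V) (move p South) (SideD c (Suc d) W)"
proof -
  obtain x y where p: "p = (x, y)" by (cases p)
  define l where "l = (if c then x - int W else x)"
  define r where "r = (if c then x else x + int W)"
  define far where "far = (if c then x - int W else x + int W)"
  have V: "l \<le> u \<and> u \<le> r \<and> v \<le> y + int d \<and> (u = x \<longrightarrow> v \<ge> y)" if "(u, v) \<in> V" for u v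
    using that box down p by (auto simp: side_box_def l_def r_def split: if_splits)
  obtain u v where w: "(far, v) \<in> V" "if c then u < x else u > x" "(u, y + int d) \<in> V" and pV: "(x, y) \<in> V"
    using box unfolding side_box_def p fst_conv snd_conv far_def by blast
  have "prudent_step V p South" using down by (rule free)
  moreover have "border_step V p South" using V p
    by (cases c) (auto simp: on_right_def on_left_def l_def r_def)
  moreover have "describes (insert (move p South) V) (move p South) (SideD c (Suc d) W)"
  proof -
    have e1: "\<exists>v. (far, v) \<in> insert (x, y - 1) V" using w by auto
    have e2: "\<exists>u. (if c then u < x else u > x) \<and> (u, y - 1 + int (Suc d)) \<in> insert (x, y - 1) V"
      using w by (intro exI[of _ u]) auto
    have "side_box (insert (x, y - 1) V) (x, y - 1) c (Suc d) W"
      unfolding side_box_def fst_conv snd_conv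
      by (intro conjI e1[unfolded far_def] e2)
         (auto simp: l_def r_def split: if_splits dest!: V)
    moreover have "v \<ge> y - 1" if "(x, v) \<in> V" for v using V[OF that] by simp
    ultimately show ?thesis using p pV by (auto simp: move_def)
  qed
  ultimately show ?thesis by blast
qed

text \<open>A step is admissible exactly if the automaton has a transition for it, and the transition
updates the description of the walk. Every other step would point to a visited point or leave the
admissible edges.\<close>

lemma after_correct:
  assumes "describes V p st"
  shows "case after st d of None \<Rightarrow> \<not> allowed V p d
         | Some st' \<Rightarrow> allowed V p d \<and> describes (insert (move p d) V) (move p d) st'"
proof (cases st)
  case Start
  then have V: "V = {p}" using assms by simp
  have "prudent_step V p d" "border_step V p d" unfolding V
    by (cases d; auto simp: prudent_step_def prod_eq_iff on_top_def on_right_def on_left_def)+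
  moreover have "\<exists>u>a - 1. u = a - 1 \<or> u = a" for a :: int by (intro exI[of _ a]) auto
  ultimately show ?thesis using Start V
    by (cases d; cases p) (auto simp: move_def top_box_def side_box_def)
next
  case (Descent j)
  obtain x y where p: "p = (x, y)" by (cases p)
  have pV: "(x, y) \<in> V" "(x, y + 1) \<in> V" "(x, y + int j) \<in> V" using assms Descent p by auto
  have V: "u = x \<and> y \<le> v \<and> v \<le> y + int j" if "(u, v) \<in> V" for u v
    using that assms Descent p by auto
  show ?thesis
  proof (cases d)
    case North
    then show ?thesis using Descent pV p blocked_North[of p "y + 1" V] by auto
  next
    case South
    have "prudent_step V p South" "border_step V p South"
      using p by (auto intro!: free simp: on_right_def dest!: V)
    moreover have "describes (insert (move p South) V) (move p South) (Descent (Suc j))"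
      using pV p by (auto simp: move_def dest!: V)
    ultimately show ?thesis using South Descent by simp
  next
    case East
    have "prudent_step V p East" "border_step V p East"
      using p by (auto intro!: free simp: on_right_def dest!: V)
    moreover have "\<exists>u<x + 1. (u, y + int j) \<in> insert (x + 1, y) V" "\<exists>v. (x, v) \<in> insert (x + 1, y) V"
      by (intro exI[of _ x], use pV in simp) (use pV in blast)
    then have "describes (insert (move p East) V) (move p East) (SideO True j 1)"
      using p by (auto simp: move_def side_box_def dest!: V)
    ultimately show ?thesis using East Descent by simp
  next
    case West
    have "prudent_step V p West" "border_step V p West"
      using p by (auto intro!: free simp: on_left_def dest!: V)
    moreover have "\<exists>u>x - 1. (u, y + int j) \<in> insert (x - 1, y) V" "\<exists>v. (x, v) \<in> insert (x - 1, y) V"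
      by (intro exI[of _ x], use pV in simp) (use pV in blast)
    then have "describes (insert (move p West) V) (move p West) (SideO False j 1)"
      using p by (auto simp: move_def side_box_def dest!: V)
    ultimately show ?thesis using West Descent by simp
  qed
next
  case (TopN a b)
  then show ?thesis using assms
    by (cases d) (use after_Top[of V p a b] after_Top'[of V p a b] after_TopN[of V p a b] after_TopS[of V p a b] in auto)
next
  case (TopE a b)
  then show ?thesis using assms blocked[of p West V]
    by (cases d) (use after_Top[of V p a b] after_TopN[of V p a b] after_TopS[of V p a b] in auto)
next
  case (TopW a b)
  then show ?thesis using assms blocked[of p East V]
    by (cases d) (use after_Top'[of V p a b] after_TopN[of V p a b] after_TopS[of V p a b] in auto)
next
  case (SideO c e W)
  then show ?thesis using assms after_Side_inward[of V p c e W] after_Side_outward[of V p c e W]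
     after_Side_up[of V p c e W] after_Side_down[of V p c e W]
    by (cases d; cases c) auto
next
  case (SideU c e W)
  then show ?thesis using assms after_Side_inward[of V p c e W] after_Side_outward[of V p c e W]
     after_Side_up[of V p c e W] blocked[of p South V]
    by (cases d; cases c) auto
next
  case (SideD c e W)
  then show ?thesis using assms after_Side_inward[of V p c e W] after_Side_outward[of V p c e W]
     after_Side_down[of V p c e W] blocked[of p North V]
    by (cases d; cases c) auto
qed

fun run :: "state \<Rightarrow> dir list \<Rightarrow> state option" where
  "run st [] = Some st"
| "run st (d # w) = (case after st d of None \<Rightarrow> None | Some st' \<Rightarrow> run st' w)"

lemma run_snoc:
  "run st (w @ [d]) = (case run st w of None \<Rightarrow> None | Some st' \<Rightarrow> after st' d)"
  by (induction w arbitrary: st) (auto split: option.splits)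

text \<open>Three-sidedness is preserved by prefixes, so induction on the walk from its end reduces this to
a single transition.\<close>

lemma run_correct:
  "case run Start w of None \<Rightarrow> \<not> three_sided w
   | Some st \<Rightarrow> three_sided w \<and> describes (visited w) (endpoint w) st"
proof (induction w rule: rev_induct)
  case Nil
  have "three_sided []" by (auto simp: three_sided_iff prudent_def at_border_def)
  moreover have "visited [] = {endpoint []}" by (simp add: visited_def endpoint_def)
  ultimately show ?case by simp
next
  case (snoc d w)
  show ?case
  proof (cases "run Start w")
    case None
    then show ?thesis using snoc.IH by (simp add: run_snoc three_sided_snoc)
  next
    case (Some st)
    then have "three_sided w" "describes (visited w) (endpoint w) st" using snoc.IH by auto
    then show ?thesis using after_correct[of "visited w" "endpoint w" st d] Some
      by (simp add: run_snoc three_sided_snoc visited_snoc endpoint_snoc split: option.splits)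
  qed
qed

section \<open>Widths and backward polynomials\<close>

lemma box_width_eq:
  assumes "\<And>u v. (u, v) \<in> visited w \<Longrightarrow> l \<le> u \<and> u \<le> r"
    and "\<exists>v. (l, v) \<in> visited w" "\<exists>v. (r, v) \<in> visited w"
  shows "box_width w = real_of_int (r - l)"
proof -
  define A where "A = trace w ` {0..real (length w)}"
  have lin: "linear (fst :: real \<times> real \<Rightarrow> real)" "linear (\<lambda>p :: real \<times> real. - fst p)"
    by (auto intro!: linearI)
  have vis: "real_of_int l \<le> fst (vertex w i)" "fst (vertex w i) \<le> real_of_int r" if "i \<le> length w" for i
    using assms(1)[of "fst (ivertex w i)" "snd (ivertex w i)"] that
    by (auto simp: vertex_eq real_point_def visited_def)
  have le: "fst p \<le> real_of_int r" if "p \<in> A" for p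
    using trace_le_iff[OF lin(1), of "length w" w "real_of_int r"] vis that by (auto simp: A_def)
  have ge: "real_of_int l \<le> fst p" if "p \<in> A" for p
    using trace_le_iff[OF lin(2), of "length w" w "- real_of_int l"] vis that by (auto simp: A_def)
  have mem: "real_of_int u \<in> fst ` A" if uv: "(u, v) \<in> visited w" for u v
  proof -
    obtain i where i: "i \<le> length w" "ivertex w i = (u, v)" using uv by (auto simp: visited_def)
    have "trace w (real i) \<in> A" using i unfolding A_def by (intro imageI) auto
    moreover have "fst (trace w (real i)) = real_of_int u" using i by (simp add: vertex_eq real_point_def)
    ultimately show ?thesis by (metis imageI)
  qed
  have "Sup (fst ` A) = real_of_int r" using mem assms(3) le by (intro cSup_eq_maximum) auto
  moreover have "Inf (fst ` A) = real_of_int l" using mem assms(2) ge by (intro cInf_eq_minimum) auto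
  ultimately show ?thesis by (simp add: box_width_def A_def Let_def)
qed


lemma side_box_width:
  assumes box: "side_box (visited w) p c d W"
  shows "box_width w = real W"
proof -
  obtain x y where p: "p = (x, y)" by (cases p)
  have x: "\<exists>v. (x, v) \<in> visited w" using box p by (auto simp: side_box_def)
  show ?thesis
  proof (cases c)
    case True
    have b: "x - int W \<le> u \<and> u \<le> x" if "(u, v) \<in> visited w" for u v
      using box that p True by (auto simp: side_box_def)
    have "\<exists>v. (x - int W, v) \<in> visited w" using box p True by (simp add: side_box_def)
    from box_width_eq[OF b this x] show ?thesis by simp
  next
    case False
    have b: "x \<le> u \<and> u \<le> x + int W" if "(u, v) \<in> visited w" for u v
      using box that p False by (auto simp: side_box_def)
    have "\<exists>v. (x + int W, v) \<in> visited w" using box p False by (simp add: side_box_def)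
    from box_width_eq[OF b x this] show ?thesis by simp
  qed
qed

lemma top_box_width:
  assumes box: "top_box (visited w) p a b"
  shows "box_width w = real (a + b)"
proof -
  obtain x y where p: "p = (x, y)" by (cases p)
  have b: "x - int b \<le> u \<and> u \<le> x + int a" if "(u, v) \<in> visited w" for u v
    using box that p by (auto simp: top_box_def)
  have "\<exists>v. (x - int b, v) \<in> visited w" "\<exists>v. (x + int a, v) \<in> visited w"
    using box p unfolding top_box_def by auto
  from box_width_eq[OF b this] show ?thesis by simp
qed

lemma describes_width:
  assumes "describes (visited w) (endpoint w) st"
  shows "box_width w = real (width st)"
proof -
  obtain x y where p: "endpoint w = (x, y)" by (cases "endpoint w")
  have ex: "\<exists>v. (x, v) \<in> visited w" using endpoint_in_visited[of w] p by auto
  have col: "box_width w = 0" if u: "\<And>u v. (u, v) \<in> visited w \<Longrightarrow> u = x"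
    using box_width_eq[OF _ ex ex] u by (metis diff_self of_int_0 order_refl)
  show ?thesis
  proof (cases st)
    case Start
    then show ?thesis using assms p by (intro trans[OF col]) auto
  next
    case (Descent j)
    then have "\<forall>u v. (u, v) \<in> visited w \<longrightarrow> u = x" using assms p by simp
    then have "box_width w = 0" by (intro col) blast
    then show ?thesis using Descent by simp
  next
    case (TopN a b) then show ?thesis using assms by (auto dest: top_box_width)
  next
    case (TopE a b) then show ?thesis using assms by (auto dest: top_box_width)
  next
    case (TopW a b) then show ?thesis using assms by (auto dest: top_box_width)
  next
    case (SideO c d W) then show ?thesis using assms by (auto dest: side_box_width)
  next
    case (SideU c d W) then show ?thesis using assms by (auto dest: side_box_width)
  next
    case (SideD c d W) then show ?thesis using assms by (auto dest: side_box_width)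
  qed
qed

text \<open>The length polynomials of the continuations of a walk, in which \<open>v\<close> marks the width of the final box.\<close>

fun cont :: "nat \<Rightarrow> state \<Rightarrow> complex \<Rightarrow> complex" where
  "cont 0 st v = v ^ width st"
| "cont (Suc n) st v = (\<Sum>d\<in>{North, East, South, West}. case after st d of None \<Rightarrow> 0 | Some st' \<Rightarrow> cont n st' v)"

definition accepted :: "nat \<Rightarrow> state \<Rightarrow> dir list set" where
  "accepted n st = {w. length w = n \<and> run st w \<noteq> None}"

lemma UNIV_dir: "(UNIV :: dir set) = {North, East, South, West}"
  by (auto intro: dir.exhaust)

instance dir :: finite
  by standard (simp add: UNIV_dir)

lemma finite_accepted: "finite (accepted n st)"
  by (rule finite_subset[OF _ finite_lists_length_eq[of "UNIV :: dir set" n]])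
     (auto simp: accepted_def)

lemma accepted_Suc:
  "accepted (Suc n) st = (\<Union>d\<in>UNIV. case after st d of None \<Rightarrow> {} | Some st' \<Rightarrow> (#) d ` accepted n st')"
proof (intro set_eqI iffI)
  fix w assume "w \<in> accepted (Suc n) st"
  then obtain d w' where w: "w = d # w'" "length w' = n" "run st (d # w') \<noteq> None"
    by (auto simp: accepted_def length_Suc_conv)
  then show "w \<in> (\<Union>d\<in>UNIV. case after st d of None \<Rightarrow> {} | Some st' \<Rightarrow> (#) d ` accepted n st')"
    by (auto simp: accepted_def split: option.splits intro!: exI[of _ d])
qed (auto simp: accepted_def split: option.splits)

lemma sum_accepted:
  "(\<Sum>w\<in>accepted n st. v ^ width (the (run st w))) = cont n st v"
proof (induction n arbitrary: st)
  case 0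
  have "accepted 0 st = {[]}" by (auto simp: accepted_def)
  then show ?case by simp
next
  case (Suc n)
  define X where "X d = (case after st d of None \<Rightarrow> {} | Some st' \<Rightarrow> (#) d ` accepted n st')" for d
  have fin: "finite (X d)" for d by (auto simp: X_def finite_accepted split: option.splits)
  have "(\<Sum>w\<in>accepted (Suc n) st. v ^ width (the (run st w))) =
        (\<Sum>d\<in>UNIV. \<Sum>w\<in>X d. v ^ width (the (run st w)))"
    unfolding accepted_Suc X_def[symmetric]
    by (rule sum.UNION_disjoint) (auto simp: fin, auto simp: X_def split: option.splits)
  also have "\<dots> = (\<Sum>d\<in>UNIV. case after st d of None \<Rightarrow> 0 | Some st' \<Rightarrow> cont n st' v)"
  proof (rule sum.cong[OF refl])
    fix d
    show "(\<Sum>w\<in>X d. v ^ width (the (run st w))) = (case after st d of None \<Rightarrow> 0 | Some st' \<Rightarrow> cont n st' v)"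
    proof (cases "after st d")
      case (Some st')
      then have "(\<Sum>w\<in>X d. v ^ width (the (run st w))) = (\<Sum>w\<in>accepted n st'. v ^ width (the (run st (d # w))))"
        by (simp add: X_def sum.reindex)
      also have "\<dots> = cont n st' v" using Suc.IH[of st'] Some by simp
      finally show ?thesis using Some by simp
    qed (simp add: X_def)
  qed
  finally show ?case by (simp add: UNIV_dir)
qed

lemma three_sided_walks_eq: "three_sided_walks n = accepted n Start"
proof -
  have "three_sided w \<longleftrightarrow> run Start w \<noteq> None" for w
    using run_correct[of w] by (auto split: option.splits)
  then show ?thesis by (simp add: three_sided_walks_def accepted_def)
qed

definition width_poly :: "nat \<Rightarrow> complex \<Rightarrow> complex" where
  "width_poly n v = (\<Sum>w\<in>three_sided_walks n. v ^ nat \<lfloor>box_width w\<rfloor>)"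

lemma box_width_nat:
  assumes "w \<in> three_sided_walks n"
  shows "box_width w = real (width (the (run Start w)))"
proof -
  obtain st where "run Start w = Some st" using assms by (auto simp: three_sided_walks_eq accepted_def)
  then show ?thesis using run_correct[of w] describes_width by auto
qed

lemma width_poly_eq: "width_poly n v = cont n Start v"
  unfolding width_poly_def sum_accepted[symmetric] three_sided_walks_eq[symmetric]
  by (intro sum.cong) (simp_all add: box_width_nat)

lemma finite_three_sided: "finite (three_sided_walks n)"
  by (simp add: three_sided_walks_eq finite_accepted)


section \<open>The excursion series\<close>

text \<open>The generating function of the Catalan numbers. The form with the root in the denominator is regular
at 0 and makes sense on the whole slit plane.\<close>

definition cat :: "complex \<Rightarrow> complex" where
  "cat z = 2 / (1 + csqrt (1 - 4 * z))"

definition catr :: "real \<Rightarrow> real" where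
  "catr z = 2 / (1 + sqrt (1 - 4 * z))"

definition catarg :: "'a \<Rightarrow> 'a \<Rightarrow> 'a :: field" where
  "catarg t x = t ^ 3 * x / ((1 - t ^ 2) * (1 - t * x) ^ 2)"

text \<open>The excursion series is \<open>exc t x = x * excx t x\<close>. The quotient by \<open>x\<close> is introduced first because the
parameter \<open>x = v * q ^ k\<close> may vanish.\<close>

definition excx :: "complex \<Rightarrow> complex \<Rightarrow> complex" where
  "excx t x = t / (1 - t * x) * cat (catarg t x)"

definition excxr :: "real \<Rightarrow> real \<Rightarrow> real" where
  "excxr t x = t / (1 - t * x) * catr (catarg t x)"

definition exc :: "complex \<Rightarrow> complex \<Rightarrow> complex" where
  "exc t x = x * excx t x"

definition excr :: "real \<Rightarrow> real \<Rightarrow> real" where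
  "excr t x = x * excxr t x"

text \<open>The condition says that \<open>catarg r L < 1/4\<close> in a form without denominators; for \<open>L = 1\<close> it is
\<open>r < sqrt 2 - 1\<close>. It guarantees convergence on the closed bidisc of radii \<open>r\<close> and \<open>L\<close>.\<close>

definition good :: "real \<Rightarrow> real \<Rightarrow> bool" where
  "good r L \<longleftrightarrow> 0 \<le> r \<and> 0 \<le> L \<and> r + r * L + r ^ 2 * L < 1"

lemma csqrt_add_1_nz: "1 + csqrt z \<noteq> 0"
proof
  assume "1 + csqrt z = 0"
  then have "1 + Re (csqrt z) = 0" by (metis one_complex.sel(1) plus_complex.sel(1) zero_complex.sel(1))
  then show False using csqrt_principal[of z] by linarith
qed

lemma cat_eq: "cat z = 1 + z * cat z ^ 2"
proof -
  define s where "s = csqrt (1 - 4 * z)"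
  have s: "s ^ 2 = 1 - 4 * z" by (simp add: s_def)
  have nz: "1 + s \<noteq> 0" by (simp add: s_def csqrt_add_1_nz)
  have c: "cat z = 2 / (1 + s)" by (simp add: cat_def s_def)
  have "1 + z * (2 / (1 + s)) ^ 2 = 1 + (4 * z) / (1 + s) ^ 2"
    by (simp add: power_divide)
  also have "4 * z = 1 - s ^ 2" by (simp add: s)
  also have "1 + (1 - s ^ 2) / (1 + s) ^ 2 = ((1 + s) ^ 2 + (1 - s ^ 2)) / (1 + s) ^ 2"
    using nz by (simp add: field_simps)
  also have "(1 + s) ^ 2 + (1 - s ^ 2) = 2 * (1 + s)" by (simp add: power2_eq_square algebra_simps)
  also have "2 * u / u ^ 2 = 2 / u" if "u \<noteq> 0" for u :: complex
    using that by (simp add: power2_eq_square)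
  from this[OF nz] have "2 * (1 + s) / (1 + s) ^ 2 = 2 / (1 + s)" .
  finally show ?thesis by (simp add: c)
qed

lemma cat_nz: "cat z \<noteq> 0"
  by (simp add: cat_def csqrt_add_1_nz)

lemma catr_bounds: "0 \<le> z \<Longrightarrow> z \<le> 1/4 \<Longrightarrow> 1 \<le> catr z" "z \<le> 1/4 \<Longrightarrow> catr z \<le> 2" "z \<le> 1/4 \<Longrightarrow> 0 < catr z"
proof -
  have b: "1 \<le> 2 / (1 + s)" if "0 \<le> s" "s \<le> 1" for s :: real
    using that by (simp add: field_simps)
  have b': "2 / (1 + s) \<le> 2" if "0 \<le> s" for s :: real
    using that by (simp add: field_simps)
  show "1 \<le> catr z" if "0 \<le> z" "z \<le> 1/4"
  proof -
    have "sqrt (1 - 4 * z) \<le> 1" "0 \<le> sqrt (1 - 4 * z)" using that by auto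
    then show ?thesis unfolding catr_def by (intro b)
  qed
  show "catr z \<le> 2" if "z \<le> 1/4"
  proof -
    have "0 \<le> sqrt (1 - 4 * z)" using that by auto
    then show ?thesis unfolding catr_def by (intro b')
  qed
  show "0 < catr z" if "z \<le> 1/4"
  proof -
    have "0 \<le> sqrt (1 - 4 * z)" using that by auto
    then have "0 < 1 + sqrt (1 - 4 * z)" by linarith
    then show ?thesis by (simp add: catr_def)
  qed
qed

lemma catr_mono: "z \<le> w \<Longrightarrow> w \<le> 1/4 \<Longrightarrow> catr z \<le> catr w"
  unfolding catr_def by (intro divide_left_mono add_left_mono real_sqrt_le_mono mult_pos_pos add_pos_nonneg) auto

lemma norm_cat_le:
  assumes "norm z \<le> w" "w \<le> 1/4"
  shows "norm (cat z) \<le> catr w"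
proof -
  define u where "u = 1 - 4 * z"
  have Re_le: "Re u \<ge> 1 - 4 * w"
    using complex_Re_le_cmod[of z] assms by (simp add: u_def)
  have "Re (csqrt u) = sqrt ((cmod u + Re u) / 2)" by simp
  also have "\<dots> \<ge> sqrt (1 - 4 * w)"
    using Re_le complex_Re_le_cmod[of u] by (intro real_sqrt_le_mono) auto
  finally have "1 + sqrt (1 - 4 * w) \<le> Re (1 + csqrt u)" by simp
  also have "\<dots> \<le> norm (1 + csqrt u)" by (rule complex_Re_le_cmod)
  finally show ?thesis
    using assms unfolding cat_def catr_def u_def norm_divide
    by (auto intro!: divide_left_mono mult_pos_pos add_pos_nonneg simp: csqrt_add_1_nz)
qed

lemma cat_of_real: "z \<le> 1/4 \<Longrightarrow> cat (of_real z) = of_real (catr z)"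
proof -
  assume "z \<le> 1/4"
  then have "csqrt (of_real (1 - 4 * z)) = of_real (sqrt (1 - 4 * z))" by (subst csqrt_of_real_nonneg) auto
  then show ?thesis by (simp add: cat_def catr_def)
qed

lemma cat_arg_nonneg_Reals: "norm (z :: complex) < 1/4 \<Longrightarrow> 1 - 4 * z \<notin> \<real>\<^sub>\<le>\<^sub>0"
  using complex_Re_le_cmod[of z] by (auto simp: complex_nonpos_Reals_iff)

lemma holomorphic_cat: "f holomorphic_on S \<Longrightarrow> (\<And>z. z \<in> S \<Longrightarrow> norm (f z) < 1/4) \<Longrightarrow> (\<lambda>z. cat (f z)) holomorphic_on S"
  unfolding cat_def
  by (intro holomorphic_intros) (auto simp: csqrt_add_1_nz cat_arg_nonneg_Reals)

lemma continuous_on_cat: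
  fixes f :: "'a :: topological_space \<Rightarrow> complex"
  assumes "continuous_on S f" "\<And>z. z \<in> S \<Longrightarrow> norm (f z) < 1/4"
  shows "continuous_on S (\<lambda>z. cat (f z))"
proof -
  have "continuous_on S (\<lambda>z. 1 - 4 * f z)" by (intro continuous_intros assms)
  then have "continuous_on S (\<lambda>z. csqrt (1 - 4 * f z))"
    by (rule continuous_on_compose2[OF continuous_on_csqrt]) (use assms(2) cat_arg_nonneg_Reals in auto)
  then show ?thesis unfolding cat_def by (intro continuous_intros) (auto simp: csqrt_add_1_nz)
qed

context
  fixes r L :: real
  assumes good: "good r L"
begin

lemma goodD: "0 \<le> r" "0 \<le> L" "r < 1" "r * L < 1" "r ^ 2 < 1" "0 < 1 - r * L" "0 < 1 - r\<^sup>2"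
proof -
  show r: "0 \<le> r" "0 \<le> L" using good by (auto simp: good_def)
  have "0 \<le> r * L" "0 \<le> r ^ 2 * L" using r by auto
  then show lt: "r < 1" "r * L < 1" using good r unfolding good_def by linarith+
  show "r ^ 2 < 1" using lt r by (simp add: power_less_one_iff)
  then show "0 < 1 - r\<^sup>2" "0 < 1 - r * L" using lt by linarith+
qed

lemma good_alt: "r * (1 + r * L) < 1 - r * L"
  using good by (simp add: good_def power2_eq_square algebra_simps)

lemma catarg_lt: "catarg r L < 1/4"
proof -
  have "0 \<le> r * L" using goodD by simp
  then have "(r * (1 + r * L)) ^ 2 < (1 - r * L) ^ 2" using good_alt goodD by (intro power_strict_mono) auto
  then have "4 * (r ^ 3 * L) < (1 - r ^ 2) * (1 - r * L) ^ 2"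
    by (simp add: power2_eq_square power3_eq_cube algebra_simps)
  moreover have "0 < (1 - r ^ 2) * (1 - r * L) ^ 2" using goodD by (intro mult_pos_pos) auto
  ultimately show ?thesis by (simp add: catarg_def pos_divide_less_eq)
qed

lemma good_mono: "0 \<le> t \<Longrightarrow> t \<le> r \<Longrightarrow> 0 \<le> x \<Longrightarrow> x \<le> L \<Longrightarrow> good t x"
proof -
  assume a: "0 \<le> t" "t \<le> r" "0 \<le> x" "x \<le> L"
  have "t + t * x + t ^ 2 * x \<le> r + r * L + r ^ 2 * L"
    using a by (intro add_mono mult_mono power_mono) auto
  then show ?thesis using a good by (simp add: good_def)
qed

lemma norm_lower:
  assumes "norm t \<le> r" "norm x \<le> L"
  shows "1 - r * L \<le> norm (1 - t * x)" "1 - r ^ 2 \<le> norm (1 - t ^ 2)"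
    "1 - t * x \<noteq> (0 :: complex)" "1 - t ^ 2 \<noteq> (0 :: complex)"
proof -
  have "norm (t * x) \<le> r * L" unfolding norm_mult using assms goodD by (intro mult_mono) auto
  then show 1: "1 - r * L \<le> norm (1 - t * x)" using norm_triangle_ineq2[of 1 "t * x"] by simp
  have "norm (t ^ 2) \<le> r ^ 2" unfolding norm_power using assms by (intro power_mono) auto
  then show 2: "1 - r ^ 2 \<le> norm (1 - t ^ 2)" using norm_triangle_ineq2[of 1 "t ^ 2"] by simp
  show "1 - t * x \<noteq> 0" "1 - t ^ 2 \<noteq> 0" using 1 2 goodD by auto
qed

lemma norm_catarg_le:
  assumes "norm t \<le> r" "norm x \<le> L"
  shows "norm (catarg t x :: complex) \<le> catarg r L"
  unfolding catarg_def norm_divide norm_mult norm_power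
  using assms norm_lower[OF assms] goodD
  by (intro frac_le mult_mono power_mono mult_pos_pos) (auto simp: norm_power)

lemma norm_excx_le:
  assumes "norm t \<le> r" "norm x \<le> L"
  shows "norm (excx t x) \<le> excxr r L"
proof -
  have "norm (cat (catarg t x)) \<le> catr (catarg r L)"
    using norm_catarg_le[OF assms] catarg_lt by (intro norm_cat_le) auto
  moreover have "norm (t / (1 - t * x)) \<le> r / (1 - r * L)"
    unfolding norm_divide using assms norm_lower[OF assms] goodD by (intro frac_le) auto
  ultimately show ?thesis
    unfolding excx_def excxr_def norm_mult using goodD by (intro mult_mono) auto
qed

lemma norm_exc_le:
  assumes "norm t \<le> r" "norm x \<le> L"
  shows "norm (exc t x) \<le> excr r L"
  unfolding exc_def excr_def norm_mult using norm_excx_le[OF assms] assms goodD by (intro mult_mono) auto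

lemma excx_eq:
  assumes "norm t \<le> r" "norm x \<le> L"
  shows "(1 - t ^ 2) * (1 - t * x) * excx t x = t * (1 - t ^ 2) + t ^ 2 * x * excx t x ^ 2"
proof -
  note nz = norm_lower(3,4)[OF assms]
  define c where "c = cat (catarg t x)"
  have "(1 - t ^ 2) * (1 - t * x) * excx t x = t * (1 - t ^ 2) * c"
    using nz by (simp add: excx_def c_def)
  also have "c = 1 + catarg t x * c ^ 2" unfolding c_def by (rule cat_eq)
  also have "t * p * (1 + t ^ 3 * x / (p * m ^ 2) * c ^ 2) = t * p + t ^ 2 * x * (t / m * c) ^ 2"
    if "p \<noteq> 0" "m \<noteq> 0" for p m :: complex
    using that by (simp add: field_simps power2_eq_square power3_eq_cube)
  from this[OF nz(2,1)] have "t * (1 - t ^ 2) * (1 + catarg t x * c ^ 2) = t * (1 - t ^ 2) + t ^ 2 * x * (t / (1 - t * x) * c) ^ 2"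
    by (simp add: catarg_def)
  finally show ?thesis by (simp add: excx_def c_def)
qed

lemma exc_eq:
  assumes "norm t \<le> r" "norm x \<le> L"
  shows "t ^ 2 * exc t x ^ 2 - (1 - t ^ 2) * (1 - t * x) * exc t x + t * x * (1 - t ^ 2) = 0"
proof -
  have "x * ((1 - t ^ 2) * (1 - t * x) * excx t x) = x * (t * (1 - t ^ 2) + t ^ 2 * x * excx t x ^ 2)"
    by (simp only: excx_eq[OF assms])
  then show ?thesis by (simp add: exc_def power2_eq_square algebra_simps)
qed

lemma excx_nz:
  assumes "norm t \<le> r" "norm x \<le> L" "t \<noteq> 0"
  shows "excx t x \<noteq> 0"
  using assms norm_lower(3)[OF assms(1,2)] by (simp add: excx_def cat_nz)

lemma excx_of_real:
  assumes "0 \<le> t" "t \<le> r" "0 \<le> x" "x \<le> L"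
  shows "excx (of_real t) (of_real x) = of_real (excxr t x)"
proof -
  have "catarg t x < 1/4" using good_mono[OF assms] by (rule Submission.catarg_lt)
  moreover have "catarg (complex_of_real t) (of_real x) = of_real (catarg t x)" by (simp add: catarg_def)
  ultimately show ?thesis by (simp add: excx_def excxr_def cat_of_real)
qed

lemma exc_of_real:
  assumes "0 \<le> t" "t \<le> r" "0 \<le> x" "x \<le> L"
  shows "exc (of_real t) (of_real x) = of_real (excr t x)"
  by (simp add: exc_def excr_def excx_of_real[OF assms])

lemma holomorphic_excx:
  assumes "f holomorphic_on S" "g holomorphic_on S"
    "\<And>z. z \<in> S \<Longrightarrow> norm (f z) \<le> r" "\<And>z. z \<in> S \<Longrightarrow> norm (g z) \<le> L"
  shows "(\<lambda>z. excx (f z) (g z)) holomorphic_on S"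
  unfolding excx_def
proof (intro holomorphic_intros assms holomorphic_cat)
  show "(\<lambda>z. catarg (f z) (g z)) holomorphic_on S"
    unfolding catarg_def using norm_lower(3,4)[OF assms(3,4)] by (intro holomorphic_intros assms) auto
  show "norm (catarg (f z) (g z)) < 1/4" if "z \<in> S" for z
    using norm_catarg_le[OF assms(3,4)[OF that]] catarg_lt by simp
  show "1 - f z * g z \<noteq> 0" if "z \<in> S" for z using norm_lower assms(3,4) that by blast
qed

lemma continuous_on_excx:
  fixes f g :: "'a :: topological_space \<Rightarrow> complex"
  assumes "continuous_on S f" "continuous_on S g"
    "\<And>z. z \<in> S \<Longrightarrow> norm (f z) \<le> r" "\<And>z. z \<in> S \<Longrightarrow> norm (g z) \<le> L"
  shows "continuous_on S (\<lambda>z. excx (f z) (g z))"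
  unfolding excx_def
proof (intro continuous_intros assms continuous_on_cat)
  show "continuous_on S (\<lambda>z. catarg (f z) (g z))"
    unfolding catarg_def using norm_lower(3,4)[OF assms(3,4)] by (intro continuous_intros assms) auto
  show "norm (catarg (f z) (g z)) < 1/4" if "z \<in> S" for z
    using norm_catarg_le[OF assms(3,4)[OF that]] catarg_lt by simp
  show "\<forall>z\<in>S. 1 - f z * g z \<noteq> 0" using norm_lower assms(3,4) by blast
qed

lemma holomorphic_exc:
  assumes "f holomorphic_on S" "g holomorphic_on S"
    "\<And>z. z \<in> S \<Longrightarrow> norm (f z) \<le> r" "\<And>z. z \<in> S \<Longrightarrow> norm (g z) \<le> L"
  shows "(\<lambda>z. exc (f z) (g z)) holomorphic_on S"
  unfolding exc_def by (intro holomorphic_intros holomorphic_excx assms)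

lemma continuous_on_exc:
  fixes f g :: "'a :: topological_space \<Rightarrow> complex"
  assumes "continuous_on S f" "continuous_on S g"
    "\<And>z. z \<in> S \<Longrightarrow> norm (f z) \<le> r" "\<And>z. z \<in> S \<Longrightarrow> norm (g z) \<le> L"
  shows "continuous_on S (\<lambda>z. exc (f z) (g z))"
  unfolding exc_def by (intro continuous_intros continuous_on_excx assms)

lemma catarg_mono:
  assumes "0 \<le> t" "t \<le> r" "0 \<le> x" "x \<le> L"
  shows "0 \<le> catarg t x" "catarg t x \<le> catarg r L"
proof -
  have tx: "t * x \<le> r * L" using assms by (intro mult_mono) auto
  have t2: "t ^ 2 \<le> r ^ 2" using assms by (intro power_mono) auto
  have "0 \<le> 1 - t ^ 2" using t2 goodD(5) by linarith
  then have t2': "t ^ 2 \<le> 1" by simp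
  have "0 \<le> 1 - t ^ 2" using t2 goodD(5) by linarith
  then show "0 \<le> catarg t x" unfolding catarg_def using assms tx goodD(4)
    by (intro divide_nonneg_nonneg mult_nonneg_nonneg zero_le_power) auto
  show "catarg t x \<le> catarg r L"
    unfolding catarg_def using assms tx t2 t2' goodD
    by (intro frac_le mult_mono power_mono mult_pos_pos) auto
qed

text \<open>All coefficients are nonnegative and the series vanishes at \<open>t = 0\<close>, so the quotient by \<open>t\<close> still
increases. Later this makes the zeros of the denominators simple.\<close>

lemma excxr_div_mono:
  assumes "0 \<le> t" "t \<le> r" "0 \<le> x" "x \<le> L"
  shows "1 / (1 - t * x) * catr (catarg t x) \<le> 1 / (1 - r * L) * catr (catarg r L)"
proof -
  have tx: "t * x \<le> r * L" using assms by (intro mult_mono) auto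
  have "0 < catr (catarg t x)" using catarg_mono[OF assms] catarg_lt by (intro catr_bounds) auto
  moreover have "catr (catarg t x) \<le> catr (catarg r L)"
    using catarg_mono[OF assms] catarg_lt by (intro catr_mono) auto
  ultimately show ?thesis using tx goodD by (intro mult_mono frac_le) auto
qed

lemma excxr_alt: "excxr t x = t * (1 / (1 - t * x) * catr (catarg t x))"
  by (simp add: excxr_def)

lemma catr_catarg_pos: "0 < catr (catarg r L)" "1 \<le> catr (catarg r L)" "catr (catarg r L) \<le> 2"
  using catarg_lt catarg_mono[of r L] goodD by (auto intro!: catr_bounds)

lemma excxr_nonneg: "0 \<le> excxr r L" "0 \<le> excr r L"
proof -
  show 1: "0 \<le> excxr r L" using catr_catarg_pos(1) goodD by (auto simp: excxr_def)
  show "0 \<le> excr r L" using 1 goodD by (auto simp: excr_def)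
qed

lemma excxr_mono:
  assumes "0 \<le> t" "t \<le> r" "0 \<le> x" "x \<le> L"
  shows "excxr t x \<le> excxr r L" "excr t x \<le> excr r L"
proof -
  show 1: "excxr t x \<le> excxr r L"
  proof -
    have "0 \<le> 1 / (1 - t * x) * catr (catarg t x)"
      using Submission.catr_catarg_pos(1)[OF good_mono[OF assms]] Submission.goodD(6)[OF good_mono[OF assms]] by simp
    with excxr_div_mono[OF assms] show ?thesis unfolding excxr_alt using assms by (rule_tac mult_mono) auto
  qed
  show "excr t x \<le> excr r L"
    unfolding excr_def using 1 assms Submission.excxr_nonneg[OF good_mono[OF assms]] by (intro mult_mono) auto
qed

lemma excr_le: "excr r L \<le> 2 * r * L / (1 - r * L)"
proof -
  have "r / (1 - r * L) * catr (catarg r L) \<le> r / (1 - r * L) * 2"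
    using catr_catarg_pos goodD by (intro mult_left_mono) auto
  from mult_left_mono[OF this goodD(2)] show ?thesis by (simp add: excr_def excxr_def mult_ac)
qed

text \<open>With \<open>y = r * (1 + E)\<close> the weight of a climb by one level, this makes the geometric series over the depth
of a descent converge.\<close>

lemma y_lt: "r ^ 2 * (1 + excr r L) < 1"
proof -
  define z where "z = r * L"
  have z: "0 \<le> z" "z < 1" using goodD by (auto simp: z_def)
  have "r * (r * (1 + z)) \<le> 1 * (r * (1 + z))" using goodD z by (intro mult_right_mono) auto
  then have key: "r ^ 2 * (1 + z) < 1 - z" using good_alt by (simp add: z_def power2_eq_square mult.assoc)
  have "1 + excr r L \<le> 1 + 2 * z / (1 - z)" using excr_le by (simp add: z_def)
  also have "\<dots> = (1 + z) / (1 - z)" using z by (simp add: field_simps)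
  finally have "r ^ 2 * (1 + excr r L) \<le> r ^ 2 * ((1 + z) / (1 - z))" by (intro mult_left_mono) auto
  also have "\<dots> < 1" using key z by (simp add: field_simps)
  finally show ?thesis .
qed

lemma ty_nz:
  assumes "norm t \<le> r" "norm x \<le> L"
  shows "1 - r ^ 2 * (1 + excr r L) \<le> norm (1 - t * (t * (1 + exc t x)))"
    "1 - t * (t * (1 + exc t x)) \<noteq> 0"
proof -
  have "norm (t * (t * (1 + exc t x))) \<le> r * (r * (1 + excr r L))"
    unfolding norm_mult
    using assms norm_exc_le[OF assms] goodD excxr_nonneg norm_triangle_ineq[of 1 "exc t x"]
    by (intro mult_mono) auto
  then show "1 - r ^ 2 * (1 + excr r L) \<le> norm (1 - t * (t * (1 + exc t x)))"
    using norm_triangle_ineq2[of 1 "t * (t * (1 + exc t x))"] by (simp add: power2_eq_square mult_ac)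
  then show "1 - t * (t * (1 + exc t x)) \<noteq> 0" using y_lt by auto
qed

end


section \<open>The series of three-sided walks\<close>

text \<open>Here \<open>ee\<close> and \<open>qq\<close> are \<open>e = E(t, 1)\<close> and \<open>q = t * (1 + e)\<close>, \<open>xk t v k\<close> is the parameter \<open>v * q ^ k\<close> of the \<open>k\<close>-th
mode and \<open>ek t v k\<close> its excursion series. The suffix \<open>r\<close> marks the real functions that dominate these
series.\<close>

definition ee :: "complex \<Rightarrow> complex" where "ee t = exc t 1"
definition eer :: "real \<Rightarrow> real" where "eer t = excr t 1"
definition qq :: "complex \<Rightarrow> complex" where "qq t = t * (1 + ee t)"
definition qqr :: "real \<Rightarrow> real" where "qqr t = t * (1 + eer t)"
definition xk :: "complex \<Rightarrow> complex \<Rightarrow> nat \<Rightarrow> complex" where "xk t v k = v * qq t ^ k"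
definition ek :: "complex \<Rightarrow> complex \<Rightarrow> nat \<Rightarrow> complex" where "ek t v k = exc t (xk t v k)"
definition ekr :: "real \<Rightarrow> real \<Rightarrow> nat \<Rightarrow> real" where "ekr t v k = excr t (v * qqr t ^ k)"
definition tau :: "complex \<Rightarrow> complex" where "tau t = t * qq t / (1 - t * qq t)"
definition taur :: "real \<Rightarrow> real" where "taur t = t * qqr t / (1 - t * qqr t)"

text \<open>Particular solutions of the backward equations with the corners neglected, divided by \<open>v ^ width\<close>:
\<open>alpha\<close> and \<open>alE\<close> on the top edge after a step to the north or along the edge, \<open>sE\<close> and \<open>sN\<close> on a side
edge after an outward or a vertical step.\<close>

definition alpha :: "complex \<Rightarrow> complex" where "alpha t = (1 + t) / (1 - 2 * t - t ^ 2)"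
definition alE :: "complex \<Rightarrow> complex" where "alE t = (1 + t * alpha t) / (1 - t)"
definition sE :: "complex \<Rightarrow> complex \<Rightarrow> complex" where "sE t v = (1 + t) / (1 - t - t * v - t ^ 2 * v)"
definition sN :: "complex \<Rightarrow> complex \<Rightarrow> complex" where "sN t v = (1 + t * v * sE t v) / (1 - t)"

text \<open>The amplitude \<open>bb t v k\<close> of the \<open>k\<close>-th mode is a product of quotients \<open>rat\<close>. The first numerator contains
the mismatch of the particular solutions at the corner, the others the passage from one mode to the
next. The weight \<open>ww\<close> is the contribution of a mode to the start state: \<open>2 * t\<close> for a first step to the north,
\<open>theta\<close> for the other first steps.\<close>

definition den :: "complex \<Rightarrow> complex \<Rightarrow> nat \<Rightarrow> complex" where
  "den t v k = 1 - ee t * ek t v k"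
definition num :: "complex \<Rightarrow> complex \<Rightarrow> nat \<Rightarrow> complex" where
  "num t v k = (if k = 0 then ee t * (v * sE t v - alE t + (alpha t - sN t v) * ek t v 0)
                else ee t * (ek t v k - tau t))"
definition rat :: "complex \<Rightarrow> complex \<Rightarrow> nat \<Rightarrow> complex" where
  "rat t v k = num t v k / den t v k"
definition bb :: "complex \<Rightarrow> complex \<Rightarrow> nat \<Rightarrow> complex" where
  "bb t v k = (\<Prod>j\<le>k. rat t v j)"
definition theta :: "complex \<Rightarrow> complex \<Rightarrow> nat \<Rightarrow> complex" where
  "theta t v k = 2 * t * ek t v k / (1 - t * (t * (1 + ek t v k)))"
definition ww :: "complex \<Rightarrow> complex \<Rightarrow> nat \<Rightarrow> complex" where
  "ww t v k = 2 * t + theta t v k + theta t v (Suc k)"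
definition base :: "complex \<Rightarrow> complex \<Rightarrow> complex" where
  "base t v = 1 + t * alpha t + 2 * t * v * sE t v + t * (1 + 2 * t * v * sE t v) / (1 - t)
     + (alpha t - sN t v) * theta t v 0"
text \<open>The modes from \<open>K\<close> on, divided by the amplitude \<open>bb t v K\<close>. Splitting the sum there isolates the
finitely many denominators that may vanish in a given disc.\<close>

definition tail :: "nat \<Rightarrow> complex \<Rightarrow> complex \<Rightarrow> complex" where
  "tail K t v = (\<Sum>i. (\<Prod>j<i. rat t v (Suc K + j)) * ww t v (K + i))"
definition PP :: "complex \<Rightarrow> complex \<Rightarrow> complex" where
  "PP t v = base t v + rat t v 0 * tail 0 t v"

definition ratr :: "real \<Rightarrow> real \<Rightarrow> nat \<Rightarrow> real" where
  "ratr r L k = eer r * (ekr r L k + taur r) / (1 - eer r * ekr r L k)"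
definition wwr :: "real \<Rightarrow> real \<Rightarrow> real" where
  "wwr r L = 2 * r + 2 * (2 * r * excr r L / (1 - r ^ 2 * (1 + excr r L)))"

context
  fixes r L :: real
  assumes good: "good r L" and L: "1 \<le> L"
begin

lemma good1: "good r 1"
  using good_mono[OF good, of r 1] goodD[OF good] L by auto

lemma r_sq: "2 * r + r ^ 2 < 1"
  using good1 by (simp add: good_def)

lemma eer_bounds: "0 \<le> eer r" "eer r \<le> 2 * r / (1 - r)"
  using excxr_nonneg[OF good1] excr_le[OF good1] by (auto simp: eer_def)

lemma qqr_bounds: "0 \<le> qqr r" "qqr r < 1"
proof -
  note g = goodD[OF good1]
  show "0 \<le> qqr r" using eer_bounds g by (simp add: qqr_def)
  have "1 + eer r \<le> 1 + 2 * r / (1 - r)" using eer_bounds by simp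
  also have "\<dots> = (1 + r) / (1 - r)" using g by (simp add: field_simps)
  finally have "qqr r \<le> r * ((1 + r) / (1 - r))" unfolding qqr_def using g by (intro mult_left_mono) auto
  also have "\<dots> < 1" using r_sq g by (simp add: field_simps power2_eq_square)
  finally show "qqr r < 1" .
qed

lemma rq_lt: "r * qqr r < 1" "0 \<le> r * qqr r"
proof -
  note g = goodD[OF good1]
  show "0 \<le> r * qqr r" using g qqr_bounds by simp
  have "r * qqr r \<le> 1 * qqr r" using g qqr_bounds by (intro mult_right_mono) auto
  then show "r * qqr r < 1" using qqr_bounds by simp
qed

lemma taur_nonneg: "0 \<le> taur r"
  using rq_lt by (simp add: taur_def)

text \<open>The product \<open>e * \<tau>\<close> is the limit of the quotients of consecutive amplitudes. That it is less than 1 makes the sum over the modes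
converge geometrically.\<close>

lemma ee_taur: "1 - eer r * taur r = (1 - qqr r ^ 2) / (1 - r * qqr r)" "eer r * taur r < 1"
proof -
  show *: "1 - eer r * taur r = (1 - qqr r ^ 2) / (1 - r * qqr r)"
  proof -
    have "(1 - r * qqr r) - eer r * (r * qqr r) = 1 - qqr r ^ 2"
      by (simp add: qqr_def power2_eq_square algebra_simps)
    then show ?thesis using rq_lt unfolding taur_def
      by (smt (verit, ccfv_SIG) diff_divide_distrib divide_self times_divide_eq_right)
  qed
  have "qqr r ^ 2 < 1" using qqr_bounds by (simp add: power_less_one_iff)
  then have "0 < (1 - qqr r ^ 2) / (1 - r * qqr r)" using rq_lt by (intro divide_pos_pos) auto
  then show "eer r * taur r < 1" using * by linarith
qed

lemma Lq_le: "0 \<le> L * qqr r ^ k" "L * qqr r ^ k \<le> L"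
proof -
  have "qqr r ^ k \<le> 1" using qqr_bounds by (intro power_le_one) auto
  then show "L * qqr r ^ k \<le> L" using L by (simp add: mult_left_le)
  show "0 \<le> L * qqr r ^ k" using qqr_bounds L by simp
qed

lemma good_k: "good r (L * qqr r ^ k)"
  using good_mono[OF good _ _ Lq_le(1) Lq_le(2)] goodD[OF good] by auto

lemma ekr_nonneg: "0 \<le> ekr r L k"
  unfolding ekr_def using excxr_nonneg(2)[OF good_k] .

lemma ekr_le: "ekr r L k \<le> excr r L"
  unfolding ekr_def using excxr_mono(2)[OF good _ _ Lq_le] goodD[OF good] by auto

lemma ekr_antimono: "j \<le> k \<Longrightarrow> ekr r L k \<le> ekr r L j"
proof -
  assume "j \<le> k"
  then have "L * qqr r ^ k \<le> L * qqr r ^ j" using qqr_bounds L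
    by (intro mult_left_mono power_decreasing) auto
  then show ?thesis unfolding ekr_def
    using excxr_mono(2)[OF good_k[of j] _ _ Lq_le(1)] goodD[OF good] by auto
qed

lemma ekr_tendsto: "(\<lambda>k. ekr r L k) \<longlonglongrightarrow> 0"
proof (rule tendsto_sandwich)
  show "\<forall>\<^sub>F k in sequentially. 0 \<le> ekr r L k" using ekr_nonneg by simp
  show "\<forall>\<^sub>F k in sequentially. ekr r L k \<le> 2 * r * (L * qqr r ^ k) / (1 - r * L)"
  proof (intro always_eventually allI)
    fix k
    have "ekr r L k \<le> 2 * r * (L * qqr r ^ k) / (1 - r * (L * qqr r ^ k))"
      unfolding ekr_def by (rule excr_le[OF good_k])
    also have "\<dots> \<le> 2 * r * (L * qqr r ^ k) / (1 - r * L)"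
      using goodD[OF good] Lq_le[of k] qqr_bounds by (intro frac_le mult_nonneg_nonneg diff_left_mono mult_left_mono) auto
    finally show "ekr r L k \<le> 2 * r * (L * qqr r ^ k) / (1 - r * L)" .
  qed
  have q0: "(\<lambda>k. qqr r ^ k) \<longlonglongrightarrow> 0" using qqr_bounds by (intro LIMSEQ_power_zero) auto
  have "(\<lambda>k. 2 * r * (L * qqr r ^ k) / (1 - r * L)) \<longlonglongrightarrow> 2 * r * (L * 0) / (1 - r * L)"
    using goodD[OF good] by (intro tendsto_intros q0) auto
  then show "(\<lambda>k. 2 * r * (L * qqr r ^ k) / (1 - r * L)) \<longlonglongrightarrow> 0" by simp
qed simp

lemma norm_ee_le: "norm t \<le> r \<Longrightarrow> norm (ee t) \<le> eer r"
  unfolding ee_def eer_def by (intro norm_exc_le[OF good1]) auto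

lemma norm_qq_le: "norm t \<le> r \<Longrightarrow> norm (qq t) \<le> qqr r"
  unfolding qq_def qqr_def norm_mult using goodD[OF good] eer_bounds norm_ee_le[of t] norm_triangle_ineq[of 1 "ee t"]
  by (intro mult_mono) auto

lemma norm_xk_le: "norm t \<le> r \<Longrightarrow> norm v \<le> L \<Longrightarrow> norm (xk t v k) \<le> L * qqr r ^ k"
  unfolding xk_def norm_mult norm_power using norm_qq_le L by (intro mult_mono power_mono) auto

lemma norm_xk_le': "norm t \<le> r \<Longrightarrow> norm v \<le> L \<Longrightarrow> norm (xk t v k) \<le> L"
  using norm_xk_le Lq_le order_trans by blast

lemma norm_ek_le: "norm t \<le> r \<Longrightarrow> norm v \<le> L \<Longrightarrow> norm (ek t v k) \<le> ekr r L k"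
  unfolding ek_def ekr_def using norm_xk_le by (intro norm_exc_le[OF good_k]) auto

lemma norm_ek_le': "norm t \<le> r \<Longrightarrow> norm v \<le> L \<Longrightarrow> norm (ek t v k) \<le> excr r L"
  using norm_ek_le ekr_le order_trans by blast

lemma one_tq: "norm t \<le> r \<Longrightarrow> 1 - r * qqr r \<le> norm (1 - t * qq t)" "norm t \<le> r \<Longrightarrow> 1 - t * qq t \<noteq> 0"
proof -
  assume t: "norm t \<le> r"
  have "norm (t * qq t) \<le> r * qqr r" unfolding norm_mult
    using t norm_qq_le goodD[OF good] qqr_bounds by (intro mult_mono) auto
  then show "1 - r * qqr r \<le> norm (1 - t * qq t)" using norm_triangle_ineq2[of 1 "t * qq t"] by simp
  then show "1 - t * qq t \<noteq> 0" using rq_lt by auto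
qed

lemma norm_tau_le: "norm t \<le> r \<Longrightarrow> norm (tau t) \<le> taur r"
  unfolding tau_def taur_def norm_divide norm_mult
  using one_tq rq_lt norm_qq_le goodD[OF good] qqr_bounds by (intro frac_le mult_mono) auto

lemma lin_nz:
  fixes t v :: complex
  assumes "norm t \<le> r" "norm v \<le> L"
  shows "1 - t \<noteq> 0" "1 - 2 * t - t ^ 2 \<noteq> 0" "1 - t - t * v - t ^ 2 * v \<noteq> 0"
proof -
  note g = goodD[OF good]
  show "1 - t \<noteq> 0" using assms g by auto
  have "norm (t + t * v + t ^ 2 * v) \<le> norm t + norm (t * v) + norm (t ^ 2 * v)"
    by (intro norm_triangle_mono order_refl)
  also have "\<dots> \<le> r + r * L + r ^ 2 * L" unfolding norm_mult norm_power
    using assms g by (intro add_mono mult_mono power_mono) auto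
  also have "\<dots> < 1" using good by (simp add: good_def)
  finally have "t + t * v + t ^ 2 * v \<noteq> 1" by auto
  then show "1 - t - t * v - t ^ 2 * v \<noteq> 0" by (auto simp: algebra_simps)
  have "norm (2 * t + t ^ 2) \<le> norm (2 * t) + norm (t ^ 2)" by (rule norm_triangle_ineq)
  also have "\<dots> \<le> 2 * r + r ^ 2" unfolding norm_mult norm_power
    using assms g by (intro add_mono power_mono) auto
  also have "\<dots> < 1" by (rule r_sq)
  finally have "2 * t + t ^ 2 \<noteq> 1" by auto
  then show "1 - 2 * t - t ^ 2 \<noteq> 0" by (auto simp: algebra_simps)
qed

lemma ek_ty_nz: "norm t \<le> r \<Longrightarrow> norm v \<le> L \<Longrightarrow> 1 - t * (t * (1 + ek t v k)) \<noteq> 0"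
  unfolding ek_def using norm_xk_le' by (intro ty_nz(2)[OF good]) auto

lemma norm_theta_le:
  assumes "norm t \<le> r" "norm v \<le> L"
  shows "norm (theta t v k) \<le> 2 * r * excr r L / (1 - r ^ 2 * (1 + excr r L))"
proof -
  have "1 - r ^ 2 * (1 + excr r L) \<le> norm (1 - t * (t * (1 + ek t v k)))"
    unfolding ek_def using norm_xk_le'[OF assms] by (intro ty_nz(1)[OF good assms(1)]) auto
  then show ?thesis
    unfolding theta_def norm_divide norm_mult
    using assms norm_ek_le'[OF assms] y_lt[OF good] goodD[OF good] excxr_nonneg[OF good]
    by (intro frac_le mult_mono) auto
qed

lemma norm_ww_le: "norm t \<le> r \<Longrightarrow> norm v \<le> L \<Longrightarrow> norm (ww t v k) \<le> wwr r L"
proof -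
  assume a: "norm t \<le> r" "norm v \<le> L"
  have "norm (2 * t) \<le> 2 * r" using a by (simp add: norm_mult)
  define M where "M = 2 * r * excr r L / (1 - r ^ 2 * (1 + excr r L))"
  show ?thesis
    using \<open>norm (2 * t) \<le> 2 * r\<close> norm_theta_le[OF a, of k, folded M_def] norm_theta_le[OF a, of "Suc k", folded M_def] norm_triangle_ineq[of "2 * t + theta t v k" "theta t v (Suc k)"]
      norm_triangle_ineq[of "2 * t" "theta t v k"]
    unfolding ww_def wwr_def M_def[symmetric] by linarith
qed

lemma wwr_nonneg: "0 \<le> wwr r L"
  using norm_ww_le[of 0 0 0] goodD[OF good] norm_ge_zero order_trans by (metis norm_zero)

text \<open>For fixed \<open>k\<close> all ingredients are holomorphic in \<open>t\<close>, jointly continuous in \<open>(t, v)\<close>.\<close>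

lemma holomorphic_ee: "S \<subseteq> cball 0 r \<Longrightarrow> ee holomorphic_on S"
  unfolding ee_def[abs_def] by (intro holomorphic_exc[OF good1] holomorphic_intros) auto

lemma holomorphic_qq: "S \<subseteq> cball 0 r \<Longrightarrow> qq holomorphic_on S"
  unfolding qq_def[abs_def] by (intro holomorphic_intros holomorphic_ee)

lemma holomorphic_ek:
  assumes "S \<subseteq> cball 0 r" "norm v \<le> L"
  shows "(\<lambda>t. ek t v k) holomorphic_on S"
  unfolding ek_def
proof (intro holomorphic_exc[OF good])
  show "(\<lambda>t. xk t v k) holomorphic_on S" unfolding xk_def by (intro holomorphic_intros holomorphic_qq assms)
qed (use assms norm_xk_le' in \<open>auto intro!: holomorphic_intros\<close>)

lemma holomorphic_den:
  assumes "S \<subseteq> cball 0 r" "norm v \<le> L"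
  shows "(\<lambda>t. den t v k) holomorphic_on S"
  unfolding den_def by (intro holomorphic_intros holomorphic_ek holomorphic_ee assms)

lemma holomorphic_coeffs:
  assumes "S \<subseteq> cball 0 r" "norm v \<le> L"
  shows "alpha holomorphic_on S" "alE holomorphic_on S" "(\<lambda>t. sE t v) holomorphic_on S" "(\<lambda>t. sN t v) holomorphic_on S"
    "tau holomorphic_on S"
proof -
  have t: "t \<in> S \<Longrightarrow> norm t \<le> r" for t using assms by auto
  note nz = lin_nz[OF t assms(2)]
  show a: "alpha holomorphic_on S" unfolding alpha_def[abs_def] using nz by (intro holomorphic_intros) auto
  show "alE holomorphic_on S" unfolding alE_def[abs_def] using nz by (intro holomorphic_intros a) auto
  show s: "(\<lambda>t. sE t v) holomorphic_on S" unfolding sE_def[abs_def] using nz by (intro holomorphic_intros) auto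
  show "(\<lambda>t. sN t v) holomorphic_on S" unfolding sN_def[abs_def] using nz by (intro holomorphic_intros s) auto
  show "tau holomorphic_on S" unfolding tau_def[abs_def] using one_tq(2)[OF t]
    by (intro holomorphic_intros holomorphic_qq assms) auto
qed

lemma holomorphic_num:
  assumes "S \<subseteq> cball 0 r" "norm v \<le> L"
  shows "(\<lambda>t. num t v k) holomorphic_on S"
  unfolding num_def
  by (cases "k = 0") (auto intro!: holomorphic_intros holomorphic_ek holomorphic_ee holomorphic_coeffs[OF assms] assms)

lemma holomorphic_theta:
  assumes "S \<subseteq> cball 0 r" "norm v \<le> L"
  shows "(\<lambda>t. theta t v k) holomorphic_on S"
  unfolding theta_def using ek_ty_nz[OF _ assms(2)] assms(1)
  by (intro holomorphic_intros holomorphic_ek assms) auto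

lemma holomorphic_ww:
  assumes "S \<subseteq> cball 0 r" "norm v \<le> L"
  shows "(\<lambda>t. ww t v k) holomorphic_on S"
  unfolding ww_def by (intro holomorphic_intros holomorphic_theta assms)

lemma holomorphic_base:
  assumes "S \<subseteq> cball 0 r" "norm v \<le> L"
  shows "(\<lambda>t. base t v) holomorphic_on S"
  unfolding base_def using lin_nz(1)[OF _ assms(2)] assms(1)
  by (intro holomorphic_intros holomorphic_theta holomorphic_coeffs[OF assms] assms) (auto simp: subset_iff)

lemma continuous_ee: "continuous_on (cball 0 r \<times> cball 0 L) (\<lambda>p. ee (fst p))"
  unfolding ee_def by (intro continuous_on_exc[OF good1] continuous_intros) auto

lemma continuous_qq: "continuous_on (cball 0 r \<times> cball 0 L) (\<lambda>p. qq (fst p))"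
  unfolding qq_def by (intro continuous_intros continuous_ee)

lemma continuous_ek: "continuous_on (cball 0 r \<times> cball 0 L) (\<lambda>p. ek (fst p) (snd p) k)"
  unfolding ek_def
proof (intro continuous_on_exc[OF good])
  show "continuous_on (cball 0 r \<times> cball 0 L) (\<lambda>p. xk (fst p) (snd p) k)"
    unfolding xk_def by (intro continuous_intros continuous_qq)
qed (use norm_xk_le' in \<open>auto intro!: continuous_intros\<close>)

lemma continuous_den: "continuous_on (cball 0 r \<times> cball 0 L) (\<lambda>p. den (fst p) (snd p) k)"
  unfolding den_def by (intro continuous_intros continuous_ek continuous_ee)

lemma continuous_coeffs:
  "continuous_on (cball 0 r \<times> cball 0 L) (\<lambda>p. alpha (fst p))"
  "continuous_on (cball 0 r \<times> cball 0 L) (\<lambda>p. alE (fst p))"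
  "continuous_on (cball 0 r \<times> cball 0 L) (\<lambda>p. sE (fst p) (snd p))"
  "continuous_on (cball 0 r \<times> cball 0 L) (\<lambda>p. sN (fst p) (snd p))"
  "continuous_on (cball 0 r \<times> cball 0 L) (\<lambda>p. tau (fst p))"
proof -
  note nz = lin_nz
  show a: "continuous_on (cball 0 r \<times> cball 0 L) (\<lambda>p. alpha (fst p))"
    unfolding alpha_def using nz(2)[of _ 0] L by (intro continuous_intros) auto
  show "continuous_on (cball 0 r \<times> cball 0 L) (\<lambda>p. alE (fst p))"
    unfolding alE_def using nz(1)[of _ 0] L by (intro continuous_intros a) auto
  show s: "continuous_on (cball 0 r \<times> cball 0 L) (\<lambda>p. sE (fst p) (snd p))"
    unfolding sE_def using nz(3) by (intro continuous_intros) auto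
  show "continuous_on (cball 0 r \<times> cball 0 L) (\<lambda>p. sN (fst p) (snd p))"
    unfolding sN_def using nz(1)[of _ 0] L by (intro continuous_intros s) auto
  show "continuous_on (cball 0 r \<times> cball 0 L) (\<lambda>p. tau (fst p))"
    unfolding tau_def using one_tq(2) by (intro continuous_intros continuous_qq) auto
qed

lemma continuous_num: "continuous_on (cball 0 r \<times> cball 0 L) (\<lambda>p. num (fst p) (snd p) k)"
  unfolding num_def
  by (cases "k = 0") (auto intro!: continuous_intros continuous_ek continuous_ee continuous_coeffs)

lemma continuous_theta: "continuous_on (cball 0 r \<times> cball 0 L) (\<lambda>p. theta (fst p) (snd p) k)"
  unfolding theta_def using ek_ty_nz by (intro continuous_intros continuous_ek) auto

lemma continuous_ww: "continuous_on (cball 0 r \<times> cball 0 L) (\<lambda>p. ww (fst p) (snd p) k)"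
  unfolding ww_def by (intro continuous_intros continuous_theta)

lemma continuous_base: "continuous_on (cball 0 r \<times> cball 0 L) (\<lambda>p. base (fst p) (snd p))"
  unfolding base_def using lin_nz(1)[of _ 0] L
  by (intro continuous_intros continuous_theta continuous_coeffs) auto

text \<open>If \<open>e * E(t, v * q ^ k) < 1\<close> at the dominating real point for the first index beyond \<open>K\<close>, then all
later denominators are bounded away from zero, and the tail converges uniformly by the Weierstrass
test.\<close>

context
  fixes K :: nat
  assumes K: "eer r * ekr r L (Suc K) < 1"
begin

lemma f_lt: "k > K \<Longrightarrow> eer r * ekr r L k < 1"
  using K mult_left_mono[OF ekr_antimono[of "Suc K" k] eer_bounds(1)] by simp

lemma den_lower:
  assumes "norm t \<le> r" "norm v \<le> L"
  shows "1 - eer r * ekr r L k \<le> norm (den t v k)" "k > K \<Longrightarrow> den t v k \<noteq> 0"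
proof -
  have "norm (ee t * ek t v k) \<le> eer r * ekr r L k" unfolding norm_mult
    using norm_ee_le norm_ek_le assms eer_bounds by (intro mult_mono) auto
  then show 1: "1 - eer r * ekr r L k \<le> norm (den t v k)"
    using norm_triangle_ineq2[of 1 "ee t * ek t v k"] by (simp add: den_def)
  show "den t v k \<noteq> 0" if "k > K" using 1 f_lt[OF that] by auto
qed

lemma norm_rat_le:
  assumes "norm t \<le> r" "norm v \<le> L" "k > K"
  shows "norm (rat t v k) \<le> ratr r L k"
proof -
  have "norm (ek t v k - tau t) \<le> ekr r L k + taur r"
    using norm_triangle_ineq4[of "ek t v k" "tau t"] norm_ek_le[OF assms(1,2), of k] norm_tau_le[OF assms(1)] by linarith
  then have "norm (num t v k) \<le> eer r * (ekr r L k + taur r)"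
    using assms(3) norm_ee_le[OF assms(1)] eer_bounds unfolding num_def by (auto simp: norm_mult intro!: mult_mono)
  then show ?thesis unfolding rat_def ratr_def norm_divide
    using den_lower[OF assms(1,2)] f_lt[OF assms(3)] eer_bounds ekr_nonneg[of k] taur_nonneg
    by (intro frac_le) auto
qed

lemma ratr_nonneg: "k > K \<Longrightarrow> 0 \<le> ratr r L k"
  using f_lt[of k] eer_bounds ekr_nonneg[of k] taur_nonneg by (simp add: ratr_def)

lemma ratr_tendsto: "ratr r L \<longlonglongrightarrow> eer r * taur r"
proof -
  have "(\<lambda>k. eer r * (ekr r L k + taur r) / (1 - eer r * ekr r L k)) \<longlonglongrightarrow>
    eer r * (0 + taur r) / (1 - eer r * 0)"
    by (intro tendsto_intros ekr_tendsto) auto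
  then show ?thesis by (simp add: ratr_def[abs_def])
qed

lemma summable_majorant: "0 \<le> C \<Longrightarrow> summable (\<lambda>i. (\<Prod>j<i. ratr r L (Suc K + j)) * C)"
proof -
  assume C: "0 \<le> C"
  define c where "c = (1 + eer r * taur r) / 2"
  have c: "eer r * taur r < c" "c < 1" using ee_taur(2) by (auto simp: c_def)
  have "(\<lambda>j. ratr r L (Suc K + j)) \<longlonglongrightarrow> eer r * taur r"
    using LIMSEQ_ignore_initial_segment[OF ratr_tendsto, of "Suc K"] by (simp add: add.commute)
  then have "\<forall>\<^sub>F j in sequentially. ratr r L (Suc K + j) < c" using c(1) by (rule order_tendstoD(2))
  then obtain N where N: "\<And>j. j \<ge> N \<Longrightarrow> ratr r L (Suc K + j) < c" by (auto simp: eventually_sequentially)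
  show ?thesis
  proof (rule summable_ratio_test[OF c(2), of N])
    fix n assume n: "N \<le> n"
    have nn: "0 \<le> (\<Prod>j<n. ratr r L (Suc K + j)) * C"
      using ratr_nonneg C by (intro mult_nonneg_nonneg prod_nonneg) auto
    have "(\<Prod>j<Suc n. ratr r L (Suc K + j)) * C = ratr r L (Suc K + n) * ((\<Prod>j<n. ratr r L (Suc K + j)) * C)"
      by (simp add: mult_ac)
    moreover have p: "0 \<le> ratr r L (Suc K + n)" by (rule ratr_nonneg) simp
    ultimately have "norm ((\<Prod>j<Suc n. ratr r L (Suc K + j)) * C) =
        ratr r L (Suc K + n) * ((\<Prod>j<n. ratr r L (Suc K + j)) * C)"
      using nn by (metis abs_of_nonneg mult_nonneg_nonneg real_norm_def)
    also have "\<dots> \<le> c * ((\<Prod>j<n. ratr r L (Suc K + j)) * C)"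
      using nn N[OF n] by (intro mult_right_mono) auto
    also have "\<dots> = c * norm ((\<Prod>j<n. ratr r L (Suc K + j)) * C)"
      using nn by (metis abs_of_nonneg real_norm_def)
    finally show "norm ((\<Prod>j<Suc n. ratr r L (Suc K + j)) * C) \<le> c * norm ((\<Prod>j<n. ratr r L (Suc K + j)) * C)" .
  qed
qed

lemma term_le:
  assumes "norm t \<le> r" "norm v \<le> L"
  shows "norm ((\<Prod>j<i. rat t v (Suc K + j)) * ww t v (K + i)) \<le> (\<Prod>j<i. ratr r L (Suc K + j)) * wwr r L"
  unfolding norm_mult prod_norm[symmetric]
  using norm_rat_le[OF assms] ratr_nonneg norm_ww_le[OF assms] wwr_nonneg
  by (intro mult_mono prod_mono prod_nonneg) auto

lemma summable_tail:
  assumes "norm t \<le> r" "norm v \<le> L"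
  shows "summable (\<lambda>i. norm ((\<Prod>j<i. rat t v (Suc K + j)) * ww t v (K + i)))"
  by (rule summable_comparison_test'[OF summable_majorant[OF wwr_nonneg], of 0]) (use term_le[OF assms] in auto)

lemma tail_uniform:
  "uniform_limit (cball 0 r \<times> cball 0 L)
     (\<lambda>n p. \<Sum>i<n. (\<Prod>j<i. rat (fst p) (snd p) (Suc K + j)) * ww (fst p) (snd p) (K + i))
     (\<lambda>p. tail K (fst p) (snd p)) sequentially"
  unfolding tail_def by (rule Weierstrass_m_test[OF _ summable_majorant[OF wwr_nonneg]], rule term_le) auto

lemma continuous_rat: "k > K \<Longrightarrow> continuous_on (cball 0 r \<times> cball 0 L) (\<lambda>p. rat (fst p) (snd p) k)"
  unfolding rat_def using den_lower(2) by (intro continuous_intros continuous_num continuous_den) auto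

lemma holomorphic_rat:
  assumes "S \<subseteq> cball 0 r" "norm v \<le> L" "k > K"
  shows "(\<lambda>t. rat t v k) holomorphic_on S"
  unfolding rat_def using den_lower(2)[OF _ assms(2,3)] assms(1)
  by (intro holomorphic_intros holomorphic_num holomorphic_den assms) auto

lemma continuous_tail: "continuous_on (cball 0 r \<times> cball 0 L) (\<lambda>p. tail K (fst p) (snd p))"
  by (rule uniform_limit_theorem[OF _ tail_uniform])
     (auto intro!: always_eventually continuous_intros continuous_rat continuous_ww)

lemma holomorphic_tail:
  assumes v: "norm v \<le> L"
  shows "(\<lambda>t. tail K t v) holomorphic_on ball 0 r"
proof (rule holomorphic_uniform_sequence[OF open_ball])
  show "(\<lambda>t. \<Sum>i<n. (\<Prod>j<i. rat t v (Suc K + j)) * ww t v (K + i)) holomorphic_on ball 0 r" for n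
    by (intro holomorphic_intros holomorphic_rat holomorphic_ww v) auto
  fix x :: complex assume "x \<in> ball 0 r"
  then obtain d where d: "d > 0" "cball x d \<subseteq> ball 0 r" by (metis open_ball open_contains_cball)
  have "uniform_limit (cball x d) (\<lambda>n t. \<Sum>i<n. (\<Prod>j<i. rat t v (Suc K + j)) * ww t v (K + i)) (\<lambda>t. tail K t v) sequentially"
  proof -
    have "t \<in> cball x d \<Longrightarrow> norm t \<le> r" for t using d by (auto simp: subset_iff dest!: spec[of _ t])
    then have "(\<lambda>t. (t, v)) \<in> cball x d \<rightarrow> cball 0 r \<times> cball 0 L" using v by auto
    from uniform_limit_compose'[OF tail_uniform this] show ?thesis by simp
  qed
  then show "\<exists>d>0. cball x d \<subseteq> ball 0 r \<and> uniform_limit (cball x d)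
      (\<lambda>n t. \<Sum>i<n. (\<Prod>j<i. rat t v (Suc K + j)) * ww t v (K + i)) (\<lambda>t. tail K t v) sequentially"
    using d by blast
qed

end

end


section \<open>Solving the backward equations\<close>

lemma width_after: "after st d = Some st' \<Longrightarrow> width st' \<le> Suc (width st)"
proof -
  have 1: "width (east a b) \<le> Suc (a + b)" for a b by (cases a) auto
  have 2: "width (west a b) \<le> Suc (a + b)" for a b by (cases b) auto
  have 3: "width (side_up c d W) \<le> Suc W" for c d W by (cases d) auto
  show "after st d = Some st' \<Longrightarrow> width st' \<le> Suc (width st)"
    using 1 2 3 by (cases st; cases d) (auto split: if_splits)
qed

definition backward_sum :: "state \<Rightarrow> (state \<Rightarrow> complex) \<Rightarrow> complex" where
  "backward_sum st f = (\<Sum>d\<in>{North, East, South, West}. case after st d of None \<Rightarrow> 0 | Some st' \<Rightarrow> f st')"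

lemma backward_sum_norm:
  assumes "\<And>st'. norm (f st') \<le> M * L ^ width st'" "1 \<le> L" "0 \<le> M"
  shows "norm (backward_sum st f) \<le> 4 * (M * L * L ^ width st)"
proof -
  have b: "norm (case after st d of None \<Rightarrow> 0 | Some st' \<Rightarrow> f st') \<le> M * L * L ^ width st" for d
  proof (cases "after st d")
    case (Some st')
    have "M * L ^ width st' \<le> M * L ^ Suc (width st)"
      using assms width_after[OF Some] by (intro mult_left_mono power_increasing) auto
    then show ?thesis using Some assms(1)[of st'] by (simp add: mult_ac)
  qed (use assms in auto)
  have "norm (backward_sum st f) \<le> (\<Sum>d\<in>{North, East, South, West}. M * L * L ^ width st)"
    unfolding backward_sum_def by (intro sum_norm_le b)
  then show ?thesis by simp
qed

text \<open>A state has at most four successors, and a step increases the width by at most 1. So iterating the equations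
contracts the difference of two bounded solutions once \<open>4 * |t| * L < 1\<close>. It is this uniqueness
that allows verifying a solution instead of deriving it.\<close>

lemma backward_unique:
  assumes sol: "\<And>st. sol st = v ^ width st + t * backward_sum st sol"
    and bound: "\<And>st. norm (sol st) \<le> M * L ^ width st" and L: "1 \<le> L" and t: "4 * norm t * L < 1"
  shows "(\<lambda>n. cont n st v * t ^ n) sums sol st"
proof -
  define D where "D N st = sol st - (\<Sum>n<N. cont n st v * t ^ n)" for N st
  have M: "0 \<le> M" using order_trans[OF norm_ge_zero bound[of Start]] by simp
  have D_Suc: "D (Suc N) st = t * backward_sum st (D N)" for N st
  proof -
    have "(\<Sum>n<Suc N. cont n st v * t ^ n) = v ^ width st + (\<Sum>n<N. cont (Suc n) st v * t ^ Suc n)"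
      by (subst sum.lessThan_Suc_shift) simp
    also have "(\<Sum>n<N. cont (Suc n) st v * t ^ Suc n) = t * backward_sum st (\<lambda>st'. \<Sum>n<N. cont n st' v * t ^ n)"
      unfolding backward_sum_def cont.simps
      by (subst sum_distrib_left) (auto simp: sum_distrib_left sum_distrib_right sum.distrib algebra_simps split: option.splits)
    finally have "D (Suc N) st = t * backward_sum st sol - t * backward_sum st (\<lambda>st'. \<Sum>n<N. cont n st' v * t ^ n)"
      by (simp add: D_def sol[of st])
    also have "\<dots> = t * backward_sum st (D N)"
      unfolding backward_sum_def D_def by (simp add: algebra_simps split: option.splits)
    finally show ?thesis .
  qed
  have D_le: "norm (D N st) \<le> (4 * norm t * L) ^ N * M * L ^ width st" for N st
  proof (induction N arbitrary: st)
    case 0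
    then show ?case using bound by (simp add: D_def)
  next
    case (Suc N)
    have "norm (D (Suc N) st) = norm t * norm (backward_sum st (D N))" by (simp add: D_Suc norm_mult)
    also have "\<dots> \<le> norm t * (4 * ((4 * norm t * L) ^ N * M * L * L ^ width st))"
      using L M by (intro mult_left_mono backward_sum_norm Suc.IH) auto
    finally show ?case by (simp add: mult_ac)
  qed
  have "(\<lambda>N. (4 * norm t * L) ^ N * M * L ^ width st) \<longlonglongrightarrow> 0 * M * L ^ width st"
    using t L by (intro tendsto_intros LIMSEQ_power_zero) (auto simp: abs_mult)
  then have lim: "(\<lambda>N. (4 * norm t * L) ^ N * M * L ^ width st) \<longlonglongrightarrow> 0" by simp
  have "(\<lambda>N. D N st) \<longlonglongrightarrow> 0"
    by (rule Lim_null_comparison[OF always_eventually lim]) (simp add: D_le)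
  then have "(\<lambda>N. sol st - D N st) \<longlonglongrightarrow> sol st - 0" by (intro tendsto_intros)
  then show ?thesis by (simp add: sums_def D_def)
qed

context
  fixes r L :: real and t v :: complex
  assumes good: "good r L" and L: "1 \<le> L"
    and f0: "eer r * ekr r L 0 < 1"
    and t: "norm t \<le> r" and t0: "t \<noteq> 0" and v: "norm v \<le> L"
begin

private abbreviation (input) "e \<equiv> ee t"
private abbreviation (input) "q \<equiv> qq t"
private abbreviation (input) "x \<equiv> xk t v"
private abbreviation (input) "E \<equiv> ek t v"
definition "outc k = excx t (x k)"
definition "yk k = t * (1 + E k)"
definition "downc k = t * E k / (1 - t * yk k)"
private abbreviation (input) "b \<equiv> bb t v"

lemma f1: "eer r * ekr r L (Suc 0) < 1"
  using f_lt[OF good L, of 0 1] f0 mult_left_mono[OF ekr_antimono[OF good L, of 0 "Suc 0"] eer_bounds(1)[OF good L]] by simp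

lemma den_nz: "den t v k \<noteq> 0"
proof (cases k)
  case 0
  have "eer r * ekr r L 0 < 1" by (rule f0)
  then show ?thesis using den_lower(1)[OF good L f1 t v, of 0] 0 by auto
next
  case (Suc k')
  then show ?thesis using den_lower(2)[OF good L f1 t v] by simp
qed

lemma E_eq: "E k = x k * outc k" by (simp add: ek_def outc_def exc_def)

lemma e_nz: "e \<noteq> 0"
  using excx_nz[OF good1[OF good L] t _ t0, of 1] by (simp add: ee_def exc_def)

lemma yk_nz: "1 - t * yk k \<noteq> 0"
  unfolding yk_def by (rule ek_ty_nz[OF good L t v])

lemma tq_nz: "1 - t * q \<noteq> 0" by (rule one_tq(2)[OF good L t])

text \<open>The equation of the top edge after a step to the north, for the mode \<open>q ^ a\<close>. The terms come from the
next step: to the north, towards the right corner, away from it.\<close>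

lemma kernel: "e = t * e + t + t * tau t * e"
proof -
  have F: "t ^ 2 * e ^ 2 - (1 - t ^ 2) * (1 - t) * e + t * (1 - t ^ 2) = 0"
    using exc_eq[OF good1[OF good L] t, of 1] by (simp add: ee_def)
  have "(e - t * e - t) * (1 - t * q) = t * (t * q) * e"
    using F unfolding qq_def by algebra
  then have "e - t * e - t = t * (t * q) * e / (1 - t * q)"
    using tq_nz by (simp add: field_simps)
  then show ?thesis by (simp add: tau_def algebra_simps)
qed

text \<open>The homogeneous equations of a side edge. They express the decomposition of an excursion by its first
steps: an outward step, then nothing, another excursion, or a descent followed by a climb.\<close>

lemma X_eq: "outc k = t * (E k + downc k * yk k + 1)" "downc k = t * (E k + downc k * yk k)" "yk k = t * (1 + E k)"
proof -
  show yk: "yk k = t * (1 + E k)" by (simp add: yk_def)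
  show "downc k = t * (E k + downc k * yk k)" using yk_nz[of k] by (simp add: downc_def field_simps)
  have "(1 - t ^ 2) * (1 - t * x k) * outc k = t * (1 - t ^ 2) + t ^ 2 * x k * outc k ^ 2"
    unfolding outc_def by (rule excx_eq[OF good t]) (rule norm_xk_le'[OF good L t v])
  then have "outc k * (1 - t * yk k) = yk k * (1 - t ^ 2)" unfolding yk E_eq by algebra
  moreover have "t * (E k + downc k * yk k + 1) * (1 - t * yk k) = t * ((1 + E k) * (1 - t * yk k) + t * E k * yk k)"
    using yk_nz[of k] by (simp add: downc_def field_simps)
  moreover have "\<dots> = yk k * (1 - t ^ 2)" unfolding yk by algebra
  ultimately have "outc k * (1 - t * yk k) = t * (E k + downc k * yk k + 1) * (1 - t * yk k)" by simp
  then show "outc k = t * (E k + downc k * yk k + 1)" using yk_nz[of k] by simp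
qed

lemma coeff_eqs:
  "alpha t = 1 + t * (alpha t + 2 * alE t)" "alE t = 1 + t * (alpha t + alE t)"
  "sE t v = 1 + t * (v * sE t v + 2 * sN t v)" "sN t v = 1 + t * (v * sE t v + sN t v)"
proof -
  note nz = lin_nz[OF good L t v]
  show a: "alE t = 1 + t * (alpha t + alE t)" using nz(1) by (simp add: alE_def field_simps)
  show s: "sN t v = 1 + t * (v * sE t v + sN t v)" using nz(1) by (simp add: sN_def field_simps)
  have "alpha t * (1 - 2 * t - t ^ 2) = 1 + t" using nz(2) by (simp add: alpha_def)
  then have "(1 - t) * alpha t = (1 - t) * (1 + t * alpha t) + 2 * t * (1 + t * alpha t)" by algebra
  also have "1 + t * alpha t = (1 - t) * alE t" using a by algebra
  finally have "(1 - t) * alpha t = (1 - t) * (1 + t * (alpha t + 2 * alE t))" using a by algebra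
  then show "alpha t = 1 + t * (alpha t + 2 * alE t)" using nz(1) by simp
  have "sE t v * (1 - t - t * v - t ^ 2 * v) = 1 + t" using nz(3) by (simp add: sE_def)
  then have "(1 - t) * sE t v = (1 - t) * (1 + t * (v * sE t v + 2 * sN t v))" using s by algebra
  then show "sE t v = 1 + t * (v * sE t v + 2 * sN t v)" using nz(1) by simp
qed

lemma b_0: "b 0 * (1 - e * E 0) = e * (v * sE t v - alE t + (alpha t - sN t v) * E 0)"
  using den_nz[of 0] by (simp add: bb_def rat_def num_def den_def)

lemma b_Suc: "b (Suc k) * (1 - e * E (Suc k)) = b k * (e * (E (Suc k) - tau t))"
  using den_nz[of "Suc k"] by (simp add: bb_def rat_def num_def den_def)

lemma bb_prod: "b k = rat t v 0 * (\<Prod>j<k. rat t v (Suc 0 + j))"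
  by (simp add: bb_def prod.atMost_shift)

lemma summable_b: "summable (\<lambda>k. norm (b k))"
proof (rule summable_comparison_test'[of _ 0])
  show "summable (\<lambda>i. (\<Prod>j<i. ratr r L (Suc 0 + j)) * norm (rat t v 0))"
    by (rule summable_majorant[OF good L f1]) simp
  have "norm (b n) \<le> (\<Prod>j<n. ratr r L (Suc 0 + j)) * norm (rat t v 0)" for n
    unfolding bb_prod norm_mult prod_norm[symmetric]
    by (subst mult.commute, intro mult_right_mono prod_mono conjI norm_ge_zero norm_rat_le[OF good L f1 t v]) simp_all
  then show "norm (norm (b n)) \<le> (\<Prod>j<n. ratr r L (Suc 0 + j)) * norm (rat t v 0)" for n by simp
qed

definition bseq :: "(nat \<Rightarrow> complex) \<Rightarrow> bool" where "bseq \<phi> \<longleftrightarrow> (\<exists>M. \<forall>k. norm (\<phi> k) \<le> M)"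

lemma bd_intros:
  "bseq (\<lambda>k. c)" "bseq \<phi> \<Longrightarrow> bseq \<psi> \<Longrightarrow> bseq (\<lambda>k. \<phi> k + \<psi> k)" "bseq \<phi> \<Longrightarrow> bseq \<psi> \<Longrightarrow> bseq (\<lambda>k. \<phi> k * \<psi> k)"
  "bseq \<phi> \<Longrightarrow> bseq (\<lambda>k. \<phi> k ^ n)" "bseq \<phi> \<Longrightarrow> bseq (\<lambda>k. \<phi> (Suc k))"
  "bseq x" "bseq E" "bseq yk" "bseq outc" "bseq downc" "bseq (\<lambda>k. theta t v k)"
proof -
  show c: "bseq (\<lambda>k. c)" for c by (auto simp: bseq_def)
  show a: "bseq (\<lambda>k. \<phi> k + \<psi> k)" if "bseq \<phi>" "bseq \<psi>" for \<phi> \<psi>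
    using that unfolding bseq_def by (meson add_mono norm_triangle_le)
  show m: "bseq (\<lambda>k. \<phi> k * \<psi> k)" if "bseq \<phi>" "bseq \<psi>" for \<phi> \<psi>
  proof -
    obtain M N where "\<And>k. norm (\<phi> k) \<le> M" "\<And>k. norm (\<psi> k) \<le> N" using \<open>bseq \<phi>\<close> \<open>bseq \<psi>\<close> by (auto simp: bseq_def)
    then have "norm (\<phi> k * \<psi> k) \<le> M * N" for k
      unfolding norm_mult by (intro mult_mono) (auto intro: order_trans[OF norm_ge_zero])
    then show ?thesis by (auto simp: bseq_def)
  qed
  show "bseq (\<lambda>k. \<phi> k ^ n)" if "bseq \<phi>" for \<phi> n
    by (induction n) (use that m c in auto)
  show "bseq (\<lambda>k. \<phi> (Suc k))" if "bseq \<phi>" for \<phi> using that by (auto simp: bseq_def)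
  show "bseq x" using norm_xk_le'[OF good L t v] by (auto simp: bseq_def)
  show E: "bseq E" using norm_ek_le'[OF good L t v] by (auto simp: bseq_def)
  then show "bseq yk" unfolding yk_def[abs_def] by (intro m a c)
  show "bseq outc" unfolding outc_def bseq_def using norm_excx_le[OF good t norm_xk_le'[OF good L t v]] by blast
  have th: "norm (theta t v k) \<le> 2 * r * excr r L / (1 - r ^ 2 * (1 + excr r L))" for k
    by (rule norm_theta_le[OF good L t v])
  then show bt: "bseq (\<lambda>k. theta t v k)" by (auto simp: bseq_def)
  have "bseq (\<lambda>k. 1 / 2 * theta t v k)" by (intro m c bt)
  moreover have "(\<lambda>k. 1 / 2 * theta t v k) = downc" by (auto simp: theta_def downc_def yk_def)
  ultimately show "bseq downc" by simp
qed

definition coefsum :: "(nat \<Rightarrow> complex) \<Rightarrow> complex" where "coefsum \<phi> = (\<Sum>k. b k * \<phi> k)"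

lemma summable_S: "bseq \<phi> \<Longrightarrow> summable (\<lambda>k. b k * \<phi> k)"
proof -
  assume "bseq \<phi>"
  then obtain M where M: "\<And>k. norm (\<phi> k) \<le> M" by (auto simp: bseq_def)
  show ?thesis
    by (rule summable_norm_cancel, rule summable_comparison_test'[of "\<lambda>k. norm (b k) * M" 0])
       (auto intro!: summable_mult2 summable_b mult_left_mono M simp: norm_mult)
qed

lemma S_add: "bseq \<phi> \<Longrightarrow> bseq \<psi> \<Longrightarrow> coefsum (\<lambda>k. \<phi> k + \<psi> k) = coefsum \<phi> + coefsum \<psi>"
  unfolding coefsum_def by (simp add: distrib_left suminf_add summable_S)

lemma S_cmult: "bseq \<phi> \<Longrightarrow> coefsum (\<lambda>k. c * \<phi> k) = c * coefsum \<phi>"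
  unfolding coefsum_def using suminf_mult[OF summable_S, of \<phi> c] by (simp add: mult_ac)

text \<open>A side mode of parameter \<open>x\<^sub>k\<close> receives the amplitude \<open>b\<^sub>k\<close> from the near corner and the amplitude of
index \<open>k - 1\<close> from the far one; the first one receives the mismatch of the particular solutions instead
of the latter. Summation by the amplitudes \<open>b\<^sub>k\<close> thus collects \<open>\<phi> k + \<phi> (Suc k)\<close>.\<close>

definition modesum :: "(nat \<Rightarrow> complex) \<Rightarrow> complex" where
  "modesum \<phi> = (alpha t - sN t v) * \<phi> 0 + coefsum (\<lambda>k. \<phi> k + \<phi> (Suc k))"

lemma mode_add: "bseq \<phi> \<Longrightarrow> bseq \<psi> \<Longrightarrow> modesum (\<lambda>k. \<phi> k + \<psi> k) = modesum \<phi> + modesum \<psi>"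
proof -
  assume bseq: "bseq \<phi>" "bseq \<psi>"
  have "coefsum (\<lambda>k. (\<phi> k + \<phi> (Suc k)) + (\<psi> k + \<psi> (Suc k))) = coefsum (\<lambda>k. \<phi> k + \<phi> (Suc k)) + coefsum (\<lambda>k. \<psi> k + \<psi> (Suc k))"
    by (intro S_add bd_intros bseq)
  moreover have "(\<lambda>k. (\<phi> k + \<phi> (Suc k)) + (\<psi> k + \<psi> (Suc k))) = (\<lambda>k. \<phi> k + \<psi> k + (\<phi> (Suc k) + \<psi> (Suc k)))"
    by (simp add: algebra_simps)
  ultimately show ?thesis by (simp add: modesum_def algebra_simps)
qed

lemma mode_cmult: "bseq \<phi> \<Longrightarrow> modesum (\<lambda>k. c * \<phi> k) = c * modesum \<phi>"
proof -
  assume bseq: "bseq \<phi>"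
  have "coefsum (\<lambda>k. c * (\<phi> k + \<phi> (Suc k))) = c * coefsum (\<lambda>k. \<phi> k + \<phi> (Suc k))" by (intro S_cmult bd_intros bseq)
  then show ?thesis by (simp add: modesum_def algebra_simps)
qed

text \<open>The corner condition, which determines the amplitudes. At a corner of a box of width \<open>w\<close> the next
outward step leaves the top edge. The continuation of the top solution to distance \<open>-1\<close>
must therefore equal the side solution at depth 0. Comparing the coefficients of \<open>x\<^sub>k ^ w\<close> gives the
recursion of \<open>b\<close>: the mode \<open>x\<^sub>k ^ w * q ^ w\<close>, seen from the far corner, is \<open>x\<^bsub>k+1\<^esub> ^ w\<close>. In the sum,
the recursion telescopes.\<close>

lemma coupling:
  "v ^ Suc w * sE t v + modesum (\<lambda>k. x k ^ w * E k) = alE t * v ^ w + coefsum (\<lambda>k. x k ^ w * (1 / e + tau t * q ^ w))"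
proof -
  define A where "A k = b k * x k ^ w * (1 / e - E k)" for k
  have xs: "x (Suc k) = x k * q" for k by (simp add: xk_def)
  have step: "b k * (x k ^ w * (1 / e + tau t * q ^ w)) - b k * (x k ^ w * E k + x (Suc k) ^ w * E (Suc k)) = A k - A (Suc k)" for k
  proof -
    have "b (Suc k) * (1 / e - E (Suc k)) = b k * (E (Suc k) - tau t)"
      using b_Suc[of k] e_nz by (simp add: field_simps)
    then have "A (Suc k) = b k * x (Suc k) ^ w * (E (Suc k) - tau t)" by (simp add: A_def mult_ac)
    then show ?thesis by (simp add: A_def xs power_mult_distrib algebra_simps)
  qed
  have bdA: "bseq (\<lambda>k. x k ^ w * (1 / e + (-1) * E k))" by (intro bd_intros)
  have "(\<lambda>k. b k * (x k ^ w * (1 / e + (-1) * E k))) \<longlonglongrightarrow> 0" by (intro summable_LIMSEQ_zero summable_S bdA)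
  then have A0: "A \<longlonglongrightarrow> 0" by (simp add: A_def[abs_def] mult.assoc)
  have s1: "summable (\<lambda>k. b k * (x k ^ w * (1 / e + tau t * q ^ w)))" by (intro summable_S bd_intros)
  have s2: "summable (\<lambda>k. b k * (x k ^ w * E k + x (Suc k) ^ w * E (Suc k)))" by (intro summable_S bd_intros)
  have "coefsum (\<lambda>k. x k ^ w * (1 / e + tau t * q ^ w)) - coefsum (\<lambda>k. x k ^ w * E k + x (Suc k) ^ w * E (Suc k)) = (\<Sum>k. A k - A (Suc k))"
    unfolding coefsum_def by (subst suminf_diff[OF s1 s2]) (simp add: step)
  also have "\<dots> = A 0" using telescope_sums'[OF A0] by (simp add: sums_iff)
  also have "A 0 = v ^ w * (v * sE t v - alE t + (alpha t - sN t v) * E 0)"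
  proof -
    have "b 0 * (1 / e - E 0) = v * sE t v - alE t + (alpha t - sN t v) * E 0"
      using b_0 e_nz by (simp add: field_simps)
    then show ?thesis by (simp add: A_def xk_def mult_ac)
  qed
  finally show ?thesis by (simp add: modesum_def xk_def algebra_simps)
qed

definition up_val :: "nat \<Rightarrow> nat \<Rightarrow> complex" where
  "up_val d W = sN t v * v ^ W + modesum (\<lambda>k. x k ^ W * yk k ^ d)"

fun sol :: "state \<Rightarrow> complex" where
  "sol (TopN a c) = alpha t * v ^ (a + c) + coefsum (\<lambda>k. x k ^ (a + c) * (q ^ a + q ^ c))"
| "sol (TopE a c) = alE t * v ^ (a + c) + coefsum (\<lambda>k. x k ^ (a + c) * (q ^ Suc a / e + t / (1 - t * q) * q ^ c))"
| "sol (TopW a c) = alE t * v ^ (a + c) + coefsum (\<lambda>k. x k ^ (a + c) * (q ^ Suc c / e + t / (1 - t * q) * q ^ a))"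
| "sol (SideO z d W) = sE t v * v ^ W + modesum (\<lambda>k. x k ^ W * (outc k * yk k ^ d))"
| "sol (SideU z d W) = up_val (Suc d) W"
| "sol (SideD z d W) = sN t v * v ^ W + modesum (\<lambda>k. x k ^ W * (downc k * yk k ^ d))"
| "sol (Descent j) = (1 + 2 * t * v * sE t v) / (1 - t) + modesum (\<lambda>k. 2 * (downc k * yk k ^ j))"
| "sol Start = 1 + t * (alpha t + coefsum (\<lambda>k. 2) + 2 * (sE t v * v + modesum E)
     + ((1 + 2 * t * v * sE t v) / (1 - t) + modesum (\<lambda>k. 2 * (downc k * yk k))))"

lemma side_up_val: "sol (side_up z d W) = up_val d W"
proof (cases d)
  case 0
  have xs: "x (Suc k) ^ W = x k ^ W * q ^ W" for k by (simp add: xk_def power_mult_distrib)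
  have 1: "x 0 = v" by (simp add: xk_def)
  show ?thesis using 0 by (cases z) (simp_all add: up_val_def modesum_def xs 1 algebra_simps)
next
  case (Suc d')
  then show ?thesis by simp
qed

lemma east_val:
  "sol (east a c) = alE t * v ^ (a + c) + coefsum (\<lambda>k. x k ^ (a + c) * (q ^ a / e + tau t * q ^ c))"
proof (cases a)
  case 0
  have "(\<lambda>k. x k ^ Suc c * (outc k * yk k ^ 0)) = (\<lambda>k. x k ^ c * E k)" by (simp add: E_eq mult_ac)
  then show ?thesis using coupling[of c] 0 by (simp add: mult_ac)
next
  case (Suc a')
  then show ?thesis by (simp add: tau_def mult.assoc)
qed

lemma west_val:
  "sol (west a c) = alE t * v ^ (a + c) + coefsum (\<lambda>k. x k ^ (a + c) * (q ^ c / e + tau t * q ^ a))"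
proof (cases c)
  case 0
  have "(\<lambda>k. x k ^ Suc a * (outc k * yk k ^ 0)) = (\<lambda>k. x k ^ a * E k)" by (simp add: E_eq mult_ac)
  then show ?thesis using coupling[of a] 0 by (simp add: mult_ac)
next
  case (Suc a')
  then show ?thesis by (simp add: tau_def mult.assoc)
qed

lemma sol_side_eqs:
  "sol (SideO z d W) = v ^ W + t * (sol (SideO z d (Suc W)) + sol (SideD z (Suc d) W) + up_val d W)"
  "sol (SideD z d W) = v ^ W + t * (sol (SideO z d (Suc W)) + sol (SideD z (Suc d) W))"
  "up_val (Suc d) W = v ^ W + t * (sol (SideO z d (Suc W)) + up_val d W)"
proof -
  have out: "modesum (\<lambda>k. x k ^ Suc W * (outc k * yk k ^ d)) = modesum (\<lambda>k. x k ^ W * (E k * yk k ^ d))"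
    by (simp add: E_eq mult_ac)
  have bd1: "bseq (\<lambda>k. x k ^ W * (E k * yk k ^ d))" by (intro bd_intros)
  have bd2: "bseq (\<lambda>k. x k ^ W * (downc k * yk k ^ Suc d))" by (intro bd_intros)
  have bd3: "bseq (\<lambda>k. x k ^ W * yk k ^ d)" by (intro bd_intros)
  have "x k ^ W * (outc k * yk k ^ d) = t * ((x k ^ W * (E k * yk k ^ d) + x k ^ W * (downc k * yk k ^ Suc d)) + x k ^ W * yk k ^ d)" for k
    by (subst X_eq(1)) (simp add: algebra_simps)
  then have "modesum (\<lambda>k. x k ^ W * (outc k * yk k ^ d)) = t * ((modesum (\<lambda>k. x k ^ W * (E k * yk k ^ d)) +
      modesum (\<lambda>k. x k ^ W * (downc k * yk k ^ Suc d))) + modesum (\<lambda>k. x k ^ W * yk k ^ d))"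
    by (simp only: mode_cmult mode_add bd1 bd2 bd3 bd_intros)
  moreover have "v ^ W * sE t v = v ^ W * (1 + t * (v * sE t v + 2 * sN t v))" using coeff_eqs(3) by simp
  ultimately show "sol (SideO z d W) = v ^ W + t * (sol (SideO z d (Suc W)) + sol (SideD z (Suc d) W) + up_val d W)"
    unfolding sol.simps up_val_def out by (simp add: algebra_simps)
  have "x k ^ W * (downc k * yk k ^ d) = t * (x k ^ W * (E k * yk k ^ d) + x k ^ W * (downc k * yk k ^ Suc d))" for k
    by (subst X_eq(2)) (simp add: algebra_simps)
  then have "modesum (\<lambda>k. x k ^ W * (downc k * yk k ^ d)) = t * (modesum (\<lambda>k. x k ^ W * (E k * yk k ^ d)) +
      modesum (\<lambda>k. x k ^ W * (downc k * yk k ^ Suc d)))"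
    by (simp only: mode_cmult mode_add bd1 bd2 bd3 bd_intros)
  moreover have s4: "v ^ W * sN t v = v ^ W * (1 + t * (v * sE t v + sN t v))" using coeff_eqs(4) by simp
  ultimately show "sol (SideD z d W) = v ^ W + t * (sol (SideO z d (Suc W)) + sol (SideD z (Suc d) W))"
    unfolding sol.simps up_val_def out by (simp add: algebra_simps)
  have "x k ^ W * yk k ^ Suc d = t * (x k ^ W * (E k * yk k ^ d) + x k ^ W * yk k ^ d)" for k
    by (subst power_Suc, subst X_eq(3)) (simp add: algebra_simps)
  then have "modesum (\<lambda>k. x k ^ W * yk k ^ Suc d) = t * (modesum (\<lambda>k. x k ^ W * (E k * yk k ^ d)) + modesum (\<lambda>k. x k ^ W * yk k ^ d))"
    by (simp only: mode_cmult mode_add bd1 bd2 bd3 bd_intros)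
  then show "up_val (Suc d) W = v ^ W + t * (sol (SideO z d (Suc W)) + up_val d W)"
    unfolding sol.simps up_val_def out using s4 by (simp add: algebra_simps)
qed

lemma sol_TopN: "sol (TopN a c) = v ^ (a + c) + t * (sol (TopN a c) + sol (east a c) + sol (west a c))"
proof -
  have bd1: "bseq (\<lambda>k. x k ^ (a + c) * (q ^ a + q ^ c))" by (intro bd_intros)
  have bd2: "bseq (\<lambda>k. x k ^ (a + c) * (q ^ a / e + tau t * q ^ c))" "bseq (\<lambda>k. x k ^ (a + c) * (q ^ c / e + tau t * q ^ a))"
    by (intro bd_intros)+
  have one: "1 = t + t / e + t * tau t" using kernel e_nz by (simp add: field_simps)
  have "x k ^ (a + c) * (q ^ a + q ^ c) = t * ((x k ^ (a + c) * (q ^ a + q ^ c) + x k ^ (a + c) * (q ^ a / e + tau t * q ^ c))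
    + x k ^ (a + c) * (q ^ c / e + tau t * q ^ a))" for k
  proof -
    have "x k ^ (a + c) * (q ^ a + q ^ c) = (t + t / e + t * tau t) * (x k ^ (a + c) * (q ^ a + q ^ c))"
      using one by simp
    also have "\<dots> = t * ((x k ^ (a + c) * (q ^ a + q ^ c) + x k ^ (a + c) * (q ^ a / e + tau t * q ^ c))
        + x k ^ (a + c) * (q ^ c / e + tau t * q ^ a))"
      by (simp add: algebra_simps)
    finally show ?thesis .
  qed
  then have "coefsum (\<lambda>k. x k ^ (a + c) * (q ^ a + q ^ c)) = coefsum (\<lambda>k. t * ((x k ^ (a + c) * (q ^ a + q ^ c) +
     x k ^ (a + c) * (q ^ a / e + tau t * q ^ c)) + x k ^ (a + c) * (q ^ c / e + tau t * q ^ a)))"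
    by (intro arg_cong[where f = coefsum] ext)
  also have "\<dots> = t * ((coefsum (\<lambda>k. x k ^ (a + c) * (q ^ a + q ^ c)) +
     coefsum (\<lambda>k. x k ^ (a + c) * (q ^ a / e + tau t * q ^ c))) + coefsum (\<lambda>k. x k ^ (a + c) * (q ^ c / e + tau t * q ^ a)))"
    by (simp only: S_cmult S_add bd1 bd2 bd_intros)
  finally have "coefsum (\<lambda>k. x k ^ (a + c) * (q ^ a + q ^ c)) = t * ((coefsum (\<lambda>k. x k ^ (a + c) * (q ^ a + q ^ c)) +
     coefsum (\<lambda>k. x k ^ (a + c) * (q ^ a / e + tau t * q ^ c))) + coefsum (\<lambda>k. x k ^ (a + c) * (q ^ c / e + tau t * q ^ a)))" .
  moreover have "v ^ (a + c) * alpha t = v ^ (a + c) * (1 + t * (alpha t + 2 * alE t))" using coeff_eqs(1) by simp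
  ultimately show ?thesis unfolding east_val west_val sol.simps by (simp add: algebra_simps)
qed

lemma sol_TopE: "sol (TopE a c) = v ^ (a + c) + t * (sol (TopN a c) + sol (east a c))"
proof -
  have bd1: "bseq (\<lambda>k. x k ^ (a + c) * (q ^ a + q ^ c))" by (intro bd_intros)
  have bd2: "bseq (\<lambda>k. x k ^ (a + c) * (q ^ a / e + tau t * q ^ c))" by (intro bd_intros)
  have 1: "q / e = t + t / e" using e_nz by (simp add: qq_def field_simps)
  have 2: "t / (1 - t * q) = t + t * tau t" using tq_nz by (simp add: tau_def field_simps)
  have "x k ^ (a + c) * (q ^ Suc a / e + t / (1 - t * q) * q ^ c) =
     t * (x k ^ (a + c) * (q ^ a + q ^ c) + x k ^ (a + c) * (q ^ a / e + tau t * q ^ c))" for k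
  proof -
    have "x k ^ (a + c) * (q ^ Suc a / e + t / (1 - t * q) * q ^ c) =
      x k ^ (a + c) * ((q / e) * q ^ a + t / (1 - t * q) * q ^ c)" by simp
    then show ?thesis unfolding 1 2 by (simp add: algebra_simps)
  qed
  then have "coefsum (\<lambda>k. x k ^ (a + c) * (q ^ Suc a / e + t / (1 - t * q) * q ^ c)) =
    t * (coefsum (\<lambda>k. x k ^ (a + c) * (q ^ a + q ^ c)) + coefsum (\<lambda>k. x k ^ (a + c) * (q ^ a / e + tau t * q ^ c)))"
    by (simp only: S_cmult S_add bd1 bd2 bd_intros)
  moreover have "v ^ (a + c) * alE t = v ^ (a + c) * (1 + t * (alpha t + alE t))" using coeff_eqs(2) by simp
  ultimately show ?thesis unfolding east_val sol.simps by (simp add: algebra_simps)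
qed

lemma sol_TopW: "sol (TopW a c) = v ^ (a + c) + t * (sol (TopN a c) + sol (west a c))"
proof -
  have "sol (TopW a c) = sol (TopE c a)" "sol (TopN a c) = sol (TopN c a)" by (simp_all add: add.commute)
  moreover have "sol (west a c) = sol (east c a)" unfolding west_val east_val by (simp add: add.commute)
  ultimately show ?thesis using sol_TopE[of c a] by (simp add: add.commute)
qed

lemma sol_Descent: "sol (Descent j) = 1 + t * (sol (Descent (Suc j)) + 2 * sol (SideO z j 1))"
proof -
  have out: "modesum (\<lambda>k. x k ^ 1 * (outc k * yk k ^ j)) = modesum (\<lambda>k. E k * yk k ^ j)"
    by (simp add: E_eq mult_ac)
  have bd1: "bseq (\<lambda>k. 2 * (downc k * yk k ^ Suc j))" "bseq (\<lambda>k. E k * yk k ^ j)" by (intro bd_intros)+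
  have "2 * (downc k * yk k ^ j) = t * (2 * (downc k * yk k ^ Suc j) + 2 * (E k * yk k ^ j))" for k
    by (subst X_eq(2)) (simp add: algebra_simps)
  then have "modesum (\<lambda>k. 2 * (downc k * yk k ^ j)) = t * (modesum (\<lambda>k. 2 * (downc k * yk k ^ Suc j)) + 2 * modesum (\<lambda>k. E k * yk k ^ j))"
    by (simp only: mode_cmult mode_add bd1 bd_intros)
  moreover have "(1 + 2 * t * v * sE t v) / (1 - t) = 1 + t * ((1 + 2 * t * v * sE t v) / (1 - t) + 2 * (v * sE t v))"
    using lin_nz(1)[OF good L t v] by (simp add: field_simps)
  moreover have "cc + A = 1 + t * ((cc + A') + 2 * (s * v ^ 1 + D))"
    if "A = t * (A' + 2 * D)" "cc = 1 + t * (cc + 2 * (v * s))" for A A' D cc s :: complex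
    using that by algebra
  ultimately show ?thesis unfolding sol.simps out by blast
qed

lemma sol_backward: "sol st = v ^ width st + t * backward_sum st sol"
proof (cases st)
  case Start
  have 1: "sol (SideO z 0 1) = sE t v * v + modesum E" for z by (simp add: E_eq[abs_def])
  show ?thesis using 1[of True] 1[of False] Start
    by (simp add: backward_sum_def)
next
  case (Descent j)
  have "sol (SideO False j 1) = sol (SideO True j 1)" by simp
  then show ?thesis using sol_Descent[of j True] Descent
    by (simp add: backward_sum_def del: sol.simps)
next
  case (TopN a c)
  show ?thesis unfolding TopN using sol_TopN[of a c] by (simp add: backward_sum_def algebra_simps del: sol.simps)
next
  case (TopE a c)
  show ?thesis unfolding TopE using sol_TopE[of a c] by (simp add: backward_sum_def algebra_simps del: sol.simps)
next
  case (TopW a c)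
  show ?thesis unfolding TopW using sol_TopW[of a c] by (simp add: backward_sum_def algebra_simps del: sol.simps)
next
  case (SideO z d W)
  show ?thesis unfolding SideO using sol_side_eqs(1)[of z d W] side_up_val[of z d W]
    by (cases z) (simp_all add: backward_sum_def algebra_simps del: sol.simps)
next
  case (SideU z d W)
  have "sol (SideU z d W) = up_val (Suc d) W" by simp
  then show ?thesis unfolding SideU using sol_side_eqs(3)[of d W z] side_up_val[of z d W]
    by (cases z) (simp_all add: backward_sum_def algebra_simps del: sol.simps)
next
  case (SideD z d W)
  show ?thesis unfolding SideD using sol_side_eqs(2)[of z d W]
    by (cases z) (simp_all add: backward_sum_def algebra_simps del: sol.simps)
qed

lemma sol_Start: "sol Start = PP t v"
proof -
  define M where "M = 2 * r * excr r L / (1 - r ^ 2 * (1 + excr r L))"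
  have th: "theta t v k = 2 * t * E k + 2 * t * (downc k * yk k)" for k
  proof -
    have "2 * t * E k + 2 * t * (downc k * yk k) = 2 * (t * (E k + downc k * yk k))" by (simp add: algebra_simps)
    also have "\<dots> = 2 * downc k" using X_eq(2)[of k] by simp
    also have "\<dots> = theta t v k" by (simp add: theta_def downc_def yk_def)
    finally show ?thesis ..
  qed
  have "modesum (\<lambda>k. theta t v k) = modesum (\<lambda>k. 2 * t * E k + 2 * t * (downc k * yk k))" by (simp only: th)
  also have "\<dots> = 2 * t * modesum E + 2 * t * modesum (\<lambda>k. downc k * yk k)"
    by (simp only: mode_add mode_cmult bd_intros)
  finally have mth: "modesum (theta t v) = 2 * t * modesum E + t * modesum (\<lambda>k. 2 * (downc k * yk k))"
    by (simp add: mode_cmult bd_intros)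
  have "coefsum (ww t v) = coefsum (\<lambda>k. t * 2 + (theta t v k + theta t v (Suc k)))"
    by (simp add: ww_def[abs_def] algebra_simps)
  also have "\<dots> = t * coefsum (\<lambda>k. 2) + coefsum (\<lambda>k. theta t v k + theta t v (Suc k))"
    by (simp only: S_add S_cmult bd_intros)
  also have "\<dots> = t * coefsum (\<lambda>k. 2) + modesum (theta t v) - (alpha t - sN t v) * theta t v 0"
    by (simp add: modesum_def)
  finally have "coefsum (ww t v) = t * coefsum (\<lambda>k. 2) + 2 * t * modesum E + t * modesum (\<lambda>k. 2 * (downc k * yk k))
      - (alpha t - sN t v) * theta t v 0" unfolding mth by simp
  moreover have "coefsum (ww t v) = rat t v 0 * tail 0 t v"
    unfolding coefsum_def bb_prod tail_def
    using suminf_mult[OF summable_norm_cancel[OF summable_tail[OF good L f1 t v]], of "rat t v 0"]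
    by (simp add: mult.assoc)
  ultimately show ?thesis by (simp add: PP_def base_def algebra_simps)
qed

lemma norm_modesum_le:
  assumes "\<And>k. norm (\<phi> k) \<le> M"
  shows "norm (modesum \<phi>) \<le> (norm (alpha t - sN t v) + 2 * (\<Sum>k. norm (b k))) * M"
proof -
  have "norm (coefsum (\<lambda>k. \<phi> k + \<phi> (Suc k))) \<le> (\<Sum>k. norm (b k) * (2 * M))"
    unfolding coefsum_def
  proof (rule norm_suminf_le)
    show "summable (\<lambda>k. norm (b k) * (2 * M))" by (intro summable_mult2 summable_b)
    show "norm (b k * (\<phi> k + \<phi> (Suc k))) \<le> norm (b k) * (2 * M)" for k
      unfolding norm_mult using assms[of k] assms[of "Suc k"] norm_triangle_ineq[of "\<phi> k" "\<phi> (Suc k)"]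
      by (intro mult_left_mono) auto
  qed
  also have "\<dots> = 2 * (\<Sum>k. norm (b k)) * M"
    using suminf_mult2[OF summable_b, of "2 * M"] by simp
  finally have "norm (coefsum (\<lambda>k. \<phi> k + \<phi> (Suc k))) \<le> 2 * (\<Sum>k. norm (b k)) * M" .
  moreover have "norm ((alpha t - sN t v) * \<phi> 0) \<le> norm (alpha t - sN t v) * M"
    unfolding norm_mult using assms by (intro mult_left_mono) auto
  ultimately show ?thesis unfolding modesum_def
    by (intro order_trans[OF norm_triangle_ineq]) (simp add: algebra_simps)
qed

lemma norm_coefsum_le:
  assumes "\<And>k. norm (\<phi> k) \<le> M"
  shows "norm (coefsum \<phi>) \<le> (\<Sum>k. norm (b k)) * M"
proof -
  have "norm (coefsum \<phi>) \<le> (\<Sum>k. norm (b k) * M)"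
    unfolding coefsum_def
    by (rule norm_suminf_le) (auto intro!: summable_mult2 summable_b mult_left_mono assms simp: norm_mult)
  then show ?thesis using suminf_mult2[OF summable_b, of M] by simp
qed

text \<open>The bound that uniqueness needs: every mode has parameter of modulus at most \<open>L\<close>, and the amplitudes are
summable.\<close>

lemma sol_bound: "\<exists>M. \<forall>st. norm (sol st) \<le> M * L ^ width st"
proof -
  have q1: "norm (q ^ a) \<le> 1" for a
  proof -
    have "norm q \<le> 1" using norm_qq_le[OF good L t] qqr_bounds[OF good L] by simp
    then show ?thesis unfolding norm_power by (intro power_le_one) auto
  qed
  obtain Y where Y: "\<And>k. norm (outc k) \<le> Y" "\<And>k. norm (downc k) \<le> Y"
  proof -
    obtain M N where "\<And>k. norm (outc k) \<le> M" "\<And>k. norm (downc k) \<le> N"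
      using bd_intros(9,10) unfolding bseq_def by blast
    then have "norm (outc k) \<le> max M N" "norm (downc k) \<le> max M N" for k
      by (simp_all add: le_max_iff_disj)
    then show ?thesis using that by blast
  qed
  have Y0: "0 \<le> Y" using order_trans[OF norm_ge_zero Y(1)] .
  have y1: "norm (yk k ^ d) \<le> 1" for k d
  proof -
    have "norm (yk k) \<le> r * (1 + excr r L)"
      unfolding yk_def norm_mult using t norm_ek_le'[OF good L t v, of k] norm_triangle_ineq[of 1 "E k"] goodD[OF good] excxr_nonneg[OF good]
      by (intro mult_mono) auto
    also have "\<dots> \<le> r * (1 + 2 * r * L / (1 - r * L))"
      using excr_le[OF good] goodD[OF good] by (intro mult_left_mono add_left_mono) auto
    also have "\<dots> = r * (1 + r * L) / (1 - r * L)" using goodD[OF good] by (simp add: field_simps)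
    also have "\<dots> \<le> 1" using good_alt[OF good] goodD[OF good] by (simp add: divide_le_eq)
    finally show ?thesis unfolding norm_power by (intro power_le_one) auto
  qed
  have xw: "norm (x k ^ w) \<le> L ^ w" for k w
    unfolding norm_power using norm_xk_le'[OF good L t v] by (intro power_mono) auto
  have vw: "norm (v ^ w) \<le> L ^ w" for w
    unfolding norm_power using v by (intro power_mono) auto
  define C where "C = norm (alpha t) + norm (alE t) + norm (sE t v) + norm (sN t v) + norm ((1 + 2 * t * v * sE t v) / (1 - t))"
  have C: "norm (alpha t) \<le> C" "norm (alE t) \<le> C" "norm (sE t v) \<le> C" "norm (sN t v) \<le> C"
    "norm ((1 + 2 * t * v * sE t v) / (1 - t)) \<le> C" "0 \<le> C"
    unfolding C_def by (auto intro!: add_nonneg_nonneg)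
  define SB where "SB = (\<Sum>k. norm (b k))"
  have SB: "0 \<le> SB" unfolding SB_def by (intro suminf_nonneg summable_b) auto
  define D where "D = norm (alpha t - sN t v) + 2 * SB"
  have D: "0 \<le> D" using SB by (simp add: D_def)
  define T where "T = 2 + norm (1 / e) + norm (t / (1 - t * q))"
  have T: "0 \<le> T" "norm (1 / e) + norm (t / (1 - t * q)) \<le> T" by (simp_all add: T_def)
  define M0 where "M0 = C + SB * T + D * (2 * Y + 1)"
  have M0: "C + SB * T \<le> M0" "C + D * Y \<le> M0" "C + D \<le> M0" "C + D * (2 * Y) \<le> M0"
    using C(6) SB D Y0 T(1) unfolding M0_def by (auto simp: algebra_simps intro!: add_nonneg_nonneg)
  have Lw: "0 \<le> L ^ w" for w using L by simp
  have top: "norm (a0 * v ^ w + coefsum (\<lambda>k. x k ^ w * g)) \<le> M0 * L ^ w"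
    if "norm a0 \<le> C" "norm g \<le> T" for a0 g w
  proof -
    have "norm (x k ^ w * g) \<le> L ^ w * T" for k
      unfolding norm_mult using xw that Lw by (intro mult_mono) auto
    then have "norm (coefsum (\<lambda>k. x k ^ w * g)) \<le> SB * (L ^ w * T)"
      unfolding SB_def by (rule norm_coefsum_le)
    moreover have "norm (a0 * v ^ w) \<le> C * L ^ w" unfolding norm_mult using that vw C by (intro mult_mono) auto
    ultimately have "norm (a0 * v ^ w + coefsum (\<lambda>k. x k ^ w * g)) \<le> (C + SB * T) * L ^ w"
      by (intro order_trans[OF norm_triangle_ineq]) (simp add: algebra_simps)
    also have "\<dots> \<le> M0 * L ^ w" using M0(1) Lw by (intro mult_right_mono) auto
    finally show ?thesis .
  qed
  have side: "norm (a0 * v ^ w + modesum (\<lambda>k. x k ^ w * g k)) \<le> M0 * L ^ w"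
    if "norm a0 \<le> C" "\<And>k. norm (g k) \<le> Z" "C + D * Z \<le> M0" for a0 g w Z
  proof -
    have "norm (x k ^ w * g k) \<le> L ^ w * Z" for k
      unfolding norm_mult using xw that Lw by (intro mult_mono) auto
    then have "norm (modesum (\<lambda>k. x k ^ w * g k)) \<le> D * (L ^ w * Z)"
      unfolding SB_def D_def by (rule norm_modesum_le)
    moreover have "norm (a0 * v ^ w) \<le> C * L ^ w" unfolding norm_mult using that vw C by (intro mult_mono) auto
    ultimately have "norm (a0 * v ^ w + modesum (\<lambda>k. x k ^ w * g k)) \<le> (C + D * Z) * L ^ w"
      by (intro order_trans[OF norm_triangle_ineq]) (simp add: algebra_simps)
    also have "\<dots> \<le> M0 * L ^ w" using that(3) Lw by (intro mult_right_mono) auto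
    finally show ?thesis .
  qed
  have gy: "norm (g * yk k ^ d) \<le> Y" if "norm g \<le> Y" for g k d
    unfolding norm_mult using mult_mono[OF that y1[of k d]] Y0 by simp
  have tt: "norm (q ^ a / e + t / (1 - t * q) * q ^ c) \<le> T" for a c
  proof -
    have "norm (q ^ a / e) \<le> norm (1 / e)" using mult_right_mono[OF q1[of a], of "norm (1 / e)"] by (simp add: norm_mult norm_divide)
    moreover have "norm (t / (1 - t * q) * q ^ c) \<le> norm (t / (1 - t * q))"
      unfolding norm_mult using mult_left_mono[OF q1[of c], of "norm (t / (1 - t * q))"] by simp
    ultimately show ?thesis using T(2) norm_triangle_ineq[of "q ^ a / e" "t / (1 - t * q) * q ^ c"] by linarith
  qed
  have qq2: "norm (q ^ a + q ^ c) \<le> T" for a c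
    using q1[of a] q1[of c] norm_triangle_ineq[of "q ^ a" "q ^ c"] norm_ge_zero[of "1 / e"] norm_ge_zero[of "t / (1 - t * q)"]
    unfolding T_def by linarith
  define M where "M = M0 + norm (sol Start)"
  have MM: "M0 * L ^ w \<le> M * L ^ w" for w using Lw by (intro mult_right_mono) (auto simp: M_def)
  have "norm (sol st) \<le> M * L ^ width st" for st
  proof (cases st)
    case Start
    have "0 \<le> M0" using M0 C(6) D by linarith
    then show ?thesis using Start by (simp add: M_def del: sol.simps)
  next
    case (Descent j)
    have g: "norm (2 * (downc k * yk k ^ j)) \<le> 2 * Y" for k using gy[OF Y(2)[of k], of k j] by (simp add: norm_mult)
    have "norm ((1 + 2 * t * v * sE t v) / (1 - t) * v ^ 0 + modesum (\<lambda>k. x k ^ 0 * (2 * (downc k * yk k ^ j)))) \<le> M0 * L ^ 0"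
      by (rule side[OF C(5) g M0(4)])
    then show ?thesis using Descent MM[of 0] by simp
  next
    case (TopN a c)
    show ?thesis unfolding TopN using order_trans[OF top[OF C(1) qq2] MM] by simp
  next
    case (TopE a c)
    show ?thesis unfolding TopE using order_trans[OF top[OF C(2) tt] MM] by (simp del: power_Suc)
  next
    case (TopW a c)
    show ?thesis unfolding TopW using order_trans[OF top[OF C(2) tt] MM] by (simp del: power_Suc)
  next
    case (SideO z d W)
    show ?thesis unfolding SideO using order_trans[OF side[OF C(3) gy[OF Y(1)] M0(2)] MM] by simp
  next
    case (SideU z d W)
    have "norm (sN t v * v ^ W + modesum (\<lambda>k. x k ^ W * yk k ^ Suc d)) \<le> M0 * L ^ W"
      by (rule side[OF C(4) y1]) (use M0(3) in simp)
    from order_trans[OF this MM] show ?thesis unfolding SideU sol.simps up_val_def width.simps .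
  next
    case (SideD z d W)
    show ?thesis unfolding SideD using order_trans[OF side[OF C(4) gy[OF Y(2)] M0(2)] MM] by simp
  qed
  then show ?thesis by blast
qed

lemma width_poly_sums_aux:
  assumes "4 * norm t * L < 1"
  shows "(\<lambda>n. width_poly n v * t ^ n) sums PP t v"
proof -
  obtain M where "\<And>st. norm (sol st) \<le> M * L ^ width st" using sol_bound by blast
  from backward_unique[OF sol_backward this L assms, of Start] show ?thesis
    by (simp only: sol_Start width_poly_eq)
qed

end


section \<open>The real zeros of the denominators\<close>

definition tcrit :: real where "tcrit = sqrt 2 - 1"

lemma tcrit: "0 < tcrit" "tcrit < 1/2" "tcrit ^ 2 = 1 - 2 * tcrit" "tcrit < 1"
proof -
  show "0 < tcrit" by (simp add: tcrit_def)
  have "sqrt 2 < sqrt ((3/2)^2)" by (intro real_sqrt_less_mono) (simp add: power2_eq_square)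
  then show "tcrit < 1/2" "tcrit < 1" by (simp_all add: tcrit_def real_sqrt_abs)
  show "tcrit ^ 2 = 1 - 2 * tcrit" by (simp add: tcrit_def power2_eq_square algebra_simps)
qed

lemma good_iff: "good x 1 \<longleftrightarrow> 0 \<le> x \<and> x < tcrit"
proof -
  have "x < tcrit \<longleftrightarrow> 2 * x + x ^ 2 < 1" if "0 \<le> x"
  proof -
    have "tcrit ^ 2 - x ^ 2 = (tcrit - x) * (tcrit + x)" by (simp add: power2_eq_square algebra_simps)
    then have "1 - 2 * x - x ^ 2 = (tcrit - x) * (tcrit + x + 2)" using tcrit(3) by (simp add: algebra_simps)
    moreover have "0 < tcrit + x + 2" using that tcrit(1) by simp
    ultimately show ?thesis
      by (smt (verit) zero_less_mult_iff mult_pos_neg mult_nonpos_nonneg)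
  qed
  then show ?thesis by (auto simp: good_def)
qed

lemma excxr_pos: "good r L \<Longrightarrow> 0 < r \<Longrightarrow> 0 < excxr r L"
  using catr_catarg_pos(1) goodD(6) by (simp add: excxr_def)

lemma excr_strict:
  assumes "good r L" "0 < r" "0 \<le> x" "x < L"
  shows "excr r x < excr r L"
proof -
  have "excxr r x \<le> excxr r L" using excxr_mono(1)[OF assms(1), of r x] assms by auto
  moreover have "0 < excxr r L" using excxr_pos assms by auto
  ultimately have "x * excxr r x \<le> x * excxr r L" "x * excxr r L < L * excxr r L"
    using assms by (auto intro!: mult_left_mono mult_strict_right_mono)
  then show ?thesis by (simp add: excr_def)
qed

definition rf :: "real \<Rightarrow> nat \<Rightarrow> real" where "rf x k = eer x * ekr x 1 k"

context
  fixes x :: real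
  assumes x: "0 < x" "x < tcrit"
begin

lemma gx: "good x 1" using x by (simp add: good_iff)

lemma eer_pos: "0 < eer x" using excxr_pos[OF gx x(1)] by (simp add: eer_def excr_def)

lemma qqr_pos: "0 < qqr x" "qqr x < 1" "x < qqr x"
  using qqr_bounds[OF gx] eer_pos x by (auto simp: qqr_def)

lemma ekr_pos: "0 < ekr x 1 k"
proof -
  have "good x (1 * qqr x ^ k)" by (rule good_k[OF gx]) simp
  from excxr_pos[OF this x(1)] show ?thesis using qqr_pos by (simp add: ekr_def excr_def)
qed

lemma ekr_0: "ekr x 1 0 = eer x" by (simp add: ekr_def eer_def)

lemma ekr_strict: "j < k \<Longrightarrow> ekr x 1 k < ekr x 1 j"
proof -
  assume "j < k"
  then have "qqr x ^ k < qqr x ^ j" using qqr_pos by (intro power_strict_decreasing) auto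
  moreover have "good x (1 * qqr x ^ j)" by (rule good_k[OF gx]) simp
  ultimately show ?thesis using excr_strict[of x "qqr x ^ j" "qqr x ^ k"] x qqr_pos by (simp add: ekr_def)
qed

lemma rf_strict: "j < k \<Longrightarrow> rf x k < rf x j"
  unfolding rf_def using ekr_strict eer_pos by (intro mult_strict_left_mono) auto

lemma rf_pos: "0 < rf x k"
  using ekr_pos eer_pos by (simp add: rf_def)

lemma rf_tendsto: "rf x \<longlonglongrightarrow> 0"
proof -
  have "(\<lambda>k. eer x * ekr x 1 k) \<longlonglongrightarrow> eer x * 0"
    by (intro tendsto_intros ekr_tendsto[OF gx]) simp
  then show ?thesis by (simp add: rf_def[abs_def])
qed

lemma taur_lt: "eer x * taur x < 1" "0 < taur x"
proof -
  show "eer x * taur x < 1" using ee_taur(2)[OF gx] by simp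
  show "0 < taur x" using rq_lt[OF gx] qqr_pos x by (simp add: taur_def)
qed

lemma of_real_values:
  "ee (of_real x) = of_real (eer x)" "qq (of_real x) = of_real (qqr x)"
  "ek (of_real x) 1 k = of_real (ekr x 1 k)" "tau (of_real x) = of_real (taur x)"
proof -
  show e: "ee (of_real x) = of_real (eer x)"
    using exc_of_real[OF gx, of x 1] x by (simp add: ee_def eer_def)
  show q: "qq (of_real x) = of_real (qqr x)" by (simp add: qq_def qqr_def e)
  have "qqr x ^ k \<le> 1" using qqr_pos by (intro power_le_one) auto
  then show "ek (of_real x) 1 k = of_real (ekr x 1 k)"
    using exc_of_real[OF gx, of x "qqr x ^ k"] x qqr_pos by (simp add: ek_def xk_def ekr_def q)
  show "tau (of_real x) = of_real (taur x)" by (simp add: tau_def taur_def q)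
qed

lemma den_of_real: "den (of_real x) 1 k = of_real (1 - rf x k)"
  by (simp add: den_def rf_def of_real_values)

end

lemma eer_mono: "0 \<le> x \<Longrightarrow> x \<le> y \<Longrightarrow> y < tcrit \<Longrightarrow> eer x \<le> eer y"
  unfolding eer_def using excxr_mono(2)[of y 1 x 1] good_iff[of y] by simp

lemma eer_slope: "0 < x \<Longrightarrow> x \<le> y \<Longrightarrow> y < tcrit \<Longrightarrow> y / x * eer x \<le> eer y"
proof -
  assume a: "0 < x" "x \<le> y" "y < tcrit"
  have "1 / (1 - x * 1) * catr (catarg x 1) \<le> 1 / (1 - y * 1) * catr (catarg y 1)"
    using excxr_div_mono[of y 1 x 1] a by (simp add: good_iff)
  from mult_left_mono[OF this, of y] a show ?thesis
    by (simp add: eer_def excr_def excxr_def)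
qed

lemma qqr_mono: "0 \<le> x \<Longrightarrow> x \<le> y \<Longrightarrow> y < tcrit \<Longrightarrow> qqr x \<le> qqr y"
  unfolding qqr_def using eer_mono[of x y] excxr_nonneg(2)[of x 1] good_iff[of x]
  by (intro mult_mono add_mono) (auto simp: eer_def)

lemma ekr_mono: "0 \<le> x \<Longrightarrow> x \<le> y \<Longrightarrow> y < tcrit \<Longrightarrow> ekr x 1 k \<le> ekr y 1 k"
proof -
  assume a: "0 \<le> x" "x \<le> y" "y < tcrit"
  have gy: "good y 1" "good x 1" using a by (auto simp: good_iff)
  have "good y (1 * qqr y ^ k)" by (rule good_k[OF gy(1)]) simp
  moreover have "0 \<le> qqr x ^ k" using qqr_bounds[OF gy(2)] by simp
  moreover have "qqr x ^ k \<le> qqr y ^ k" using qqr_mono[OF a] qqr_bounds[OF gy(2)] by (intro power_mono) auto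
  ultimately show ?thesis using excxr_mono(2)[of y "qqr y ^ k" x "qqr x ^ k"] a by (simp add: ekr_def)
qed

text \<open>Linear growth at least, inherited from the excursion series. It gives strict monotonicity, and a
derivative that does not vanish at a positive zero.\<close>

lemma rf_slope: "0 < x \<Longrightarrow> x \<le> y \<Longrightarrow> y < tcrit \<Longrightarrow> y / x * rf x k \<le> rf y k"
proof -
  assume a: "0 < x" "x \<le> y" "y < tcrit"
  have "(y / x * eer x) * ekr x 1 k \<le> eer y * ekr y 1 k"
    using eer_slope[OF a] ekr_mono[of x y k] a ekr_pos[of x k] eer_pos[of y]
    by (intro mult_mono) auto
  then show ?thesis by (simp add: rf_def)
qed

lemma rf_strict_mono: "0 < x \<Longrightarrow> x < y \<Longrightarrow> y < tcrit \<Longrightarrow> rf x k < rf y k"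
proof -
  assume a: "0 < x" "x < y" "y < tcrit"
  have "1 * rf x k < y / x * rf x k" using a rf_pos[of x k] by (intro mult_strict_right_mono) auto
  then show ?thesis using rf_slope[of x y k] a by simp
qed

text \<open>At the critical point the Catalan series is at its branch point, and \<open>q = 1\<close>. Hence \<open>q ^ k\<close> equals 1
for all \<open>k\<close>, and all the functions \<open>rf\<close> reach the same value \<open>sqrt 2 * sqrt 2\<close>.\<close>

lemma tcrit_values: "catarg tcrit 1 = 1/4" "eer tcrit = sqrt 2" "qqr tcrit = 1" "rf tcrit k = 2"
proof -
  have 1: "1 - tcrit ^ 2 = 2 * tcrit" "(1 - tcrit) ^ 2 = 2 * tcrit ^ 2" "1 - tcrit = sqrt 2 * tcrit"
    using tcrit(3) by (simp_all add: power2_eq_square algebra_simps, simp add: tcrit_def algebra_simps)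
  show c: "catarg tcrit 1 = 1/4" unfolding catarg_def using 1 tcrit(1)
    by (simp add: power2_eq_square power3_eq_cube)
  have "eer tcrit = tcrit / (sqrt 2 * tcrit) * 2" by (simp add: eer_def excr_def excxr_def c catr_def 1(3))
  also have "\<dots> = 2 / sqrt 2" using tcrit(1) by simp
  finally show e: "eer tcrit = sqrt 2" by (simp add: real_div_sqrt)
  have "qqr tcrit = (sqrt 2 - 1) * (1 + sqrt 2)" unfolding qqr_def e by (simp add: tcrit_def)
  then show q: "qqr tcrit = 1" by (simp add: algebra_simps)
  have "ekr tcrit 1 k = eer tcrit" by (simp add: ekr_def q eer_def)
  then show "rf tcrit k = 2" by (simp add: rf_def e)
qed

lemma continuous_rf: "continuous_on {0..tcrit} (\<lambda>x. rf x k)"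
proof -
  have cat1: "catarg x 1 \<le> 1/4" if "x \<in> {0..tcrit}" for x :: real
    using that catarg_lt[of x 1] tcrit_values(1) good_iff[of x] by (cases "x = tcrit") auto
  have cont_cat: "continuous_on {0..tcrit} (\<lambda>x. catr (f x))"
    if "continuous_on {0..tcrit} f" "\<And>x. x \<in> {0..tcrit} \<Longrightarrow> f x \<le> 1/4" for f
  proof -
    have "1 + sqrt (1 - 4 * f x) \<noteq> 0" if "x \<in> {0..tcrit}" for x
    proof -
      have "0 \<le> sqrt (1 - 4 * f x)" using \<open>\<And>x. x \<in> {0..tcrit} \<Longrightarrow> f x \<le> 1/4\<close>[OF that] by simp
      then show ?thesis by linarith
    qed
    then show ?thesis unfolding catr_def by (intro continuous_intros that) auto
  qed
  have nz: "(1 - x ^ 2) * (1 - x * y) ^ 2 \<noteq> 0" "1 - x * y \<noteq> 0" if "x \<in> {0..tcrit}" "0 \<le> y" "y \<le> 1" for x y :: real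
  proof -
    have "x * y \<le> x * 1" using that by (intro mult_left_mono) auto
    then have 1: "x * y < 1" using that tcrit(4) by auto
    have "x ^ 2 < 1" using that tcrit(4) by (auto simp: power_less_one_iff)
    then show "(1 - x ^ 2) * (1 - x * y) ^ 2 \<noteq> 0" "1 - x * y \<noteq> 0" using 1 by auto
  qed
  have ce: "continuous_on {0..tcrit} eer"
    unfolding eer_def excr_def excxr_def using cat1 nz(1)[of _ 1] nz(2)[of _ 1]
    by (intro continuous_intros cont_cat) (auto simp: catarg_def intro!: continuous_intros)
  have cq: "continuous_on {0..tcrit} qqr" unfolding qqr_def by (intro continuous_intros ce)
  have qb: "0 \<le> qqr x ^ k" "qqr x ^ k \<le> 1" if "x \<in> {0..tcrit}" for x
  proof -
    have "0 \<le> qqr x \<and> qqr x \<le> 1"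
      using that qqr_bounds[of x 1] tcrit_values(3) good_iff[of x] by (cases "x = tcrit") auto
    then show "0 \<le> qqr x ^ k" "qqr x ^ k \<le> 1" by (auto intro: power_le_one)
  qed
  have cat2: "catarg x (qqr x ^ k) \<le> 1/4" if "x \<in> {0..tcrit}" for x
  proof (cases "x = tcrit")
    case True
    then show ?thesis by (simp add: tcrit_values)
  next
    case False
    then have "good x 1" using that by (auto simp: good_iff)
    from catarg_lt[OF good_mono[OF this, of x "qqr x ^ k"]] show ?thesis using that qb by auto
  qed
  have ck: "continuous_on {0..tcrit} (\<lambda>x. ekr x 1 k)"
    unfolding ekr_def excr_def excxr_def mult_1
  proof (intro continuous_intros cont_cat cq)
    show "continuous_on {0..tcrit} (\<lambda>x. catarg x (qqr x ^ k))" unfolding catarg_def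
      using nz(1)[OF _ qb] by (intro continuous_intros cq) auto
  qed (use cat2 nz(2)[OF _ qb] in auto)
  show ?thesis unfolding rf_def by (intro continuous_intros ce ck)
qed

lemma rf_0: "rf 0 k = 0"
  by (simp add: rf_def eer_def excr_def excxr_def)

definition troot :: "nat \<Rightarrow> real" where
  "troot i = (THE x. 0 < x \<and> x < tcrit \<and> rf x i = 1)"

lemma troot: "0 < troot i" "troot i < tcrit" "rf (troot i) i = 1"
  and troot_unique: "0 < x \<Longrightarrow> x < tcrit \<Longrightarrow> rf x i = 1 \<Longrightarrow> x = troot i"
proof -
  have "\<exists>x\<ge>0. x \<le> tcrit \<and> rf x i = 1"
    by (rule IVT'[of "\<lambda>x. rf x i" 0 1 tcrit]) (auto simp: rf_0 tcrit_values intro: less_imp_le tcrit continuous_rf)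
  then obtain x where x: "0 \<le> x" "x \<le> tcrit" "rf x i = 1" by blast
  have x': "0 < x" "x < tcrit" using x rf_0[of i] tcrit_values(4)[of i] by (auto simp: less_le)
  have ex1: "\<exists>!x. 0 < x \<and> x < tcrit \<and> rf x i = 1"
  proof (rule ex1I[of _ x])
    fix y assume y: "0 < y \<and> y < tcrit \<and> rf y i = 1"
    then show "y = x" using rf_strict_mono[of x y i] rf_strict_mono[of y x i] x x' by (cases x y rule: linorder_cases) auto
  qed (use x x' in auto)
  from theI'[OF ex1] show "0 < troot i" "troot i < tcrit" "rf (troot i) i = 1" by (auto simp: troot_def)
  then show "0 < x \<Longrightarrow> x < tcrit \<Longrightarrow> rf x i = 1 \<Longrightarrow> x = troot i" for x
    using ex1 by blast
qed

lemma strict_mono_troot: "strict_mono troot"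
proof (rule strict_monoI)
  fix i j :: nat assume ij: "i < j"
  show "troot i < troot j"
  proof (rule ccontr)
    assume "\<not> ?thesis"
    then have "rf (troot j) i \<le> rf (troot i) i"
      using rf_strict_mono[of "troot j" "troot i" i] troot[of i] troot[of j] by (cases "troot j = troot i") auto
    moreover have "rf (troot j) j < rf (troot j) i" using rf_strict[OF troot(1,2) ij] .
    ultimately show False using troot(3)[of i] troot(3)[of j] by simp
  qed
qed

text \<open>Every \<open>x\<close> below the critical point satisfies \<open>rf x k < 1\<close> for large \<open>k\<close>, as \<open>qqr x < 1\<close>; so \<open>troot k\<close> exceeds \<open>x\<close>.\<close>

lemma troot_tendsto: "troot \<longlonglongrightarrow> tcrit"
proof (rule order_tendstoI)
  fix y assume y: "tcrit < y"
  show "\<forall>\<^sub>F i in sequentially. troot i < y" by (intro always_eventually allI less_trans[OF troot(2) y])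
next
  fix y assume y: "y < tcrit"
  define z where "z = max y (tcrit / 2)"
  have z: "0 < z" "z < tcrit" "y \<le> z" using y tcrit(1) by (auto simp: z_def)
  have "\<forall>\<^sub>F i in sequentially. rf z i < 1" using rf_tendsto[OF z(1,2)] by (rule order_tendstoD) simp
  then show "\<forall>\<^sub>F i in sequentially. y < troot i"
  proof eventually_elim
    case (elim i)
    show ?case
    proof (rule ccontr)
      assume "\<not> ?thesis"
      then have "troot i \<le> z" using z by simp
      then have "rf (troot i) i \<le> rf z i" using rf_strict_mono[of "troot i" z i] troot[of i] z by (cases "troot i = z") auto
      then show False using elim troot(3)[of i] by simp
    qed
  qed
qed

text \<open>The first zero is where \<open>e * e = 1\<close>, that is \<open>e = 1\<close>; the quadratic equation of \<open>e\<close> becomes a cubic for \<open>t\<close>.\<close>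

lemma troot_0_cubic: "1 - 2 * troot 0 - 2 * troot 0 ^ 2 + 2 * troot 0 ^ 3 = 0" "eer (troot 0) = 1"
proof -
  define x where "x = troot 0"
  have x: "0 < x" "x < tcrit" using troot by (auto simp: x_def)
  have "eer x ^ 2 = 1" using troot(3)[of 0] ekr_0[OF x] by (simp add: rf_def x_def power2_eq_square)
  then show e: "eer (troot 0) = 1" using eer_pos[OF x] by (simp add: power2_eq_1_iff x_def)
  have "ee (of_real x) = 1" using of_real_values(1)[OF x] e by (simp add: x_def)
  moreover have "of_real x ^ 2 * ee (of_real x) ^ 2 - (1 - of_real x ^ 2) * (1 - of_real x) * ee (of_real x) + of_real x * (1 - of_real x ^ 2) = 0"
    using exc_eq[OF gx[OF x], of "of_real x" 1] x by (simp add: ee_def)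
  ultimately have "complex_of_real (1 - 2 * x - 2 * x ^ 2 + 2 * x ^ 3) = 0"
    by (simp add: algebra_simps power2_eq_square power3_eq_cube)
  then show "1 - 2 * troot 0 - 2 * troot 0 ^ 2 + 2 * troot 0 ^ 3 = 0" unfolding x_def of_real_eq_0_iff .
qed

lemma troot_0_bounds: "0.4030317 < troot 0" "troot 0 < 0.4030318"
proof -
  define x where "x = troot 0"
  define p where "p = (\<lambda>x::real. 1 - 2 * x - 2 * x ^ 2 + 2 * x ^ 3)"
  have x: "0 < x" "x < 1/2" "p x = 0" using troot(1,2)[of 0] tcrit(2) troot_0_cubic(1) by (auto simp: x_def p_def)
  have dec: "p b < p a" if "0 \<le> a" "a < b" "b \<le> 1/2" for a b
  proof -
    have "a ^ 2 + a * b + b ^ 2 \<le> (1/2) ^ 2 + (1/2) * (1/2) + (1/2) ^ 2"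
      using that by (intro add_mono mult_mono power_mono) auto
    then have "0 < 2 + 2 * (a + b) - 2 * (a ^ 2 + a * b + b ^ 2)" using that by (simp add: power2_eq_square)
    then have "0 < (b - a) * (2 + 2 * (a + b) - 2 * (a ^ 2 + a * b + b ^ 2))" using that by (intro mult_pos_pos) auto
    also have "\<dots> = p a - p b" by (simp add: p_def power2_eq_square power3_eq_cube algebra_simps)
    finally show ?thesis by simp
  qed
  define a b :: real where "a = 0.4030317" and "b = 0.4030318"
  have ab: "0 < a" "a < 1/2" "0 < b" "b < 1/2" by (simp_all add: a_def b_def)
  have l: "0 < p a" and u: "p b < 0"
    by (simp_all add: p_def a_def b_def power2_eq_square power3_eq_cube)
  have "a < x"
  proof (rule ccontr)
    assume "\<not> ?thesis"
    then have "p a \<le> p x" using dec[of x a] x ab by (cases "x = a") auto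
    then show False using l x by simp
  qed
  moreover have "x < b"
  proof (rule ccontr)
    assume "\<not> ?thesis"
    then have "p x \<le> p b" using dec[of b x] x ab by (cases "x = b") auto
    then show False using u x by simp
  qed
  ultimately show "0.4030317 < troot 0" "troot 0 < 0.4030318" by (simp_all add: a_def b_def x_def)
qed


section \<open>Meromorphic continuation and its poles\<close>

definition tterm :: "nat \<Rightarrow> complex \<Rightarrow> complex \<Rightarrow> nat \<Rightarrow> complex" where
  "tterm K t v i = (\<Prod>j<i. rat t v (Suc K + j)) * ww t v (K + i)"

lemma tail_eq: "tail K t v = suminf (tterm K t v)"
  by (simp add: tail_def tterm_def[abs_def])

lemma tail_step:
  assumes s: "summable (tterm (Suc K) t v)"
  shows "summable (tterm K t v)" "tail K t v = ww t v K + rat t v (Suc K) * tail (Suc K) t v"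
proof -
  have eq: "tterm K t v (Suc i) = rat t v (Suc K) * tterm (Suc K) t v i" for i
    by (simp add: tterm_def prod.lessThan_Suc_shift mult_ac del: prod.lessThan_Suc)
  have "summable (\<lambda>i. tterm K t v (Suc i))" unfolding eq by (intro summable_mult s)
  then show s': "summable (tterm K t v)" by (subst summable_Suc_iff[symmetric])
  from suminf_split_head[OF s'] have "tail K t v = ww t v K + (\<Sum>i. tterm K t v (Suc i))"
    by (simp add: tail_eq) (simp add: tterm_def)
  also have "(\<Sum>i. tterm K t v (Suc i)) = rat t v (Suc K) * tail (Suc K) t v"
    unfolding eq tail_eq by (rule suminf_mult[OF s])
  finally show "tail K t v = ww t v K + rat t v (Suc K) * tail (Suc K) t v" .
qed

lemma tail_expand:
  assumes "summable (tterm K t v)"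
  shows "summable (tterm 0 t v) \<and>
    rat t v 0 * tail 0 t v = (\<Sum>k<K. bb t v k * ww t v k) + bb t v K * tail K t v"
  using assms
proof (induction K)
  case 0
  then show ?case by (simp add: bb_def)
next
  case (Suc K)
  from tail_step[OF Suc.prems] Suc.IH show ?case
    by (simp add: bb_def algebra_simps)
qed

lemma PP_expand:
  assumes "good r L" "1 \<le> L" "eer r * ekr r L (Suc K) < 1" "norm t \<le> r" "norm v \<le> L"
  shows "PP t v = base t v + ((\<Sum>k<K. bb t v k * ww t v k) + bb t v K * tail K t v)"
proof -
  have "summable (tterm K t v)"
    using summable_norm_cancel[OF summable_tail[OF assms]] by (simp add: tterm_def[abs_def])
  from tail_expand[OF this] show ?thesis by (simp add: PP_def)
qed

lemma choose_disc:
  fixes z :: complex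
  assumes "norm z < tcrit"
  obtains r K where "norm z < r" "0 < r" "r < tcrit" "rf r (Suc K) < 1" "K0 \<le> K"
proof -
  obtain r where r: "norm z < r" "r < tcrit" using dense[OF assms] by blast
  then have r0: "0 < r" using norm_ge_zero[of z] by linarith
  have "\<forall>\<^sub>F k in sequentially. rf r k < 1" using rf_tendsto[OF r0 r(2)] by (rule order_tendstoD) simp
  then obtain N where "\<And>k. k \<ge> N \<Longrightarrow> rf r k < 1" by (auto simp: eventually_sequentially)
  then show ?thesis using that[of r "max N K0"] r r0 by auto
qed

definition F0 :: "complex \<Rightarrow> complex" where "F0 t = PP t 1"

lemma analytic_pieces:
  assumes z: "norm z < r" and r: "r < tcrit" and K: "rf r (Suc K) < 1"
  shows "(\<lambda>t. base t 1) analytic_on {z}" "(\<lambda>t. num t 1 k) analytic_on {z}" "(\<lambda>t. den t 1 k) analytic_on {z}"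
    "(\<lambda>t. ww t 1 k) analytic_on {z}" "(\<lambda>t. tail K t 1) analytic_on {z}"
proof -
  have "0 \<le> r" using z norm_ge_zero[of z] by linarith
  then have g: "good r 1" using r by (simp add: good_iff)
  have sub: "ball 0 r \<subseteq> cball 0 r" by auto
  have K': "eer r * ekr r 1 (Suc K) < 1" using K by (simp add: rf_def)
  have an: "f analytic_on {z}" if "f holomorphic_on ball 0 r" for f :: "complex \<Rightarrow> complex"
    by (rule holomorphic_on_imp_analytic_at[OF that open_ball]) (use z in simp)
  show "(\<lambda>t. base t 1) analytic_on {z}" "(\<lambda>t. num t 1 k) analytic_on {z}" "(\<lambda>t. den t 1 k) analytic_on {z}"
    "(\<lambda>t. ww t 1 k) analytic_on {z}" "(\<lambda>t. tail K t 1) analytic_on {z}"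
    by (intro an holomorphic_base[OF g] holomorphic_num[OF g] holomorphic_den[OF g] holomorphic_ww[OF g]
        holomorphic_tail[OF g _ K'] sub; simp)+
qed

text \<open>Locally the infinite sum is a finite sum of meromorphic functions plus an analytic function times
\<open>bb t 1 K\<close>.\<close>

lemma F0_local:
  assumes z: "norm z < r" and r: "r < tcrit" and K: "rf r (Suc K) < 1"
  shows "\<forall>\<^sub>F t in nhds z. F0 t = base t 1 + ((\<Sum>k<K. bb t 1 k * ww t 1 k) + bb t 1 K * tail K t 1)"
proof -
  have "0 \<le> r" using z norm_ge_zero[of z] by linarith
  then have g: "good r 1" using r by (simp add: good_iff)
  have "\<forall>\<^sub>F t in nhds z. t \<in> ball 0 r" by (rule eventually_nhds_in_open) (use z in auto)
  then show ?thesis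
    by eventually_elim (use PP_expand[OF g, of K] K in \<open>auto simp: F0_def rf_def\<close>)
qed

lemma F0_meromorphic: "F0 meromorphic_on ball 0 tcrit"
  unfolding meromorphic_on_meromorphic_at[of F0 "ball 0 tcrit"]
proof
  fix z :: complex assume "z \<in> ball 0 tcrit"
  then have "norm z < tcrit" by simp
  then obtain r K where rK: "norm z < r" "0 < r" "r < tcrit" "rf r (Suc K) < 1" by (rule choose_disc)
  note an = analytic_pieces[OF rK(1,3,4)]
  have "(\<lambda>t. base t 1 + ((\<Sum>k<K. bb t 1 k * ww t 1 k) + bb t 1 K * tail K t 1)) meromorphic_on {z}"
    unfolding bb_def rat_def by (intro meromorphic_intros analytic_on_imp_meromorphic_on[OF an(1)]
      analytic_on_imp_meromorphic_on[OF an(2)] analytic_on_imp_meromorphic_on[OF an(3)]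
      analytic_on_imp_meromorphic_on[OF an(4)] analytic_on_imp_meromorphic_on[OF an(5)])
  moreover have "\<forall>\<^sub>F t in at z. F0 t = base t 1 + ((\<Sum>k<K. bb t 1 k * ww t 1 k) + bb t 1 K * tail K t 1)"
    using F0_local[OF rK(1,3,4)] by (rule eventually_nhds_conv_at[THEN iffD1, THEN conjunct1])
  ultimately show "F0 meromorphic_on {z}"
    using meromorphic_on_cong[of "{z}" F0 _ "{z}"] by simp
qed

lemma F0_analytic:
  assumes z: "norm z < tcrit" and nz: "\<And>k. den z 1 k \<noteq> 0"
  shows "F0 analytic_on {z}"
proof -
  obtain r K where rK: "norm z < r" "0 < r" "r < tcrit" "rf r (Suc K) < 1" using choose_disc[OF z] by metis
  note an = analytic_pieces[OF rK(1,3,4)]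
  have "(\<lambda>t. base t 1 + ((\<Sum>k<K. bb t 1 k * ww t 1 k) + bb t 1 K * tail K t 1)) analytic_on {z}"
    unfolding bb_def rat_def by (intro analytic_intros an) (use nz in auto)
  then show ?thesis using analytic_at_cong[OF F0_local[OF rK(1,3,4)] refl] by simp
qed

subsection \<open>Signs at the real zeros\<close>

definition thetar :: "real \<Rightarrow> nat \<Rightarrow> real" where
  "thetar x k = 2 * x * ekr x 1 k / (1 - x * (x * (1 + ekr x 1 k)))"

definition wr :: "real \<Rightarrow> nat \<Rightarrow> real" where "wr x k = 2 * x + thetar x k + thetar x (Suc k)"

definition rr :: "real \<Rightarrow> nat \<Rightarrow> real" where
  "rr x k = eer x * (ekr x 1 k - taur x) / (1 - rf x k)"

context
  fixes x :: real
  assumes x: "0 < x" "x < tcrit"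
begin

lemma wr_pos: "0 < wr x k" "wr x (Suc k) < wr x k"
proof -
  have d: "0 < 1 - x * (x * (1 + ekr x 1 k))" for k
  proof -
    have "good x (1 * qqr x ^ k)" by (rule good_k[OF gx[OF x]]) simp
    from y_lt[OF this] show ?thesis by (simp add: ekr_def power2_eq_square mult.assoc)
  qed
  have th: "0 < thetar x k" for k using d[of k] ekr_pos[OF x, of k] x by (simp add: thetar_def)
  then show "0 < wr x k" using x by (simp add: wr_def add_pos_pos)
  have "thetar x (Suc k) < thetar x k" for k
    unfolding thetar_def using ekr_strict[OF x, of k "Suc k"] ekr_pos[OF x, of "Suc k"] d x
    by (intro frac_less) (auto intro!: mult_strict_left_mono mult_left_mono)
  from this[of k] this[of "Suc k"] show "wr x (Suc k) < wr x k" by (simp add: wr_def)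
qed

lemma ww_of_real: "ww (of_real x) 1 k = of_real (wr x k)"
  by (simp add: ww_def theta_def wr_def thetar_def of_real_values[OF x])

lemma rat_of_real: "k > 0 \<Longrightarrow> rat (of_real x) 1 k = of_real (rr x k)"
  by (simp add: rat_def num_def den_of_real[OF x] rr_def of_real_values[OF x])

lemma num_0: "num (of_real x) 1 0 = of_real (x * eer x * (1 + eer x) / (1 - 2 * x - x ^ 2))"
proof -
  define t where "t = complex_of_real x"
  note nz = lin_nz[OF gx[OF x] order_refl, of t 1]
  have t: "norm t \<le> x" using x by (simp add: t_def)
  have 1: "1 - t \<noteq> 0" "1 - 2 * t - t ^ 2 \<noteq> 0" using nz t by auto
  have "sE t 1 = alpha t" by (simp add: sE_def alpha_def algebra_simps)
  moreover have "sN t 1 = alE t" by (simp add: sN_def alE_def calculation)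
  moreover have "ek t 1 0 = ee t" by (simp add: ek_def xk_def ee_def)
  ultimately have "num t 1 0 = ee t * ((alpha t - alE t) * (1 + ee t))" by (simp add: num_def algebra_simps)
  also have "alpha t - alE t = t / (1 - 2 * t - t ^ 2)"
  proof -
    have a: "(1 + t) = alpha t * (1 - 2 * t - t ^ 2)" using 1 by (simp add: alpha_def)
    have b: "alE t * (1 - t) = 1 + t * alpha t" using 1 by (simp add: alE_def)
    have "(1 - t) * ((alpha t - alE t) * (1 - 2 * t - t ^ 2)) = (1 - t) * t" using a b by algebra
    then have "(alpha t - alE t) * (1 - 2 * t - t ^ 2) = t" using 1(1) by simp
    then show ?thesis using 1(2) by (simp add: field_simps)
  qed
  finally show ?thesis by (simp add: t_def of_real_values[OF x])
qed

lemma num_0_pos: "0 < x * eer x * (1 + eer x) / (1 - 2 * x - x ^ 2)"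
proof -
  have "0 < 1 - 2 * x - x ^ 2" using r_sq[OF gx[OF x]] by simp
  then show ?thesis using eer_pos[OF x] x by simp
qed

lemma rr_ge: "rf x k < 1 \<Longrightarrow> -1 \<le> rr x k" "rf x k < 1 \<Longrightarrow> rr x k \<le> 0 \<longleftrightarrow> ekr x 1 k \<le> taur x"
proof -
  assume f: "rf x k < 1"
  have "rf x k - eer x * taur x \<ge> - (1 - rf x k)"
    using f taur_lt(1)[OF x] rf_pos[OF x, of k] by linarith
  then show "-1 \<le> rr x k" using f by (simp add: rr_def rf_def field_simps)
  show "rr x k \<le> 0 \<longleftrightarrow> ekr x 1 k \<le> taur x"
    using f eer_pos[OF x] by (simp add: rr_def divide_le_0_iff mult_le_0_iff)
qed

text \<open>The terms may change sign, as a ratio of consecutive amplitudes is negative when \<open>E\<^sub>k < \<tau>\<close>. In that case the ratio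
is at least -1, all later ratios are negative too, and the weights decrease. So the sum is
alternating with decreasing terms: it lies between 0 and its first term. The second part carries
this bound through the induction.\<close>

lemma partial_tail:
  assumes "rf x (Suc K) < 1"
  shows "0 \<le> (\<Sum>i<n. (\<Prod>j<i. rr x (Suc K + j)) * wr x (K + i)) \<and>
    (rr x (Suc K) \<le> 0 \<longrightarrow> (\<Sum>i<n. (\<Prod>j<i. rr x (Suc K + j)) * wr x (K + i)) \<le> wr x K)"
  using assms
proof (induction n arbitrary: K)
  case 0
  then show ?case using wr_pos[of K] by simp
next
  case (Suc n)
  define S where "S = (\<Sum>i<n. (\<Prod>j<i. rr x (Suc (Suc K) + j)) * wr x (Suc K + i))"
  have rec: "(\<Sum>i<Suc n. (\<Prod>j<i. rr x (Suc K + j)) * wr x (K + i)) = wr x K + rr x (Suc K) * S"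
    by (subst sum.lessThan_Suc_shift) (simp add: S_def sum_distrib_left prod.lessThan_Suc_shift mult_ac del: prod.lessThan_Suc sum.lessThan_Suc)
  have f2: "rf x (Suc (Suc K)) < 1" using rf_strict[OF x, of "Suc K" "Suc (Suc K)"] Suc.prems by simp
  note IH = Suc.IH[OF f2, folded S_def]
  show ?case
  proof (cases "rr x (Suc K) \<le> 0")
    case True
    then have "ekr x 1 (Suc K) \<le> taur x" using rr_ge(2)[OF Suc.prems] by simp
    then have "ekr x 1 (Suc (Suc K)) \<le> taur x" using ekr_strict[OF x, of "Suc K" "Suc (Suc K)"] by simp
    then have S: "0 \<le> S" "S \<le> wr x (Suc K)" using IH rr_ge(2)[OF f2] by auto
    have "(-1) * S \<le> rr x (Suc K) * S" using rr_ge(1)[OF Suc.prems] S by (intro mult_right_mono) auto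
    moreover have "rr x (Suc K) * S \<le> 0" using True S by (simp add: mult_nonpos_nonneg)
    ultimately show ?thesis using S wr_pos(2)[of K] unfolding rec by auto
  next
    case False
    then have "0 \<le> rr x (Suc K) * S" using IH by simp
    then show ?thesis using False wr_pos(1)[of K] unfolding rec by auto
  qed
qed

lemma tail_pos:
  assumes f: "rf x (Suc K) < 1"
  shows "\<exists>T>0. tail K (of_real x) 1 = of_real T"
proof -
  have g: "good x 1" by (rule gx[OF x])
  define Tr where "Tr K = (\<Sum>i. (\<Prod>j<i. rr x (Suc K + j)) * wr x (K + i))" for K
  have trm: "tterm K (of_real x) 1 i = of_real ((\<Prod>j<i. rr x (Suc K + j)) * wr x (K + i))" for K i
    by (simp add: tterm_def ww_of_real rat_of_real)
  have summ: "summable (\<lambda>i. (\<Prod>j<i. rr x (Suc K + j)) * wr x (K + i))" if "rf x (Suc K) < 1" for K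
  proof -
    have "summable (tterm K (of_real x) 1)"
      using summable_norm_cancel[OF summable_tail[OF g _ _ _ , of K "of_real x" 1]] that x
      by (simp add: tterm_def[abs_def] rf_def)
    then show ?thesis unfolding trm[abs_def] by (rule summable_of_real_iff[THEN iffD1])
  qed
  have Tr: "tail K (of_real x) 1 = of_real (Tr K)" if "rf x (Suc K) < 1" for K
  proof -
    have "tail K (of_real x) 1 = (\<Sum>i. tterm K (of_real x) 1 i)" by (rule tail_eq)
    also have "\<dots> = of_real (Tr K)" unfolding trm Tr_def by (rule suminf_of_real[OF summ[OF that], symmetric])
    finally show ?thesis .
  qed
  have bounds: "0 \<le> Tr K \<and> (rr x (Suc K) \<le> 0 \<longrightarrow> Tr K \<le> wr x K)" if "rf x (Suc K) < 1" for K
  proof -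
    note lim = summable_LIMSEQ[OF summ[OF that], folded Tr_def]
    show ?thesis using partial_tail[OF that] LIMSEQ_le_const[OF lim] LIMSEQ_le_const2[OF lim] by blast
  qed
  have f2: "rf x (Suc (Suc K)) < 1" using rf_strict[OF x, of "Suc K" "Suc (Suc K)"] f by simp
  have "of_real (Tr K) = (of_real (wr x K + rr x (Suc K) * Tr (Suc K)) :: complex)"
  proof -
    have "summable (tterm (Suc K) (of_real x) 1)" unfolding trm using summ[OF f2] by (simp only: summable_of_real_iff)
    from tail_step(2)[OF this] show ?thesis by (simp add: Tr[OF f] Tr[OF f2] ww_of_real rat_of_real)
  qed
  then have rec: "Tr K = wr x K + rr x (Suc K) * Tr (Suc K)" by (simp only: of_real_eq_iff)
  have "0 < Tr K"
  proof (cases "rr x (Suc K) \<le> 0")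
    case True
    then have "ekr x 1 (Suc K) \<le> taur x" using rr_ge(2)[OF f] by simp
    then have "ekr x 1 (Suc (Suc K)) \<le> taur x" using ekr_strict[OF x, of "Suc K" "Suc (Suc K)"] by simp
    then have S: "0 \<le> Tr (Suc K)" "Tr (Suc K) \<le> wr x (Suc K)" using bounds[OF f2] rr_ge(2)[OF f2] by auto
    have "(-1) * Tr (Suc K) \<le> rr x (Suc K) * Tr (Suc K)" using rr_ge(1)[OF f] S by (intro mult_right_mono) auto
    then show ?thesis using S wr_pos(2)[of K] rec by simp
  next
    case False
    then have "0 \<le> rr x (Suc K) * Tr (Suc K)" using bounds[OF f2] by simp
    then show ?thesis using rec wr_pos(1)[of K] by simp
  qed
  then show ?thesis using Tr[OF f] by blast
qed

end

lemma den_deriv_nz: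
  assumes D: "((\<lambda>t. den t 1 i) has_field_derivative D) (at (of_real (troot i)))"
  shows "D \<noteq> 0"
proof
  assume "D = 0"
  define x where "x = troot i"
  have x: "0 < x" "x < tcrit" "rf x i = 1" using troot by (auto simp: x_def)
  have "((\<lambda>h. (den (of_real x + h) 1 i - den (of_real x) 1 i) / h) \<longlongrightarrow> 0) (at 0)"
    using D \<open>D = 0\<close> by (simp add: DERIV_def x_def)
  moreover have "filterlim (\<lambda>h::real. complex_of_real h) (at 0) (at_right 0)"
    unfolding filterlim_at by (auto intro!: tendsto_eq_intros eventually_at_right_less simp: eventually_at_filter)
  ultimately have "((\<lambda>h::real. (den (of_real x + of_real h) 1 i - den (of_real x) 1 i) / of_real h) \<longlongrightarrow> 0) (at_right 0)"
    by (rule filterlim_compose)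
  then have lim: "((\<lambda>h::real. Re ((den (of_real x + of_real h) 1 i - den (of_real x) 1 i) / of_real h)) \<longlongrightarrow> 0) (at_right 0)"
    using tendsto_Re by fastforce
  have "\<forall>\<^sub>F h in at_right 0. h \<in> {0<..<tcrit - x}" using x by (intro eventually_at_right_real) auto
  then have "\<forall>\<^sub>F h in at_right 0. Re ((den (of_real x + of_real h) 1 i - den (of_real x) 1 i) / of_real h) \<le> - 1 / x"
  proof eventually_elim
    case (elim h)
    then have h: "0 < h" "x + h < tcrit" by auto
    have "den (of_real x + of_real h) 1 i = of_real (1 - rf (x + h) i)"
      using den_of_real[of "x + h" i] x h by simp
    moreover have "den (of_real x) 1 i = 0" using den_of_real[of x i] x by simp
    moreover have "(x + h) / x * 1 \<le> rf (x + h) i" using rf_slope[of x "x + h" i] x h by simp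
    then have "(1 - rf (x + h) i) / h \<le> - 1 / x" using h x by (simp add: field_simps)
    ultimately show ?case by simp
  qed
  then have "0 \<le> - 1 / x" by (rule tendsto_upperbound[OF lim]) simp
  then show False using x by simp
qed

text \<open>Near \<open>t\<^sub>i\<close> exactly the denominator of index \<open>i\<close> vanishes. It divides all modes from \<open>i\<close> on, whose
common factor is the tail, positive at \<open>t\<^sub>i\<close>. The numerators in front of it do not vanish either: the
first one is explicitly positive, and for the others \<open>e * E\<^sub>k \<ge> 1 > e * \<tau>\<close>.\<close>

lemma F0_pole: "is_pole F0 (of_real (troot i))" "zorder F0 (of_real (troot i)) = -1"
proof -
  define x where "x = troot i"
  define z where "z = complex_of_real x"
  have x: "0 < x" "x < tcrit" "rf x i = 1" using troot by (auto simp: x_def)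
  have nz: "norm z < tcrit" using x by (simp add: z_def)
  have fi: "rf x (Suc i) < 1" using rf_strict[OF x(1,2), of i "Suc i"] x by simp
  \<comment> \<open>a slightly larger disc on which only the first denominators can vanish\<close>
  have "\<forall>\<^sub>F r in at_right x. rf r (Suc i) < 1"
  proof -
    have "continuous (at x within {0..tcrit}) (\<lambda>r. rf r (Suc i))"
      using continuous_rf[of "Suc i"] x by (auto simp: continuous_on_eq_continuous_within)
    then have "isCont (\<lambda>r. rf r (Suc i)) x"
      using x at_within_interior[of x "{0..tcrit}"] by simp
    then have "((\<lambda>r. rf r (Suc i)) \<longlongrightarrow> rf x (Suc i)) (at_right x)"
      by (simp add: isCont_def filterlim_at_split)
    then show ?thesis using fi by (rule order_tendstoD)
  qed
  moreover have "\<forall>\<^sub>F r in at_right x. r \<in> {x<..<tcrit}" using x by (intro eventually_at_right_real) auto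
  ultimately have "\<forall>\<^sub>F r in at_right x. rf r (Suc i) < 1 \<and> r \<in> {x<..<tcrit}" by (rule eventually_conj)
  then have "\<exists>r. rf r (Suc i) < 1 \<and> r \<in> {x<..<tcrit}"
    by (rule eventually_happens'[rotated]) (rule trivial_limit_at_right_real)
  then obtain r where r: "rf r (Suc i) < 1" "x < r" "r < tcrit" by auto
  have zr: "norm z < r" using r x by (simp add: z_def)
  note an = analytic_pieces[OF zr r(3,1)]
  have den_i: "den z 1 i = 0" using den_of_real[of x i] x by (simp add: z_def)
  have den_j: "den z 1 j \<noteq> 0" if "j < i" for j
    using den_of_real[OF x(1,2), of j] rf_strict[OF x(1,2) that] x(3) by (simp add: z_def complex_eq_iff)
  have e_pos: "0 < eer x" by (rule eer_pos[OF x(1,2)])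
  have E_gt: "taur x < ekr x 1 j" if "j \<le> i" for j
  proof -
    have "eer x * taur x < eer x * ekr x 1 i" using taur_lt[OF x(1,2)] x(3) by (simp add: rf_def)
    then have "taur x < ekr x 1 i" using e_pos by simp
    also have "ekr x 1 i \<le> ekr x 1 j" using ekr_strict[OF x(1,2), of j i] that by (cases "j = i") auto
    finally show ?thesis .
  qed
  have num_j: "num z 1 j \<noteq> 0" if "j \<le> i" for j
  proof (cases j)
    case 0
    then show ?thesis using num_0[OF x(1,2)] num_0_pos[OF x(1,2)] unfolding z_def by (metis of_real_eq_0_iff less_irrefl)
  next
    case (Suc k)
    have "num z 1 j = of_real (eer x * (ekr x 1 j - taur x))"
      using Suc by (simp add: num_def z_def of_real_values[OF x(1,2)])
    moreover have "0 < eer x * (ekr x 1 j - taur x)" using E_gt[OF that] e_pos by simp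
    ultimately show ?thesis by (metis of_real_eq_0_iff less_irrefl)
  qed
  have tail_nz: "tail i z 1 \<noteq> 0" using tail_pos[OF x(1,2) fi] by (auto simp: z_def)
  define A where "A t = (base t 1 + (\<Sum>k<i. bb t 1 k * ww t 1 k)) * den t 1 i + (\<Prod>j<i. rat t 1 j) * num t 1 i * tail i t 1" for t
  have A_an: "A analytic_on {z}" unfolding A_def bb_def rat_def
    by (intro analytic_intros an) (use den_j in auto)
  have A_z: "A z \<noteq> 0"
    using den_i num_j den_j tail_nz by (simp add: A_def rat_def)
  obtain U where U: "open U" "z \<in> U" "A holomorphic_on U" using A_an analytic_at by blast
  obtain U' where U': "open U'" "z \<in> U'" "(\<lambda>t. den t 1 i) holomorphic_on U'" using an(3) analytic_at by blast
  obtain d where d: "d > 0" "ball z d \<subseteq> U \<inter> U'" using U U' open_contains_ball[of "U \<inter> U'"] by blast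
  have hol: "A holomorphic_on ball z d" "(\<lambda>t. den t 1 i) holomorphic_on ball z d"
    using U(3) U'(3) d by (auto elim: holomorphic_on_subset)
  obtain D where D: "((\<lambda>t. den t 1 i) has_field_derivative D) (at z)"
    using holomorphic_on_imp_differentiable_at[OF hol(2) open_ball, of z] d unfolding field_differentiable_def by force
  have D_nz: "D \<noteq> 0" using den_deriv_nz[of i D] D by (simp add: z_def x_def)
  have den_ev: "\<forall>\<^sub>F t in at z. den t 1 i \<noteq> 0"
    using tendsto_imp_eventually_ne[OF D[unfolded has_field_derivative_iff] D_nz]
    by eventually_elim (auto simp: den_i)
  have ev: "\<forall>\<^sub>F t in at z. F0 t = A t / den t 1 i"
  proof -
    note den_ev
    moreover have "\<forall>\<^sub>F t in at z. F0 t = base t 1 + ((\<Sum>k<i. bb t 1 k * ww t 1 k) + bb t 1 i * tail i t 1)"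
      using F0_local[OF zr r(3,1)] by (rule eventually_nhds_conv_at[THEN iffD1, THEN conjunct1])
    ultimately show ?thesis
    proof eventually_elim
      case (elim t)
      have "bb t 1 i = (\<Prod>j<i. rat t 1 j) * (num t 1 i / den t 1 i)"
        by (cases i) (simp_all add: bb_def lessThan_Suc_atMost rat_def)
      then show ?case using elim by (simp add: A_def field_simps)
    qed
  qed
  have "zorder F0 z = zorder (\<lambda>t. A t / den t 1 i) z" by (rule zorder_cong[OF ev refl])
  also have "\<dots> = -1"
    by (rule porder_simple_pole_deriv[OF hol open_ball _ _ D A_z den_i D_nz]) (use d in auto)
  finally show zo: "zorder F0 (of_real (troot i)) = -1" by (simp add: z_def x_def)
  have "is_pole (\<lambda>t. A t / den t 1 i) z"
  proof (rule is_pole_divide[OF analytic_at_imp_isCont[OF A_an] _ A_z])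
    have "isCont (\<lambda>t. den t 1 i) z" using an(3) by (rule analytic_at_imp_isCont)
    then show "filterlim (\<lambda>t. den t 1 i) (at 0) (at z)"
      using den_ev den_i by (simp add: filterlim_at isCont_def)
  qed
  then show "is_pole F0 (of_real (troot i))" using is_pole_cong[OF ev refl] by (simp add: z_def x_def)
qed


section \<open>The poles in the disc\<close>

text \<open>At a pole the value of \<open>F0\<close> is an artefact of division by zero; normalised values make the function
nicely meromorphic.\<close>

definition gfun :: "complex \<Rightarrow> complex" where "gfun = remove_sings F0"

lemma gfun_nice: "gfun nicely_meromorphic_on ball 0 tcrit"
  unfolding gfun_def by (rule remove_sings_nicely_meromorphic[OF F0_meromorphic])

lemma isolated_F0: "norm z < tcrit \<Longrightarrow> isolated_singularity_at F0 z"
  using F0_meromorphic meromorphic_on_altdef[of F0 "ball 0 tcrit"] by simp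

lemma gfun_pole_iff: "norm z < tcrit \<Longrightarrow> is_pole gfun z \<longleftrightarrow> is_pole F0 z"
  unfolding gfun_def by (rule is_pole_remove_sings_iff[OF isolated_F0])

lemma gfun_analytic:
  assumes "norm z < tcrit" "\<And>k. den z 1 k \<noteq> 0"
  shows "gfun analytic_on {z}" "gfun z = F0 z" "\<not> is_pole gfun z"
proof -
  have an: "F0 analytic_on {z}" by (rule F0_analytic[OF assms])
  then show g: "gfun analytic_on {z}" unfolding gfun_def by (rule remove_sings_analytic_on)
  show "gfun z = F0 z" unfolding gfun_def using an by (rule remove_sings_at_analytic)
  show "\<not> is_pole gfun z" using g
    by (meson analytic_at not_is_pole_holomorphic)
qed

lemma gfun_real_poles: "range troot = {x. 0 < x \<and> x < tcrit \<and> is_pole gfun (of_real x)}"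
proof (intro equalityI subsetI)
  fix x assume "x \<in> range troot"
  then obtain i where i: "x = troot i" by auto
  then show "x \<in> {x. 0 < x \<and> x < tcrit \<and> is_pole gfun (of_real x)}"
    using troot[of i] F0_pole(1)[of i] gfun_pole_iff[of "of_real x"] by simp
next
  fix x assume "x \<in> {x. 0 < x \<and> x < tcrit \<and> is_pole gfun (of_real x)}"
  then have x: "0 < x" "x < tcrit" "is_pole gfun (of_real x)" by auto
  have "\<exists>k. den (of_real x) 1 k = 0" using gfun_analytic(3)[of "of_real x"] x by auto
  then obtain k where "complex_of_real (1 - rf x k) = 0" using den_of_real[OF x(1,2)] by auto
  then have "rf x k = 1" unfolding of_real_eq_0_iff by simp
  then have "x = troot k" using troot_unique[OF x(1,2)] by simp
  then show "x \<in> range troot" by simp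
qed

lemma gfun_zorder: "zorder gfun (of_real (troot i)) = -1"
  unfolding gfun_def using zorder_remove_sings[OF isolated_F0, of "of_real (troot i)"] troot[of i] F0_pole(2)[of i] by simp

lemma gfun_infinite_poles: "infinite {z \<in> ball 0 tcrit. is_pole gfun z}"
proof
  assume fin: "finite {z \<in> ball 0 tcrit. is_pole gfun z}"
  have "(\<lambda>i. complex_of_real (troot i)) ` UNIV \<subseteq> {z \<in> ball 0 tcrit. is_pole gfun z}"
  proof safe
    fix i
    have n: "norm (complex_of_real (troot i)) < tcrit" using troot[of i] by simp
    then show "complex_of_real (troot i) \<in> ball 0 tcrit" by simp
    show "is_pole gfun (complex_of_real (troot i))" using gfun_pole_iff[OF n] F0_pole(1) by simp
  qed
  moreover have "inj (\<lambda>i. complex_of_real (troot i))"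
    using strict_mono_eq[OF strict_mono_troot] by (auto intro: injI)
  ultimately show False using fin finite_imageD finite_subset infinite_UNIV_nat by metis
qed

text \<open>The factor \<open>t / (1 - t)\<close> of \<open>e\<close> already makes the inequality strict: equality in \<open>|1 - t| \<ge> 1 - |t|\<close>
requires \<open>t \<ge> 0\<close>.\<close>

lemma norm_ee_less:
  assumes t: "norm t \<le> x" "x < tcrit" "0 < x" and ne: "t \<noteq> of_real x"
  shows "norm (ee t) < eer x"
proof -
  note g = gx[OF t(3,2)]
  have lt: "norm (t / (1 - t)) < x / (1 - x)"
  proof (cases "norm t = x")
    case True
    have "norm (1 - t) > 1 - x"
    proof -
      have "norm (1 - t) \<ge> 1 - x" using norm_triangle_ineq2[of 1 t] True by simp
      moreover have "norm (1 - t) \<noteq> 1 - x"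
      proof
        assume "norm (1 - t) = 1 - x"
        then have "(1 - Re t) ^ 2 + (Im t) ^ 2 = (1 - x) ^ 2" by (metis cmod_power2 minus_complex.sel one_complex.sel diff_0 power2_minus)
        moreover have "Re t ^ 2 + Im t ^ 2 = x ^ 2" using True by (metis cmod_power2)
        ultimately have "Re t = x" by (simp add: power2_eq_square algebra_simps)
        then have "t = of_real x" using \<open>Re t ^ 2 + Im t ^ 2 = x ^ 2\<close> by (simp add: complex_eq_iff)
        then show False using ne by simp
      qed
      ultimately show ?thesis by simp
    qed
    then show ?thesis unfolding norm_divide using True t tcrit by (intro frac_less2) auto
  next
    case False
    then have "norm t < x" using t by simp
    moreover have "1 - x \<le> norm (1 - t)" using norm_triangle_ineq2[of 1 t] t by simp
    ultimately show ?thesis unfolding norm_divide using t tcrit by (intro frac_less) auto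
  qed
  have "norm (cat (catarg t 1)) \<le> catr (catarg x 1)"
    using norm_catarg_le[OF g t(1), of 1] catarg_lt[OF g] by (intro norm_cat_le) auto
  then have "norm (t / (1 - t) * cat (catarg t 1)) < x / (1 - x) * catr (catarg x 1)"
    unfolding norm_mult using lt catr_catarg_pos(1)[OF g] by (intro mult_less_le_imp_less) (auto simp: cat_nz)
  then show ?thesis by (simp add: ee_def eer_def exc_def excr_def excx_def excxr_def)
qed

text \<open>On the closed disc of radius \<open>t\<^sub>0\<close> one has \<open>|e| \<le> 1\<close> with equality only at \<open>t\<^sub>0\<close>, and
\<open>|E(t, q ^ k)| \<le> 1\<close> as well; so no denominator vanishes elsewhere.\<close>

lemma gfun_dominant: "gfun analytic_on (cball 0 (troot 0) - {of_real (troot 0)})"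
proof -
  define x where "x = troot 0"
  have x: "0 < x" "x < tcrit" "rf x 0 = 1" using troot by (auto simp: x_def)
  note g = gx[OF x(1,2)]
  have e1: "eer x = 1" using troot_0_cubic(2) by (simp add: x_def)
  have "gfun analytic_on {z}" if z: "norm z \<le> x" "z \<noteq> of_real x" for z
  proof (rule gfun_analytic(1))
    show "norm z < tcrit" using z x by simp
    fix k
    have "norm (ee z) < 1" using norm_ee_less[OF z(1) x(2,1) z(2)] e1 by simp
    moreover have "norm (ek z 1 k) \<le> 1"
    proof -
      have "norm (ek z 1 k) \<le> ekr x 1 k" by (rule norm_ek_le[OF g]) (use z in auto)
      also have "\<dots> \<le> ekr x 1 0" by (rule ekr_antimono[OF g]) auto
      finally show ?thesis using e1 ekr_0[OF x(1,2)] by simp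
    qed
    ultimately have "norm (ee z * ek z 1 k) < 1" unfolding norm_mult
      using mult_strict_mono'[of "norm (ee z)" 1 "norm (ek z 1 k)"] mult_right_mono[of "norm (ee z)" 1 "norm (ek z 1 k)"]
      by (smt (verit) mult_left_le norm_ge_zero)
    then have "ee z * ek z 1 k \<noteq> 1" by auto
    then show "den z 1 k \<noteq> 0" by (simp add: den_def)
  qed
  then show ?thesis by (subst analytic_on_analytic_at) (auto simp: x_def)
qed

section \<open>The power series\<close>

lemma PP_0: "PP 0 v = 1"
  by (simp add: PP_def base_def rat_def num_def theta_def ee_def exc_def excx_def)

lemma width_poly_0: "width_poly 0 v = 1"
  by (simp add: width_poly_eq)

lemma width_poly_sums:
  assumes "good r L" "1 \<le> L" "eer r * ekr r L 0 < 1" "norm t \<le> r" "norm v \<le> L" "4 * r * L < 1"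
  shows "(\<lambda>n. width_poly n v * t ^ n) sums PP t v"
proof (cases "t = 0")
  case True
  have "(\<lambda>n. width_poly n v * 0 ^ n) sums width_poly 0 v" by (rule powser_sums_zero)
  then show ?thesis using True by (simp add: PP_0 width_poly_0)
next
  case False
  have "4 * norm t * L \<le> 4 * r * L" using assms by (intro mult_right_mono) auto
  then show ?thesis using width_poly_sums_aux[OF assms(1-4) False assms(5)] assms(6) by simp
qed

text \<open>One disc serves all \<open>v\<close> with \<open>|v| \<le> 3/2\<close>: the radii 1/8 and 3/2 are so far inside the domain that the
product \<open>e * E\<close> stays below \<open>2/7 * 6/13\<close>.\<close>

lemma small_disc:
  assumes "norm t \<le> 1/8" "norm v \<le> 3/2"
  shows "(\<lambda>n. width_poly n v * t ^ n) sums PP t v" "den t v k \<noteq> 0" "norm t < tcrit"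
proof -
  have g: "good (1/8) (3/2)" by (simp add: good_def power2_eq_square)
  have e1: "eer (1/8) \<le> 2/7" using eer_bounds(2)[OF g] by simp
  have e0: "0 \<le> eer (1/8)" using eer_bounds(1)[OF g] by simp
  have e2: "ekr (1/8) (3/2) k \<le> 6/13" for k
  proof -
    have "ekr (1/8) (3/2) k \<le> excr (1/8) (3/2)" by (rule ekr_le[OF g]) simp
    also have "\<dots> \<le> 6/13" using excr_le[OF g] by simp
    finally show ?thesis .
  qed
  have lt: "eer (1/8) * ekr (1/8) (3/2) k < 1" for k
  proof -
    have "eer (1/8) * ekr (1/8) (3/2) k \<le> 2/7 * (6/13)"
      using e1 e0 e2[of k] ekr_nonneg[OF g, of k] by (intro mult_mono) auto
    then show ?thesis by simp
  qed
  show "(\<lambda>n. width_poly n v * t ^ n) sums PP t v"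
    by (rule width_poly_sums[OF g _ lt]) (use assms in auto)
  have "1 - eer (1/8) * ekr (1/8) (3/2) k \<le> norm (den t v k)"
    by (rule den_lower(1)[OF g _ lt]) (use assms in auto)
  then show "den t v k \<noteq> 0" using lt[of k] by auto
  have "1/8 < tcrit" using good_iff[of "1/8"] by (simp add: good_def power2_eq_square)
  then show "norm t < tcrit" using assms by simp
qed

lemma width_poly_1: "width_poly n 1 = of_nat (card (three_sided_walks n))"
  by (simp add: width_poly_def)

lemma gfun_sums: "norm t \<le> 1/8 \<Longrightarrow> (\<lambda>n. of_nat (card (three_sided_walks n)) * t ^ n) sums gfun t"
  using small_disc[of t 1] gfun_analytic(2)[of t] by (simp add: width_poly_1 F0_def)

lemma gfun_continuation:
  "meromorphic_continuation (\<lambda>n. of_nat (card (three_sided_walks n))) (ball 0 tcrit) gfun"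
proof -
  have "\<forall>\<^sub>F t in nhds 0. t \<in> ball (0 :: complex) (1/8)" by (rule eventually_nhds_in_open) auto
  then have "\<forall>\<^sub>F t in nhds 0. (\<lambda>n. of_nat (card (three_sided_walks n)) * t ^ n) sums gfun t"
    by eventually_elim (simp add: gfun_sums)
  then show ?thesis by (simp add: meromorphic_continuation_def gfun_nice)
qed

lemma gfun_fps: "gfun has_fps_expansion Abs_fps (\<lambda>n. of_nat (card (three_sided_walks n)))"
proof (rule has_fps_expansionI)
  have "\<forall>\<^sub>F t in nhds 0. t \<in> ball (0 :: complex) (1/8)" by (rule eventually_nhds_in_open) auto
  then show "\<forall>\<^sub>F t in nhds 0. (\<lambda>n. fps_nth (Abs_fps (\<lambda>n. of_nat (card (three_sided_walks n)))) n * t ^ n) sums gfun t"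
    by eventually_elim (simp add: gfun_sums)
qed

section \<open>D-finiteness\<close>

lemma deriv_shift_arg: "deriv (\<lambda>w. f (z + w)) = (\<lambda>w. deriv f (z + w))"
  unfolding deriv_def by (simp add: DERIV_shift add.commute)

lemma higher_deriv_shift: "(deriv ^^ n) (\<lambda>w. f (z + w)) = (\<lambda>w. (deriv ^^ n) f (z + w))"
  by (induction n) (simp_all add: deriv_shift_arg)

lemma higher_deriv_laurent:
  "f has_laurent_expansion F \<Longrightarrow> (deriv ^^ n) f has_laurent_expansion (fls_deriv ^^ n) F"
  by (induction n) (auto intro: has_laurent_expansion_deriv)

text \<open>Differentiation increases the order of a pole by exactly 1. Hence in a linear differential equation
the highest derivative cannot be balanced at a pole where its coefficient is nonzero; a meromorphic
solution with infinitely many poles in a disc would force infinitely many zeros of a polynomial.\<close>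

lemma fls_higher_deriv_subdegree:
  fixes F :: "complex fls"
  assumes "fls_subdegree F < 0"
  shows "fls_subdegree ((fls_deriv ^^ n) F) = fls_subdegree F - int n \<and> (fls_deriv ^^ n) F \<noteq> 0"
proof (induction n)
  case 0
  then show ?case using assms by auto
next
  case (Suc n)
  then have sub: "fls_subdegree ((fls_deriv ^^ n) F) = fls_subdegree F - int n" "(fls_deriv ^^ n) F \<noteq> 0" by auto
  have "fls_subdegree (fls_deriv ((fls_deriv ^^ n) F)) = fls_subdegree ((fls_deriv ^^ n) F) - 1"
    by (rule fls_subdegree_deriv) (use sub assms in auto)
  then show ?case using sub assms by auto
qed

lemma poly_has_fps_expansion: "poly p has_fps_expansion fps_of_poly (p :: complex poly)"
  by (simp add: has_fps_expansion_def)

lemma not_D_finite: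
  fixes C :: "complex fps"
  assumes exp: "f has_fps_expansion C" and mero: "f meromorphic_on ball 0 R" and R: "R > 0"
    and inf: "infinite {z \<in> ball 0 R. is_pole f z}"
  shows "\<not> D_finite C"
proof
  assume "D_finite C"
  then obtain k and P :: "nat \<Rightarrow> complex poly" where P: "P k \<noteq> 0"
    and ode: "(\<Sum>i\<le>k. fps_of_poly (P i) * (fps_deriv ^^ i) C) = 0"
    by (auto simp: D_finite_def)
  define G where "G z = (\<Sum>i\<le>k. poly (P i) z * (deriv ^^ i) f z)" for z
  have dexp: "(deriv ^^ i) f has_fps_expansion (fps_deriv ^^ i) C" for i
    by (induction i) (auto intro: exp has_fps_expansion_deriv)
  have "G has_fps_expansion (\<Sum>i\<le>k. fps_of_poly (P i) * (fps_deriv ^^ i) C)"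
    unfolding G_def[abs_def] by (intro fps_expansion_intros dexp poly_has_fps_expansion)
  then have G0: "\<forall>\<^sub>F z in nhds 0. G z = 0" by (simp add: ode has_fps_expansion_0_iff)
  have poly_an: "poly p analytic_on A" for p :: "complex poly" and A
  proof -
    have "poly p holomorphic_on UNIV" by (meson holomorphic_on_open open_UNIV poly_DERIV)
    then show ?thesis by (meson analytic_on_holomorphic open_UNIV subset_UNIV)
  qed
  have G_mero: "G meromorphic_on ball 0 R"
    unfolding G_def[abs_def] by (intro meromorphic_intros meromorphic_on_higher_deriv mero analytic_on_imp_meromorphic_on poly_an)
  have G_ae: "\<forall>\<^sub>F z in at w. G z = 0" if w: "w \<in> ball 0 R" for w
  proof -
    have "eventually (\<lambda>z. G z = 0) (cosparse (ball 0 R)) \<or> eventually (\<lambda>z. G z \<noteq> 0) (cosparse (ball 0 R))"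
      by (rule meromorphic_imp_constant_or_avoid[OF G_mero]) auto
    moreover have "\<not> eventually (\<lambda>z. G z \<noteq> 0) (cosparse (ball 0 R))"
    proof
      assume "eventually (\<lambda>z. G z \<noteq> 0) (cosparse (ball 0 R))"
      then have "\<forall>\<^sub>F z in at 0. G z \<noteq> 0" by (rule eventually_cosparse_imp_eventually_at) (use R in auto)
      moreover have "\<forall>\<^sub>F z in at 0. G z = 0" using G0 by (rule eventually_nhds_conv_at[THEN iffD1, THEN conjunct1])
      ultimately have "\<forall>\<^sub>F z in at (0::complex). False" by eventually_elim auto
      then show False by simp
    qed
    ultimately show ?thesis using eventually_cosparse_imp_eventually_at[of _ "ball 0 R" w UNIV] w by auto
  qed
  have "poly (P k) z = 0" if z: "z \<in> ball 0 R" "is_pole f z" for z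
  proof (rule ccontr)
    assume nz: "poly (P k) z \<noteq> 0"
    obtain F where F: "(\<lambda>w. f (z + w)) has_laurent_expansion F"
      using mero[unfolded meromorphic_on_def] z(1) by blast
    have sub: "fls_subdegree F < 0" using is_pole_fls_subdegree_iff[OF F] z by simp
    have D: "(\<lambda>w. (deriv ^^ i) f (z + w)) has_laurent_expansion (fls_deriv ^^ i) F" for i
      using higher_deriv_laurent[OF F, of i] by (simp add: higher_deriv_shift)
    define Q where "Q i = fps_to_fls (fps_of_poly (pcompose (P i) [:z, 1:]))" for i
    have Q: "(\<lambda>w. poly (P i) (z + w)) has_laurent_expansion Q i" for i
    proof -
      have "poly (pcompose (P i) [:z, 1:]) has_fps_expansion fps_of_poly (pcompose (P i) [:z, 1:])"
        by (rule poly_has_fps_expansion)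
      moreover have "poly (pcompose (P i) [:z, 1:]) = (\<lambda>w. poly (P i) (z + w))"
        by (simp add: fun_eq_iff poly_pcompose)
      ultimately show ?thesis unfolding Q_def by (intro has_laurent_expansion_fps) simp
    qed
    have "(\<lambda>w. G (z + w)) has_laurent_expansion (\<Sum>i\<le>k. Q i * (fls_deriv ^^ i) F)"
      unfolding G_def by (intro laurent_expansion_intros Q D)
    moreover have "(\<lambda>w. G (z + w)) has_laurent_expansion 0"
    proof -
      have "\<forall>\<^sub>F w in at 0. G (z + w) = 0" using G_ae[OF z(1)]
        by (simp add: at_to_0'[of z] eventually_filtermap add.commute)
      then show ?thesis using has_laurent_expansion_cong[of "\<lambda>w. G (z + w)" "\<lambda>_. 0" 0 0] by simp
    qed
    ultimately have zero: "(\<Sum>i\<le>k. Q i * (fls_deriv ^^ i) F) = 0" by (rule has_laurent_expansion_unique)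
    define s where "s = fls_subdegree F - int k"
    note ds = fls_higher_deriv_subdegree[OF sub]
    have Qsub: "fls_subdegree (Q i) \<ge> 0" for i by (simp add: Q_def fls_subdegree_fls_to_fps_gt0)
    have low: "fls_nth (Q i * (fls_deriv ^^ i) F) s = 0" if "i < k" for i
    proof (cases "Q i = 0")
      case False
      then have "fls_subdegree (Q i * (fls_deriv ^^ i) F) = fls_subdegree (Q i) + fls_subdegree ((fls_deriv ^^ i) F)"
        using ds[of i] by (intro fls_subdegree_mult) auto
      then show ?thesis using Qsub[of i] ds[of i] that by (intro fls_eq0_below_subdegree) (auto simp: s_def)
    qed simp
    have "fls_nth (Q k) 0 = poly (P k) z"
      by (simp add: Q_def poly_0_coeff_0[symmetric] poly_pcompose)
    then have Qk: "Q k \<noteq> 0" "fls_subdegree (Q k) = 0" "fls_nth (Q k) 0 \<noteq> 0"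
      using nz Qsub[of k] fls_subdegree_leI[of "Q k" 0] by auto
    have "fls_nth (Q k * (fls_deriv ^^ k) F) s = fls_nth (Q k) 0 * fls_nth ((fls_deriv ^^ k) F) s"
      using fls_times_base[of "Q k" "(fls_deriv ^^ k) F"] Qk ds[of k] by (simp add: s_def)
    also have "\<dots> \<noteq> 0" using Qk ds[of k] nth_fls_subdegree_nonzero[of "(fls_deriv ^^ k) F"] by (simp add: s_def)
    finally have "fls_nth (Q k * (fls_deriv ^^ k) F) s \<noteq> 0" .
    moreover have "fls_nth (\<Sum>i\<le>k. Q i * (fls_deriv ^^ i) F) s = fls_nth (Q k * (fls_deriv ^^ k) F) s"
    proof -
      have "{..k} = insert k {..<k}" by auto
      then show ?thesis by (simp add: fls_nth_sum low)
    qed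
    ultimately show False using zero by simp
  qed
  then have "{z \<in> ball 0 R. is_pole f z} \<subseteq> {z. poly (P k) z = 0}" by auto
  then show False using inf poly_roots_finite[OF P] finite_subset by blast
qed

lemma walks_not_D_finite: "\<not> D_finite (Abs_fps (\<lambda>n. of_nat (card (three_sided_walks n))))"
  using gfun_fps gfun_nice tcrit(1) gfun_infinite_poles unfolding nicely_meromorphic_on_def
  by (intro not_D_finite[of gfun]) auto


section \<open>Coefficients of a function with one simple pole\<close>

lemma geometric_tail_bound:
  fixes k :: "nat \<Rightarrow> complex"
  assumes k: "\<And>m. norm (k m) \<le> M * \<theta> ^ m" and th: "0 \<le> \<theta>" "\<theta> < 1"
  shows "norm ((\<Sum>m<n. k m) - suminf k) \<le> M / (1 - \<theta>) * \<theta> ^ n"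
proof -
  have sg: "summable (\<lambda>m. M * \<theta> ^ m)" using th by (intro summable_mult summable_geometric) auto
  have sk: "summable k" by (rule summable_comparison_test'[OF sg, of 0]) (use k in auto)
  have "suminf k = (\<Sum>m. k (m + n)) + (\<Sum>m<n. k m)" by (rule suminf_split_initial_segment[OF sk])
  then have "norm ((\<Sum>m<n. k m) - suminf k) = norm (\<Sum>m. k (m + n))" by (simp add: norm_minus_commute)
  also have "\<dots> \<le> (\<Sum>m. M * \<theta> ^ n * \<theta> ^ m)"
  proof (rule norm_suminf_le)
    show "norm (k (m + n)) \<le> M * \<theta> ^ n * \<theta> ^ m" for m using k[of "m + n"] by (simp add: power_add mult_ac)
    show "summable (\<lambda>m. M * \<theta> ^ n * \<theta> ^ m)" using th by (intro summable_mult summable_geometric) auto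
  qed
  also have "\<dots> = M * \<theta> ^ n * (\<Sum>m. \<theta> ^ m)" using th by (intro suminf_mult summable_geometric) auto
  also have "\<dots> = M / (1 - \<theta>) * \<theta> ^ n" using th by (simp add: suminf_geometric)
  finally show ?thesis .
qed

text \<open>Multiplication by \<open>1 - t / \<rho>\<close> removes the pole. The coefficients of the product \<open>K\<close> decay like \<open>r ^ (-n)\<close>
by Cauchy's estimate, and \<open>a n * \<rho> ^ n\<close> is a partial sum of the series of \<open>K\<close> at \<open>\<rho>\<close>.
The explicit error is uniform in any parameter.\<close>

lemma simple_pole_coeffs:
  fixes a :: "nat \<Rightarrow> complex" and K :: "complex \<Rightarrow> complex"
  assumes K: "K holomorphic_on ball 0 R" and r: "0 < r" "r < R"
    and M: "\<And>t. norm t = r \<Longrightarrow> norm (K t) \<le> M"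
    and \<rho>: "\<rho> \<noteq> 0" "norm \<rho> \<le> \<theta> * r" "0 \<le> \<theta>" "\<theta> < 1"
    and s: "0 < s" "\<And>t. norm t < s \<Longrightarrow> (\<lambda>n. a n * t ^ n) sums f t"
      "\<And>t. norm t < s \<Longrightarrow> (1 - t / \<rho>) * f t = K t"
  shows "norm (a n * \<rho> ^ n - K \<rho>) \<le> M / (1 - \<theta>) * \<theta> ^ Suc n"
proof -
  define k where "k m = (deriv ^^ m) K 0 / fact m" for m
  have K_sums: "(\<lambda>m. k m * t ^ m) sums K t" if "norm t < R" for t
    using holomorphic_power_series[OF K, of t] that by (simp add: k_def)
  have k_le: "norm (k m) \<le> M / r ^ m" for m
  proof -
    have "norm ((deriv ^^ m) K 0) \<le> fact m * M / r ^ m"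
    proof (rule Cauchy_inequality)
      show "K holomorphic_on ball 0 r" using K r by (auto elim: holomorphic_on_subset)
      show "continuous_on (cball 0 r) K" using K r by (auto intro!: holomorphic_on_imp_continuous_on elim: holomorphic_on_subset)
    qed (use r M in auto)
    then show ?thesis by (simp add: k_def norm_divide field_simps)
  qed
  define b where "b n = a n - (case n of 0 \<Rightarrow> 0 | Suc m \<Rightarrow> a m / \<rho>)" for n
  have b_sums: "(\<lambda>n. b n * t ^ n) sums K t" if t: "norm t < s" for t
  proof -
    have "(\<lambda>n. (case n of 0 \<Rightarrow> 0 | Suc m \<Rightarrow> a m / \<rho>) * t ^ n) sums (t / \<rho> * f t)"
    proof -
      have "(\<lambda>n. (case Suc n of 0 \<Rightarrow> 0 | Suc m \<Rightarrow> a m / \<rho>) * t ^ Suc n) sums (t / \<rho> * f t)"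
        using sums_mult[OF s(2)[OF t], of "t / \<rho>"] by (simp add: mult_ac)
      from sums_Suc[OF this] show ?thesis by simp
    qed
    from sums_diff[OF s(2)[OF t] this] have "(\<lambda>n. b n * t ^ n) sums (f t - t / \<rho> * f t)"
      by (simp add: b_def left_diff_distrib)
    moreover have "f t - t / \<rho> * f t = K t" using s(3)[OF t] by (simp add: left_diff_distrib)
    ultimately show ?thesis by simp
  qed
  have "b = k"
  proof -
    have "\<forall>\<^sub>F t in nhds 0. t \<in> ball (0 :: complex) (min s R)" by (rule eventually_nhds_in_open) (use s r in auto)
    then have "K has_fps_expansion Abs_fps b" "K has_fps_expansion Abs_fps k"
      by (auto intro!: has_fps_expansionI elim!: eventually_mono simp: b_sums K_sums)
    then have "Abs_fps b = Abs_fps k" using fps_expansion_unique_complex by blast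
    then show ?thesis by (metis fps_nth_Abs_fps ext)
  qed
  have a_eq: "a n * \<rho> ^ n = (\<Sum>m<Suc n. k m * \<rho> ^ m)" for n
  proof (induction n)
    case 0
    show ?case using fun_cong[OF \<open>b = k\<close>, of 0] by (simp add: b_def)
  next
    case (Suc n)
    have "k (Suc n) = a (Suc n) - a n / \<rho>" using fun_cong[OF \<open>b = k\<close>, of "Suc n"] by (simp add: b_def)
    then have "k (Suc n) * \<rho> ^ Suc n = a (Suc n) * \<rho> ^ Suc n - a n / \<rho> * \<rho> ^ Suc n"
      by (simp only: left_diff_distrib)
    also have "a n / \<rho> * \<rho> ^ Suc n = a n * \<rho> ^ n" using \<rho>(1) by simp
    finally have "k (Suc n) * \<rho> ^ Suc n = a (Suc n) * \<rho> ^ Suc n - a n * \<rho> ^ n" .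
    then show ?case using Suc.IH by simp
  qed
  have "norm (k m * \<rho> ^ m) \<le> M * \<theta> ^ m" for m
  proof -
    have "0 \<le> M / r ^ m" using k_le[of m] norm_ge_zero[of "k m"] by linarith
    then have "norm (k m * \<rho> ^ m) \<le> M / r ^ m * (\<theta> * r) ^ m"
      unfolding norm_mult norm_power using k_le \<rho> by (intro mult_mono power_mono) auto
    also have "\<dots> = M * \<theta> ^ m" using r by (simp add: power_mult_distrib)
    finally show ?thesis .
  qed
  from geometric_tail_bound[OF this \<rho>(3,4), of "Suc n"]
  have "norm ((\<Sum>m<Suc n. k m * \<rho> ^ m) - (\<Sum>m. k m * \<rho> ^ m)) \<le> M / (1 - \<theta>) * \<theta> ^ Suc n" .
  moreover have "(\<Sum>m. k m * \<rho> ^ m) = K \<rho>"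
  proof -
    have "\<theta> * r < 1 * r" using \<rho> r by (intro mult_strict_right_mono) auto
    then have "norm \<rho> < R" using \<rho>(2) r by linarith
    from K_sums[OF this] show ?thesis by (simp add: sums_iff)
  qed
  ultimately show ?thesis by (simp only: a_eq)
qed

section \<open>The moving pole\<close>

text \<open>Eliminating \<open>E(t, v)\<close> from \<open>e * E(t, v) = 1\<close> and the quadratic equation of \<open>E(t, v)\<close> leaves \<open>v = Vfun t\<close>.
The cofactor \<open>Jfun\<close> belongs to the other root of the quadratic equation.\<close>

definition Vfun :: "complex \<Rightarrow> complex" where
  "Vfun t = ((1 - t ^ 2) * ee t - t ^ 2) / (t * (1 - t ^ 2) * ee t * (1 + ee t))"

definition Jfun :: "complex \<Rightarrow> complex \<Rightarrow> complex" where
  "Jfun t v = (1 - t ^ 2) * ee t - t ^ 2 * (1 + ee t * ek t v 0 + ek t v 0)"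

lemma V_den:
  assumes g: "good r L" "1 \<le> L" "norm t \<le> r" "norm v \<le> L"
    and nz: "t \<noteq> 0" "ee t \<noteq> 0" "1 + ee t \<noteq> 0"
  shows "(Vfun t - v) * (t * (1 - t ^ 2) * ee t * (1 + ee t) * (1 + ek t v 0)) = den t v 0 * Jfun t v"
proof -
  have t2: "1 - t ^ 2 \<noteq> 0" using norm_lower(4)[OF g(1,3,4)] .
  have "ek t v 0 = exc t v" by (simp add: ek_def xk_def)
  then have E: "t ^ 2 * ek t v 0 ^ 2 - (1 - t ^ 2) * (1 - t * v) * ek t v 0 + t * v * (1 - t ^ 2) = 0"
    using exc_eq[OF g(1,3,4)] by simp
  have "Vfun t * (t * (1 - t ^ 2) * ee t * (1 + ee t)) = (1 - t ^ 2) * ee t - t ^ 2"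
    using nz t2 by (simp add: Vfun_def)
  then have "(Vfun t - v) * (t * (1 - t ^ 2) * ee t * (1 + ee t) * (1 + ek t v 0)) =
    ((1 - t ^ 2) * ee t - t ^ 2) * (1 + ek t v 0) - v * (t * (1 - t ^ 2) * ee t * (1 + ee t) * (1 + ek t v 0))"
    by algebra
  also have "\<dots> = den t v 0 * Jfun t v" using E unfolding den_def Jfun_def by algebra
  finally show ?thesis .
qed

definition rho :: real where "rho = troot 0"

lemma rho: "0 < rho" "rho < tcrit" "eer rho = 1" "1 - 2 * rho - 2 * rho ^ 2 + 2 * rho ^ 3 = 0"
    "0.4030317 < rho" "rho < 0.4030318" "rf rho 0 = 1" "ee (of_real rho) = 1" "ek (of_real rho) 1 0 = 1"
proof -
  show 1: "0 < rho" "rho < tcrit" "eer rho = 1" "1 - 2 * rho - 2 * rho ^ 2 + 2 * rho ^ 3 = 0"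
    "0.4030317 < rho" "rho < 0.4030318" "rf rho 0 = 1"
    using troot[of 0] troot_0_cubic troot_0_bounds by (auto simp: rho_def)
  show "ee (of_real rho) = 1" "ek (of_real rho) 1 0 = 1" using of_real_values[OF 1(1,2)] ekr_0[OF 1(1,2)] 1(3) by auto
qed

text \<open>By continuity there is room beyond the values \<open>t = \<rho>\<close> and \<open>v = 1\<close>, with all denominators but the first
one still bounded away from 0.\<close>

lemma choose_region:
  obtains R L where "rho < R" "1 < L" "good R L" "eer R * ekr R L (Suc 0) < 1" "L \<le> 3/2" "R < tcrit"
proof -
  have f1: "rf rho (Suc 0) < 1" using rf_strict[OF rho(1,2), of 0 "Suc 0"] rho(7) by simp
  have "\<exists>r. rf r (Suc 0) < 1 \<and> r \<in> {rho<..<tcrit}"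
  proof -
    have "continuous (at rho within {0..tcrit}) (\<lambda>r. rf r (Suc 0))"
      using continuous_rf[of "Suc 0"] rho(1,2) by (auto simp: continuous_on_eq_continuous_within)
    then have "isCont (\<lambda>r. rf r (Suc 0)) rho"
      using rho(1,2) at_within_interior[of rho "{0..tcrit}"] by simp
    then have "((\<lambda>r. rf r (Suc 0)) \<longlongrightarrow> rf rho (Suc 0)) (at_right rho)"
      by (simp add: isCont_def filterlim_at_split)
    then have "\<forall>\<^sub>F r in at_right rho. rf r (Suc 0) < 1" using f1 by (rule order_tendstoD)
    moreover have "\<forall>\<^sub>F r in at_right rho. r \<in> {rho<..<tcrit}" using rho(2) by (intro eventually_at_right_real) auto
    ultimately have "\<forall>\<^sub>F r in at_right rho. rf r (Suc 0) < 1 \<and> r \<in> {rho<..<tcrit}" by (rule eventually_conj)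
    then show ?thesis by (rule eventually_happens'[rotated]) (rule trivial_limit_at_right_real)
  qed
  then obtain R' where R': "rf R' (Suc 0) < 1" "rho < R'" "R' < tcrit" by auto
  define R where "R = (rho + R') / 2"
  have R: "rho < R" "R < R'" "R < tcrit" "0 < R" "0 < R'" using R' rho(1) by (auto simp: R_def)
  have q: "0 < qqr R" "qqr R < qqr R'"
  proof -
    show "0 < qqr R" using qqr_pos R by auto
    have "R * (1 + eer R) < R' * (1 + eer R')"
      using eer_mono[of R R'] eer_pos[of R] R R' by (intro mult_less_le_imp_less) auto
    then show "qqr R < qqr R'" by (simp add: qqr_def)
  qed
  define L2 where "L2 = (1 - R) / (R + R ^ 2)"
  have g1: "R + R + R ^ 2 < 1" using good_iff[of R] R by (auto simp: good_def)
  have pR: "0 < R + R ^ 2" using R by (simp add: add_pos_pos)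
  have L2: "1 < L2" using g1 pR by (simp add: L2_def)
  define L where "L = min (qqr R' / qqr R) (min ((1 + L2) / 2) (3/2))"
  have "L \<le> (1 + L2) / 2" "L \<le> 3/2" unfolding L_def by (simp_all only: min_le_iff_disj) auto
  moreover have "1 < L" "L \<le> qqr R' / qqr R" using L2 q by (simp_all add: L_def)
  ultimately have L: "1 < L" "L \<le> qqr R' / qqr R" "L < L2" "L \<le> 3/2" using L2 by auto
  have "L * (R + R ^ 2) < L2 * (R + R ^ 2)" using L pR by (intro mult_strict_right_mono) auto
  also have "\<dots> = 1 - R" using pR by (simp add: L2_def)
  finally have g: "good R L" using L R by (simp add: good_def algebra_simps)
  have "eer R * ekr R L (Suc 0) \<le> eer R' * ekr R' 1 (Suc 0)"
  proof (rule mult_mono)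
    show "eer R \<le> eer R'" using eer_mono[of R R'] R R' by auto
    have gR': "good R' (qqr R')" using good_k[of R' 1 1] R' R by (simp add: good_iff)
    have "L * qqr R \<le> qqr R'" using L(2) q by (simp add: field_simps)
    then show "ekr R L (Suc 0) \<le> ekr R' 1 (Suc 0)"
      unfolding ekr_def using excxr_mono(2)[OF gR', of R "L * qqr R"] R L q by simp
    show "0 \<le> eer R'" using eer_pos[of R'] R R' by simp
    show "0 \<le> ekr R L (Suc 0)" using ekr_nonneg[OF g] L by simp
  qed
  also have "\<dots> < 1" using R'(1) by (simp add: rf_def)
  finally show ?thesis using that R L g by auto
qed


section \<open>Uniform asymptotics of the width polynomials\<close>

lemma den_dominant:
  assumes "norm z \<le> rho" "z \<noteq> of_real rho"
  shows "den z 1 0 \<noteq> 0"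
proof -
  have "norm (ee z) < 1" using norm_ee_less[OF assms(1) rho(2,1) assms(2)] rho(3) by simp
  then have "norm (ee z) * norm (ee z) < 1 * 1" by (intro mult_strict_mono) auto
  then have "ee z * ee z \<noteq> 1" by (metis less_irrefl mult_1 norm_mult norm_one)
  then show ?thesis by (simp add: den_def ek_def xk_def ee_def)
qed

lemma rho_identities:
  "2 * rho ^ 3 = 2 * rho + 2 * rho ^ 2 - 1" "0 < 1 - rho - rho ^ 2" "0 < 1 - 4 * rho ^ 2" "rho < 1/2" "rho ^ 2 < 1/4"
proof -
  show "2 * rho ^ 3 = 2 * rho + 2 * rho ^ 2 - 1" using rho(4) by simp
  show h: "rho < 1/2" using rho(6) by simp
  have "rho * rho < 1/2 * (1/2)" using rho(1) h by (intro mult_strict_mono) auto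
  then show q: "rho ^ 2 < 1/4" by (simp add: power2_eq_square)
  then show "0 < 1 - rho - rho ^ 2" "0 < 1 - 4 * rho ^ 2" using h by linarith+
qed

lemma ee_equation:
  assumes "norm t < tcrit"
  shows "t ^ 2 * ee t ^ 2 - (1 - t ^ 2) * (1 - t) * ee t + t * (1 - t ^ 2) = 0"
proof -
  have "good (norm t) 1" using assms by (simp add: good_iff)
  from exc_eq[OF this order_refl, of 1] show ?thesis by (simp add: ee_def)
qed

lemma holomorphic_ee_crit: "ee holomorphic_on ball 0 tcrit"
proof -
  have "ee analytic_on {z}" if z: "norm z < tcrit" for z
  proof -
    obtain r where r: "norm z < r" "r < tcrit" using dense[OF z] by blast
    then have "0 \<le> r" using norm_ge_zero[of z] by linarith
    then have "good r 1" using r by (simp add: good_iff)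
    then have "ee holomorphic_on ball 0 r" by (rule holomorphic_ee) auto
    then show ?thesis by (rule holomorphic_on_imp_analytic_at) (use r in auto)
  qed
  then have "ee analytic_on ball 0 tcrit" by (subst analytic_on_analytic_at) auto
  then show ?thesis by (simp add: analytic_on_open)
qed

lemma Vfun_eq:
  assumes "norm t < tcrit" "t \<noteq> 0" "ee t \<noteq> 0" "1 + ee t \<noteq> 0"
  shows "Vfun t * (t * (1 - t ^ 2) * ee t * (1 + ee t)) = (1 - t ^ 2) * ee t - t ^ 2"
proof -
  have "good (norm t) 1" using assms by (simp add: good_iff)
  from norm_lower(4)[OF this order_refl, of 0] have "1 - t ^ 2 \<noteq> 0" by simp
  then show ?thesis using assms by (simp add: Vfun_def)
qed

text \<open>Needed for the local inverse of \<open>Vfun\<close>. If the derivative vanished, the polynomial equations between \<open>t\<close>,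
\<open>e\<close> and \<open>v = Vfun t\<close> would give contradictory linear equations for the derivative of \<open>e\<close> at \<open>\<rho>\<close>.\<close>

lemma deriv_V_nz:
  assumes V: "(Vfun has_field_derivative V') (at (of_real rho))"
  shows "V' \<noteq> 0"
proof
  assume "V' = 0"
  define z where "z = complex_of_real rho"
  have z: "norm z < tcrit" "z \<noteq> 0" using rho(1,2) by (auto simp: z_def)
  obtain e' where e': "(ee has_field_derivative e') (at z)"
    using holomorphic_on_imp_differentiable_at[OF holomorphic_ee_crit open_ball, of z] z
    unfolding field_differentiable_def by auto
  have ez: "ee z = 1" using rho(8) by (simp add: z_def)
  have near: "\<forall>\<^sub>F t in nhds z. t \<in> ball 0 tcrit \<and> t \<noteq> 0 \<and> ee t \<noteq> 0 \<and> 1 + ee t \<noteq> 0"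
  proof -
    have c: "isCont ee z" using e' by (rule DERIV_isCont)
    then have "(ee \<longlongrightarrow> ee z) (nhds z)" by (simp only: isCont_def tendsto_at_iff_tendsto_nhds)
    then have "(ee \<longlongrightarrow> 1) (nhds z)" by (simp only: ez)
    then have "\<forall>\<^sub>F t in nhds z. ee t \<in> ball 1 1" by (rule topological_tendstoD) auto
    moreover have "\<forall>\<^sub>F t in nhds z. t \<in> ball 0 tcrit - {0}" by (rule eventually_nhds_in_open) (use z in auto)
    ultimately show ?thesis
    proof eventually_elim
      case (elim t)
      then have "norm (1 - ee t) < 1" by (simp add: dist_norm)
      then have "ee t \<noteq> 0" "ee t \<noteq> -1" by auto
      then show ?case using elim by (auto simp: add_eq_0_iff)
    qed
  qed
  have 1: "((\<lambda>t. t ^ 2 * ee t ^ 2 - (1 - t ^ 2) * (1 - t) * ee t + t * (1 - t ^ 2)) has_field_derivative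
     (2 + 4 * z - 6 * z ^ 2) + (2 * z ^ 2 - (1 - z ^ 2) * (1 - z)) * e') (at z)"
    by (rule derivative_eq_intros e' refl | simp add: ez)+ (simp add: power2_eq_square algebra_simps)
  have "((\<lambda>t. t ^ 2 * ee t ^ 2 - (1 - t ^ 2) * (1 - t) * ee t + t * (1 - t ^ 2)) has_field_derivative 0) (at z)"
    by (rule has_field_derivative_transform_within_open[of "\<lambda>_. 0" 0 z "ball 0 tcrit"])
       (use z in \<open>auto simp: ee_equation\<close>)
  from DERIV_unique[OF 1 this] have F1: "(2 + 4 * z - 6 * z ^ 2) + (2 * z ^ 2 - (1 - z ^ 2) * (1 - z)) * e' = 0" .
  have Vz: "Vfun z = 1"
  proof -
    have "1 - z ^ 2 \<noteq> 0" using rho_identities(5) by (simp add: z_def flip: of_real_power) 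
    moreover have "2 * z * (1 - z ^ 2) = (1 - z ^ 2) - z ^ 2"
    proof -
      have "complex_of_real (2 * rho * (1 - rho ^ 2)) = of_real ((1 - rho ^ 2) - rho ^ 2)"
        using rho(4) by (intro arg_cong[of _ _ of_real]) (simp add: power2_eq_square power3_eq_cube algebra_simps)
      then show ?thesis by (simp add: z_def)
    qed
    ultimately show ?thesis using z(2) by (simp add: Vfun_def ez field_simps)
  qed
  have 2: "((\<lambda>t. Vfun t * (t * (1 - t ^ 2) * ee t * (1 + ee t)) - (1 - t ^ 2) * ee t + t ^ 2) has_field_derivative
     V' * (2 * z * (1 - z ^ 2)) + (2 + 4 * z - 6 * z ^ 2) + (3 * z * (1 - z ^ 2) - (1 - z ^ 2)) * e') (at z)"
    by (rule derivative_eq_intros e' V[folded z_def] refl | simp add: ez Vz)+ (simp add: power2_eq_square algebra_simps)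
  have "((\<lambda>t. Vfun t * (t * (1 - t ^ 2) * ee t * (1 + ee t)) - (1 - t ^ 2) * ee t + t ^ 2) has_field_derivative 0) (at z)"
  proof -
    have "\<forall>\<^sub>F t in nhds z. 0 = Vfun t * (t * (1 - t ^ 2) * ee t * (1 + ee t)) - (1 - t ^ 2) * ee t + t ^ 2"
      using near by eventually_elim (simp add: Vfun_eq)
    from DERIV_cong_ev[OF refl this refl, of 0] show ?thesis by simp
  qed
  from DERIV_unique[OF 2 this] have F2: "(2 + 4 * z - 6 * z ^ 2) + (3 * z * (1 - z ^ 2) - (1 - z ^ 2)) * e' = 0"
    using \<open>V' = 0\<close> by simp
  have "(2 + 4 * z - 6 * z ^ 2) * (2 * z * (1 - z - z ^ 2)) = 0" using F1 F2 by algebra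
  moreover have "(2 + 4 * z - 6 * z ^ 2) * (2 * z * (1 - z - z ^ 2)) =
      of_real ((2 + 4 * rho - 6 * rho ^ 2) * (2 * rho * (1 - rho - rho ^ 2)))" by (simp add: z_def)
  moreover have "0 < (2 + 4 * rho - 6 * rho ^ 2) * (2 * rho * (1 - rho - rho ^ 2))"
    using rho_identities rho(1) by (intro mult_pos_pos) auto
  ultimately show False by (metis less_irrefl of_real_eq_0_iff)
qed

text \<open>For \<open>v\<close> near 1 the pole \<open>rh v\<close> is the value at \<open>v\<close> of the local inverse of \<open>Vfun\<close>. By compactness it
stays the only zero of the first denominator in a disc of radius larger than \<open>\<rho>\<close>, so \<open>(1 - t / rh v) * PP t v\<close>
is analytic and bounded there, uniformly in \<open>v\<close>.\<close>

theorem width_poly_quasi_power: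
  obtains \<delta> C \<theta> :: real and rh lam :: "complex \<Rightarrow> complex" where
    "0 < \<delta>" "\<delta> \<le> 1/2" "rh holomorphic_on ball 1 \<delta>" "rh 1 = of_real rho"
    "\<And>v. v \<in> ball 1 \<delta> \<Longrightarrow> norm (rh v) < tcrit \<and> rh v \<noteq> 0 \<and> ee (rh v) \<noteq> 0 \<and> 1 + ee (rh v) \<noteq> 0 \<and> Vfun (rh v) = v"
    "0 \<le> \<theta>" "\<theta> < 1"
    "\<And>v n. v \<in> ball 1 \<delta> \<Longrightarrow> norm (width_poly n v * rh v ^ n - lam v) \<le> C * \<theta> ^ n"
    "lam 1 \<noteq> 0"
proof -
  obtain R L where RL: "rho < R" "1 < L" "good R L" "eer R * ekr R L (Suc 0) < 1" "L \<le> 3/2" "R < tcrit"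
    by (rule choose_region)
  have L1: "1 \<le> L" using RL by simp
  define z where "z = complex_of_real rho"
  have z: "norm z = rho" "z \<noteq> 0" using rho(1) by (auto simp: z_def)
  have ez: "ee z = 1" "ek z 1 0 = 1" using rho(8,9) by (simp_all add: z_def)
  define D where "D = cball (0::complex) R \<times> cball (0::complex) L"
  have compD: "compact D" by (simp add: D_def compact_Times)
  have contden: "continuous_on D (\<lambda>p. den (fst p) (snd p) 0)" unfolding D_def by (rule continuous_den[OF RL(3) L1])
  \<comment> \<open>a neighbourhood on which the relation between \<open>den\<close> and \<open>Vfun\<close> is an equivalence\<close>
  define \<Phi> where "\<Phi> p = fst p * ee (fst p) * (1 + ee (fst p)) * (1 + ek (fst p) (snd p) 0) * Jfun (fst p) (snd p)" for p
  have cont\<Phi>: "continuous_on D \<Phi>" unfolding \<Phi>_def[abs_def] Jfun_def D_def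
    by (intro continuous_intros continuous_ee[OF RL(3) L1] continuous_ek[OF RL(3) L1])
  define U0 where "U0 = {p \<in> ball 0 R \<times> ball 0 L. \<Phi> p \<noteq> 0}"
  have "open U0"
  proof -
    have "continuous_on (ball 0 R \<times> ball 0 L) \<Phi>" by (rule continuous_on_subset[OF cont\<Phi>]) (auto simp: D_def)
    then have "open ((ball 0 R \<times> ball 0 L) \<inter> \<Phi> -` (- {0}))"
      by (rule continuous_open_preimage) (auto simp: open_Times)
    moreover have "U0 = (ball 0 R \<times> ball 0 L) \<inter> \<Phi> -` (- {0})" by (auto simp: U0_def)
    ultimately show ?thesis by simp
  qed
  moreover have "(z, 1) \<in> U0"
  proof -
    have "Jfun z 1 = 1 - 4 * z ^ 2" by (simp add: Jfun_def ez)
    also have "\<dots> = of_real (1 - 4 * rho ^ 2)" by (simp add: z_def)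
    finally have "Jfun z 1 = of_real (1 - 4 * rho ^ 2)" .
    moreover have "complex_of_real (1 - 4 * rho ^ 2) \<noteq> 0" using rho_identities(3) by (metis less_irrefl of_real_eq_0_iff)
    ultimately have "Jfun z 1 \<noteq> 0" by simp
    then show ?thesis using z RL by (simp add: U0_def \<Phi>_def ez)
  qed
  ultimately obtain A B where AB: "open A" "open B" "z \<in> A" "1 \<in> B" "A \<times> B \<subseteq> U0" by (rule open_prod_elim) auto
  obtain \<epsilon>0 where \<epsilon>0: "\<epsilon>0 > 0" "ball z \<epsilon>0 \<subseteq> A" using AB open_contains_ball by blast
  obtain \<delta>0 where \<delta>0: "\<delta>0 > 0" "ball 1 \<delta>0 \<subseteq> B" using AB open_contains_ball by blast
  have nz: "norm t < R" "norm v < L" "t \<noteq> 0" "ee t \<noteq> 0" "1 + ee t \<noteq> 0" "1 + ek t v 0 \<noteq> 0" "Jfun t v \<noteq> 0"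
    if "t \<in> ball z \<epsilon>0" "v \<in> ball 1 \<delta>0" for t v
  proof -
    have "(t, v) \<in> U0" using that AB(5) \<epsilon>0(2) \<delta>0(2) by blast
    then show "norm t < R" "norm v < L" "t \<noteq> 0" "ee t \<noteq> 0" "1 + ee t \<noteq> 0" "1 + ek t v 0 \<noteq> 0" "Jfun t v \<noteq> 0"
      by (auto simp: U0_def \<Phi>_def)
  qed
  have one_in: "1 \<in> ball (1::complex) \<delta>0" using \<delta>0 by simp
  have den_iff: "den t v 0 = 0 \<longleftrightarrow> Vfun t = v" if tv: "t \<in> ball z \<epsilon>0" "v \<in> ball 1 \<delta>0" for t v
  proof -
    note n = nz[OF tv]
    have t2: "1 - t ^ 2 \<noteq> 0" using norm_lower(4)[OF RL(3), of t v] n by simp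
    have "(Vfun t - v) * (t * (1 - t ^ 2) * ee t * (1 + ee t) * (1 + ek t v 0)) = den t v 0 * Jfun t v"
      by (rule V_den[OF RL(3) L1]) (use n in auto)
    then show ?thesis using n t2 by (metis mult_eq_0_iff right_minus_eq)
  qed
  have holV: "Vfun holomorphic_on ball z \<epsilon>0"
  proof -
    have "1 - t ^ 2 \<noteq> 0" if "t \<in> ball z \<epsilon>0" for t
      using norm_lower(4)[OF RL(3), of t 1] nz[OF that one_in] by simp
    moreover have "ball z \<epsilon>0 \<subseteq> ball 0 tcrit" using nz(1)[OF _ one_in] RL(6) by force
    ultimately show ?thesis unfolding Vfun_def[abs_def] using nz[OF _ one_in]
      by (intro holomorphic_intros holomorphic_on_subset[OF holomorphic_ee_crit]) auto
  qed
  have zin: "z \<in> ball z \<epsilon>0" using \<epsilon>0 by simp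
  have "deriv Vfun z \<noteq> 0"
    using deriv_V_nz holomorphic_derivI[OF holV open_ball zin, of UNIV] by (simp add: z_def)
  then obtain \<epsilon>1 where \<epsilon>1: "\<epsilon>1 > 0" "ball z \<epsilon>1 \<subseteq> ball z \<epsilon>0" "open (Vfun ` ball z \<epsilon>1)" "inj_on Vfun (ball z \<epsilon>1)"
    using has_complex_derivative_locally_invertible[OF holV zin open_ball] by blast
  have holV1: "Vfun holomorphic_on ball z \<epsilon>1" using holV \<epsilon>1 by (auto elim: holomorphic_on_subset)
  obtain g where g: "g holomorphic_on (Vfun ` ball z \<epsilon>1)"
     "\<And>t. t \<in> ball z \<epsilon>1 \<Longrightarrow> deriv Vfun t * deriv g (Vfun t) = 1"
     "\<And>t. t \<in> ball z \<epsilon>1 \<Longrightarrow> g (Vfun t) = t"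
    using holomorphic_has_inverse[OF holV1 open_ball \<epsilon>1(4)] by blast
  have dz: "den z 1 0 = 0" by (simp add: den_def ez)
  then have Vz: "Vfun z = 1" using den_iff[OF zin one_in] by simp
  have z1: "z \<in> ball z \<epsilon>1" using \<epsilon>1 by simp
  have den1_ball: "den t 1 0 = 0 \<longleftrightarrow> t = z" if "t \<in> ball z \<epsilon>1" for t
    using den_iff[of t 1] one_in that \<epsilon>1(2,4) z1 Vz by (metis inj_onD subsetD)
  \<comment> \<open>a radius beyond \<open>rho\<close> below which \<open>z\<close> is the only zero of the denominator at \<open>v = 1\<close>\<close>
  obtain R1 where R1: "rho < R1" "R1 < R" "\<And>t. norm t \<le> R1 \<Longrightarrow> den t 1 0 = 0 \<Longrightarrow> t = z"
  proof -
    define Z where "Z = {t \<in> cball 0 R. den t 1 0 = 0} - ball z \<epsilon>1"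
    have c1: "continuous_on (cball 0 R) (\<lambda>t. den t 1 0)"
      by (rule holomorphic_on_imp_continuous_on, rule holomorphic_den[OF RL(3) L1]) (use L1 in auto)
    have "compact Z"
    proof -
      have "closed {t \<in> cball 0 R. den t 1 0 = 0}"
        using continuous_closed_preimage_constant[OF c1 closed_cball, of 0] by simp
      then have "closed Z" unfolding Z_def by (intro closed_Diff) auto
      moreover have "bounded Z" by (rule bounded_subset[OF bounded_cball[of 0 R]]) (auto simp: Z_def)
      ultimately show ?thesis by (simp add: compact_eq_bounded_closed)
    qed
    have Zr: "rho < norm t" if "t \<in> Z" for t
    proof (rule ccontr)
      assume "\<not> ?thesis"
      then have "t = z" using den_dominant[of t] that by (auto simp: Z_def z_def)
      then show False using that \<epsilon>1(1) by (simp add: Z_def)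
    qed
    show ?thesis
    proof (cases "Z = {}")
      case True
      show ?thesis
      proof (rule that[of "(rho + R) / 2"])
        fix t assume t: "norm t \<le> (rho + R) / 2" "den t 1 0 = 0"
        have "(rho + R) / 2 \<le> R" using RL(1) by simp
        with t(1) have "norm t \<le> R" by (rule order_trans)
        then have "t \<in> ball z \<epsilon>1" using True t(2) unfolding Z_def by auto
        then show "t = z" using den1_ball t by simp
      qed (use RL in auto)
    next
      case False
      obtain y where y: "y \<in> Z" "\<And>t. t \<in> Z \<Longrightarrow> norm y \<le> norm t"
        using continuous_attains_inf[OF \<open>compact Z\<close> False, of norm] by (auto intro: continuous_intros)
      have yr: "rho < norm y" "norm y \<le> R" using Zr[OF y(1)] y(1) by (auto simp: Z_def)
      show ?thesis
      proof (rule that[of "(rho + norm y) / 2"])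
        fix t assume t: "norm t \<le> (rho + norm y) / 2" "den t 1 0 = 0"
        then have "t \<notin> Z" using y(2)[of t] yr by auto
        have "(rho + norm y) / 2 \<le> R" using yr by simp
        with t(1) have "norm t \<le> R" by (rule order_trans)
        then have "t \<in> ball z \<epsilon>1" using \<open>t \<notin> Z\<close> t(2) unfolding Z_def by auto
        then show "t = z" using den1_ball t by simp
      qed (use yr RL in auto)
    qed
  qed
  define \<epsilon>2 where "\<epsilon>2 = min \<epsilon>1 (min ((R1 - rho) / 2) (rho / 2))"
  have \<epsilon>2: "0 < \<epsilon>2" "\<epsilon>2 \<le> \<epsilon>1" "\<epsilon>2 \<le> (R1 - rho) / 2" "\<epsilon>2 \<le> rho / 2"
    using \<epsilon>1(1) R1(1) rho(1) unfolding \<epsilon>2_def min_le_iff_disj by simp_all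
  define R0 where "R0 = (rho + \<epsilon>2 + R1) / 2"
  have R0: "rho + \<epsilon>2 < R0" "R0 < R1" "0 < R0" using \<epsilon>2 R1 rho(1) by (auto simp: R0_def)
  define C where "C = cball 0 R1 - ball z \<epsilon>2"
  have compC: "compact C" unfolding C_def by (intro compact_diff) auto
  have C_ne: "of_real R1 \<in> C"
    using R1 \<epsilon>2 rho(1) by (auto simp: C_def z_def dist_norm simp flip: of_real_diff)
  have c1: "continuous_on C (\<lambda>t. norm (den t 1 0))"
    by (intro continuous_on_norm holomorphic_on_imp_continuous_on holomorphic_den[OF RL(3) L1])
       (use R1 L1 in \<open>auto simp: C_def\<close>)
  obtain y where y: "y \<in> C" "\<And>t. t \<in> C \<Longrightarrow> norm (den y 1 0) \<le> norm (den t 1 0)"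
    using continuous_attains_inf[OF compC _ c1] C_ne by blast
  define m where "m = norm (den y 1 0)"
  have m: "0 < m"
  proof -
    have "y \<noteq> z" using y(1) \<epsilon>2(1) by (auto simp: C_def)
    then show ?thesis using R1(3)[of y] y(1) by (auto simp: m_def C_def)
  qed
  have "uniformly_continuous_on D (\<lambda>p. den (fst p) (snd p) 0)"
    using compact_uniformly_continuous[OF contden compD] .
  then obtain \<delta>1 where \<delta>1: "\<delta>1 > 0" "\<And>p p'. p \<in> D \<Longrightarrow> p' \<in> D \<Longrightarrow> dist p' p < \<delta>1 \<Longrightarrow>
      dist (den (fst p') (snd p') 0) (den (fst p) (snd p) 0) < m / 2"
    unfolding uniformly_continuous_on_def using m by (metis half_gt_zero)
  have den_C: "m / 2 \<le> norm (den t v 0)" if t: "t \<in> C" and v: "norm v \<le> L" "dist v 1 < \<delta>1" for t v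
  proof -
    have "(t, v) \<in> D" "(t, 1) \<in> D" using t v L1 R1 by (auto simp: D_def C_def)
    moreover have "dist (t, v) (t, 1) < \<delta>1" using v by (simp add: dist_Pair_Pair)
    ultimately have "dist (den t v 0) (den t 1 0) < m / 2" using \<delta>1(2)[of "(t, 1)" "(t, v)"] by simp
    moreover have "m \<le> norm (den t 1 0)" using y(2)[OF t] by (simp add: m_def)
    ultimately show ?thesis using norm_triangle_ineq2[of "den t 1 0" "den t 1 0 - den t v 0"]
      by (simp add: dist_norm norm_minus_commute)
  qed
  obtain \<delta>2 where \<delta>2: "\<delta>2 > 0" "ball 1 \<delta>2 \<subseteq> Vfun ` ball z \<epsilon>1" "\<And>v. v \<in> ball 1 \<delta>2 \<Longrightarrow> g v \<in> ball z \<epsilon>2"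
  proof -
    have 1: "1 \<in> Vfun ` ball z \<epsilon>1" using z1 Vz by (metis imageI)
    have gc: "continuous_on (Vfun ` ball z \<epsilon>1) g" using g(1) by (rule holomorphic_on_imp_continuous_on)
    then have "open ((Vfun ` ball z \<epsilon>1) \<inter> g -` ball z \<epsilon>2)" by (rule continuous_open_preimage) (auto simp: \<epsilon>1)
    moreover have "1 \<in> (Vfun ` ball z \<epsilon>1) \<inter> g -` ball z \<epsilon>2" using 1 g(3)[OF z1] Vz \<epsilon>2 by simp
    ultimately obtain d where "d > 0" "ball 1 d \<subseteq> (Vfun ` ball z \<epsilon>1) \<inter> g -` ball z \<epsilon>2"
      using open_contains_ball by blast
    then show ?thesis using that[of d] by blast
  qed
  define \<delta> where "\<delta> = min (min \<delta>0 \<delta>1) (min \<delta>2 (L - 1))"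
  have \<delta>: "0 < \<delta>" "\<delta> \<le> \<delta>0" "\<delta> \<le> \<delta>1" "\<delta> \<le> \<delta>2" "\<delta> \<le> L - 1" using \<delta>0 \<delta>1 \<delta>2 RL by (auto simp: \<delta>_def)
  have v_in: "v \<in> ball 1 \<delta>0" "v \<in> ball 1 \<delta>2" "dist v 1 < \<delta>1" "norm v < L" if "v \<in> ball 1 \<delta>" for v :: complex
  proof -
    show "v \<in> ball 1 \<delta>0" "v \<in> ball 1 \<delta>2" "dist v 1 < \<delta>1" using that \<delta> by (auto simp: dist_commute)
    show "norm v < L" using that \<delta> norm_triangle_ineq2[of v 1] by (simp add: dist_norm norm_minus_commute)
  qed
  have gv: "g v \<in> ball z \<epsilon>2" "Vfun (g v) = v" if v: "v \<in> ball 1 \<delta>" for v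
  proof -
    show "g v \<in> ball z \<epsilon>2" using \<delta>2(3) v_in(2)[OF v] .
    obtain t where "t \<in> ball z \<epsilon>1" "v = Vfun t" using \<delta>2(2) v_in(2)[OF v] by blast
    then show "Vfun (g v) = v" using g(3) by simp
  qed
  have ball_sub: "ball z \<epsilon>2 \<subseteq> ball z \<epsilon>1" "ball z \<epsilon>2 \<subseteq> ball z \<epsilon>0" using \<epsilon>2(2) \<epsilon>1(2) by auto
  have den_zero: "den t v 0 = 0 \<longleftrightarrow> t = g v" if t: "norm t \<le> R1" and v: "v \<in> ball 1 \<delta>" for t v
  proof (cases "t \<in> ball z \<epsilon>2")
    case True
    have "den t v 0 = 0 \<longleftrightarrow> Vfun t = Vfun (g v)"
      using den_iff[of t v] True ball_sub v_in(1)[OF v] gv(2)[OF v] by auto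
    also have "\<dots> \<longleftrightarrow> t = g v" using inj_onD[OF \<epsilon>1(4)] True gv(1)[OF v] ball_sub by blast
    finally show ?thesis .
  next
    case False
    then have "t \<in> C" using t by (simp add: C_def)
    then have "den t v 0 \<noteq> 0" using den_C[of t v] v_in[OF v] m by auto
    moreover have "t \<noteq> g v" using False gv(1)[OF v] by auto
    ultimately show ?thesis by simp
  qed
  have hol_den: "(\<lambda>t. den t v 0) holomorphic_on ball 0 R" if "v \<in> ball 1 \<delta>" for v
    by (rule holomorphic_den[OF RL(3) L1]) (use v_in(4)[OF that] in auto)
  have gR: "norm (g v) < R1" "g v \<noteq> 0" "rho / 2 \<le> norm (g v)" "norm (g v) \<le> rho + \<epsilon>2" if "v \<in> ball 1 \<delta>" for v
  proof -
    have n: "norm (z - g v) < \<epsilon>2" using gv(1)[OF that] by (simp add: dist_norm)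
    then show "norm (g v) \<le> rho + \<epsilon>2" using norm_triangle_ineq2[of "g v" z] z by (simp add: norm_minus_commute)
    then show "norm (g v) < R1" using R0 by simp
    show r: "rho / 2 \<le> norm (g v)" using n norm_triangle_ineq2[of z "g v"] z \<epsilon>2(4) by simp
    then show "g v \<noteq> 0" using rho(1) by auto
  qed
  have deriv_den: "deriv (\<lambda>t. den t v 0) (g v) \<noteq> 0" if v: "v \<in> ball 1 \<delta>" for v
  proof -
    define w where "w = g v"
    have w: "w \<in> ball z \<epsilon>0" "w \<in> ball z \<epsilon>1" "Vfun w = v" using gv[OF v] ball_sub by (auto simp: w_def)
    define q where "q t = t * (1 - t ^ 2) * ee t * (1 + ee t) * (1 + ek t v 0)" for t
    have v0: "v \<in> ball 1 \<delta>0" using v_in(1)[OF v] .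
    have sub: "ball z \<epsilon>0 \<subseteq> cball 0 R" using nz(1)[OF _ v0] by force
    have holq: "q holomorphic_on ball z \<epsilon>0" unfolding q_def
      by (intro holomorphic_intros holomorphic_ee[OF RL(3) L1] holomorphic_ek[OF RL(3) L1] sub)
         (use v_in(4)[OF v] in auto)
    have qw: "q w \<noteq> 0"
      using nz[OF w(1) v0] norm_lower(4)[OF RL(3), of w v] by (auto simp: q_def)
    have DV: "(Vfun has_field_derivative deriv Vfun w) (at w)"
      using holomorphic_derivI[OF holV open_ball w(1), of UNIV] by simp
    have Dq: "(q has_field_derivative deriv q w) (at w)"
      using holomorphic_derivI[OF holq open_ball w(1), of UNIV] by simp
    have "((\<lambda>t. (Vfun t - v) * q t) has_field_derivative deriv Vfun w * q w) (at w)"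
      using DERIV_mult[OF DERIV_diff[OF DV DERIV_const[of v]] Dq] w(3) by simp
    then have D1: "((\<lambda>t. den t v 0 * Jfun t v) has_field_derivative deriv Vfun w * q w) (at w)"
    proof (rule has_field_derivative_transform_within_open[OF _ open_ball w(1)])
      fix t assume "t \<in> ball z \<epsilon>0"
      from nz[OF this v0] show "(Vfun t - v) * q t = den t v 0 * Jfun t v"
        unfolding q_def by (intro V_den[OF RL(3) L1]) auto
    qed
    have holJ: "(\<lambda>t. Jfun t v) holomorphic_on ball z \<epsilon>0" unfolding Jfun_def
      by (intro holomorphic_intros holomorphic_ee[OF RL(3) L1] holomorphic_ek[OF RL(3) L1] sub)
         (use v_in(4)[OF v] in auto)
    have DJ: "((\<lambda>t. Jfun t v) has_field_derivative deriv (\<lambda>t. Jfun t v) w) (at w)"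
      using holomorphic_derivI[OF holJ open_ball w(1), of UNIV] by simp
    have wR: "w \<in> ball 0 R" using nz(1)[OF w(1) v0] by simp
    have Dd: "((\<lambda>t. den t v 0) has_field_derivative deriv (\<lambda>t. den t v 0) w) (at w)"
      using holomorphic_derivI[OF hol_den[OF v] open_ball wR, of UNIV] by simp
    have dw: "den w v 0 = 0" using den_iff[OF w(1) v0] w(3) by simp
    have "((\<lambda>t. den t v 0 * Jfun t v) has_field_derivative deriv (\<lambda>t. den t v 0) w * Jfun w v) (at w)"
      using DERIV_mult[OF Dd DJ] dw by simp
    from DERIV_unique[OF this D1] have "deriv (\<lambda>t. den t v 0) w * Jfun w v = deriv Vfun w * q w" .
    moreover have "deriv Vfun w \<noteq> 0" using g(2)[OF w(2)] by auto
    ultimately show ?thesis using qw by (auto simp: w_def)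
  qed
  define h where "h v t = (if t = g v then deriv (\<lambda>t. den t v 0) (g v) else (den t v 0 - den (g v) v 0) / (t - g v))" for v t
  have den_g: "den (g v) v 0 = 0" if "v \<in> ball 1 \<delta>" for v using den_zero[of "g v" v] gR(1)[OF that] that by simp
  have h_nz: "h v t \<noteq> 0" if "v \<in> ball 1 \<delta>" "norm t \<le> R1" for v t
    using den_zero[OF that(2,1)] deriv_den[OF that(1)] den_g[OF that(1)] by (simp add: h_def)
  have h_hol: "h v holomorphic_on ball 0 R" if "v \<in> ball 1 \<delta>" for v
    unfolding h_def[abs_def] by (rule pole_lemma_open[OF hol_den[OF that] open_ball])
  define N where "N t v = base t v * den t v 0 + num t v 0 * tail 0 t v" for t v
  have holN: "(\<lambda>t. N t v) holomorphic_on ball 0 R" if "v \<in> ball 1 \<delta>" for v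
    unfolding N_def using v_in(4)[OF that]
    by (intro holomorphic_intros holomorphic_base[OF RL(3) L1] holomorphic_den[OF RL(3) L1]
        holomorphic_num[OF RL(3) L1] holomorphic_tail[OF RL(3) L1 RL(4)]) auto
  have "continuous_on D (\<lambda>p. N (fst p) (snd p))" unfolding N_def D_def
    by (intro continuous_intros continuous_base[OF RL(3) L1] continuous_den[OF RL(3) L1]
        continuous_num[OF RL(3) L1] continuous_tail[OF RL(3) L1 RL(4)])
  then have "bounded ((\<lambda>p. N (fst p) (snd p)) ` D)" using compD by (intro compact_imp_bounded compact_continuous_image)
  then obtain M0 where M0: "\<And>t v. (t, v) \<in> D \<Longrightarrow> norm (N t v) \<le> M0"
    unfolding bounded_iff by force
  define K where "K v t = - (1 / g v) * (N t v / h v t)" for v t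
  define M where "M = (1 + R0 / (rho / 2)) * (M0 / (m / 2))"
  define \<theta> where "\<theta> = (rho + \<epsilon>2) / R0"
  have \<theta>: "0 \<le> \<theta>" "\<theta> < 1" "\<theta> * R0 = rho + \<epsilon>2" using R0 rho(1) \<epsilon>2 by (auto simp: \<theta>_def)
  have K_alt: "K v t = (1 - t / g v) * (N t v / den t v 0)" if "v \<in> ball 1 \<delta>" "t \<noteq> g v" for v t
  proof -
    have "1 - t / g v = - (1 / g v) * (t - g v)" using gR(2)[OF that(1)] by (simp add: field_simps)
    then have "(1 - t / g v) * (N t v / den t v 0) = - (1 / g v) * ((t - g v) * N t v / den t v 0)" by simp
    then show ?thesis using that den_g[OF that(1)] by (simp add: K_def h_def mult_ac)
  qed
  have est: "norm (width_poly n v * g v ^ n - K v (g v)) \<le> M / (1 - \<theta>) * \<theta> ^ Suc n" if v: "v \<in> ball 1 \<delta>" for n v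
  proof (rule simple_pole_coeffs[where R = R1 and r = R0 and s = "1/8" and f = "\<lambda>t. PP t v"])
    show "K v holomorphic_on ball 0 R1" unfolding K_def
      by (intro holomorphic_intros holomorphic_on_subset[OF holN[OF v]] holomorphic_on_subset[OF h_hol[OF v]])
         (use R1 h_nz[OF v] gR(2)[OF v] in auto)
    show "norm (K v t) \<le> M" if t: "norm t = R0" for t
    proof -
      have "t \<in> C"
      proof -
        have "\<epsilon>2 \<le> norm (z - t)" using norm_triangle_ineq2[of t z] t R0 z by (simp add: norm_minus_commute)
        then show ?thesis using t R0 by (simp add: C_def dist_norm)
      qed
      then have "m / 2 \<le> norm (den t v 0)" using den_C v_in[OF v] by simp
      moreover have "t \<noteq> g v" using gR(4)[OF v] t R0 by auto
      moreover have "norm (1 - t / g v) \<le> 1 + R0 / (rho / 2)"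
      proof -
        have "norm (1 - t / g v) \<le> 1 + norm (t / g v)" using norm_triangle_ineq4[of 1 "t / g v"] by simp
        also have "norm (t / g v) \<le> R0 / (rho / 2)" unfolding norm_divide t
          using gR(3)[OF v] rho(1) R0 by (intro divide_left_mono mult_pos_pos) auto
        finally show ?thesis by simp
      qed
      moreover have N_le: "norm (N t v) \<le> M0" using M0[of t v] t R0 R1 v_in(4)[OF v] by (simp add: D_def)
      moreover have "0 \<le> M0" using order_trans[OF norm_ge_zero N_le] .
      ultimately show ?thesis unfolding M_def K_alt[OF v \<open>t \<noteq> g v\<close>] norm_mult norm_divide
        using m R0 rho(1) by (intro mult_mono frac_le) (auto simp: norm_divide)
    qed
    show "norm (g v) \<le> \<theta> * R0" using gR(4)[OF v] \<theta>(3) by simp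
    fix t :: complex assume t: "norm t < 1/8"
    have v32: "norm v \<le> 3/2" using v_in(4)[OF v] RL(5) by simp
    show "(\<lambda>n. width_poly n v * t ^ n) sums PP t v" using small_disc(1)[of t v] t v32 by simp
    have d: "den t v 0 \<noteq> 0" using small_disc(2)[of t v] t v32 by simp
    then have "t \<noteq> g v" using den_g[OF v] by auto
    then show "(1 - t / g v) * PP t v = K v t"
      using d by (simp add: K_alt[OF v] N_def PP_def rat_def field_simps)
  qed (use R0 \<theta> gR(2)[OF v] in auto)
  have g1: "g 1 = z" using g(3)[OF z1] Vz by simp
  have one: "1 \<in> ball (1::complex) \<delta>" using \<delta> by simp
  have "K 1 (g 1) \<noteq> 0"
  proof -
    have "N z 1 = num z 1 0 * tail 0 z 1" using dz by (simp add: N_def)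
    moreover have "num z 1 0 \<noteq> 0"
      using num_0[OF rho(1,2)] num_0_pos[OF rho(1,2)] unfolding z_def by (metis of_real_eq_0_iff less_irrefl)
    moreover have "rf rho (Suc 0) < 1" using rf_strict[OF rho(1,2), of 0 "Suc 0"] rho(7) by simp
    then have "tail 0 z 1 \<noteq> 0" using tail_pos[OF rho(1,2), of 0] by (auto simp: z_def)
    ultimately show ?thesis using z(2) h_nz[OF one, of z] z(1) R1 by (simp add: K_def g1)
  qed
  moreover have "g holomorphic_on ball 1 \<delta>"
    by (rule holomorphic_on_subset[OF g(1)]) (use \<delta> \<delta>2(2) in force)
  moreover have "norm (g v) < tcrit \<and> g v \<noteq> 0 \<and> ee (g v) \<noteq> 0 \<and> 1 + ee (g v) \<noteq> 0 \<and> Vfun (g v) = v" if v: "v \<in> ball 1 \<delta>" for v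
    using gR[OF v] gv[OF v] nz[OF _ one_in, of "g v"] ball_sub R1 RL(6) by auto
  moreover have "\<delta> \<le> 1/2" using \<delta>(5) RL(5) by simp
  moreover have "norm (width_poly n v * g v ^ n - K v (g v)) \<le> (M / (1 - \<theta>) * \<theta>) * \<theta> ^ n" if "v \<in> ball 1 \<delta>" for v n
    using est[OF that, of n] by (simp add: mult_ac)
  ultimately show ?thesis using that[of \<delta> g \<theta> "\<lambda>v. K v (g v)" "M / (1 - \<theta>) * \<theta>"] \<delta>(1) \<theta> g1
    by (auto simp: z_def)
qed


section \<open>Derivatives of the moving pole\<close>

definition mean_const :: real where "mean_const = (1 + rho) / (2 * (1 + 3 * rho))"

definition var_const :: real where
  "var_const = 3 * rho * (1 + rho) * (385 - 1148 * rho ^ 2 - 494 * rho)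
                / (16 * (rho ^ 2 + rho - 1) * (3 * rho - 1) ^ 3 * (1 + 3 * rho) ^ 3)"

lemma zero_derivative:
  fixes f :: "complex \<Rightarrow> complex"
  assumes "\<And>v. v \<in> ball c d \<Longrightarrow> f v = 0" "w \<in> ball c d" "(f has_field_derivative D) (at w)"
  shows "D = 0"
proof -
  have "(f has_field_derivative 0) (at w)"
    by (rule has_field_derivative_transform_within_open[OF DERIV_const open_ball assms(2)]) (simp add: assms(1))
  then show ?thesis using assms(3) DERIV_unique by blast
qed

text \<open>Let \<open>\<rho>(v)\<close> be the moving pole and \<open>e(v) = E(\<rho>(v), 1)\<close>. The first four constants are
\<open>\<rho>'(1)\<close>, \<open>e'(1)\<close>, \<open>e''(1)\<close> and \<open>\<rho>''(1)\<close>, reduced to polynomials of degree 2 in \<open>\<rho>\<close> by the cubic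
equation. The other two are the values at 1 of the terms without second derivatives in the two
equations obtained by differentiating twice.\<close>

definition pole_deriv :: real where "pole_deriv = - (6 + 7 * rho + 4 * rho ^ 2) / 74"
definition exc_deriv :: real where "exc_deriv = (- 9 - 4 * rho + 6 * rho ^ 2) / 5"
definition exc_deriv2 :: real where "exc_deriv2 = (7788 + 3758 * rho - 5982 * rho ^ 2) / 925"
definition pole_deriv2 :: real where "pole_deriv2 = (- 31183 - 6478 * rho + 38362 * rho ^ 2) / 68450"
definition source1 :: real where "source1 = (334036 + 171976 * rho - 258704 * rho ^ 2) / 136900"
definition source2 :: real where "source2 = (- 160284 + 69856 * rho + 379176 * rho ^ 2) / 136900"

lemma real_identities:
  "2 * rho ^ 2 - 1 = (1 - 4 * rho ^ 2) * exc_deriv"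
  "(2 * rho ^ 2 - 1/2) * exc_deriv = - ((2 + 4 * rho - 6 * rho ^ 2) * pole_deriv)"
  "((4 - 12 * rho) * pole_deriv + (6 * rho + 1 - 3 * rho ^ 2) * exc_deriv) * pole_deriv + ((6 * rho + 1 - 3 * rho ^ 2) * pole_deriv + 2 * rho ^ 2 * exc_deriv) * exc_deriv = source1"
  "2 * (2 * (1 - 3 * rho ^ 2) * pole_deriv + 3 * rho * (1 - rho ^ 2) * exc_deriv) +
     ((4 - 12 * rho) * pole_deriv + (3 + 2 * rho - 9 * rho ^ 2) * exc_deriv) * pole_deriv + ((3 + 2 * rho - 9 * rho ^ 2) * pole_deriv + 2 * rho * (1 - rho ^ 2) * exc_deriv) * exc_deriv = source2"
  "source1 - source2 = (1 - 4 * rho ^ 2) * exc_deriv2"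
  "- source1 - (2 * rho ^ 2 - 1/2) * exc_deriv2 = (2 + 4 * rho - 6 * rho ^ 2) * pole_deriv2"
proof -
  note cub = rho_identities(1)
  have n: "74 * pole_deriv = - (6 + 7 * rho + 4 * rho ^ 2)" "5 * exc_deriv = - 9 - 4 * rho + 6 * rho ^ 2"
    "925 * exc_deriv2 = 7788 + 3758 * rho - 5982 * rho ^ 2" "68450 * pole_deriv2 = - 31183 - 6478 * rho + 38362 * rho ^ 2"
    "136900 * source1 = 334036 + 171976 * rho - 258704 * rho ^ 2" "136900 * source2 = - 160284 + 69856 * rho + 379176 * rho ^ 2"
    by (simp_all add: pole_deriv_def exc_deriv_def exc_deriv2_def pole_deriv2_def source1_def source2_def)
  define an where "an = - (6 + 7 * rho + 4 * rho ^ 2)"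
  define fn where "fn = - 9 - 4 * rho + 6 * rho ^ 2"
  have af: "pole_deriv = an / 74" "exc_deriv = fn / 5" by (simp_all add: pole_deriv_def exc_deriv_def an_def fn_def)
  have "(1 - 4 * rho ^ 2) * (- 9 - 4 * rho + 6 * rho ^ 2) = 5 * (2 * rho ^ 2 - 1)" using cub by algebra
  then show "2 * rho ^ 2 - 1 = (1 - 4 * rho ^ 2) * exc_deriv" by (simp add: exc_deriv_def)
  have "74 * ((2 * rho ^ 2 - 1/2) * (- 9 - 4 * rho + 6 * rho ^ 2)) = 5 * ((2 + 4 * rho - 6 * rho ^ 2) * (6 + 7 * rho + 4 * rho ^ 2))"
    using cub by algebra
  moreover have "74 * (X * p) = 5 * (Y * w) \<Longrightarrow> X * (p / 5) = - (Y * (- w / 74))" for X Y p w :: real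
    by (simp add: field_simps)
  ultimately show "(2 * rho ^ 2 - 1/2) * exc_deriv = - ((2 + 4 * rho - 6 * rho ^ 2) * pole_deriv)"
    unfolding exc_deriv_def pole_deriv_def by blast
  have quad: "(x * (an / 74) + y * (fn / 5)) * (an / 74) + (y * (an / 74) + w * (fn / 5)) * (fn / 5) = s"
    if "(x * an * 25 + y * fn * 370) * an + (y * an * 370 + w * fn * 5476) * fn = 136900 * s" for x y w s :: real
    using that by (simp add: field_simps)
  have quad': "2 * (x' * (an / 74) + w' * (fn / 5)) + (x * (an / 74) + y * (fn / 5)) * (an / 74) + (y * (an / 74) + w * (fn / 5)) * (fn / 5) = s"
    if "2 * (x' * an * 1850 + w' * fn * 27380) + (x * an * 25 + y * fn * 370) * an + (y * an * 370 + w * fn * 5476) * fn = 136900 * s"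
    for x y w x' w' s :: real
    using that by (simp add: field_simps)
  have "((4 - 12 * rho) * an * 25 + (6 * rho + 1 - 3 * rho ^ 2) * fn * 370) * an +
      ((6 * rho + 1 - 3 * rho ^ 2) * an * 370 + 2 * rho ^ 2 * fn * 5476) * fn = 136900 * source1"
    unfolding n an_def fn_def using cub by algebra
  then show "((4 - 12 * rho) * pole_deriv + (6 * rho + 1 - 3 * rho ^ 2) * exc_deriv) * pole_deriv + ((6 * rho + 1 - 3 * rho ^ 2) * pole_deriv + 2 * rho ^ 2 * exc_deriv) * exc_deriv = source1"
    unfolding af by (rule quad)
  have "2 * (2 * (1 - 3 * rho ^ 2) * an * 1850 + 3 * rho * (1 - rho ^ 2) * fn * 27380) +
     ((4 - 12 * rho) * an * 25 + (3 + 2 * rho - 9 * rho ^ 2) * fn * 370) * an +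
     ((3 + 2 * rho - 9 * rho ^ 2) * an * 370 + 2 * rho * (1 - rho ^ 2) * fn * 5476) * fn = 136900 * source2"
    unfolding n an_def fn_def using cub by algebra
  then show "2 * (2 * (1 - 3 * rho ^ 2) * pole_deriv + 3 * rho * (1 - rho ^ 2) * exc_deriv) +
     ((4 - 12 * rho) * pole_deriv + (3 + 2 * rho - 9 * rho ^ 2) * exc_deriv) * pole_deriv + ((3 + 2 * rho - 9 * rho ^ 2) * pole_deriv + 2 * rho * (1 - rho ^ 2) * exc_deriv) * exc_deriv = source2"
    unfolding af by (rule quad')
  have "334036 + 171976 * rho - 258704 * rho ^ 2 - (- 160284 + 69856 * rho + 379176 * rho ^ 2) =
      148 * ((1 - 4 * rho ^ 2) * (7788 + 3758 * rho - 5982 * rho ^ 2))" using cub by algebra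
  moreover have "p - w = 148 * (X * y) \<Longrightarrow> p / 136900 - w / 136900 = X * (y / 925)" for p w X y :: real
    by (simp add: field_simps)
  ultimately show "source1 - source2 = (1 - 4 * rho ^ 2) * exc_deriv2" unfolding source1_def source2_def exc_deriv2_def by blast
  have "- (334036 + 171976 * rho - 258704 * rho ^ 2) - 148 * ((2 * rho ^ 2 - 1/2) * (7788 + 3758 * rho - 5982 * rho ^ 2)) =
      2 * ((2 + 4 * rho - 6 * rho ^ 2) * (- 31183 - 6478 * rho + 38362 * rho ^ 2))" using cub by algebra
  moreover have "- p - 148 * (X * y) = 2 * (Y * w) \<Longrightarrow> - (p / 136900) - X * (y / 925) = Y * (w / 68450)" for p w X y Y :: real
    by (simp add: field_simps)
  ultimately show "- source1 - (2 * rho ^ 2 - 1/2) * exc_deriv2 = (2 + 4 * rho - 6 * rho ^ 2) * pole_deriv2"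
    unfolding source1_def exc_deriv2_def pole_deriv2_def by blast
qed

lemma reduced_coefficients:
  fixes z :: complex
  defines "z \<equiv> of_real rho"
  shows "2 + 4 * z - 6 * z ^ 2 = of_real (2 + 4 * rho - 6 * rho ^ 2)"
    "2 * z ^ 2 - (1 - z ^ 2) * (1 - z) = of_real (2 * rho ^ 2 - 1/2)"
    "3 * z * (1 - z ^ 2) - (1 - z ^ 2) = of_real (1/2 - 2 * rho ^ 2)"
    "2 * z * (1 - z ^ 2) = of_real (1 - 2 * rho ^ 2)"
proof -
  show "2 + 4 * z - 6 * z ^ 2 = of_real (2 + 4 * rho - 6 * rho ^ 2)" by (simp add: z_def)
  have h: "2 * rho ^ 2 - (1 - rho ^ 2) * (1 - rho) = 2 * rho ^ 2 - 1/2"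
    "3 * rho * (1 - rho ^ 2) - (1 - rho ^ 2) = 1/2 - 2 * rho ^ 2" "2 * rho * (1 - rho ^ 2) = 1 - 2 * rho ^ 2"
    using rho_identities(1) by (simp_all add: power_numeral_reduce algebra_simps)
  show "2 * z ^ 2 - (1 - z ^ 2) * (1 - z) = of_real (2 * rho ^ 2 - 1/2)"
    using arg_cong[OF h(1), of complex_of_real] by (simp add: z_def)
  show "3 * z * (1 - z ^ 2) - (1 - z ^ 2) = of_real (1/2 - 2 * rho ^ 2)"
    using arg_cong[OF h(2), of complex_of_real] by (simp add: z_def)
  show "2 * z * (1 - z ^ 2) = of_real (1 - 2 * rho ^ 2)"
    using arg_cong[OF h(3), of complex_of_real] by (simp add: z_def)
qed

text \<open>Implicit differentiation of the quadratic equation of \<open>e\<close> and of the equation \<open>v = Vfun (\<rho>(v))\<close>. Each order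
leads to a linear system for the derivatives of \<open>\<rho>(v)\<close> and \<open>e(v)\<close> with the same matrix, whose
determinant is nonzero by the bounds on \<open>\<rho>\<close>.\<close>

lemma moving_pole_derivs:
  fixes T e T' e' :: "complex \<Rightarrow> complex"
  assumes d: "0 < d"
    and eq1: "\<And>v. v \<in> ball 1 d \<Longrightarrow> T v ^ 2 * e v ^ 2 - (1 - T v ^ 2) * (1 - T v) * e v + T v * (1 - T v ^ 2) = 0"
    and eq2: "\<And>v. v \<in> ball 1 d \<Longrightarrow> v * (T v * (1 - T v ^ 2) * e v * (1 + e v)) - (1 - T v ^ 2) * e v + T v ^ 2 = 0"
    and T: "\<And>v. v \<in> ball 1 d \<Longrightarrow> (T has_field_derivative T' v) (at v)"
    and e: "\<And>v. v \<in> ball 1 d \<Longrightarrow> (e has_field_derivative e' v) (at v)"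
    and T2: "(T' has_field_derivative b) (at 1)" and e2: "(e' has_field_derivative c) (at 1)"
    and T1: "T 1 = of_real rho" and e1: "e 1 = 1"
  shows "T' 1 = of_real pole_deriv" and "b = of_real pole_deriv2"
proof -
  define z where "z = complex_of_real rho"
  have nz1: "complex_of_real (1 - 4 * rho ^ 2) \<noteq> 0"
    using rho_identities(3) by (metis less_irrefl of_real_eq_0_iff)
  have nz2: "complex_of_real (2 + 4 * rho - 6 * rho ^ 2) \<noteq> 0"
  proof -
    have "0 < 2 + 4 * rho - 6 * rho ^ 2" using rho_identities(4,5) rho(1) by simp
    then show ?thesis by (metis less_irrefl of_real_eq_0_iff)
  qed
  have one: "1 \<in> ball (1::complex) d" using d by simp
  define G1 where "G1 v = (2 * T v * e v ^ 2 + (1 + 2 * T v - 3 * T v ^ 2) * e v + 1 - 3 * T v ^ 2) * T' v +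
      (2 * T v ^ 2 * e v - (1 - T v ^ 2) * (1 - T v)) * e' v" for v
  define G2 where "G2 v = T v * (1 - T v ^ 2) * e v * (1 + e v) +
      (v * (1 - 3 * T v ^ 2) * e v * (1 + e v) + 2 * T v * e v + 2 * T v) * T' v +
      (v * T v * (1 - T v ^ 2) * (1 + 2 * e v) - (1 - T v ^ 2)) * e' v" for v
  have G1: "G1 v = 0" if v: "v \<in> ball 1 d" for v
  proof (rule zero_derivative[OF eq1 v])
    note dd = T[OF v] e[OF v]
    show "((\<lambda>v. T v ^ 2 * e v ^ 2 - (1 - T v ^ 2) * (1 - T v) * e v + T v * (1 - T v ^ 2)) has_field_derivative G1 v) (at v)"
      unfolding G1_def by (rule derivative_eq_intros dd refl)+ (simp add: power2_eq_square algebra_simps)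
  qed
  have G2: "G2 v = 0" if v: "v \<in> ball 1 d" for v
  proof (rule zero_derivative[OF eq2 v])
    note dd = T[OF v] e[OF v]
    show "((\<lambda>v. v * (T v * (1 - T v ^ 2) * e v * (1 + e v)) - (1 - T v ^ 2) * e v + T v ^ 2) has_field_derivative G2 v) (at v)"
      unfolding G2_def by (rule derivative_eq_intros dd refl)+ (simp add: power2_eq_square algebra_simps)
  qed
  define a where "a = T' 1"
  define f where "f = e' 1"
  note at1 = T1[folded z_def] e1 a_def[symmetric] f_def[symmetric]
  have A1: "(2 + 4 * z - 6 * z ^ 2) * a + (2 * z ^ 2 - (1 - z ^ 2) * (1 - z)) * f = 0"
    using G1[OF one] by (simp add: G1_def at1 algebra_simps)
  have A2: "2 * z * (1 - z ^ 2) + (2 + 4 * z - 6 * z ^ 2) * a + (3 * z * (1 - z ^ 2) - (1 - z ^ 2)) * f = 0"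
    using G2[OF one] by (simp add: G2_def at1 algebra_simps)
  note red = reduced_coefficients[folded z_def]
  have gap: "complex_of_real (1/2 - 2 * rho ^ 2) - of_real (2 * rho ^ 2 - 1/2) = of_real (1 - 4 * rho ^ 2)"
    by (simp flip: of_real_diff)
  have elim1: "D + A * y + C * x = 0 \<Longrightarrow> A * y + B * x = 0 \<Longrightarrow> (C - B) * x = - D" for A B C D x y :: complex
    by algebra
  have elim2: "D + A * y + B * x = 0 \<Longrightarrow> D' + A * y + C * x = 0 \<Longrightarrow> (C - B) * x = D - D'" for A B C D D' x y :: complex
    by algebra
  have elim3: "D + A * y + B * x = 0 \<Longrightarrow> A * y = - D - B * x" for A B D x y :: complex
    by algebra
  have f: "f = of_real exc_deriv"
  proof -
    have "of_real (1 - 4 * rho ^ 2) * f = - of_real (1 - 2 * rho ^ 2)"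
      using elim1[OF A2[unfolded red] A1[unfolded red]] unfolding gap .
    also have "\<dots> = of_real (2 * rho ^ 2 - 1)" by simp
    also have "\<dots> = of_real ((1 - 4 * rho ^ 2) * exc_deriv)" unfolding real_identities(1) ..
    finally show ?thesis using nz1 by simp
  qed
  have a: "a = of_real pole_deriv"
  proof -
    have "of_real (2 + 4 * rho - 6 * rho ^ 2) * a = - of_real ((2 * rho ^ 2 - 1 / 2) * exc_deriv)"
      using A1 unfolding red f by (simp add: eq_neg_iff_add_eq_0)
    also have "\<dots> = of_real ((2 + 4 * rho - 6 * rho ^ 2) * pole_deriv)" unfolding real_identities(2) by simp
    finally show ?thesis using nz2 by simp
  qed
  show "T' 1 = of_real pole_deriv" using a by (simp add: a_def)
  note dd = T[OF one] e[OF one] T2 e2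
  have "(G1 has_field_derivative
     (((4 - 12 * z) * a + (6 * z + 1 - 3 * z ^ 2) * f) * a + ((6 * z + 1 - 3 * z ^ 2) * a + 2 * z ^ 2 * f) * f) +
     (2 + 4 * z - 6 * z ^ 2) * b + (2 * z ^ 2 - (1 - z ^ 2) * (1 - z)) * c) (at 1)"
    unfolding G1_def[abs_def]
    by (rule derivative_eq_intros dd refl)+ (simp add: at1 power2_eq_square algebra_simps)
  from zero_derivative[OF G1 one this]
  have B1: "of_real source1 + of_real (2 + 4 * rho - 6 * rho ^ 2) * b + of_real (2 * rho ^ 2 - 1/2) * c = 0"
    unfolding red(1,2) a f by (simp add: z_def flip: real_identities(3))
  have "(G2 has_field_derivative
     (2 * (2 * (1 - 3 * z ^ 2) * a + 3 * z * (1 - z ^ 2) * f) +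
     ((4 - 12 * z) * a + (3 + 2 * z - 9 * z ^ 2) * f) * a + ((3 + 2 * z - 9 * z ^ 2) * a + 2 * z * (1 - z ^ 2) * f) * f) +
     (2 + 4 * z - 6 * z ^ 2) * b + (3 * z * (1 - z ^ 2) - (1 - z ^ 2)) * c) (at 1)"
    unfolding G2_def[abs_def]
    by (rule derivative_eq_intros dd refl)+ (simp add: at1 power2_eq_square algebra_simps)
  from zero_derivative[OF G2 one this]
  have B2: "of_real source2 + of_real (2 + 4 * rho - 6 * rho ^ 2) * b + of_real (1/2 - 2 * rho ^ 2) * c = 0"
    unfolding red(1,3) a f by (simp add: z_def flip: real_identities(4))
  have c: "c = of_real exc_deriv2"
  proof -
    have "of_real (1 - 4 * rho ^ 2) * c = of_real source1 - of_real source2" using elim2[OF B1 B2] unfolding gap .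
    also have "\<dots> = of_real (source1 - source2)" by simp
    also have "\<dots> = of_real ((1 - 4 * rho ^ 2) * exc_deriv2)" unfolding real_identities(5) ..
    finally show ?thesis using nz1 by simp
  qed
  have "of_real (2 + 4 * rho - 6 * rho ^ 2) * b = of_real (- source1 - (2 * rho ^ 2 - 1/2) * exc_deriv2)"
    using elim3[OF B1] unfolding c by simp
  also have "\<dots> = of_real ((2 + 4 * rho - 6 * rho ^ 2) * pole_deriv2)" unfolding real_identities(6) ..
  finally show "b = of_real pole_deriv2" using nz2 by simp
qed

lemma mean_const_alt: "pole_deriv = - mean_const * rho"
proof -
  have "74 * ((1 + rho) * rho) = (2 * (1 + 3 * rho)) * (6 + 7 * rho + 4 * rho ^ 2)"
    using rho_identities(1) by algebra
  moreover have "74 * (X * y) = Y * w \<Longrightarrow> Y \<noteq> 0 \<Longrightarrow> - w / 74 = - (X / Y) * y" for X Y y w :: real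
    by (simp add: field_simps)
  moreover have "2 * (1 + 3 * rho) \<noteq> 0" using rho(1) by simp
  ultimately show ?thesis unfolding pole_deriv_def mean_const_def by blast
qed

lemma var_const_alt: "136900 * var_const = 184863 + 85008 * rho - 154332 * rho ^ 2"
proof -
  have "136900 * (3 * rho * (1 + rho) * (385 - 1148 * rho ^ 2 - 494 * rho)) =
     (184863 + 85008 * rho - 154332 * rho ^ 2) * (16 * (rho ^ 2 + rho - 1) * (3 * rho - 1) ^ 3 * (1 + 3 * rho) ^ 3)"
    using rho_identities(1) by algebra
  moreover have "16 * (rho ^ 2 + rho - 1) * (3 * rho - 1) ^ 3 * (1 + 3 * rho) ^ 3 \<noteq> 0"
    using rho(5,6) rho_identities(2) by auto
  moreover have "136900 * X = y * Y \<Longrightarrow> Y \<noteq> 0 \<Longrightarrow> 136900 * (X / Y) = y" for X Y y :: real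
    by (simp add: field_simps)
  ultimately show ?thesis unfolding var_const_def by blast
qed

text \<open>The right-hand side is minus the sum of the first two derivatives of \<open>ln \<rho>(v)\<close> at 1.\<close>

lemma var_const_deriv: "var_const = (pole_deriv / rho) ^ 2 - pole_deriv2 / rho - pole_deriv / rho"
proof -
  have "25 * (6 + 7 * rho + 4 * rho ^ 2) ^ 2 - 2 * rho * (- 31183 - 6478 * rho + 38362 * rho ^ 2)
      + 1850 * rho * (6 + 7 * rho + 4 * rho ^ 2) = rho ^ 2 * (184863 + 85008 * rho - 154332 * rho ^ 2)"
    using rho_identities(1) by algebra
  note * = this
  have g: "25 * X ^ 2 - 2 * y * Y + 1850 * y * X = y ^ 2 * w \<Longrightarrow> y \<noteq> 0 \<Longrightarrow>
      w / 136900 = (- X / 74 / y) ^ 2 - Y / 68450 / y - - X / 74 / y" for X Y y w :: real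
    by (simp add: field_simps power2_eq_square)
  have "var_const = (184863 + 85008 * rho - 154332 * rho ^ 2) / 136900" using var_const_alt by simp
  also have "\<dots> = (pole_deriv / rho) ^ 2 - pole_deriv2 / rho - pole_deriv / rho"
    unfolding pole_deriv_def pole_deriv2_def by (rule g[OF *]) (use rho(1) in simp)
  finally show ?thesis .
qed

lemma const_bounds: "\<bar>mean_const - 0.31\<bar> < 0.01" "\<bar>var_const - 1.41\<bar> < 0.01" "0 < var_const" "0 < mean_const"
proof -
  show "\<bar>mean_const - 0.31\<bar> < 0.01" "0 < mean_const"
    using rho(5,6) by (auto simp: mean_const_def field_simps abs_less_iff)
  have r2: "0.16243 < rho ^ 2" "rho ^ 2 < 0.16244"
  proof -
    have "0.4030317 ^ 2 < rho ^ 2" using rho(5) by (intro power_strict_mono) auto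
    then show "0.16243 < rho ^ 2" by (simp add: power2_eq_square)
    have "rho ^ 2 < 0.4030318 ^ 2" using rho(1,6) by (intro power_strict_mono) auto
    then show "rho ^ 2 < 0.16244" by (simp add: power2_eq_square)
  qed
  have v: "var_const = (184863 + 85008 * rho - 154332 * rho ^ 2) / 136900" using var_const_alt by simp
  show "\<bar>var_const - 1.41\<bar> < 0.01" "0 < var_const"
    using r2 rho(5,6) unfolding v by (auto simp: field_simps abs_less_iff)
qed


section \<open>The quasi-powers theorem\<close>

text \<open>The Taylor coefficient of order two, read off by dividing out the zero at 0 once.\<close>

lemma holomorphic_second_order_zero:
  fixes f f' :: "complex \<Rightarrow> complex"
  assumes d: "0 < d" and f: "\<And>u. u \<in> ball 0 d \<Longrightarrow> (f has_field_derivative f' u) (at u)"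
    and f': "(f' has_field_derivative c) (at 0)" and z: "f 0 = 0" "f' 0 = 0"
  shows "((\<lambda>u. f u / u ^ 2) \<longlongrightarrow> c / 2) (at 0)"
proof -
  have holo: "f holomorphic_on ball 0 d"
    unfolding holomorphic_on_open[OF open_ball] using f by blast
  have d0: "deriv f 0 = 0" using DERIV_imp_deriv[OF f[of 0]] d z by simp
  define k where "k u = (if u = 0 then deriv f 0 else (f u - f 0) / (u - 0))" for u
  have k: "k holomorphic_on ball 0 d"
    using pole_lemma_open[OF holo open_ball, of 0] by (simp add: k_def[abs_def])
  have fk: "f u = u * k u" for u using z by (simp add: k_def)
  have kd: "(k has_field_derivative deriv k u) (at u)" if "u \<in> ball 0 d" for u
    using k that by (intro holomorphic_derivI) auto
  have kd2: "(deriv k has_field_derivative deriv (deriv k) u) (at u)" if "u \<in> ball 0 d" for u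
    using holomorphic_deriv[OF k open_ball] that by (intro holomorphic_derivI) auto
  have f'k: "f' u = k u + u * deriv k u" if u: "u \<in> ball 0 d" for u
  proof -
    have "(f has_field_derivative k u + u * deriv k u) (at u)"
      unfolding fk[abs_def] by (rule derivative_eq_intros kd[OF u] refl)+ (simp add: algebra_simps)
    with f[OF u] show ?thesis by (rule DERIV_unique)
  qed
  have 0: "0 \<in> ball (0 :: complex) d" using d by simp
  have "((\<lambda>u. k u + u * deriv k u) has_field_derivative 2 * deriv k 0) (at 0)"
    by (rule derivative_eq_intros kd[OF 0] kd2[OF 0] refl)+ simp
  then have "(f' has_field_derivative 2 * deriv k 0) (at 0)"
    by (rule has_field_derivative_transform_within_open[OF _ open_ball 0]) (simp add: f'k)
  with f' have c: "c = 2 * deriv k 0" by (rule DERIV_unique)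
  have "((\<lambda>u. (k u - k 0) / (u - 0)) \<longlongrightarrow> deriv k 0) (at 0)"
    using kd[OF 0] by (simp only: has_field_derivative_iff)
  moreover have "(k u - k 0) / (u - 0) = f u / u ^ 2" for u
  proof -
    have "k 0 = 0" using d0 by (simp add: k_def)
    then show ?thesis by (simp add: fk power2_eq_square)
  qed
  ultimately show ?thesis unfolding c by simp
qed

text \<open>Hwang's setting: the polynomials \<open>\<Sum>w\<in>A n. v ^ X w\<close> behave like \<open>lam v * T v powi (- n)\<close>, uniformly near
\<open>v = 1\<close>. The statistic \<open>Y\<close> takes natural numbers as values, but only on the sets \<open>A n\<close>.\<close>

locale quasi_power_family =
  fixes A :: "nat \<Rightarrow> 'a set" and X :: "'a \<Rightarrow> nat" and Y :: "'a \<Rightarrow> real"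
    and \<delta> \<rho> a b :: real and T lam :: "complex \<Rightarrow> complex"
  assumes finite_A: "\<And>n. finite (A n)" and Y_eq: "\<And>n w. w \<in> A n \<Longrightarrow> Y w = real (X w)"
    and delta: "0 < \<delta>" and T_holo: "T holomorphic_on ball 1 \<delta>"
    and T_nz: "\<And>v. v \<in> ball 1 \<delta> \<Longrightarrow> T v \<noteq> 0"
    and lim: "uniform_limit (ball 1 \<delta>) (\<lambda>n v. (\<Sum>w\<in>A n. v ^ X w) * T v ^ n) lam sequentially"
    and lam_1: "lam 1 \<noteq> 0" and rho_pos: "0 < \<rho>"
    and T_1: "T 1 = of_real \<rho>" and T_1': "deriv T 1 = of_real a" and T_1'': "deriv (deriv T) 1 = of_real b"
begin

text \<open>With \<open>g(u) = - ln (T (exp u))\<close> these are the first two derivatives of \<open>g\<close> at 0. If the \<open>n\<close>-th polynomial were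
exactly \<open>T v powi (- n)\<close>, then \<open>n * \<mu>\<close> and \<open>n * \<nu>\<close> would be the mean and the variance.\<close>

definition \<mu> :: real where "\<mu> = - a / \<rho>"
definition \<nu> :: real where "\<nu> = (a / \<rho>) ^ 2 - b / \<rho> - a / \<rho>"

definition P :: "nat \<Rightarrow> complex \<Rightarrow> complex" where "P n v = (\<Sum>w\<in>A n. v ^ X w)"
definition Q :: "nat \<Rightarrow> complex \<Rightarrow> complex" where "Q n v = P n v * T v ^ n"
definition P' :: "nat \<Rightarrow> complex \<Rightarrow> complex" where "P' n v = (\<Sum>w\<in>A n. of_nat (X w) * v ^ (X w - 1))"
definition R :: "complex \<Rightarrow> complex" where "R v = deriv T v / T v"
definition Q' :: "nat \<Rightarrow> complex \<Rightarrow> complex" where "Q' n v = (P' n v + of_nat n * R v * P n v) * T v ^ n"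

lemma one_in: "1 \<in> ball (1 :: complex) \<delta>" using delta by simp

lemma deriv_P: "(P n has_field_derivative P' n v) (at v)"
  unfolding P_def[abs_def] P'_def by (rule derivative_eq_intros refl)+ simp

lemma deriv_P': "(P' n has_field_derivative (\<Sum>w\<in>A n. of_nat (X w) * of_nat (X w - 1))) (at 1)"
  unfolding P'_def[abs_def] by (rule derivative_eq_intros refl)+ (simp add: mult.commute)

lemma deriv_T: "v \<in> ball 1 \<delta> \<Longrightarrow> (T has_field_derivative R v * T v) (at v)"
  using holomorphic_derivI[OF T_holo open_ball, of v UNIV] T_nz[of v] by (simp add: R_def)

lemma deriv_R: "(R has_field_derivative of_real (b / \<rho> - (a / \<rho>) ^ 2)) (at 1)"
proof -
  have T2: "(deriv T has_field_derivative deriv (deriv T) 1) (at 1)"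
    using holomorphic_derivI[OF holomorphic_deriv[OF T_holo open_ball] open_ball one_in] .
  have T1: "(T has_field_derivative deriv T 1) (at 1)"
    using holomorphic_derivI[OF T_holo open_ball one_in] .
  show ?thesis unfolding R_def[abs_def]
    by (rule derivative_eq_intros T1 T2 refl)+
      (use rho_pos in \<open>simp_all add: T_1 T_1' T_1'' power2_eq_square diff_divide_distrib\<close>)
qed

lemma R_1: "R 1 = of_real (- \<mu>)" by (simp add: R_def T_1 T_1' \<mu>_def)

lemma deriv_R_1: "of_real (b / \<rho> - (a / \<rho>) ^ 2) = of_real (\<mu> - \<nu>)"
  by (simp add: \<mu>_def \<nu>_def)

lemma deriv_Tn: "v \<in> ball 1 \<delta> \<Longrightarrow> ((\<lambda>v. T v ^ n) has_field_derivative of_nat n * R v * T v ^ n) (at v)"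
  by (rule derivative_eq_intros deriv_T refl | assumption)+ (cases n; simp)

lemma deriv_Q: "v \<in> ball 1 \<delta> \<Longrightarrow> (Q n has_field_derivative Q' n v) (at v)"
  unfolding Q_def[abs_def] Q'_def
  by (rule derivative_eq_intros deriv_P deriv_Tn refl | assumption)+ (simp add: algebra_simps)

definition N :: "nat \<Rightarrow> real" where "N n = real (card (A n))"
definition S1 :: "nat \<Rightarrow> real" where "S1 n = (\<Sum>w\<in>A n. real (X w))"
definition S2 :: "nat \<Rightarrow> real" where "S2 n = (\<Sum>w\<in>A n. real (X w) * real (X w - 1))"

lemma at_1: "P n 1 = of_real (N n)" "P' n 1 = of_real (S1 n)" "Q n 1 = of_real (N n * \<rho> ^ n)"
    "Q' n 1 = of_real ((S1 n - real n * \<mu> * N n) * \<rho> ^ n)"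
  by (simp_all add: P_def P'_def Q_def Q'_def N_def S1_def T_1 R_1)

lemma deriv_Q': "(Q' n has_field_derivative
    of_real ((S2 n + real n * (\<mu> - \<nu>) * N n - 2 * real n * \<mu> * S1 n + (real n * \<mu>) ^ 2 * N n) * \<rho> ^ n)) (at 1)"
proof -
  have S2: "(\<Sum>w\<in>A n. of_nat (X w) * of_nat (X w - 1)) = complex_of_real (S2 n)" by (simp add: S2_def)
  have "((\<lambda>v. P' n v + of_nat n * R v * P n v) has_field_derivative
      of_real (S2 n) + (of_nat n * of_real (\<mu> - \<nu>) * P n 1 + of_nat n * R 1 * P' n 1)) (at 1)"
    unfolding S2[symmetric] by (rule derivative_eq_intros deriv_P deriv_P' deriv_R[unfolded deriv_R_1] refl)+ simp
  from DERIV_mult[OF this deriv_Tn[OF one_in]] show ?thesis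
    unfolding Q'_def[abs_def] by (rule DERIV_cong) (simp add: at_1 T_1 R_1 power2_eq_square algebra_simps)
qed

lemma Q_holo: "Q n holomorphic_on ball 1 \<delta>"
  unfolding holomorphic_on_open[OF open_ball] using deriv_Q by blast

lemma Q_lim: "uniform_limit (ball 1 \<delta>) Q lam sequentially"
  using lim by (simp add: Q_def[abs_def] P_def)

lemma lam_holo: "lam holomorphic_on ball 1 \<delta>"
proof (rule holomorphic_uniform_sequence[OF open_ball Q_holo])
  fix x :: complex assume "x \<in> ball 1 \<delta>"
  then obtain d where "0 < d" "cball x d \<subseteq> ball 1 \<delta>" using open_contains_cball open_ball by blast
  then show "\<exists>d. 0 < d \<and> cball x d \<subseteq> ball 1 \<delta> \<and> uniform_limit (cball x d) Q lam sequentially"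
    using uniform_limit_on_subset[OF Q_lim] by blast
qed

text \<open>Locally uniform limits of holomorphic functions may be differentiated, so the derivatives at 1 converge
too. They contain the factorial moments.\<close>

lemma Q_limits: "(\<lambda>n. Q n 1) \<longlonglongrightarrow> lam 1" "(\<lambda>n. Q' n 1) \<longlonglongrightarrow> deriv lam 1"
    "(\<lambda>n. deriv (Q' n) 1) \<longlonglongrightarrow> deriv (deriv lam) 1"
proof -
  have *: "(\<lambda>n. (deriv ^^ m) (Q n) 1) \<longlonglongrightarrow> (deriv ^^ m) lam 1" for m
    by (rule higher_deriv_complex_uniform_limit[OF Q_lim _ _ open_ball one_in]) (simp_all add: Q_holo)
  have d: "deriv (Q n) v = Q' n v" if "v \<in> ball 1 \<delta>" for n v using deriv_Q[OF that] by (rule DERIV_imp_deriv)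
  have "\<forall>\<^sub>F v in nhds 1. deriv (Q n) v = Q' n v" for n
    using eventually_nhds_in_open[OF open_ball one_in] by eventually_elim (rule d)
  then have "deriv (deriv (Q n)) 1 = deriv (Q' n) 1" for n by (rule deriv_cong_ev) simp
  then show "(\<lambda>n. deriv (Q' n) 1) \<longlonglongrightarrow> deriv (deriv lam) 1" using *[of 2] by (simp add: numeral_2_eq_2)
  show "(\<lambda>n. Q n 1) \<longlonglongrightarrow> lam 1" using *[of 0] by simp
  show "(\<lambda>n. Q' n 1) \<longlonglongrightarrow> deriv lam 1" using *[of 1] d[OF one_in] by simp
qed

lemma lam_1_real: "lam 1 = of_real (Re (lam 1))" "0 < Re (lam 1)"
proof -
  have "(\<lambda>n. Im (Q n 1)) \<longlonglongrightarrow> Im (lam 1)" using Q_limits(1) by (rule tendsto_Im)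
  then have "Im (lam 1) = 0" unfolding at_1 by (simp add: tendsto_const_iff)
  then show r: "lam 1 = of_real (Re (lam 1))" by (simp add: complex_eq_iff)
  have "(\<lambda>n. Re (Q n 1)) \<longlonglongrightarrow> Re (lam 1)" using Q_limits(1) by (rule tendsto_Re)
  moreover have "0 \<le> Re (Q n 1)" for n unfolding at_1 using rho_pos by (simp add: N_def)
  ultimately have "0 \<le> Re (lam 1)" by (intro LIMSEQ_le_const[of "\<lambda>n. Re (Q n 1)"]) auto
  moreover have "Re (lam 1) \<noteq> 0" using lam_1 r by auto
  ultimately show "0 < Re (lam 1)" by simp
qed

lemma N_limit: "(\<lambda>n. N n * \<rho> ^ n) \<longlonglongrightarrow> Re (lam 1)"
  using tendsto_Re[OF Q_limits(1)] unfolding at_1 Re_complex_of_real .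

lemma N_asymp_equiv: "N \<sim>[at_top] (\<lambda>n. Re (lam 1) * (1 / \<rho>) ^ n)"
proof (rule asymp_equivI')
  have "(\<lambda>n. N n * \<rho> ^ n / Re (lam 1)) \<longlonglongrightarrow> Re (lam 1) / Re (lam 1)"
    using lam_1_real(2) by (intro tendsto_intros N_limit) simp
  then show "(\<lambda>n. N n / (Re (lam 1) * (1 / \<rho>) ^ n)) \<longlonglongrightarrow> 1"
    using lam_1_real(2) by (simp add: power_one_over field_simps)
qed

lemma N_pos: "\<forall>\<^sub>F n in sequentially. 0 < N n"
proof -
  have "\<forall>\<^sub>F n in sequentially. 0 < N n * \<rho> ^ n" using N_limit lam_1_real(2) by (rule order_tendstoD)
  then show ?thesis by eventually_elim (use rho_pos in \<open>simp add: zero_less_mult_iff\<close>)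
qed

lemma A_nonempty: "0 < N n \<Longrightarrow> A n \<noteq> {}" by (auto simp: N_def)

text \<open>The logarithmic derivatives of \<open>Q n\<close> at 1. Their limits are finite; hence the moments of \<open>Y\<close> agree with
those of the pure power \<open>T v powi (- n)\<close> up to bounded terms.\<close>

definition q1 :: "nat \<Rightarrow> real" where "q1 n = S1 n / N n - real n * \<mu>"
definition q2 :: "nat \<Rightarrow> real" where
  "q2 n = S2 n / N n + real n * (\<mu> - \<nu>) - 2 * real n * \<mu> * (S1 n / N n) + (real n * \<mu>) ^ 2"

lemma q_limits: obtains c1 c2 where "q1 \<longlonglongrightarrow> c1" "q2 \<longlonglongrightarrow> c2"
proof -
  have nz: "\<forall>\<^sub>F n in sequentially. N n \<noteq> 0" using N_pos by eventually_elim simp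
  have Q'': "deriv (Q' n) 1 = of_real ((S2 n + real n * (\<mu> - \<nu>) * N n - 2 * real n * \<mu> * S1 n + (real n * \<mu>) ^ 2 * N n) * \<rho> ^ n)" for n
    using deriv_Q' by (rule DERIV_imp_deriv)
  have l1: "(\<lambda>n. Re (Q' n 1) / (N n * \<rho> ^ n)) \<longlonglongrightarrow> Re (deriv lam 1) / Re (lam 1)"
    using lam_1_real(2) by (intro tendsto_intros N_limit Q_limits) simp
  have l2: "(\<lambda>n. Re (deriv (Q' n) 1) / (N n * \<rho> ^ n)) \<longlonglongrightarrow> Re (deriv (deriv lam) 1) / Re (lam 1)"
    using lam_1_real(2) by (intro tendsto_intros N_limit Q_limits) simp
  have "\<forall>\<^sub>F n in sequentially. Re (Q' n 1) / (N n * \<rho> ^ n) = q1 n"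
    using nz by eventually_elim (use rho_pos in \<open>simp add: at_1 q1_def field_simps\<close>)
  with l1 have 1: "q1 \<longlonglongrightarrow> Re (deriv lam 1) / Re (lam 1)" by (simp add: tendsto_cong)
  have "\<forall>\<^sub>F n in sequentially. Re (deriv (Q' n) 1) / (N n * \<rho> ^ n) = q2 n"
    using nz by eventually_elim (use rho_pos in \<open>simp add: Q'' q2_def field_simps\<close>)
  with l2 have "q2 \<longlonglongrightarrow> Re (deriv (deriv lam) 1) / Re (lam 1)" by (simp add: tendsto_cong)
  with 1 show ?thesis by (rule that)
qed

lemma integral_A:
  fixes f :: "'a \<Rightarrow> real"
  assumes "0 < N n"
  shows "measure_pmf.expectation (pmf_of_set (A n)) f = (\<Sum>w\<in>A n. f w) / N n"
  using integral_pmf_of_set[OF A_nonempty[OF assms] finite_A] by (simp add: N_def)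

lemma expectation_eq: "0 < N n \<Longrightarrow> measure_pmf.expectation (pmf_of_set (A n)) Y = q1 n + real n * \<mu>"
  by (simp add: integral_A q1_def S1_def Y_eq)

lemma variance_eq:
  assumes n: "0 < N n"
  shows "measure_pmf.variance (pmf_of_set (A n)) Y = q2 n + q1 n - q1 n ^ 2 + real n * \<nu>"
proof -
  define E where "E = S1 n / N n"
  have E: "measure_pmf.expectation (pmf_of_set (A n)) Y = E"
    using n by (simp add: expectation_eq q1_def E_def)
  have S1: "S1 n = E * N n" using n by (simp add: E_def)
  have sq: "real k * real (k - 1) + real k = real k ^ 2" for k by (cases k) (simp_all add: power2_eq_square algebra_simps)
  have "measure_pmf.variance (pmf_of_set (A n)) Y = (\<Sum>w\<in>A n. (Y w - E) ^ 2) / N n"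
    unfolding E by (rule integral_A[OF n])
  also have "(\<Sum>w\<in>A n. (Y w - E) ^ 2) = (\<Sum>w\<in>A n. real (X w) * real (X w - 1) + (1 - 2 * E) * real (X w) + E ^ 2)"
    by (intro sum.cong refl) (simp add: Y_eq power2_diff flip: sq, simp add: algebra_simps)
  also have "\<dots> = S2 n + (1 - 2 * E) * S1 n + N n * E ^ 2"
    by (simp add: sum.distrib S2_def S1_def N_def sum_distrib_left)
  also have "\<dots> / N n = S2 n / N n + E - E ^ 2"
    unfolding S1 using n by (simp add: field_simps power2_eq_square)
  also have "\<dots> = q2 n + q1 n - q1 n ^ 2 + real n * \<nu>"
    unfolding q2_def q1_def E_def[symmetric] by (simp add: power2_eq_square algebra_simps)
  finally show ?thesis .
qed

lemma asymp_equiv_linear: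
  fixes f g :: "nat \<Rightarrow> real"
  assumes "g \<longlonglongrightarrow> c" "\<forall>\<^sub>F n in sequentially. f n = g n + real n * m" "m \<noteq> 0"
  shows "f \<sim>[at_top] (\<lambda>n. m * real n)"
proof (rule asymp_equivI')
  have "(\<lambda>n. 1 + g n * inverse (real n) / m) \<longlonglongrightarrow> 1 + c * 0 / m"
    using assms(3) by (intro tendsto_intros assms lim_inverse_n)
  then have lim: "(\<lambda>n. 1 + g n * inverse (real n) / m) \<longlonglongrightarrow> 1" by simp
  have "\<forall>\<^sub>F n in sequentially. 1 + g n * inverse (real n) / m = f n / (m * real n)"
    using assms(2) eventually_gt_at_top[of 0]
    by eventually_elim (use assms(3) in \<open>simp add: field_simps\<close>)
  with lim show "(\<lambda>n. f n / (m * real n)) \<longlonglongrightarrow> 1" by (rule Lim_transform_eventually)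
qed

theorem expectation_asymp:
  "\<mu> \<noteq> 0 \<Longrightarrow> (\<lambda>n. measure_pmf.expectation (pmf_of_set (A n)) Y) \<sim>[at_top] (\<lambda>n. \<mu> * real n)"
proof (rule q_limits)
  fix c1 c2 assume "\<mu> \<noteq> 0" "q1 \<longlonglongrightarrow> c1"
  moreover have "\<forall>\<^sub>F n in sequentially. measure_pmf.expectation (pmf_of_set (A n)) Y = q1 n + real n * \<mu>"
    using N_pos by eventually_elim (rule expectation_eq)
  ultimately show ?thesis by (intro asymp_equiv_linear)
qed

theorem variance_asymp:
  "\<nu> \<noteq> 0 \<Longrightarrow> (\<lambda>n. measure_pmf.variance (pmf_of_set (A n)) Y) \<sim>[at_top] (\<lambda>n. \<nu> * real n)"
proof (rule q_limits)
  fix c1 c2 assume nz: "\<nu> \<noteq> 0" and q: "q1 \<longlonglongrightarrow> c1" "q2 \<longlonglongrightarrow> c2"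
  have "(\<lambda>n. q2 n + q1 n - q1 n ^ 2) \<longlonglongrightarrow> c2 + c1 - c1 ^ 2" by (intro tendsto_intros q)
  moreover have "\<forall>\<^sub>F n in sequentially. measure_pmf.variance (pmf_of_set (A n)) Y = (q2 n + q1 n - q1 n ^ 2) + real n * \<nu>"
    using N_pos by eventually_elim (rule variance_eq)
  ultimately show ?thesis using nz by (intro asymp_equiv_linear)
qed

text \<open>The factor that one power \<open>1 / T\<close> contributes to the centred characteristic function, normalised to 1 at
\<open>u = 0\<close>.\<close>

definition tilt :: "complex \<Rightarrow> complex" where "tilt u = exp (- of_real \<mu> * u) * T 1 / T (exp u)"

lemma T_1_nz: "T 1 \<noteq> 0" using T_nz one_in by blast

lemma deriv_tilt:
  assumes "exp u \<in> ball 1 \<delta>"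
  shows "(tilt has_field_derivative tilt u * (- of_real \<mu> - exp u * R (exp u))) (at u)"
proof -
  have T: "((\<lambda>u. T (exp u)) has_field_derivative R (exp u) * T (exp u) * exp u) (at u)"
    using DERIV_chain2[OF deriv_T[OF assms] DERIV_exp] .
  show ?thesis unfolding tilt_def[abs_def]
    by (rule derivative_eq_intros T refl)+ (use T_nz[OF assms] in \<open>simp_all add: field_simps\<close>)
qed

text \<open>Centring cancels the linear term of the logarithm; the quadratic one is \<open>\<nu> * u ^ 2 / 2\<close>.\<close>

lemma log_tilt:
  obtains d l where "0 < d" "\<And>u. u \<in> ball 0 d \<Longrightarrow> exp u \<in> ball 1 \<delta> \<and> exp (l u) = tilt u"
    "((\<lambda>u. l u / u ^ 2) \<longlongrightarrow> of_real \<nu> / 2) (at 0)"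
proof -
  define U where "U = exp -` ball (1 :: complex) \<delta>"
  have U: "open U" unfolding U_def by (intro open_vimage open_ball continuous_on_exp continuous_on_id)
  have cont: "continuous_on U tilt"
  proof (rule continuous_at_imp_continuous_on, rule ballI)
    fix u assume "u \<in> U"
    then show "isCont tilt u" by (intro DERIV_isCont[OF deriv_tilt]) (simp add: U_def)
  qed
  have t0: "tilt 0 = 1" using T_1_nz by (simp add: tilt_def)
  have "open (U \<inter> tilt -` ball 1 1)" using cont U open_ball by (rule continuous_open_preimage)
  moreover have "0 \<in> U \<inter> tilt -` ball 1 1" using delta t0 by (simp add: U_def)
  ultimately obtain d where d: "0 < d" "ball 0 d \<subseteq> U \<inter> tilt -` ball 1 1" by (rule openE)
  have in_ball: "exp u \<in> ball 1 \<delta>" "tilt u \<in> ball 1 1" if "u \<in> ball 0 d" for u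
    using d(2) that by (auto simp: U_def)
  have slit: "tilt u \<notin> \<real>\<^sub>\<le>\<^sub>0" if "u \<in> ball 0 d" for u
  proof
    assume "tilt u \<in> \<real>\<^sub>\<le>\<^sub>0"
    then obtain r where r: "tilt u = of_real r" "r \<le> 0" by (auto elim: nonpos_Reals_cases)
    have "1 - r = norm (complex_of_real (1 - r))" using r(2) by (simp only: norm_of_real)
    also have "\<dots> = dist 1 (tilt u)" unfolding r(1) by (simp add: dist_norm)
    also have "\<dots> < 1" using in_ball(2)[OF that] by simp
    finally show False using r(2) by simp
  qed
  define l where "l u = Ln (tilt u)" for u
  define l' where "l' u = - of_real \<mu> - exp u * R (exp u)" for u
  have nz: "tilt u \<noteq> 0" if "u \<in> ball 0 d" for u using slit[OF that] by auto
  have dl: "(l has_field_derivative l' u) (at u)" if u: "u \<in> ball 0 d" for u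
    unfolding l_def[abs_def] l'_def
    by (rule derivative_eq_intros deriv_tilt[OF in_ball(1)[OF u]] slit[OF u] refl)+
      (use nz[OF u] in \<open>simp add: field_simps\<close>)
  have R0: "(R has_field_derivative of_real (\<mu> - \<nu>)) (at (exp 0))" using deriv_R[unfolded deriv_R_1] by simp
  have "((\<lambda>u. R (exp u)) has_field_derivative of_real (\<mu> - \<nu>) * exp 0) (at 0)"
    using DERIV_chain2[OF R0 DERIV_exp] .
  then have dl': "(l' has_field_derivative of_real \<nu>) (at 0)"
    unfolding l'_def[abs_def] by - ((rule derivative_eq_intros refl | assumption)+, simp add: R_1)
  have "l 0 = 0" "l' 0 = 0" using t0 by (simp_all add: l_def l'_def R_1)
  from holomorphic_second_order_zero[OF d(1) dl dl' this]
  have "((\<lambda>u. l u / u ^ 2) \<longlongrightarrow> of_real \<nu> / 2) (at 0)" .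
  then show ?thesis using that[of d l] d(1) in_ball(1) nz by (simp add: l_def)
qed

lemma integral_A_complex:
  fixes f :: "'a \<Rightarrow> complex"
  assumes "0 < N n"
  shows "integral\<^sup>L (measure_pmf (pmf_of_set (A n))) f = (\<Sum>w\<in>A n. f w) / of_real (N n)"
proof -
  have "integral\<^sup>L (measure_pmf (pmf_of_set (A n))) f = (\<Sum>w\<in>A n. pmf (pmf_of_set (A n)) w *\<^sub>R f w)"
    using A_nonempty[OF assms] finite_A by (intro integral_measure_pmf) (auto simp: set_pmf_of_set)
  also have "\<dots> = (\<Sum>w\<in>A n. f w / of_real (N n))"
    using A_nonempty[OF assms] finite_A
    by (intro sum.cong refl) (simp add: pmf_of_set N_def scaleR_conv_of_real)
  finally show ?thesis by (simp add: sum_divide_distrib)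
qed

text \<open>With \<open>u\<^sub>n = \<i> * t / (sqrt \<nu> * sqrt n)\<close> the characteristic function at \<open>t\<close> is
\<open>Q n (exp u\<^sub>n) / Q n 1 * tilt u\<^sub>n ^ n\<close>. The quotient tends to 1 by uniform convergence, and the power to
\<open>exp (- t\<^sup>2 / 2)\<close> by the expansion of \<open>ln tilt\<close>. Levy's continuity theorem concludes.\<close>

theorem central_limit:
  assumes nu: "0 < \<nu>"
  shows "weak_conv_m (\<lambda>n. distr (measure_pmf (pmf_of_set (A n))) borel
      (\<lambda>w. (Y w - \<mu> * real n) / (sqrt \<nu> * sqrt (real n)))) std_normal_distribution"
proof (rule levy_continuity)
  define Z where "Z n w = (Y w - \<mu> * real n) / (sqrt \<nu> * sqrt (real n))" for n w
  define M where "M n = distr (measure_pmf (pmf_of_set (A n))) borel (Z n)" for n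
  have meas: "Z n \<in> borel_measurable (measure_pmf p)" for n p by simp
  show "real_distribution (distr (measure_pmf (pmf_of_set (A n))) borel (\<lambda>w. (Y w - \<mu> * real n) / (sqrt \<nu> * sqrt (real n))))" for n
    using prob_space.real_distribution_distr[OF prob_space_measure_pmf meas] unfolding Z_def .
  show "real_distribution std_normal_distribution" by (rule real_dist_normal_dist)
  have "(\<lambda>n. char (M n) t) \<longlonglongrightarrow> char std_normal_distribution t" for t
  proof (cases "t = 0")
    case True
    have "char (M n) 0 = 1" for n
      unfolding M_def by (rule real_distribution.char_zero[OF prob_space.real_distribution_distr[OF prob_space_measure_pmf meas]])
    moreover have "char std_normal_distribution 0 = 1"
      by (rule real_distribution.char_zero[OF real_dist_normal_dist])
    ultimately show ?thesis using True by simp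
  next
    case False
    obtain d l where d: "0 < d" and l: "\<And>u. u \<in> ball 0 d \<Longrightarrow> exp u \<in> ball 1 \<delta> \<and> exp (l u) = tilt u"
      and l_lim: "((\<lambda>u. l u / u ^ 2) \<longlongrightarrow> of_real \<nu> / 2) (at 0)" by (rule log_tilt) blast
    define r where "r n = t / (sqrt \<nu> * sqrt (real n))" for n
    define u where "u n = \<i> * of_real (r n)" for n
    have r_lim: "r \<longlonglongrightarrow> 0"
    proof -
      have "(\<lambda>n. t / sqrt \<nu> * sqrt (inverse (real n))) \<longlonglongrightarrow> t / sqrt \<nu> * sqrt 0"
        by (intro tendsto_intros lim_inverse_n)
      moreover have "t / sqrt \<nu> * sqrt (inverse (real n)) = r n" for n
        unfolding r_def real_sqrt_inverse divide_inverse by (simp add: mult_ac)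
      ultimately show ?thesis by (simp only: real_sqrt_zero mult_zero_right)
    qed
    have u_lim: "u \<longlonglongrightarrow> 0"
    proof -
      have "(\<lambda>n. \<i> * complex_of_real (r n)) \<longlonglongrightarrow> \<i> * of_real 0" by (intro tendsto_intros r_lim)
      then show ?thesis by (simp add: u_def[abs_def])
    qed
    have r_nz: "r n \<noteq> 0" if "0 < n" for n using that False nu by (simp add: r_def)
    have u_at: "filterlim u (at 0) sequentially"
    proof -
      have "\<forall>\<^sub>F n in sequentially. u n \<in> UNIV \<and> u n \<noteq> 0"
        using eventually_gt_at_top[of 0] by eventually_elim (simp add: u_def r_nz)
      with u_lim show ?thesis unfolding filterlim_at by blast
    qed
    have nu2: "of_nat n * u n ^ 2 = of_real (- (t ^ 2) / \<nu>)" if n: "0 < n" for n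
    proof -
      have "real n * r n ^ 2 = t ^ 2 / \<nu>" using n nu by (simp add: r_def power_divide power_mult_distrib)
      then have "complex_of_real (real n * r n ^ 2) = of_real (t ^ 2 / \<nu>)" by (simp only:)
      then show ?thesis by (simp add: u_def power_mult_distrib)
    qed
    have ev_ball: "\<forall>\<^sub>F n in sequentially. u n \<in> ball 0 d"
      using u_lim topological_tendstoD[of u 0 sequentially "ball 0 d"] d by simp
    have nl: "(\<lambda>n. of_nat n * l (u n)) \<longlonglongrightarrow> of_real (- (t ^ 2) / 2)"
    proof -
      have "(\<lambda>n. of_real (- (t ^ 2) / \<nu>) * (l (u n) / u n ^ 2)) \<longlonglongrightarrow> of_real (- (t ^ 2) / \<nu>) * (of_real \<nu> / 2)"
        by (intro tendsto_intros filterlim_compose[OF l_lim u_at])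
      also have "of_real (- (t ^ 2) / \<nu>) * (of_real \<nu> / 2) = complex_of_real (- (t ^ 2) / 2)" using nu by simp
      finally have *: "(\<lambda>n. of_real (- (t ^ 2) / \<nu>) * (l (u n) / u n ^ 2)) \<longlonglongrightarrow> complex_of_real (- (t ^ 2) / 2)" .
      have "\<forall>\<^sub>F n in sequentially. of_real (- (t ^ 2) / \<nu>) * (l (u n) / u n ^ 2) = of_nat n * l (u n)"
        using eventually_gt_at_top[of 0]
      proof eventually_elim
        case (elim n)
        have "u n \<noteq> 0" using r_nz[OF elim] by (simp add: u_def)
        then show ?case unfolding nu2[OF elim, symmetric] by simp
      qed
      with * show ?thesis by (rule Lim_transform_eventually)
    qed
    have exp_lim: "(\<lambda>n. exp (u n)) \<longlonglongrightarrow> 1" using tendsto_exp[OF u_lim] by simp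
    have Q_exp: "(\<lambda>n. Q n (exp (u n))) \<longlonglongrightarrow> lam 1"
    proof -
      have "(\<lambda>n. Q n (exp (u n)) - lam (exp (u n))) \<longlonglongrightarrow> 0"
      proof (rule tendstoI)
        fix e :: real assume "0 < e"
        with Q_lim have "\<forall>\<^sub>F n in sequentially. \<forall>v\<in>ball 1 \<delta>. dist (Q n v) (lam v) < e" by (rule uniform_limitD)
        with ev_ball show "\<forall>\<^sub>F n in sequentially. dist (Q n (exp (u n)) - lam (exp (u n))) 0 < e"
          by eventually_elim (use l in \<open>simp add: dist_norm\<close>)
      qed
      moreover have "(\<lambda>n. lam (exp (u n))) \<longlonglongrightarrow> lam 1"
      proof (rule isCont_tendsto_compose[OF _ exp_lim])
        show "isCont lam 1"
          using holomorphic_on_imp_continuous_on[OF lam_holo] one_in by (simp add: continuous_on_eq_continuous_at)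
      qed
      ultimately have "(\<lambda>n. (Q n (exp (u n)) - lam (exp (u n))) + lam (exp (u n))) \<longlonglongrightarrow> 0 + lam 1"
        by (rule tendsto_add)
      then show ?thesis by simp
    qed
    have main: "(\<lambda>n. Q n (exp (u n)) / Q n 1 * exp (of_nat n * l (u n))) \<longlonglongrightarrow> lam 1 / lam 1 * exp (of_real (- (t ^ 2) / 2))"
      by (intro tendsto_intros Q_exp Q_limits(1) lam_1 nl)
    have "\<forall>\<^sub>F n in sequentially. Q n (exp (u n)) / Q n 1 * exp (of_nat n * l (u n)) = char (M n) t"
      using N_pos ev_ball
    proof eventually_elim
      case (elim n)
      have b: "exp (u n) \<in> ball 1 \<delta>" "exp (l (u n)) = tilt (u n)" using l[OF elim(2)] by auto
      have "char (M n) t = integral\<^sup>L (measure_pmf (pmf_of_set (A n))) (\<lambda>w. exp (\<i> * of_real (t * Z n w)))"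
        unfolding char_def M_def by (subst integral_distr) (simp_all add: meas)
      also have "\<dots> = (\<Sum>w\<in>A n. exp (\<i> * of_real (t * Z n w))) / of_real (N n)"
        by (rule integral_A_complex[OF elim(1)])
      also have "(\<Sum>w\<in>A n. exp (\<i> * of_real (t * Z n w))) = (\<Sum>w\<in>A n. exp (- of_real \<mu> * u n) ^ n * exp (u n) ^ X w)"
      proof (rule sum.cong[OF refl])
        fix w assume w: "w \<in> A n"
        have "t * Z n w = real (X w) * r n + real n * (- \<mu> * r n)"
          by (simp add: Z_def r_def Y_eq[OF w] diff_divide_distrib algebra_simps)
        then have "\<i> * of_real (t * Z n w) = \<i> * of_real (real (X w) * r n + real n * (- \<mu> * r n))"
          by (simp only:)
        also have "\<dots> = of_nat n * (- of_real \<mu> * u n) + of_nat (X w) * u n"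
          by (simp add: u_def algebra_simps)
        finally show "exp (\<i> * of_real (t * Z n w)) = exp (- of_real \<mu> * u n) ^ n * exp (u n) ^ X w"
          by (simp only: exp_add exp_of_nat_mult)
      qed
      also have "\<dots> = exp (- of_real \<mu> * u n) ^ n * P n (exp (u n))"
        by (simp add: P_def sum_distrib_left)
      also have "\<dots> / of_real (N n) = Q n (exp (u n)) / Q n 1 * tilt (u n) ^ n"
        using T_nz[OF b(1)] T_1_nz elim(1)
        by (simp add: Q_def tilt_def at_1 power_divide power_mult_distrib field_simps)
      finally show ?case unfolding b(2)[symmetric] exp_of_nat_mult by (rule sym)
    qed
    with main have "(\<lambda>n. char (M n) t) \<longlonglongrightarrow> lam 1 / lam 1 * exp (of_real (- (t ^ 2) / 2))"
      by (rule Lim_transform_eventually)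
    also have "lam 1 / lam 1 * exp (of_real (- (t ^ 2) / 2)) = char std_normal_distribution t"
      unfolding char_std_normal_distribution exp_of_real using lam_1 by simp
    finally show ?thesis .
  qed
  then show "(\<lambda>n. char (distr (measure_pmf (pmf_of_set (A n))) borel (\<lambda>w. (Y w - \<mu> * real n) / (sqrt \<nu> * sqrt (real n)))) t)
      \<longlonglongrightarrow> char std_normal_distribution t" for t
    unfolding M_def Z_def .
qed

end


section \<open>Two-sided walks\<close>

text \<open>A step to the west cannot end at a rightmost point, so it ends, and hence also starts, at a topmost one;
for a step to the south the two edges are exchanged. Such steps therefore run along an edge.\<close>

lemma two_sided_imp_three_sided:
  assumes "two_sided w" shows "three_sided w"
proof -
  have pr: "prudent w" using assms by (simp add: two_sided_def)
  have corner: "(\<forall>j\<le>i. snd (vertex w j) \<le> snd (vertex w i)) \<or> (\<forall>j\<le>i. fst (vertex w j) \<le> fst (vertex w i))"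
    if i: "i \<le> length w" for i
  proof -
    define A where "A = trace w ` {0..real i}"
    have mem: "trace w (real i) \<in> A" unfolding A_def by (rule imageI) simp
    have "trace w (real i) \<in> top_edge A \<union> right_edge A"
      using assms i unfolding two_sided_def Let_def A_def by blast
    then have "(\<forall>a\<in>A. snd a \<le> snd (trace w (real i))) \<or> (\<forall>a\<in>A. fst a \<le> fst (trace w (real i)))"
      using bounding_box_edges(1,2)[of A "trace w (real i)"] bounded_trace mem by (auto simp: A_def)
    moreover have "trace w (real j) \<in> A" if "j \<le> i" for j unfolding A_def by (rule imageI) (use that in simp)
    ultimately show ?thesis by (metis trace_nat)
  qed
  have "i \<le> length w \<Longrightarrow> three_sided (take i w)" for i
  proof (induction i)
    case 0
    show ?case by (auto simp: three_sided_iff prudent_def at_border_def)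
  next
    case (Suc i)
    define u where "u = take i w"
    define d where "d = w ! i"
    have lt: "i < length w" and len: "length u = i" using Suc.prems by (auto simp: u_def)
    have take: "take (Suc i) w = u @ [d]" using lt by (simp add: u_def d_def take_Suc_conv_app_nth)
    have w: "w = u @ drop i w" by (simp add: u_def)
    have iv: "ivertex w j = ivertex u j" if "j \<le> i" for j
      using ivertex_append[of j u "drop i w"] that len w by simp
    have w': "w = (u @ [d]) @ drop (Suc i) w" using take by (metis append_take_drop_id)
    have iv': "ivertex w (Suc i) = endpoint (u @ [d])"
      using ivertex_append[of "Suc i" "u @ [d]" "drop (Suc i) w"] len w' by (simp add: endpoint_def)
    have c1: "on_top (visited u) (endpoint u) \<or> on_right (visited u) (endpoint u)"
      using corner[of i] lt len iv
      by (auto simp: on_top_def on_right_def visited_def endpoint_def vertex_eq real_point_def)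
    have c2: "(\<forall>p\<in>visited u. snd p \<le> snd (move (endpoint u) d)) \<or> (\<forall>p\<in>visited u. fst p \<le> fst (move (endpoint u) d))"
      using corner[of "Suc i"] Suc.prems len iv iv' endpoint_snoc[of u d]
      by (auto simp: visited_def vertex_eq real_point_def less_Suc_eq_le le_Suc_eq)
    have pu: "prudent (u @ [d])"
    proof -
      have "clear_ray (u @ [d]) j ((u @ [d]) ! j)" if j: "j \<le> i" for j
      proof -
        have "clear_ray w j (w ! j)" using pr j lt by (simp add: prudent_iff)
        moreover have "w ! j = (u @ [d]) ! j" using j len w' by (metis length_append_singleton less_Suc_eq_le nth_append)
        ultimately show ?thesis using clear_ray_append[of j "u @ [d]" "drop (Suc i) w"] j len w' by simp
      qed
      then show ?thesis using len by (simp add: prudent_iff less_Suc_eq_le)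
    qed
    have "border_step (visited u) (endpoint u) d"
      using c1 c2 endpoint_in_visited[of u]
      by (cases d) (auto simp: on_top_def on_right_def on_left_def move_def)
    then show ?case using Suc lt pu
      unfolding take three_sided_snoc prudent_snoc by (simp add: u_def)
  qed
  from this[of "length w"] show ?thesis by simp
qed

text \<open>A subfamily of the two-sided walks, large enough to have the same growth rate.  A walk of this
  family alternates between excursions along the right edge, below the corner, and excursions
  along the top edge, to its left.  State \<open>(c, l, d)\<close>: on the right (\<open>c\<close>) or the top edge, at distance
  \<open>d\<close> from the corner.\<close>

datatype side_move = Out | Back | Away

text \<open>The two edges are interchanged by the reflection in the diagonal; \<open>Back\<close> is a step towards the corner and
\<open>Away\<close> a step from it. A step past the corner continues as an outward step on the other edge.\<close>

fun after2 :: "bool \<times> side_move \<times> nat \<Rightarrow> dir \<Rightarrow> (bool \<times> side_move \<times> nat) option" where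
  "after2 (c, l, d) a =
    (if a = (if c then East else North) then Some (c, Out, d)
     else if a = (if c then North else East) \<and> l \<noteq> Away then
       (if d = 0 then Some (\<not> c, Out, 0) else Some (c, Back, d - 1))
     else if a = (if c then South else West) \<and> l \<noteq> Back then Some (c, Away, Suc d)
     else None)"

definition describes2 :: "(int \<times> int) set \<Rightarrow> int \<times> int \<Rightarrow> bool \<times> side_move \<times> nat \<Rightarrow> bool" where
  "describes2 V p st \<longleftrightarrow> (case st of (c, l, d) \<Rightarrow> p \<in> V \<and>
     (\<forall>u v. (u, v) \<in> V \<longrightarrow> (if c then u \<le> fst p \<and> v \<le> snd p + int d else v \<le> snd p \<and> u \<le> fst p + int d)) \<and>
     (\<forall>u v. (u, v) \<in> V \<longrightarrow> (if c then u = fst p \<longrightarrow> (l \<noteq> Away \<longrightarrow> v \<le> snd p) \<and> (l \<noteq> Back \<longrightarrow> v \<ge> snd p)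
         else v = snd p \<longrightarrow> (l \<noteq> Away \<longrightarrow> u \<le> fst p) \<and> (l \<noteq> Back \<longrightarrow> u \<ge> fst p))))"

lemma after2_correct:
  assumes "describes2 V p st" "after2 st a = Some st'"
  shows "prudent_step V p a \<and> describes2 (insert (move p a) V) (move p a) st'"
proof -
  obtain c l d where st: "st = (c, l, d)" by (cases st) auto
  obtain x y where p: "p = (x, y)" by (cases p)
  show ?thesis
  proof (cases c)
    case True
    have V: "u \<le> x \<and> v \<le> y + int d \<and> (u = x \<longrightarrow> (l \<noteq> Away \<longrightarrow> v \<le> y) \<and> (l \<noteq> Back \<longrightarrow> v \<ge> y))" if "(u, v) \<in> V" for u v
      using assms(1) that True by (auto simp: describes2_def st p)
    show ?thesis
    proof (cases a)
      case East
      then have "st' = (True, Out, d)" using assms(2) True by (simp add: st)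
      moreover have "prudent_step V p East" using p by (intro free) (auto dest!: V)
      ultimately show ?thesis using East p by (auto simp: describes2_def move_def dest!: V)
    next
      case North
      then have l: "l \<noteq> Away" and st': "st' = (if d = 0 then (False, Out, 0) else (True, Back, d - 1))"
        using assms(2) True by (auto simp: st split: if_splits)
      moreover have "prudent_step V p North" using p l by (intro free) (auto dest!: V)
      ultimately show ?thesis using North p by (cases "d = 0") (auto simp: describes2_def move_def dest!: V)
    next
      case South
      then have l: "l \<noteq> Back" and st': "st' = (True, Away, Suc d)"
        using assms(2) True by (auto simp: st split: if_splits)
      moreover have "prudent_step V p South" using p l by (intro free) (auto dest!: V)
      ultimately show ?thesis using South p by (auto simp: describes2_def move_def dest!: V)
    next
      case West
      then show ?thesis using assms(2) True by (simp add: st)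
    qed
  next
    case False
    have V: "v \<le> y \<and> u \<le> x + int d \<and> (v = y \<longrightarrow> (l \<noteq> Away \<longrightarrow> u \<le> x) \<and> (l \<noteq> Back \<longrightarrow> u \<ge> x))" if "(u, v) \<in> V" for u v
      using assms(1) that False by (auto simp: describes2_def st p)
    show ?thesis
    proof (cases a)
      case North
      then have "st' = (False, Out, d)" using assms(2) False by (simp add: st)
      moreover have "prudent_step V p North" using p by (intro free) (auto dest!: V)
      ultimately show ?thesis using North p by (auto simp: describes2_def move_def dest!: V)
    next
      case East
      then have l: "l \<noteq> Away" and st': "st' = (if d = 0 then (True, Out, 0) else (False, Back, d - 1))"
        using assms(2) False by (auto simp: st split: if_splits)
      moreover have "prudent_step V p East" using p l by (intro free) (auto dest!: V)
      ultimately show ?thesis using East p by (cases "d = 0") (auto simp: describes2_def move_def dest!: V)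
    next
      case West
      then have l: "l \<noteq> Back" and st': "st' = (False, Away, Suc d)"
        using assms(2) False by (auto simp: st split: if_splits)
      moreover have "prudent_step V p West" using p l by (intro free) (auto dest!: V)
      ultimately show ?thesis using West p by (auto simp: describes2_def move_def dest!: V)
    next
      case South
      then show ?thesis using assms(2) False by (simp add: st)
    qed
  qed
qed

fun run2 :: "bool \<times> side_move \<times> nat \<Rightarrow> dir list \<Rightarrow> (bool \<times> side_move \<times> nat) option" where
  "run2 st [] = Some st"
| "run2 st (a # w) = (case after2 st a of None \<Rightarrow> None | Some st' \<Rightarrow> run2 st' w)"

lemma run2_snoc: "run2 st (w @ [a]) = (case run2 st w of None \<Rightarrow> None | Some st' \<Rightarrow> after2 st' a)"
  by (induction w arbitrary: st) (auto split: option.splits simp del: after2.simps)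

lemma two_sided_iff:
  "two_sided w \<longleftrightarrow> prudent w \<and> (\<forall>i\<le>length w.
     (\<forall>j\<le>i. snd (ivertex w j) \<le> snd (ivertex w i)) \<or> (\<forall>j\<le>i. fst (ivertex w j) \<le> fst (ivertex w i)))"
proof -
  have "(trace w (real i) \<in> top_edge (trace w ` {0..real i}) \<union> right_edge (trace w ` {0..real i})) \<longleftrightarrow>
      (\<forall>j\<le>i. snd (ivertex w j) \<le> snd (ivertex w i)) \<or> (\<forall>j\<le>i. fst (ivertex w j) \<le> fst (ivertex w i))" for i
  proof -
    have lin: "linear (snd :: real \<times> real \<Rightarrow> real)" "linear (fst :: real \<times> real \<Rightarrow> real)" by (auto intro!: linearI)
    have mem: "trace w (real i) \<in> trace w ` {0..real i}" by (rule imageI) simp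
    show ?thesis
      using trace_le_iff[OF lin(1), of i w "snd (vertex w i)"] trace_le_iff[OF lin(2), of i w "fst (vertex w i)"]
      by (simp only: Un_iff bounding_box_edges[OF bounded_trace mem] ball_simps) (simp add: vertex_eq real_point_def)
  qed
  then show ?thesis by (simp add: two_sided_def Let_def)
qed

lemma run2_correct:
  "run2 (True, Out, 0) w = Some st \<Longrightarrow> two_sided w \<and> describes2 (visited w) (endpoint w) st"
proof (induction w arbitrary: st rule: rev_induct)
  case Nil
  then show ?case by (auto simp: two_sided_iff prudent_iff describes2_def visited_def endpoint_def ivertex_def)
next
  case (snoc a w)
  then obtain st1 where st1: "run2 (True, Out, 0) w = Some st1" "after2 st1 a = Some st"
    by (auto simp: run2_snoc simp del: after2.simps split: option.splits)
  have IH: "two_sided w" "describes2 (visited w) (endpoint w) st1" using snoc.IH[OF st1(1)] by auto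
  have step: "prudent_step (visited w) (endpoint w) a" "describes2 (visited (w @ [a])) (endpoint (w @ [a])) st"
    using after2_correct[OF IH(2) st1(2)] by (simp_all add: visited_snoc endpoint_snoc)
  have edge: "(\<forall>q\<in>visited (w @ [a]). snd q \<le> snd (endpoint (w @ [a]))) \<or> (\<forall>q\<in>visited (w @ [a]). fst q \<le> fst (endpoint (w @ [a])))"
  proof -
    obtain c l d where st: "st = (c, l, d)" by (cases st) auto
    show ?thesis using step(2) unfolding st describes2_def by (cases c) auto
  qed
  have "two_sided (w @ [a])" unfolding two_sided_iff
  proof (intro conjI allI impI)
    show "prudent (w @ [a])" using IH(1) step(1) by (simp add: prudent_snoc two_sided_def)
    fix i assume i: "i \<le> length (w @ [a])"
    show "(\<forall>j\<le>i. snd (ivertex (w @ [a]) j) \<le> snd (ivertex (w @ [a]) i)) \<or> (\<forall>j\<le>i. fst (ivertex (w @ [a]) j) \<le> fst (ivertex (w @ [a]) i))"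
    proof (cases "i \<le> length w")
      case True
      then show ?thesis using IH(1) by (simp add: two_sided_iff ivertex_append)
    next
      case False
      then have "i = length (w @ [a])" using i by simp
      then show ?thesis using edge by (simp only:) (auto simp: visited_def endpoint_def)
    qed
  qed
  then show ?case using step(2) by simp
qed

fun cont2 :: "nat \<Rightarrow> bool \<times> side_move \<times> nat \<Rightarrow> real" where
  "cont2 0 st = 1"
| "cont2 (Suc n) st = (\<Sum>a\<in>UNIV. case after2 st a of None \<Rightarrow> 0 | Some st' \<Rightarrow> cont2 n st')"

lemma cont2_card: "cont2 n st = real (card {w. length w = n \<and> run2 st w \<noteq> None})"
proof (induction n arbitrary: st)
  case 0
  have "{w :: dir list. length w = 0 \<and> run2 st w \<noteq> None} = {[]}" by (cases st) auto
  then show ?case by simp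
next
  case (Suc n)
  define S where "S st' = {w. length w = n \<and> run2 st' w \<noteq> None}" for st'
  define X where "X a = (case after2 st a of None \<Rightarrow> {} | Some st' \<Rightarrow> (#) a ` S st')" for a
  have fin: "finite (S st')" for st'
    unfolding S_def by (rule finite_subset[OF _ finite_lists_length_eq[of "UNIV :: dir set" n]]) auto
  have finX: "finite (X a)" for a
    by (cases "after2 st a") (simp_all only: X_def option.case finite.emptyI finite_imageI fin)
  have "w \<in> {w. length w = Suc n \<and> run2 st w \<noteq> None} \<longleftrightarrow> w \<in> (\<Union>a\<in>UNIV. X a)" for w
  proof (cases w)
    case Nil
    have "[] \<notin> X a" for a by (cases "after2 st a") (auto simp only: X_def option.case)
    then show ?thesis unfolding Nil by simp
  next
    case (Cons a w')
    have iff: "a # w' \<in> X a' \<longleftrightarrow> a' = a \<and> (\<exists>st'. after2 st a = Some st' \<and> w' \<in> S st')" for a'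
      by (cases "after2 st a'") (auto simp only: X_def option.case)
    show ?thesis unfolding Cons UN_iff iff by (cases "after2 st a") (simp_all add: S_def)
  qed
  then have "{w. length w = Suc n \<and> run2 st w \<noteq> None} = (\<Union>a\<in>UNIV. X a)" by blast
  moreover have "X a \<inter> X a' = {}" if "a \<noteq> a'" for a a'
    using that by (cases "after2 st a"; cases "after2 st a'") (auto simp only: X_def option.case)
  ultimately have "card {w. length w = Suc n \<and> run2 st w \<noteq> None} = (\<Sum>a\<in>UNIV. card (X a))"
    using card_UN_disjoint[of UNIV X] finX by (simp add: UNIV_dir)
  moreover have "real (card (X a)) = (case after2 st a of None \<Rightarrow> 0 | Some st' \<Rightarrow> cont2 n st')" for a
    by (cases "after2 st a") (simp_all only: X_def option.case Suc.IH flip: S_def, simp_all add: card_image)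
  ultimately show ?case by simp
qed

lemma cont2_le: "cont2 n (True, Out, 0) \<le> real (card (two_sided_walks n))"
proof -
  have "finite (two_sided_walks n)"
    by (rule finite_subset[OF _ finite_lists_length_eq[of "UNIV :: dir set" n]]) (auto simp: two_sided_walks_def)
  moreover have "{w. length w = n \<and> run2 (True, Out, 0) w \<noteq> None} \<subseteq> two_sided_walks n"
    using run2_correct by (auto simp: two_sided_walks_def)
  ultimately show ?thesis unfolding cont2_card by (simp add: card_mono)
qed

lemma cont2_nonneg: "0 \<le> cont2 n st" by (simp add: cont2_card)

lemma cont2_steps:
  "cont2 (Suc n) (c, Out, d) = cont2 n (c, Out, d) + cont2 n (c, Away, Suc d) +
      (if d = 0 then cont2 n (\<not> c, Out, 0) else cont2 n (c, Back, d - 1))"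
  "cont2 (Suc n) (c, Away, d) = cont2 n (c, Out, d) + cont2 n (c, Away, Suc d)"
  "cont2 (Suc n) (c, Back, d) = cont2 n (c, Out, d) +
      (if d = 0 then cont2 n (\<not> c, Out, 0) else cont2 n (c, Back, d - 1))"
  by (cases c; simp add: UNIV_dir)+

lemma cont2_sym: "cont2 n (c, l, d) = cont2 n (True, l, d)"
proof (induction n arbitrary: c l d)
  case (Suc n)
  have IH: "cont2 n (False, l, d) = cont2 n (True, l, d)" for l d by (rule Suc.IH)
  show ?case
    by (cases c; cases l) (simp_all add: cont2_steps IH del: cont2.simps)
qed simp

text \<open>If the series converged at \<open>x\<close>, its value \<open>K\<close> at the corner would bound all partial sums. Let \<open>A = E(x, 1)\<close>. A
walk starting at the corner either never passes it again or makes an excursion, counted by \<open>A\<close> with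
the step past the corner, after which it is in the same situation on the other edge. So \<open>K \<ge> 1 + A * K\<close>,
which is impossible for \<open>A \<ge> 1\<close>. To avoid decomposing walks, this is carried out on the equations:
the partial sums at the corner eventually exceed \<open>\<kappa> = K - 1/2\<close>, and then the partial sums in all
states stay above \<open>\<kappa>\<close> times the homogeneous solution with boundary value 1, up to an error that a
positive solution of the inhomogeneous equations makes tend to 0 geometrically. This gives
\<open>K \<ge> 1 + \<kappa> * A\<close>.\<close>

lemma cont2_diverges:
  assumes x0: "0 < x" and x1': "x < tcrit" and e: "1 \<le> eer x"
  shows "\<not> summable (\<lambda>n. cont2 n (True, Out, 0) * x ^ n)"
proof
  assume summ: "summable (\<lambda>n. cont2 n (True, Out, 0) * x ^ n)"
  have x: "0 < x" "0 < x" "x < tcrit" using x0 x1' by auto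
  define r where "r N l d = (\<Sum>n<N. cont2 n (True, l, d) * x ^ n)" for N l d
  define K where "K = (\<Sum>n. cont2 n (True, Out, 0) * x ^ n)"
  have r_le: "r N Out 0 \<le> K" for N
    unfolding r_def K_def using summ x cont2_nonneg by (intro sum_le_suminf) auto
  have r_lim: "(\<lambda>N. r N Out 0) \<longlonglongrightarrow> K" unfolding r_def K_def using summ by (rule summable_LIMSEQ)
  have K1: "1 \<le> K" using r_le[of 1] by (simp add: r_def)
  have r_nonneg: "0 \<le> r N l d" for N l d unfolding r_def using cont2_nonneg x by (intro sum_nonneg) auto
  define up where "up N d = (if d = 0 then r N Out 0 else r N Back (d - 1))" for N d
  have shift: "r (Suc N) l d = 1 + x * (\<Sum>n<N. cont2 (Suc n) (True, l, d) * x ^ n)" for N l d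
    unfolding r_def by (subst sum.lessThan_Suc_shift) (simp add: sum_distrib_left mult_ac del: cont2.simps(2))
  have up_sum: "up N d = (\<Sum>n<N. (if d = 0 then cont2 n (\<not> True, Out, 0) else cont2 n (True, Back, d - 1)) * x ^ n)" for N d
    using cont2_sym[of _ "\<not> True" Out 0] by (simp add: up_def r_def)
  have rO: "r (Suc N) Out d = 1 + x * (r N Out d + r N Away (Suc d) + up N d)" for N d
    unfolding shift up_sum cont2_steps unfolding r_def by (simp add: sum.distrib distrib_right)
  have rA: "r (Suc N) Away d = 1 + x * (r N Out d + r N Away (Suc d))" for N d
    unfolding shift cont2_steps unfolding r_def by (simp add: sum.distrib distrib_right)
  have rB: "r (Suc N) Back d = 1 + x * (r N Out d + up N d)" for N d
    unfolding shift up_sum cont2_steps unfolding r_def by (simp add: sum.distrib distrib_right)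
  \<comment> \<open>the homogeneous solution that is geometric in the distance to the corner\<close>
  define A where "A = eer x"
  define y where "y = qqr x"
  define B where "B = x * A / (1 - x * y)"
  have y: "0 < y" "y < 1" using qqr_pos[OF x(2,3)] by (auto simp: y_def)
  have xy: "x * y < 1" using rq_lt(1)[OF gx[OF x(2,3)]] by (simp add: y_def)
  have hy: "y = x * (A + 1)" by (simp add: y_def A_def qqr_def algebra_simps)
  have hB: "B = x * (A + B * y)" using xy by (simp add: B_def field_simps)
  have quad: "x ^ 2 * A ^ 2 - (1 - x ^ 2) * (1 - x) * A + x * (1 - x ^ 2) = 0"
  proof -
    have "of_real x ^ 2 * ee (of_real x) ^ 2 - (1 - of_real x ^ 2) * (1 - of_real x) * ee (of_real x) + of_real x * (1 - of_real x ^ 2) = 0"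
      using exc_eq[OF gx[OF x(2,3)], of "of_real x" 1] x(2) by (simp add: ee_def)
    then have "complex_of_real (x ^ 2 * A ^ 2 - (1 - x ^ 2) * (1 - x) * A + x * (1 - x ^ 2)) = 0"
      using of_real_values(1)[OF x(2,3)] by (simp add: A_def)
    then show ?thesis unfolding of_real_eq_0_iff .
  qed
  have hA: "A = x * (A + B * y + 1)"
  proof -
    have "A * (1 - x * y) = x * ((A + 1) * (1 - x * y) + x * A * y)" using quad unfolding hy by algebra
    also have "\<dots> = x * (A + B * y + 1) * (1 - x * y)" using xy by (simp add: B_def field_simps)
    finally show ?thesis using xy by simp
  qed
  \<comment> \<open>a positive solution of the inhomogeneous equations; it controls the error\<close>
  define sO where "sO = (1 + x) / (1 - 2 * x - x ^ 2)"
  define sA where "sA = (1 + x * sO) / (1 - x)"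
  have dpos: "0 < 1 - 2 * x - x ^ 2" using r_sq[OF gx[OF x(2,3)]] by simp
  have x1: "x < 1" using x tcrit by simp
  have sO0: "0 < sO" using dpos x by (simp add: sO_def)
  have sA: "sA = 1 + x * (sO + sA)" using x1 by (simp add: sA_def field_simps)
  have sO: "sO = 1 + x * (sO + sA + sA)"
  proof -
    have "sO * (1 - 2 * x - x ^ 2) = 1 + x" using dpos by (simp add: sO_def)
    moreover have "sA * (1 - x) = 1 + x * sO" using x1 by (simp add: sA_def)
    ultimately have "(1 - x) * sO = (1 - x) * (1 + x * (sO + sA + sA))" by algebra
    then show ?thesis using x1 by simp
  qed
  have sA0: "0 < sA" using sO0 x x1 by (simp add: sA_def add_pos_nonneg)
  have s1: "1 \<le> sO" "1 \<le> sA" "sA \<le> sO"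
  proof -
    have "0 \<le> x * (sO + sA)" "0 \<le> x * (sO + sA + sA)" using sA0 sO0 x by simp_all
    then show "1 \<le> sA" "1 \<le> sO" using sA sO by linarith+
    have "sO - sA = x * sA" using sO sA by algebra
    moreover have "0 \<le> x * sA" using sA0 x by simp
    ultimately show "sA \<le> sO" by linarith
  qed
  define \<beta> where "\<beta> = 1 - 1 / sO"
  have \<beta>: "0 \<le> \<beta>" "\<beta> < 1" using s1 by (auto simp: \<beta>_def)
  have \<beta>s: "sO - 1 \<le> \<beta> * sO" "sA - 1 \<le> \<beta> * sA"
  proof -
    show "sO - 1 \<le> \<beta> * sO" using sO0 by (simp add: \<beta>_def algebra_simps)
    have "sA / sO \<le> 1" using s1 sO0 by simp
    then show "sA - 1 \<le> \<beta> * sA" by (simp add: \<beta>_def algebra_simps)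
  qed
  define \<kappa> where "\<kappa> = K - 1/2"
  have \<kappa>: "0 \<le> \<kappa>" using K1 by (simp add: \<kappa>_def)
  have "\<forall>\<^sub>F N in sequentially. \<kappa> < r N Out 0" using r_lim by (rule order_tendstoD) (simp add: \<kappa>_def)
  then obtain N0 where N0: "\<And>N. N \<ge> N0 \<Longrightarrow> \<kappa> \<le> r N Out 0" by (auto simp: eventually_sequentially intro: less_imp_le)
  define H where "H = max 1 (max A B)"
  have A0: "0 \<le> A" using e by (simp add: A_def)
  have B0: "0 \<le> B" using A0 xy x by (simp add: B_def)
  define c where "c = \<kappa> * H"
  have c0: "0 \<le> c" using \<kappa> by (simp add: c_def H_def)
  have hbound: "z * y ^ d \<le> H" if "z \<le> H" "0 \<le> z" for z d
  proof -
    have "z * y ^ d \<le> z * 1" using y that by (intro mult_left_mono power_le_one) auto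
    then show ?thesis using that by simp
  qed
  have main: "- c * \<beta> ^ j * sO \<le> r (N0 + j) Out d - \<kappa> * (A * y ^ d) \<and>
      - c * \<beta> ^ j * sA \<le> r (N0 + j) Away d - \<kappa> * (B * y ^ d) \<and>
      - c * \<beta> ^ j * sA \<le> r (N0 + j) Back d - \<kappa> * (1 * y ^ Suc d)" for j d
  proof (induction j arbitrary: d)
    case 0
    have g: "- c * s \<le> r N0 l d - \<kappa> * (z * y ^ k)" if "1 \<le> s" "z \<le> H" "0 \<le> z" for s l z k
    proof -
      have "\<kappa> * (z * y ^ k) \<le> \<kappa> * H" using hbound[OF that(2,3)] \<kappa> by (intro mult_left_mono)
      also have "\<dots> \<le> c * s" using c0 that(1) mult_left_mono[of 1 s c] by (simp add: c_def)
      finally show ?thesis using r_nonneg[of N0 l d] by simp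
    qed
    show ?case using g[of sO A Out d] g[of sA B Away d] g[of sA 1 Back "Suc d"] s1 A0 B0 by (simp add: H_def)
  next
    case (Suc j)
    define b where "b = c * \<beta> ^ j"
    have b0: "0 \<le> b" using c0 \<beta> by (simp add: b_def)
    have IH: "- b * sO \<le> r (N0 + j) Out d - \<kappa> * (A * y ^ d)" "- b * sA \<le> r (N0 + j) Away d - \<kappa> * (B * y ^ d)"
      "- b * sA \<le> r (N0 + j) Back d - \<kappa> * (y ^ Suc d)" for d
      using Suc.IH[of d] by (simp_all add: b_def)
    have IHup: "- b * sA \<le> up (N0 + j) d - \<kappa> * y ^ d" for d
    proof (cases d)
      case 0
      have "0 \<le> up (N0 + j) 0 - \<kappa>" using N0[of "N0 + j"] by (simp add: up_def)
      moreover have "- b * sA \<le> 0" using b0 sA0 by simp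
      ultimately show ?thesis using 0 by simp
    next
      case (Suc k)
      then show ?thesis using IH(3)[of k] by (simp add: up_def)
    qed
    have step: "- c * \<beta> ^ Suc j * s \<le> R - \<kappa> * h"
      if "R = 1 + x * Q" "h = x * g" "- b * u \<le> Q - \<kappa> * g" "s = 1 + x * u" "s - 1 \<le> \<beta> * s" for R Q h g u s
    proof -
      have "x * (- b * u) \<le> x * (Q - \<kappa> * g)" using that(3) x by (intro mult_left_mono) auto
      moreover have "x * (- b * u) = - b * (s - 1)" using that(4) by simp
      moreover have "b * (s - 1) \<le> b * (\<beta> * s)" using b0 that(5) by (intro mult_left_mono)
      ultimately show ?thesis unfolding that(1,2) by (simp add: b_def algebra_simps)
    qed
    have O': "- c * \<beta> ^ Suc j * sO \<le> r (Suc (N0 + j)) Out d - \<kappa> * (A * y ^ d)"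
    proof (rule step[OF rO _ _ _ \<beta>s(1)])
      show "A * y ^ d = x * (A * y ^ d + B * y ^ Suc d + y ^ d)" by (subst hA) (simp add: algebra_simps)
      show "- b * (sO + sA + sA) \<le> r (N0 + j) Out d + r (N0 + j) Away (Suc d) + up (N0 + j) d - \<kappa> * (A * y ^ d + B * y ^ Suc d + y ^ d)"
        using IH(1)[of d] IH(2)[of "Suc d"] IHup[of d] by (simp add: algebra_simps)
      show "sO = 1 + x * (sO + sA + sA)" by (rule sO)
    qed
    have A': "- c * \<beta> ^ Suc j * sA \<le> r (Suc (N0 + j)) Away d - \<kappa> * (B * y ^ d)"
    proof (rule step[OF rA _ _ _ \<beta>s(2)])
      show "B * y ^ d = x * (A * y ^ d + B * y ^ Suc d)" by (subst hB) (simp add: algebra_simps)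
      show "- b * (sO + sA) \<le> r (N0 + j) Out d + r (N0 + j) Away (Suc d) - \<kappa> * (A * y ^ d + B * y ^ Suc d)"
        using IH(1)[of d] IH(2)[of "Suc d"] by (simp add: algebra_simps)
      show "sA = 1 + x * (sO + sA)" by (rule sA)
    qed
    have B': "- c * \<beta> ^ Suc j * sA \<le> r (Suc (N0 + j)) Back d - \<kappa> * (1 * y ^ Suc d)"
    proof (rule step[OF rB _ _ _ \<beta>s(2)])
      have "y * y ^ d = x * (A + 1) * y ^ d" using hy by simp
      then show "1 * y ^ Suc d = x * (A * y ^ d + y ^ d)" by (simp add: algebra_simps)
      show "- b * (sO + sA) \<le> r (N0 + j) Out d + up (N0 + j) d - \<kappa> * (A * y ^ d + y ^ d)"
        using IH(1)[of d] IHup[of d] by (simp add: algebra_simps)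
      show "sA = 1 + x * (sO + sA)" by (rule sA)
    qed
    show ?case using O' A' B' by simp
  qed
  have "1 + \<kappa> * A - c * \<beta> ^ j * (sO - 1) \<le> K" for j
  proof -
    define b where "b = c * \<beta> ^ j"
    have b0: "0 \<le> b" using c0 \<beta> by (simp add: b_def)
    have 1: "- b * sO \<le> r (N0 + j) Out 0 - \<kappa> * A" "- b * sA \<le> r (N0 + j) Away (Suc 0) - \<kappa> * (B * y)"
      using main[of j 0] main[of j "Suc 0"] by (simp_all add: b_def)
    have 2: "- b * sA \<le> up (N0 + j) 0 - \<kappa>"
    proof -
      have "0 \<le> up (N0 + j) 0 - \<kappa>" using N0[of "N0 + j"] by (simp add: up_def)
      moreover have "- b * sA \<le> 0" using b0 sA0 by simp
      ultimately show ?thesis by linarith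
    qed
    have "x * (- b * (sO + sA + sA)) \<le> x * (r (N0 + j) Out 0 + r (N0 + j) Away (Suc 0) + up (N0 + j) 0 - \<kappa> * (A + B * y + 1))"
      using 1 2 x by (intro mult_left_mono) (simp_all add: algebra_simps)
    moreover have "x * (- b * (sO + sA + sA)) = - b * (sO - 1)" using sO by simp
    moreover have "\<kappa> * A = x * (\<kappa> * (A + B * y + 1))" using hA by simp
    ultimately have "1 + \<kappa> * A - b * (sO - 1) \<le> r (Suc (N0 + j)) Out 0" unfolding rO by (simp add: algebra_simps)
    also have "\<dots> \<le> K" by (rule r_le)
    finally show ?thesis by (simp add: b_def)
  qed
  moreover have "(\<lambda>j. 1 + \<kappa> * A - c * \<beta> ^ j * (sO - 1)) \<longlonglongrightarrow> 1 + \<kappa> * A - c * 0 * (sO - 1)"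
    using \<beta> by (intro tendsto_intros LIMSEQ_power_zero) auto
  ultimately have "1 + \<kappa> * A \<le> K" using LIMSEQ_le_const2 by fastforce
  moreover have "\<kappa> * 1 \<le> \<kappa> * A" using \<kappa> e by (intro mult_left_mono) (auto simp: A_def)
  ultimately show False by (simp add: \<kappa>_def)
qed


section \<open>Proof of the theorem\<close>

text \<open>The moving pole \<open>rh\<close> satisfies \<open>Vfun (rh v) = v\<close>, which is all that its derivatives at 1 depend on.\<close>

lemma width_family:
  obtains \<delta> T lam where
    "quasi_power_family three_sided_walks (\<lambda>w. nat \<lfloor>box_width w\<rfloor>) box_width \<delta> rho pole_deriv pole_deriv2 T lam"
proof -
  obtain \<delta> C \<theta> rh lam where q: "0 < \<delta>" "\<delta> \<le> 1/2" "rh holomorphic_on ball 1 \<delta>" "rh 1 = of_real rho"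
    and rh: "\<And>v. v \<in> ball 1 \<delta> \<Longrightarrow> norm (rh v) < tcrit \<and> rh v \<noteq> 0 \<and> ee (rh v) \<noteq> 0 \<and> 1 + ee (rh v) \<noteq> 0 \<and> Vfun (rh v) = v"
    and th: "0 \<le> \<theta>" "\<theta> < 1"
    and bd: "\<And>v n. v \<in> ball 1 \<delta> \<Longrightarrow> norm (width_poly n v * rh v ^ n - lam v) \<le> C * \<theta> ^ n"
    and lam: "lam 1 \<noteq> 0" by (rule width_poly_quasi_power) blast
  define e where "e v = ee (rh v)" for v
  have e_holo: "e holomorphic_on ball 1 \<delta>"
  proof -
    have "(ee \<circ> rh) holomorphic_on ball 1 \<delta>"
      by (rule holomorphic_on_compose_gen[OF q(3) holomorphic_ee_crit]) (use rh in auto)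
    then show ?thesis by (simp add: e_def[abs_def] o_def)
  qed
  have one: "1 \<in> ball (1 :: complex) \<delta>" using q(1) by simp
  have D: "(f has_field_derivative deriv f v) (at v)" if "f holomorphic_on ball 1 \<delta>" "v \<in> ball 1 \<delta>" for f v
    using holomorphic_derivI[OF that(1) open_ball that(2)] .
  note DD = D[OF holomorphic_deriv[OF _ open_ball] one]
  have eq2: "v * (rh v * (1 - rh v ^ 2) * e v * (1 + e v)) - (1 - rh v ^ 2) * e v + rh v ^ 2 = 0"
    if "v \<in> ball 1 \<delta>" for v
    using Vfun_eq[of "rh v"] rh[OF that] by (simp add: e_def)
  have eq1: "rh v ^ 2 * e v ^ 2 - (1 - rh v ^ 2) * (1 - rh v) * e v + rh v * (1 - rh v ^ 2) = 0"
    if "v \<in> ball 1 \<delta>" for v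
    using ee_equation[of "rh v"] rh[OF that] by (simp add: e_def)
  have e1: "e 1 = 1" using q(4) rho(8) by (simp add: e_def)
  note derivs = moving_pole_derivs[OF q(1) eq1 eq2 D[OF q(3)] D[OF e_holo] DD[OF q(3)] DD[OF e_holo] q(4) e1]
  have "quasi_power_family three_sided_walks (\<lambda>w. nat \<lfloor>box_width w\<rfloor>) box_width \<delta> rho pole_deriv pole_deriv2 rh lam"
  proof
    show "finite (three_sided_walks n)" for n by (rule finite_three_sided)
    show "box_width w = real (nat \<lfloor>box_width w\<rfloor>)" if "w \<in> three_sided_walks n" for n w
      using box_width_nat[OF that] by simp
    show "rh v \<noteq> 0" if "v \<in> ball 1 \<delta>" for v using rh[OF that] by blast
    show "uniform_limit (ball 1 \<delta>) (\<lambda>n v. (\<Sum>w\<in>three_sided_walks n. v ^ nat \<lfloor>box_width w\<rfloor>) * rh v ^ n) lam sequentially"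
    proof (rule uniform_limitI)
      fix \<epsilon> :: real assume "0 < \<epsilon>"
      have "(\<lambda>n. C * \<theta> ^ n) \<longlonglongrightarrow> C * 0" using th by (intro tendsto_intros LIMSEQ_power_zero) auto
      then have "\<forall>\<^sub>F n in sequentially. C * \<theta> ^ n < \<epsilon>" using \<open>0 < \<epsilon>\<close> by (intro order_tendstoD(2)[of _ "C * 0"]) auto
      then show "\<forall>\<^sub>F n in sequentially. \<forall>v\<in>ball 1 \<delta>.
          dist ((\<Sum>w\<in>three_sided_walks n. v ^ nat \<lfloor>box_width w\<rfloor>) * rh v ^ n) (lam v) < \<epsilon>"
      proof eventually_elim
        case (elim n)
        show ?case
        proof
          fix v :: complex assume "v \<in> ball 1 \<delta>"
          from le_less_trans[OF bd[OF this] elim]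
          show "dist ((\<Sum>w\<in>three_sided_walks n. v ^ nat \<lfloor>box_width w\<rfloor>) * rh v ^ n) (lam v) < \<epsilon>"
            by (simp add: dist_norm width_poly_def)
        qed
      qed
    qed
  qed (use q lam rho(1) derivs in simp_all)
  then show ?thesis by (rule that)
qed

text \<open>The growth rate of the larger class bounds the radius from below, the divergence at \<open>\<rho>\<close>, where
\<open>E(\<rho>, 1) = 1\<close>, from above.\<close>

lemma conv_radius_two_sided:
  assumes lim: "(\<lambda>n. real (card (three_sided_walks n)) * rho ^ n) \<longlonglongrightarrow> c"
  shows "conv_radius (\<lambda>n. real (card (two_sided_walks n))) = ereal rho"
proof (rule antisym)
  show "ereal rho \<le> conv_radius (\<lambda>n. real (card (two_sided_walks n)))"
  proof (rule conv_radius_geI_ex')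
    fix r :: real assume r: "0 < r" "ereal r < ereal rho"
    obtain B where B: "\<And>n. norm (real (card (three_sided_walks n)) * rho ^ n) \<le> B"
      using convergent_imp_Bseq[OF convergentI[OF lim]] unfolding Bseq_def by blast
    have "summable (\<lambda>n. B * (r / rho) ^ n)" using r rho(1) by (intro summable_mult summable_geometric) simp
    then show "summable (\<lambda>n. real (card (two_sided_walks n)) * of_real r ^ n)"
    proof (rule summable_comparison_test[rotated], intro exI allI impI)
      fix n
      have "card (two_sided_walks n) \<le> card (three_sided_walks n)"
        using two_sided_imp_three_sided
        by (intro card_mono finite_three_sided) (auto simp: two_sided_walks_def three_sided_walks_def)
      then have "real (card (two_sided_walks n)) * rho ^ n \<le> real (card (three_sided_walks n)) * rho ^ n"
        using rho(1) by (intro mult_right_mono) auto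
      also have "\<dots> \<le> B" using B[of n] rho(1) by simp
      finally have "real (card (two_sided_walks n)) * rho ^ n \<le> B" .
      then have "real (card (two_sided_walks n)) * rho ^ n * (r / rho) ^ n \<le> B * (r / rho) ^ n"
        using r rho(1) by (intro mult_right_mono) auto
      then show "norm (real (card (two_sided_walks n)) * of_real r ^ n) \<le> B * (r / rho) ^ n"
        using r rho(1) by (simp add: power_divide)
    qed
  qed
  have "\<not> summable (\<lambda>n. real (card (two_sided_walks n)) * rho ^ n)"
  proof
    assume "summable (\<lambda>n. real (card (two_sided_walks n)) * rho ^ n)"
    then have "summable (\<lambda>n. cont2 n (True, Out, 0) * rho ^ n)"
      by (rule summable_comparison_test[rotated])
        (use rho(1) in \<open>auto simp: abs_mult cont2_nonneg intro!: mult_right_mono cont2_le\<close>)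
    with cont2_diverges[OF rho(1,2)] rho(3) show False by simp
  qed
  from conv_radius_leI'[OF this] show "conv_radius (\<lambda>n. real (card (two_sided_walks n))) \<le> ereal rho"
    using rho(1) by simp
qed

theorem proposition8:
  fixes p :: "nat \<Rightarrow> nat" and tc :: real
  defines "p \<equiv> (\<lambda>n. card (three_sided_walks n))"
    and "tc \<equiv> sqrt 2 - 1"
  shows
    "\<exists>(F :: complex \<Rightarrow> complex) (t :: nat \<Rightarrow> real) (\<rho> :: real) (\<mu> :: real) (m :: real) (s :: real).
       meromorphic_continuation (\<lambda>n. of_nat (p n)) (ball 0 tc) F \<and>
       infinite {z \<in> ball 0 tc. is_pole F z} \<and>
       \<not> D_finite (Abs_fps (\<lambda>n. of_nat (p n))) \<and>
       range t = {x. 0 < x \<and> x < tc \<and> is_pole F (of_real x)} \<and>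
       (\<forall>i. zorder F (of_real (t i)) = -1) \<and>
       strict_mono t \<and> t \<longlonglongrightarrow> tc \<and>
       F analytic_on (cball 0 (t 0) - {of_real (t 0)}) \<and>
       conv_radius (\<lambda>n. real (card (two_sided_walks n))) = ereal \<rho> \<and>
       t 0 = \<rho> \<and>
       1 - 2 * \<rho> - 2 * \<rho> ^ 2 + 2 * \<rho> ^ 3 = 0 \<and>
       \<bar>\<rho> - 0.403\<bar> < 0.001 \<and>
       \<mu> = 1 / \<rho> \<and>
       \<bar>\<mu> - 2.48\<bar> < 0.01 \<and>
       (\<exists>\<kappa>>0. (\<lambda>n. real (p n)) \<sim>[at_top] (\<lambda>n. \<kappa> * \<mu> ^ n)) \<and>
       m = (1 + \<rho>) / (2 * (1 + 3 * \<rho>)) \<and>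
       \<bar>m - 0.31\<bar> < 0.01 \<and>
       s > 0 \<and>
       s ^ 2 = 3 * \<rho> * (1 + \<rho>) * (385 - 1148 * \<rho> ^ 2 - 494 * \<rho>)
                / (16 * (\<rho> ^ 2 + \<rho> - 1) * (3 * \<rho> - 1) ^ 3 * (1 + 3 * \<rho>) ^ 3) \<and>
       \<bar>s ^ 2 - 1.41\<bar> < 0.01 \<and>
       (\<lambda>n. measure_pmf.expectation (pmf_of_set (three_sided_walks n)) box_width)
          \<sim>[at_top] (\<lambda>n. m * real n) \<and>
       (\<lambda>n. measure_pmf.variance (pmf_of_set (three_sided_walks n)) box_width)
          \<sim>[at_top] (\<lambda>n. s ^ 2 * real n) \<and>
       weak_conv_m
         (\<lambda>n. distr (measure_pmf (pmf_of_set (three_sided_walks n))) borel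
                (\<lambda>w. (box_width w - m * real n) / (s * sqrt (real n))))
         std_normal_distribution"
proof -
  obtain \<delta> T lam where
    "quasi_power_family three_sided_walks (\<lambda>w. nat \<lfloor>box_width w\<rfloor>) box_width \<delta> rho pole_deriv pole_deriv2 T lam"
    by (rule width_family)
  then interpret W: quasi_power_family three_sided_walks "\<lambda>w. nat \<lfloor>box_width w\<rfloor>" box_width \<delta> rho pole_deriv pole_deriv2 T lam .
  have mean: "W.\<mu> = mean_const" unfolding W.\<mu>_def unfolding mean_const_alt using rho(1) by simp
  have var: "W.\<nu> = var_const" unfolding W.\<nu>_def unfolding var_const_deriv ..
  have s2: "sqrt var_const ^ 2 = var_const" using const_bounds(3) by simp
  have tc: "tc = tcrit" by (simp add: tc_def tcrit_def)
  have N: "(\<lambda>n. real (card (three_sided_walks n))) = W.N" by (rule ext) (simp add: W.N_def)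
  have rad: "conv_radius (\<lambda>n. real (card (two_sided_walks n))) = ereal rho"
    using conv_radius_two_sided W.N_limit unfolding W.N_def .
  have growth: "\<exists>\<kappa>>0. (\<lambda>n. real (p n)) \<sim>[at_top] (\<lambda>n. \<kappa> * (1 / rho) ^ n)"
    using W.N_asymp_equiv W.lam_1_real(2) unfolding p_def N by blast
  have b: "\<bar>rho - 0.403\<bar> < 0.001" "\<bar>1 / rho - 2.48\<bar> < 0.01" using rho(1,5,6) by (auto simp: abs_less_iff field_simps)
  have cubic: "1 - 2 * rho - 2 * rho ^ 2 + 2 * rho ^ 3 = 0" by (rule rho(4))
  have E: "(\<lambda>n. measure_pmf.expectation (pmf_of_set (three_sided_walks n)) box_width) \<sim>[at_top] (\<lambda>n. mean_const * real n)"
    using W.expectation_asymp const_bounds(4) unfolding mean by simp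
  have V: "(\<lambda>n. measure_pmf.variance (pmf_of_set (three_sided_walks n)) box_width) \<sim>[at_top] (\<lambda>n. sqrt var_const ^ 2 * real n)"
    using W.variance_asymp const_bounds(3) unfolding var s2 by simp
  have clt: "weak_conv_m (\<lambda>n. distr (measure_pmf (pmf_of_set (three_sided_walks n))) borel
      (\<lambda>w. (box_width w - mean_const * real n) / (sqrt var_const * sqrt (real n)))) std_normal_distribution"
    using W.central_limit const_bounds(3) unfolding mean var by blast
  have s: "sqrt var_const > 0" using const_bounds(3) by simp
  have t0: "troot 0 = rho" by (simp add: rho_def)
  show ?thesis
    apply (rule exI[of _ gfun], rule exI[of _ troot], rule exI[of _ rho], rule exI[of _ "1 / rho"],
        rule exI[of _ mean_const], rule exI[of _ "sqrt var_const"])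
    apply (intro conjI)
    subgoal unfolding p_def tc by (rule gfun_continuation)
    subgoal unfolding tc by (rule gfun_infinite_poles)
    subgoal unfolding p_def by (rule walks_not_D_finite)
    subgoal unfolding tc by (rule gfun_real_poles)
    subgoal by (rule allI, rule gfun_zorder)
    subgoal by (rule strict_mono_troot)
    subgoal unfolding tc by (rule troot_tendsto)
    subgoal by (rule gfun_dominant)
    subgoal by (rule rad)
    subgoal by (rule t0)
    subgoal by (rule cubic)
    subgoal by (rule b)
    subgoal by (rule refl)
    subgoal by (rule b)
    subgoal by (rule growth)
    subgoal by (rule mean_const_def)
    subgoal by (rule const_bounds)
    subgoal by (rule s)
    subgoal unfolding s2 by (rule var_const_def)
    subgoal unfolding s2 by (rule const_bounds)
    subgoal by (rule E)
    subgoal by (rule V)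
    subgoal by (rule clt)
    done
qed

end
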